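(* Suppose that $\mu^C=0$. (1) Suppose that the variables $\tau^{(i)}$, $i\in S$, have comparable heavy tails, that is, for each $i\in S$ there is $c_i>0$ with $\mathbb P_i(\tau>t)\sim c_i\,\mathbb P_{(0,0)}(\tau>t)$ as $t\to\infty$, and $\frac{\mathbb P_i(\tau>t+s)}{\mathbb P_i(\tau>t)}\to1$ as $t\to\infty$ for all $s\ge0$. Define $h_i=c_i$ for $i\in S$ and $h_{(0,u)}=\frac{1-e^{-q_0(1-u)}}{1-e^{-q_0}}$ for $u\in[0,1)$. Then $$\frac{s_j(t-v)}{s_i(t)}\to\frac{h_j}{h_i}\ \text{ as } t\to\infty\quad\text{for all } v\ge0\text{ and all } i,j\in\hat S.$$ (2) In particular, suppose that the variables $\tau_0^{(i)}$, $i\in C$, have comparable subexponential tails, with $\mathbb P_i(\tau_0>t)\sim a_i\,\mathbb P_1(\tau_0>t)$ as $t\to\infty$ ($a_i>0$), and that, for some $n$, $q_{0,i}=0$ for $i>n$. Define $a_0=0$, $m=\sum_{i\in C}q_{0,i}a_i/q_0$, $$h_i=1+\frac{a_i}{(e^{q_0}-1)m}\ \text{ for } i\in S,\qquad h_{(0,u)}=\frac{1-e^{-q_0(1-u)}}{1-e^{-q_0}}\ \text{ for } u\in[0,1).$$ Then $$\frac{s_j(t-v)}{s_i(t)}\to\frac{h_j}{h_i}\ \text{ as } t\to\infty\quad\text{for all } v\ge0\text{ and all } i,j\in\hat S.$$ (3) In the situation of (2), $a$ must be $\tilde P$-superharmonic. If $a$ is $\tilde P$-harmonic then $h$ is $\hat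 P$-harmonic, so that, in this case, for each $s>0$, the restriction to $\mathcal F_s$ of the law of $X^T$ (the chain on $\hat S$ obtained by conditioning $\hat X$ on $(\tau>T)$) converges weakly as $T\to\infty$ to that of $X^\infty$ restricted to $\mathcal F_s$, where the semigroup $P^\infty$ of $X^\infty$ is the (stochastic) $h$-transform of $\hat P$.
   Context: $X=(X_t)_{t\ge 0}$ is an irreducible, non-explosive, recurrent continuous-time Markov chain on $S=\mathbb Z^+=\{0,1,2,\dots\}$ or $S=\{0,\dots,K\}$, with distinguished state $0$; $C=S\setminus\{0\}$. Its $Q$-matrix is $(q_{i,j})$ and $q_i=-q_{i,i}$. $\tilde X$ is $X$ killed on first hitting $0$, with substochastic semigroup $(\tilde P(t))_{t\ge0}$ on $C$; it is assumed irreducible on $C$. $\tau_0$ is the first hitting time of $0$ by $X$; $\tau_0^{(i)}$ is a random variable with the law of $\tau_0$ under $\mathbb P_i$. Set $$\mu^C=\inf\Big\{\lambda:\int_0^\infty\mathbb P_i(\tau_0>t)e^{\lambda t}dt=\infty\Big\},$$ which does not depend on $i\in C$. The current holding time $H_t$ is the time elapsed since the most recent entry of $X$ into $0$ if $X_t=0$, and $H_t=\emptyset$ if $X_t\ne0$. Let $\tau=\inf\{t: H_t\ge1\}$; $\tau^{(i)}$ is a random variable with the law of $\tau$ under $\mathbb P_i$. Let $\hat S=C\cup(\{0\}\times[0,1))$; $\hat X$ denotes the process $(X_t,H_t)$ killed at $\tau$, viewed as a process on $\hat S$: it is in state $i\in C$ when $X_t=i$ and in state $(0,u)$ when $X_t=0$,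 $H_t=u$. The state $0$ is identified with $(0,0)$ (consistently, $c_0=1$ and $h_0=h_{(0,0)}=1$). The processes start from a fixed state of $\hat S$; $\mathbb P_i$ is the law started from $i\in\hat S$ (starting from $(0,u)$ means that $X_0=0$ and the chain has already been at $0$ for time $u$) on Skorokhod path space, with corresponding filtration $(\mathcal F_t)_{t\ge0}$. $(\hat P(t))_{t\ge0}$ is the substochastic transition semigroup of $\hat X$, and $s_i(t)=\mathbb P_i(\tau>t)$ for $i\in\hat S$. A nonnegative function $f$ is superharmonic (harmonic) for a semigroup $P$ if $P(t)f\le f$ (resp. $P(t)f=f$) for all $t\ge0$. The $h$-transform of $\hat P$ is the semigroup with kernel $\frac{h(y)}{h(x)}\hat P(x,dy;t)$. A random variable $Z\ge 0$ with distribution function $F_Z$ is subexponential if $\overline{F_Z^{n}}(t)/\overline{F_Z}(t)\to n$ as $t\to\infty$ for all $n$, where $F_Z^{n}$ is the $n$-fold convolution of $F_Z$ and $\overline G=1-G$. *)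

theory Defs
  imports "HOL-Probability.Probability" "HOL-Library.Landau_Symbols"
begin

text \<open>Uniform limits of paths in \<open>nat \<times> real\<close> need a metric on \<open>nat\<close>; it induces the existing
  (discrete) topology, as the instance proof shows.\<close>

instantiation nat :: metric_space
begin

definition dist_nat :: "nat \<Rightarrow> nat \<Rightarrow> real" where
  "dist_nat m n = \<bar>real m - real n\<bar>"

definition uniformity_nat :: "(nat \<times> nat) filter" where
  "uniformity_nat = (INF e\<in>{0 <..}. principal {(x, y). dist x y < e})"

instance
proof
  show "(uniformity :: (nat \<times> nat) filter) = (INF e\<in>{0 <..}. principal {(x, y). dist x y < e})"
    by (fact uniformity_nat_def)
  have ev: "eventually P uniformity" if P: "\<And>x. P (x, x)" for P :: "nat \<times> nat \<Rightarrow> bool"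
  proof -
    have "{(x :: nat, y). dist x y < 1} \<subseteq> {p. P p}"
    proof (rule subsetI, clarify)
      fix m n :: nat
      assume "dist m n < 1"
      then have "m = n" unfolding dist_nat_def by linarith
      then show "P (m, n)" using P by simp
    qed
    then have 1: "eventually P (principal {(x :: nat, y). dist x y < 1})"
      unfolding eventually_principal by blast
    have 2: "uniformity \<le> principal {(x :: nat, y). dist x y < 1}"
      unfolding uniformity_nat_def by (rule INF_lower) simp
    show ?thesis by (rule filter_leD[OF 2 1])
  qed
  show "open U \<longleftrightarrow> (\<forall>x\<in>U. \<forall>\<^sub>F (x', y) in uniformity. x' = x \<longrightarrow> y \<in> U)" for U :: "nat set"
  proof -
    have *: "\<forall>x\<in>U. \<forall>\<^sub>F (x', y) in uniformity. x' = x \<longrightarrow> y \<in> U"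
      by (intro ballI ev) simp
    show ?thesis
    proof
      show "open U" by (rule discrete_topology_class.open_discrete)
    qed (rule *)
  qed
  show "dist x y = 0 \<longleftrightarrow> x = y" for x y :: nat
    by (simp add: dist_nat_def)
  show "dist x y \<le> dist x z + dist y z" for x y z :: nat
    by (simp add: dist_nat_def)
qed

end

text \<open>
  Paths indexed by \<open>I\<close> that are right continuous with left limits, where values and left limits
  lie in \<open>E\<close>.  If \<open>t\<close> has no predecessors (successors) in \<open>I\<close>, the left (right) filter is trivial.
\<close>

definition cadlag_paths :: "real set \<Rightarrow> 'a::topological_space set \<Rightarrow> (real \<Rightarrow> 'a) set" where
  "cadlag_paths I E = {\<omega> \<in> extensional I. \<forall>t\<in>I. \<omega> t \<in> E
     \<and> (\<omega> \<longlongrightarrow> \<omega> t) (at t within I \<inter> {t<..})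
     \<and> (\<exists>l\<in>E. (\<omega> \<longlongrightarrow> l) (at t within I \<inter> {..<t}))}"

definition skorokhod_space :: "'a::topological_space set \<Rightarrow> (real \<Rightarrow> 'a) measure" where
  "skorokhod_space E = restrict_space (\<Pi>\<^sub>M t\<in>{0..}. borel) (cadlag_paths {0..} E)"

definition path_filtration :: "'a::topological_space set \<Rightarrow> real \<Rightarrow> (real \<Rightarrow> 'a) measure" where
  "path_filtration E s = vimage_algebra (cadlag_paths {0..} E)
     (\<lambda>\<omega>. restrict \<omega> {0..s}) (\<Pi>\<^sub>M t\<in>{0..s}. borel)"

text \<open>
  \<open>L\<close> is the law, on the Skorokhod space over \<open>E\<close>, of a Markov process with transition kernels
  \<open>K t x\<close> (that is, \<open>K(x, dy; t)\<close>) and initial state \<open>x\<close>.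
\<close>

definition markov_law ::
  "'a::topological_space set \<Rightarrow> (real \<Rightarrow> 'a \<Rightarrow> 'a measure) \<Rightarrow> 'a \<Rightarrow> (real \<Rightarrow> 'a) measure \<Rightarrow> bool" where
  "markov_law E K x L \<longleftrightarrow>
     prob_space L \<and> sets L = sets (skorokhod_space E) \<and> (AE \<omega> in L. \<omega> 0 = x) \<and>
     (\<forall>s\<ge>0. \<forall>t\<ge>0. \<forall>A\<in>sets (path_filtration E s). \<forall>B\<in>sets borel.
        emeasure L {\<omega>\<in>A. \<omega> (s + t) \<in> B} =
        (\<integral>\<^sup>+\<omega>\<in>A. emeasure (K t (\<omega> s)) B \<partial>L))"

text \<open>
  The law of \<open>(Y\<^sub>t)\<close>, \<open>t \<le> s\<close>, under \<open>M\<close>: this is the restriction to \<open>\<F>\<^sub>s\<close> of the law of \<open>Y\<close>,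
  carried over to paths on \<open>[0, s]\<close>.
\<close>

definition law_upto ::
  "real \<Rightarrow> 'w measure \<Rightarrow> (real \<Rightarrow> 'w \<Rightarrow> 'a::topological_space) \<Rightarrow> (real \<Rightarrow> 'a) measure" where
  "law_upto s M Y = distr M (\<Pi>\<^sub>M t\<in>{0..s}. borel) (\<lambda>\<omega>. \<lambda>t\<in>{0..s}. Y t \<omega>)"

text \<open>
  Convergence in Skorokhod's \<open>J\<^sub>1\<close> topology on \<open>D([0, s])\<close>.  An increasing bijection of \<open>[0, s]\<close> is
  a homeomorphism.  The topology is metrizable, so continuity is sequential continuity.
\<close>

definition skorokhod_tendsto ::
  "real \<Rightarrow> (nat \<Rightarrow> real \<Rightarrow> 'a::metric_space) \<Rightarrow> (real \<Rightarrow> 'a) \<Rightarrow> bool" where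
  "skorokhod_tendsto s \<omega>s \<omega> \<longleftrightarrow> (\<exists>\<rho> :: nat \<Rightarrow> real \<Rightarrow> real.
     (\<forall>n. strict_mono_on {0..s} (\<rho> n) \<and> \<rho> n ` {0..s} = {0..s}) \<and>
     uniform_limit {0..s} \<rho> (\<lambda>u. u) sequentially \<and>
     uniform_limit {0..s} (\<lambda>n u. \<omega>s n (\<rho> n u)) \<omega> sequentially)"

definition skorokhod_continuous ::
  "'a::metric_space set \<Rightarrow> real \<Rightarrow> ((real \<Rightarrow> 'a) \<Rightarrow> real) \<Rightarrow> bool" where
  "skorokhod_continuous E s f \<longleftrightarrow>
     (\<forall>\<omega>s \<omega>. (\<forall>n. \<omega>s n \<in> cadlag_paths {0..s} E) \<and> \<omega> \<in> cadlag_paths {0..s} E \<and>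
        skorokhod_tendsto s \<omega>s \<omega> \<longrightarrow> (\<lambda>n. f (\<omega>s n)) \<longlonglongrightarrow> f \<omega>)"

text \<open>
  Weak convergence, as \<open>T \<rightarrow> \<infinity>\<close>, on \<open>D([0, s], E)\<close> of laws given on the product
  \<open>\<sigma>\<close>-algebra and carried (in the sense of outer measure) by \<open>D([0, s], E)\<close>.  On the latter set the
  trace of the product \<open>\<sigma>\<close>-algebra is the Borel \<open>\<sigma>\<close>-algebra of the \<open>J\<^sub>1\<close> topology, so that every
  bounded continuous function on \<open>D([0, s], E)\<close> is the restriction of a bounded function that is
  measurable for the product \<open>\<sigma>\<close>-algebra; its values off \<open>D([0, s], E)\<close> are irrelevant.
\<close>

definition skorokhod_weak_conv ::
  "'a::metric_space set \<Rightarrow> real \<Rightarrow> (real \<Rightarrow> (real \<Rightarrow> 'a) measure) \<Rightarrow> (real \<Rightarrow> 'a) measure \<Rightarrow> bool" where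
  "skorokhod_weak_conv E s \<mu> \<nu> \<longleftrightarrow>
     (\<forall>f \<in> borel_measurable (\<Pi>\<^sub>M t\<in>{0..s}. borel).
        bounded (f ` space (\<Pi>\<^sub>M t\<in>{0..s}. (borel :: 'a measure))) \<and> skorokhod_continuous E s f \<longrightarrow>
        ((\<lambda>T. integral\<^sup>L (\<mu> T) f) \<longlongrightarrow> integral\<^sup>L \<nu> f) at_top)"

definition irreducible_on :: "nat set \<Rightarrow> (real \<Rightarrow> nat \<Rightarrow> nat measure) \<Rightarrow> bool" where
  "irreducible_on E K \<longleftrightarrow> (\<forall>i\<in>E. \<forall>j\<in>E. \<exists>t\<ge>0. measure (K t i) {j} > 0)"

definition superharmonic :: "'a set \<Rightarrow> (real \<Rightarrow> 'a \<Rightarrow> 'a measure) \<Rightarrow> ('a \<Rightarrow> real) \<Rightarrow> bool" where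
  "superharmonic E K f \<longleftrightarrow> (\<forall>x\<in>E. 0 \<le> f x) \<and>
     (\<forall>t\<ge>0. \<forall>x\<in>E. (\<integral>\<^sup>+y. ennreal (f y) \<partial>K t x) \<le> ennreal (f x))"

definition harmonic :: "'a set \<Rightarrow> (real \<Rightarrow> 'a \<Rightarrow> 'a measure) \<Rightarrow> ('a \<Rightarrow> real) \<Rightarrow> bool" where
  "harmonic E K f \<longleftrightarrow> (\<forall>x\<in>E. 0 \<le> f x) \<and>
     (\<forall>t\<ge>0. \<forall>x\<in>E. (\<integral>\<^sup>+y. ennreal (f y) \<partial>K t x) = ennreal (f x))"

definition h_transform ::
  "(real \<Rightarrow> 'a \<Rightarrow> 'a measure) \<Rightarrow> ('a \<Rightarrow> real) \<Rightarrow> real \<Rightarrow> 'a \<Rightarrow> 'a measure" where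
  "h_transform K h t x = density (K t x) (\<lambda>y. ennreal (h y / h x))"

definition stochastic :: "'a set \<Rightarrow> (real \<Rightarrow> 'a \<Rightarrow> 'a measure) \<Rightarrow> bool" where
  "stochastic E K \<longleftrightarrow> (\<forall>t\<ge>0. \<forall>x\<in>E. prob_space (K t x) \<and> emeasure (K t x) E = 1)"

definition Q_matrix :: "nat set \<Rightarrow> (nat \<Rightarrow> nat \<Rightarrow> real) \<Rightarrow> bool" where
  "Q_matrix S q \<longleftrightarrow>
     (\<forall>i\<in>S. \<forall>j\<in>S. i \<noteq> j \<longrightarrow> 0 \<le> q i j) \<and> (\<forall>i\<in>S. ((\<lambda>j. q i j) has_sum 0) S)"

text \<open>
  A chain is given by the family \<open>P i\<close> of laws (of the chain started at \<open>i\<close>) on the Skorokhod space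
  over \<open>S\<close>, with \<open>X\<^sub>t \<omega> = \<omega> t\<close>.  As \<open>S\<close> is discrete, membership of this space says that paths are
  right-continuous step functions with finitely many jumps in bounded time intervals, which is
  non-explosion.
\<close>

definition transition :: "(nat \<Rightarrow> (real \<Rightarrow> nat) measure) \<Rightarrow> real \<Rightarrow> nat \<Rightarrow> nat measure" where
  "transition P t i = distr (P i) borel (\<lambda>\<omega>. \<omega> t)"

definition nonexplosive_chain ::
  "nat set \<Rightarrow> (nat \<Rightarrow> nat \<Rightarrow> real) \<Rightarrow> (nat \<Rightarrow> (real \<Rightarrow> nat) measure) \<Rightarrow> bool" where
  "nonexplosive_chain S q P \<longleftrightarrow> Q_matrix S q \<and>
     (\<forall>i\<in>S. markov_law S (transition P) i (P i)) \<and>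
     (\<forall>i\<in>S. \<forall>j\<in>S. ((\<lambda>t. (measure (transition P t i) {j} - of_bool (i = j)) / t) \<longlongrightarrow> q i j)
        (at_right 0))"

definition recurrent :: "nat set \<Rightarrow> (nat \<Rightarrow> (real \<Rightarrow> nat) measure) \<Rightarrow> bool" where
  "recurrent S P \<longleftrightarrow> (\<forall>i\<in>S. AE \<omega> in P i. \<forall>T\<ge>0. \<exists>t\<ge>T. \<omega> t = i)"

definition hit0 :: "(real \<Rightarrow> nat) \<Rightarrow> ereal" where
  "hit0 \<omega> = Inf (ereal ` {t. 0 \<le> t \<and> \<omega> t = 0})"

definition hit0_tail :: "(nat \<Rightarrow> (real \<Rightarrow> nat) measure) \<Rightarrow> nat \<Rightarrow> real \<Rightarrow> real" where
  "hit0_tail P i t = measure (P i) {\<omega> \<in> space (P i). ereal t < hit0 \<omega>}"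

definition tilde_P :: "(nat \<Rightarrow> (real \<Rightarrow> nat) measure) \<Rightarrow> real \<Rightarrow> nat \<Rightarrow> nat measure" where
  "tilde_P P t i = distr (restrict_space (P i) {\<omega>. ereal t < hit0 \<omega>}) borel (\<lambda>\<omega>. \<omega> t)"

text \<open>The exponent \<open>\<mu>\<^sup>C\<close> computed from the state \<open>i \<in> C\<close>; its value does not depend on \<open>i\<close>.\<close>

definition mu_C :: "(nat \<Rightarrow> (real \<Rightarrow> nat) measure) \<Rightarrow> nat \<Rightarrow> ereal" where
  "mu_C P i = Inf (ereal ` {l. (\<integral>\<^sup>+t\<in>{0..}. ennreal (hit0_tail P i t * exp (l * t)) \<partial>lborel) = \<infinity>})"

text \<open>
  The space \<open>C \<union> {0} \<times> [0,1)\<close> is represented inside \<open>nat \<times> real\<close>, with the induced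
  topology and \<open>\<sigma>\<close>-algebra: \<open>i \<in> C\<close> is the pair \<open>(i, 0)\<close>.  Hence \<open>(i, 0)\<close> stands for \<open>i\<close> for all
  \<open>i \<in> S\<close>, in accordance with the identification of \<open>0\<close> and \<open>(0, 0)\<close>.
\<close>

definition hat_S :: "nat set \<Rightarrow> (nat \<times> real) set" where
  "hat_S S = (\<lambda>i. (i, 0)) ` (S - {0}) \<union> {0} \<times> {0..<1}"

text \<open>
  The current holding time at time \<open>t\<close> when the chain has, if \<open>\<omega> 0 = 0\<close>, already been at \<open>0\<close> for time
  \<open>u\<close> initially; \<open>None\<close> is the value \<open>\<emptyset>\<close>.  The most recent entry into \<open>0\<close> takes place at the
  supremum of the times before \<open>t\<close> spent outside \<open>0\<close>.
\<close>

definition holding :: "real \<Rightarrow> (real \<Rightarrow> nat) \<Rightarrow> real \<Rightarrow> real option" where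
  "holding u \<omega> t =
     (if \<omega> t \<noteq> 0 then None
      else if \<forall>r\<in>{0..t}. \<omega> r = 0 then Some (u + t)
      else Some (t - Sup {r \<in> {0..t}. \<omega> r \<noteq> 0}))"

definition hat_X :: "real \<Rightarrow> real \<Rightarrow> (real \<Rightarrow> nat) \<Rightarrow> nat \<times> real" where
  "hat_X u t \<omega> = (\<omega> t, case holding u \<omega> t of None \<Rightarrow> 0 | Some r \<Rightarrow> r)"

definition tau :: "real \<Rightarrow> (real \<Rightarrow> nat) \<Rightarrow> ereal" where
  "tau u \<omega> = Inf (ereal ` {t. 0 \<le> t \<and> (\<exists>r\<ge>1. holding u \<omega> t = Some r)})"

text \<open>
  The process started at \<open>x = (i, u)\<close> is the functional \<open>\<omega> \<mapsto> (hat_X u t \<omega>)\<^sub>t\<close>, killed at \<open>tau u \<omega>\<close>, of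
  the chain under \<open>P i\<close>.
\<close>

definition surv :: "(nat \<Rightarrow> (real \<Rightarrow> nat) measure) \<Rightarrow> nat \<times> real \<Rightarrow> real \<Rightarrow> real" where
  "surv P x t = measure (P (fst x)) {\<omega> \<in> space (P (fst x)). ereal t < tau (snd x) \<omega>}"

definition hat_P ::
  "(nat \<Rightarrow> (real \<Rightarrow> nat) measure) \<Rightarrow> real \<Rightarrow> nat \<times> real \<Rightarrow> (nat \<times> real) measure" where
  "hat_P P t x = distr (restrict_space (P (fst x)) {\<omega>. ereal t < tau (snd x) \<omega>}) borel
     (hat_X (snd x) t)"

text \<open>
  The restriction to \<open>\<F>\<^sub>s\<close> of the law of the process started at \<open>x\<close> and conditioned on \<open>\<tau> > T\<close>.
  For \<open>T \<ge> s\<close>, killing has no effect on \<open>[0, s]\<close> under the conditional law.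
\<close>

definition conditioned_law ::
  "(nat \<Rightarrow> (real \<Rightarrow> nat) measure) \<Rightarrow> nat \<times> real \<Rightarrow> real \<Rightarrow> real \<Rightarrow> (real \<Rightarrow> nat \<times> real) measure" where
  "conditioned_law P x s T =
     law_upto s
       (uniform_measure (P (fst x)) {\<omega> \<in> space (P (fst x)). ereal T < tau (snd x) \<omega>})
       (hat_X (snd x))"

primrec convolution_power :: "real measure \<Rightarrow> nat \<Rightarrow> real measure" where
  "convolution_power \<mu> 0 = return borel 0"
| "convolution_power \<mu> (Suc n) = convolution \<mu> (convolution_power \<mu> n)"

definition subexponential :: "real measure \<Rightarrow> bool" where
  "subexponential \<mu> \<longleftrightarrow> prob_space \<mu> \<and> sets \<mu> = sets borel \<and> (AE z in \<mu>. 0 \<le> z) \<and>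
     (\<forall>n. ((\<lambda>t. measure (convolution_power \<mu> n) {t<..} / measure \<mu> {t<..}) \<longlongrightarrow> real n) at_top)"

text \<open>For a recurrent chain the hitting time is almost surely finite.\<close>

definition hit0_law :: "(nat \<Rightarrow> (real \<Rightarrow> nat) measure) \<Rightarrow> nat \<Rightarrow> real measure" where
  "hit0_law P i = distr (P i) borel (\<lambda>\<omega>. real_of_ereal (hit0 \<omega>))"

definition comparable_heavy_tails ::
  "nat set \<Rightarrow> (nat \<Rightarrow> (real \<Rightarrow> nat) measure) \<Rightarrow> (nat \<Rightarrow> real) \<Rightarrow> bool" where
  "comparable_heavy_tails S P c \<longleftrightarrow> (\<forall>i\<in>S.
     c i > 0 \<and> surv P (i, 0) \<sim>[at_top] (\<lambda>t. c i * surv P (0, 0) t) \<and>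
     (\<forall>s\<ge>0. ((\<lambda>t. surv P (i, 0) (t + s) / surv P (i, 0) t) \<longlongrightarrow> 1) at_top))"

definition comparable_subexponential_tails ::
  "nat set \<Rightarrow> (nat \<Rightarrow> (real \<Rightarrow> nat) measure) \<Rightarrow> (nat \<Rightarrow> real) \<Rightarrow> bool" where
  "comparable_subexponential_tails S P a \<longleftrightarrow> (\<forall>i\<in>S - {0}.
     a i > 0 \<and> subexponential (hit0_law P i) \<and>
     hit0_tail P i \<sim>[at_top] (\<lambda>t. a i * hit0_tail P 1 t))"

text \<open>
  The function \<open>h\<close> on the extended state space with given values \<open>g i\<close> at \<open>i \<in> C\<close>; the value at the
  state \<open>0\<close>, that is at \<open>(0, 0)\<close>, is \<open>1\<close>.
\<close>

definition h_fun :: "(nat \<Rightarrow> nat \<Rightarrow> real) \<Rightarrow> (nat \<Rightarrow> real) \<Rightarrow> nat \<times> real \<Rightarrow> real" where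
  "h_fun q g x = (let q0 = - q 0 0 in
     if fst x = 0 then (1 - exp (- q0 * (1 - snd x))) / (1 - exp (- q0)) else g (fst x))"

definition h_subexp :: "nat set \<Rightarrow> (nat \<Rightarrow> nat \<Rightarrow> real) \<Rightarrow> (nat \<Rightarrow> real) \<Rightarrow> nat \<times> real \<Rightarrow> real" where
  "h_subexp S q a =
     (let q0 = - q 0 0; m = (\<Sum>\<^sub>\<infinity>i\<in>S - {0}. q 0 i * a i / q0)
      in h_fun q (\<lambda>i. 1 + a i / ((exp q0 - 1) * m)))"

definition survival_ratio_limit ::
  "nat set \<Rightarrow> (nat \<Rightarrow> (real \<Rightarrow> nat) measure) \<Rightarrow> (nat \<times> real \<Rightarrow> real) \<Rightarrow> bool" where
  "survival_ratio_limit S P h \<longleftrightarrow> (\<forall>v\<ge>0. \<forall>x\<in>hat_S S. \<forall>y\<in>hat_S S.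
     ((\<lambda>t. surv P y (t - v) / surv P x t) \<longlongrightarrow> h y / h x) at_top)"

end

theory Submission
  imports Defs
begin

text \<open>
  \<^emph>\<open>Part 1.\<close> Started at 0, the chain leaves 0 before time \<open>u < 1\<close> or is in \<open>(0, u)\<close> at time \<open>u\<close>; the Markov
  property at small time steps, monotonicity and the long tail determine in which proportion the survival
  probability splits between the two cases.
  \<^emph>\<open>Part 2.\<close> Write \<open>p = 1 - exp (- q0)\<close>. Decomposing at the exit from 0 and at the next visit to 0, the survival
  function from 0 is at most \<open>p\<close> times an average of the convolutions of the hitting laws with itself.
  By subexponentiality the limes superior \<open>l\<close> of its ratio to the tail of the hitting time
  satisfies \<open>l \<le> p (m + l)\<close>, likewise for the limes inferior, so that Part 1 applies.
  \<^emph>\<open>Part 3.\<close> Superharmonicity of \<open>a\<close> is Fatou's lemma. The largest relative deficit \<open>D\<close> of \<open>h\<close> from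
  harmonicity satisfies \<open>D \<le> p D\<close>, hence vanishes. The conditioned law has on \<open>[0, s]\<close> the density
  \<open>surv (X\<^sub>s) (T - s) / surv x T\<close>, which tends to the density \<open>h (X\<^sub>s) / h x\<close> of the h-transform, and
  Scheffe's lemma gives convergence in total variation.
\<close>

section \<open>Paths\<close>

text \<open>The chain is given by its path laws and by the derivatives at 0 of its transition
  probabilities, so the strong Markov property, the exponential holding time at 0 and the exit
  distribution \<open>q 0 j / q0\<close> have to be derived before the decompositions can start. For
  the limes superior l, the inequality l <= p (m + l), with m the mean of \<open>a\<close> under the
  exit distribution, is empty while l may be infinite; finiteness needs its own argument. The fixed
  point is p m / (1 - p) = (exp q0 - 1) m, which is the denominator in \<open>h_subexp\<close>. The
  delicate object is the limit process: a law on paths whose values and left limits stay in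
  \<open>hat_S S\<close>, for all time. It is assembled from unit time segments of the killed
  process, each weighted by the ratio of \<open>h\<close> at its end to \<open>h\<close> at its
  start. Harmonicity makes each weight a probability density, and the product of the weights
  telescopes to the density on \<open>[0, s]\<close>.\<close>

lemma cadlag_nat_iff:
  fixes w :: "real \<Rightarrow> nat"
  shows "w \<in> cadlag_paths {0..} E \<longleftrightarrow> w \<in> extensional {0..} \<and>
     (\<forall>t\<ge>0. w t \<in> E \<and> (\<exists>e>0. \<forall>r\<in>{t..<t+e}. w r = w t)) \<and>
     (\<forall>t>0. \<exists>e>0. \<exists>l\<in>E. \<forall>r. t - e < r \<and> r < t \<and> 0 \<le> r \<longrightarrow> w r = l)"
proof -
  have lim: "(w \<longlongrightarrow> l) F \<longleftrightarrow> (\<forall>\<^sub>F r in F. w r = l)" for l F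
    by (simp add: tendsto_discrete)
  have R: "(\<forall>\<^sub>F r in at t within {0..} \<inter> {t<..}. w r = w t) \<longleftrightarrow>
      (\<exists>e>0. \<forall>r\<in>{t..<t+e}. w r = w t)" if "t \<ge> 0" for t
  proof
    assume "\<forall>\<^sub>F r in at t within {0..} \<inter> {t<..}. w r = w t"
    then obtain d where d: "d > 0" "\<And>r. r \<ge> 0 \<Longrightarrow> r > t \<Longrightarrow> r - t < d \<Longrightarrow> w r = w t"
      unfolding eventually_at by (auto simp: dist_real_def)
    show "\<exists>e>0. \<forall>r\<in>{t..<t+e}. w r = w t"
    proof (intro exI[of _ d] conjI ballI d(1))
      fix r assume "r \<in> {t..<t + d}"
      then show "w r = w t" using d(2)[of r] that by (cases "r = t") auto
    qed
  next
    assume "\<exists>e>0. \<forall>r\<in>{t..<t+e}. w r = w t"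
    then obtain e where e: "e > 0" "\<And>r. r\<in>{t..<t+e} \<Longrightarrow> w r = w t" by metis
    show "\<forall>\<^sub>F r in at t within {0..} \<inter> {t<..}. w r = w t"
      unfolding eventually_at
      by (rule exI[of _ e], intro conjI e(1) ballI impI e(2)) (auto simp: dist_real_def)
  qed
  have L: "(\<forall>\<^sub>F r in at t within {0..} \<inter> {..<t}. w r = l) \<longleftrightarrow>
      (\<exists>e>0. \<forall>r. t - e < r \<and> r < t \<and> 0 \<le> r \<longrightarrow> w r = l)" for t l
    unfolding eventually_at by (intro ex_cong1 conj_cong refl) (auto simp: dist_real_def)
  show ?thesis
    unfolding cadlag_paths_def lim mem_Collect_eq
  proof (intro conj_cong refl iffI conjI allI impI ballI; (elim conjE)?)
    fix t :: real
    assume A: "\<forall>t\<in>{0..}. w t \<in> E \<and> (\<forall>\<^sub>F r in at t within {0..} \<inter> {t<..}. w r = w t)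
        \<and> (\<exists>l\<in>E. \<forall>\<^sub>F r in at t within {0..} \<inter> {..<t}. w r = l)"
    show "t \<ge> 0 \<Longrightarrow> w t \<in> E" using A by simp
    show "t \<ge> 0 \<Longrightarrow> \<exists>e>0. \<forall>r\<in>{t..<t+e}. w r = w t" using A R[of t] by simp
    assume "t > 0"
    then obtain l where "l \<in> E" "\<forall>\<^sub>F r in at t within {0..} \<inter> {..<t}. w r = l" using A by fastforce
    then show "\<exists>e>0. \<exists>l\<in>E. \<forall>r. t - e < r \<and> r < t \<and> 0 \<le> r \<longrightarrow> w r = l" unfolding L by metis
  next
    fix t :: real
    assume t: "t \<in> {0..}"
    assume A: "\<forall>t\<ge>0. w t \<in> E \<and> (\<exists>e>0. \<forall>r\<in>{t..<t+e}. w r = w t)"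
     and B: "\<forall>t>0. \<exists>e>0. \<exists>l\<in>E. \<forall>r. t - e < r \<and> r < t \<and> 0 \<le> r \<longrightarrow> w r = l"
    show "w t \<in> E" using A t by simp
    show "\<forall>\<^sub>F r in at t within {0..} \<inter> {t<..}. w r = w t" using A R[of t] t by simp
    show "\<exists>l\<in>E. \<forall>\<^sub>F r in at t within {0..} \<inter> {..<t}. w r = l"
    proof (cases "t > 0")
      case True
      then show ?thesis using B unfolding L by metis
    next
      case False
      with t have "t = 0" by simp
      then have "{0..} \<inter> {..<t} = {}" by auto
      then show ?thesis using A by auto
    qed
  qed
qed

abbreviation paths :: "nat set \<Rightarrow> (real \<Rightarrow> nat) set" where
  "paths S \<equiv> cadlag_paths {0..} S"

lemma cadlag_right:
  fixes w :: "real \<Rightarrow> nat"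
  assumes "w \<in> paths S" "t \<ge> 0"
  obtains e where "e > 0" "\<And>r. t \<le> r \<Longrightarrow> r < t + e \<Longrightarrow> w r = w t"
  using assms unfolding cadlag_nat_iff by (metis atLeastLessThan_iff)

lemma cadlag_left:
  fixes w :: "real \<Rightarrow> nat"
  assumes "w \<in> paths S" "t > 0"
  obtains e l where "e > 0" "l \<in> S" "\<And>r. t - e < r \<Longrightarrow> r < t \<Longrightarrow> 0 \<le> r \<Longrightarrow> w r = l"
  using assms unfolding cadlag_nat_iff by metis

lemma cadlag_in: "w \<in> paths S \<Longrightarrow> t \<ge> 0 \<Longrightarrow> w t \<in> S"
  unfolding cadlag_nat_iff by blast

text \<open>The restriction to nonnegative times keeps shifted paths extensional, as membership in
  \<open>paths S\<close> demands.\<close>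

definition shift :: "real \<Rightarrow> (real \<Rightarrow> nat) \<Rightarrow> real \<Rightarrow> nat" where
  "shift s w = (\<lambda>t\<in>{0..}. w (s + t))"

lemma shift_apply [simp]: "t \<ge> 0 \<Longrightarrow> shift s w t = w (s + t)"
  by (simp add: shift_def)

lemma shift_cadlag:
  assumes w: "w \<in> paths S" and s: "s \<ge> 0"
  shows "shift s w \<in> paths S"
  unfolding cadlag_nat_iff
proof (intro conjI allI impI)
  show "shift s w \<in> extensional {0..}" by (simp add: shift_def)
  fix t :: real
  show "shift s w t \<in> S" if "t \<ge> 0" using that s cadlag_in[OF w] by simp
  show "\<exists>e>0. \<forall>r\<in>{t..<t + e}. shift s w r = shift s w t" if t: "t \<ge> 0"
  proof -
    from cadlag_right[OF w, of "s + t"] obtain e where e: "e > 0"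
      "\<And>r. s + t \<le> r \<Longrightarrow> r < s + t + e \<Longrightarrow> w r = w (s + t)" using s t by auto
    have "shift s w r = shift s w t" if "r \<in> {t..<t + e}" for r
      using that t e(2)[of "s + r"] by simp
    then show ?thesis using e(1) by blast
  qed
  show "\<exists>e>0. \<exists>l\<in>S. \<forall>r. t - e < r \<and> r < t \<and> 0 \<le> r \<longrightarrow> shift s w r = l" if t: "t > 0"
  proof -
    from cadlag_left[OF w, of "s + t"] obtain e l where e: "e > 0" "l \<in> S"
      "\<And>r. s + t - e < r \<Longrightarrow> r < s + t \<Longrightarrow> 0 \<le> r \<Longrightarrow> w r = l" using s t by auto
    have "shift s w r = l" if "t - e < r \<and> r < t \<and> 0 \<le> r" for r
      using that s e(3)[of "s + r"] by simp
    then show ?thesis using e(1,2) by blast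
  qed
qed

text \<open>Away from 0 the age is 0, the same as at the instant of an entry into 0. Killing only
  looks at ages of at least 1, so this coding loses nothing.\<close>

definition age :: "real \<Rightarrow> real \<Rightarrow> (real \<Rightarrow> nat) \<Rightarrow> real" where
  "age u t w = snd (hat_X u t w)"

lemma hat_X_eq: "hat_X u t w = (w t, age u t w)"
  by (simp add: age_def hat_X_def)

definition zero_on :: "(real \<Rightarrow> nat) \<Rightarrow> real \<Rightarrow> real \<Rightarrow> bool" where
  "zero_on w s t \<longleftrightarrow> (\<forall>r\<in>{s..t}. w r = 0)"

lemma zero_onD: "zero_on w s t \<Longrightarrow> s \<le> r \<Longrightarrow> r \<le> t \<Longrightarrow> w r = 0"
  by (simp add: zero_on_def)

lemma zero_on_mono: "zero_on w s t \<Longrightarrow> s \<le> s' \<Longrightarrow> t' \<le> t \<Longrightarrow> zero_on w s' t'"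
  by (simp add: zero_on_def)

lemma zero_on_join: "zero_on w s t \<Longrightarrow> zero_on w t r \<Longrightarrow> zero_on w s r"
  unfolding zero_on_def by (metis atLeastAtMost_iff linear)

lemma zero_on_split:
  "s \<le> t \<Longrightarrow> t \<le> r \<Longrightarrow> zero_on w s r \<longleftrightarrow> zero_on w s t \<and> zero_on w t r"
  by (meson order_refl zero_on_join zero_on_mono)

lemma zero_on_shift: "0 \<le> a \<Longrightarrow> zero_on (shift s w) a b \<longleftrightarrow> zero_on w (s + a) (s + b)"
proof
  assume a: "0 \<le> a" and z: "zero_on (shift s w) a b"
  show "zero_on w (s + a) (s + b)"
    unfolding zero_on_def
  proof
    fix r assume "r \<in> {s+a..s+b}"
    then show "w r = 0" using zero_onD[OF z, of "r - s"] a by simp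
  qed
qed (auto simp: zero_on_def)

text \<open>By right continuity a nonzero value persists for a while, so the supremum of the nonzero
  times is itself a zero of the path and is approached by nonzero times from the left.\<close>

lemma last_entry:
  assumes w: "w \<in> paths S" and t: "t \<ge> 0" "w t = 0" and nz: "\<not> zero_on w 0 t"
  defines "e \<equiv> Sup {r \<in> {0..t}. w r \<noteq> 0}"
  shows "0 < e" "e \<le> t" "zero_on w e t" "\<And>d. d < e \<Longrightarrow> \<exists>r. d < r \<and> r < e \<and> 0 \<le> r \<and> w r \<noteq> 0"
proof -
  let ?A = "{r \<in> {0..t}. w r \<noteq> 0}"
  have ne: "?A \<noteq> {}" using nz by (auto simp: zero_on_def)
  have bd: "bdd_above ?A" by (rule bdd_aboveI[of _ t]) simp
  obtain r0 where r0: "r0 \<in> ?A" using ne by auto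
  have up: "r \<le> e" if "r \<in> ?A" for r unfolding e_def by (rule cSup_upper[OF that bd])
  have e0: "0 \<le> e" using up[OF r0] r0 by simp
  show et: "e \<le> t" unfolding e_def by (rule cSup_least[OF ne]) simp
  have we: "w e = 0"
  proof (rule ccontr)
    assume n: "w e \<noteq> 0"
    then have "e < t" using et t by (cases "e = t") auto
    from cadlag_right[OF w e0] obtain d where d: "d > 0" "\<And>r. e \<le> r \<Longrightarrow> r < e + d \<Longrightarrow> w r = w e" by metis
    let ?r = "min t (e + d/2)"
    have "w ?r \<noteq> 0" using d(2)[of ?r] d(1) et n by simp
    then have "?r \<le> e" using e0 \<open>e < t\<close> d(1) by (intro up) auto
    then show False using \<open>e < t\<close> d(1) by auto
  qed
  show "zero_on w e t"
    unfolding zero_on_def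
  proof
    fix r assume r: "r \<in> {e..t}"
    show "w r = 0"
    proof (rule ccontr)
      assume "w r \<noteq> 0"
      then have "r \<le> e" using r e0 by (intro up) auto
      then have "r = e" using r by simp
      then show False using \<open>w r \<noteq> 0\<close> we by simp
    qed
  qed
  have *: "\<exists>r. d < r \<and> r < e \<and> 0 \<le> r \<and> w r \<noteq> 0" if "d < e" for d
  proof -
    obtain r where r: "r \<in> ?A" "d < r" using \<open>d < e\<close> unfolding e_def using less_cSup_iff[OF ne bd] by auto
    have "r \<noteq> e" using r we by auto
    then have "r < e" using up[OF r(1)] by simp
    then show ?thesis using r by auto
  qed
  show "d < e \<Longrightarrow> \<exists>r. d < r \<and> r < e \<and> 0 \<le> r \<and> w r \<noteq> 0" for d by (rule *)
  have "r0 \<noteq> e" using r0 we by auto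
  then show "0 < e" using up[OF r0] r0 by simp
qed

lemma age_zero_on: "0 \<le> t \<Longrightarrow> zero_on w 0 t \<Longrightarrow> age u t w = u + t"
  by (auto simp: age_def hat_X_def holding_def zero_on_def)

lemma age_nonzero: "w t \<noteq> 0 \<Longrightarrow> age u t w = 0"
  by (simp add: age_def hat_X_def holding_def)

lemma age_entry: "w t = 0 \<Longrightarrow> \<not> zero_on w 0 t \<Longrightarrow> age u t w = t - Sup {r \<in> {0..t}. w r \<noteq> 0}"
  by (auto simp: age_def hat_X_def holding_def zero_on_def)

lemma age_nonneg:
  assumes "w \<in> paths S" "t \<ge> 0" "u \<ge> 0"
  shows "0 \<le> age u t w"
proof (cases "w t = 0")
  case True
  show ?thesis
  proof (cases "zero_on w 0 t")
    case False
    then show ?thesis using last_entry(2)[OF assms(1,2) True] age_entry[of w t u, OF True] by simp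
  qed (use age_zero_on assms in simp)
qed (use age_nonzero in simp)

text \<open>Positive levels of the age are described by events \<open>zero_on\<close> alone. Both
  the flow property and the measurability of the age are read off from this.\<close>

lemma age_ge_iff:
  assumes "w \<in> paths S" "t \<ge> 0" "u \<ge> 0" "a > 0"
  shows "a \<le> age u t w \<longleftrightarrow> zero_on w 0 t \<and> a \<le> u + t \<or> a \<le> t \<and> zero_on w (t - a) t"
proof (cases "w t = 0")
  case False
  then show ?thesis using age_nonzero[of w t u, OF False] assms by (auto simp: zero_on_def)
next
  case True
  show ?thesis
  proof (cases "zero_on w 0 t")
    case z: True
    then show ?thesis using age_zero_on[OF assms(2) z] assms zero_on_mono[OF z, of "t - a" t] by auto
  next
    case nz: False
    define e where "e = Sup {r \<in> {0..t}. w r \<noteq> 0}"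
    note E = last_entry[OF assms(1,2) True nz, folded e_def]
    have "a \<le> t - e \<longleftrightarrow> a \<le> t \<and> zero_on w (t - a) t"
    proof
      assume "a \<le> t - e"
      then show "a \<le> t \<and> zero_on w (t - a) t" using E(1) zero_on_mono[OF E(3), of "t - a" t] by simp
    next
      assume *: "a \<le> t \<and> zero_on w (t - a) t"
      show "a \<le> t - e"
      proof (rule ccontr)
        assume "\<not> ?thesis"
        then have "t - a < e" by simp
        from E(4)[OF this] obtain r where "t - a < r" "r < e" "w r \<noteq> 0" by auto
        then show False using * zero_onD[of w "t - a" t r] E(2) by auto
      qed
    qed
    then show ?thesis using age_entry[of w t u, OF True nz] nz by (simp add: e_def)
  qed
qed

lemma nonneg_eqI:
  fixes x y :: real
  assumes "0 \<le> x" "0 \<le> y" "\<And>a. a > 0 \<Longrightarrow> a \<le> x \<longleftrightarrow> a \<le> y"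
  shows "x = y"
  using assms(1,2) assms(3)[of x] assms(3)[of y] by (cases "x = 0"; cases "y = 0") auto

lemma age_flow_nonneg:
  assumes w: "w \<in> paths S" and "s \<ge> 0" "t \<ge> 0" "u \<ge> 0"
  shows "age u (s + t) w = age (age u s w) t (shift s w)"
proof (rule nonneg_eqI)
  have sw: "shift s w \<in> paths S" by (rule shift_cadlag[OF w \<open>s \<ge> 0\<close>])
  have a0: "0 \<le> age u s w" by (rule age_nonneg[OF w]) fact+
  show "0 \<le> age u (s + t) w" using assms by (intro age_nonneg[OF w]) auto
  show "0 \<le> age (age u s w) t (shift s w)" using a0 assms by (intro age_nonneg[OF sw]) auto
  fix a :: real assume a: "a > 0"
  have L: "a \<le> age u (s + t) w \<longleftrightarrow>
      zero_on w 0 (s + t) \<and> a \<le> u + (s + t) \<or> a \<le> s + t \<and> zero_on w (s + t - a) (s + t)"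
    using assms a by (intro age_ge_iff[OF w]) auto
  have R: "a \<le> age (age u s w) t (shift s w) \<longleftrightarrow>
     zero_on w s (s + t) \<and> a \<le> age u s w + t \<or> a \<le> t \<and> zero_on w (s + t - a) (s + t)"
  proof -
    have "0 \<le> t - a \<Longrightarrow> zero_on (shift s w) (t - a) t \<longleftrightarrow> zero_on w (s + t - a) (s + t)"
      using zero_on_shift[of "t - a" s w t] by (simp add: add_diff_eq)
    moreover have "zero_on (shift s w) 0 t \<longleftrightarrow> zero_on w s (s + t)"
      using zero_on_shift[of 0 s w t] by simp
    moreover have "a \<le> age (age u s w) t (shift s w) \<longleftrightarrow>
        zero_on (shift s w) 0 t \<and> a \<le> age u s w + t \<or> a \<le> t \<and> zero_on (shift s w) (t - a) t"
      by (rule age_ge_iff[OF sw \<open>t \<ge> 0\<close> a0 a])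
    ultimately show ?thesis by (metis diff_ge_0_iff_ge)
  qed
  show "a \<le> age u (s + t) w \<longleftrightarrow> a \<le> age (age u s w) t (shift s w)"
  \<comment> \<open>For \<open>a <= t\<close> only the last \<open>a\<close> time units count on
    either side. Otherwise the path must be at 0 throughout \<open>[s, s + t]\<close> and the
    remaining \<open>a - t\<close> must already be there as age at time \<open>s\<close>.\<close>
  proof (cases "a \<le> t")
    case True
    have "zero_on w 0 (s + t) \<Longrightarrow> zero_on w (s + t - a) (s + t)"
      and "zero_on w s (s + t) \<Longrightarrow> zero_on w (s + t - a) (s + t)"
      using True assms by (auto intro: zero_on_mono)
    then show ?thesis unfolding L R using True assms by argo
  next
    case False
    then have "a \<le> age u s w + t \<longleftrightarrow> a - t \<le> age u s w" by auto
    also have "\<dots> \<longleftrightarrow> zero_on w 0 s \<and> a - t \<le> u + s \<or> a - t \<le> s \<and> zero_on w (s - (a - t)) s"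
      using assms False by (intro age_ge_iff[OF w]) auto
    finally have *: "a \<le> age u s w + t \<longleftrightarrow>
      zero_on w 0 s \<and> a \<le> u + (s + t) \<or> a \<le> s + t \<and> zero_on w (s + t - a) s"
      by (auto simp: algebra_simps)
    have 1: "zero_on w 0 (s + t) \<longleftrightarrow> zero_on w 0 s \<and> zero_on w s (s + t)"
      using assms by (intro zero_on_split) auto
    have 2: "zero_on w (s + t - a) (s + t) \<longleftrightarrow> zero_on w (s + t - a) s \<and> zero_on w s (s + t)"
      using assms False by (intro zero_on_split) auto
    show ?thesis unfolding L R * 1 2 using False by argo
  qed
qed

text \<open>Isolates the influence of the initial age, which ends with the first exit from 0. This
  extends the flow property to arbitrary \<open>u\<close> and gives measurability jointly in
  \<open>u\<close> and the path.\<close>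

lemma age_eq: "0 \<le> t \<Longrightarrow> age u t w = (if zero_on w 0 t then u + t else age 0 t w)"
  using age_zero_on[of t w u] age_entry[of w t u] age_entry[of w t 0]
    age_nonzero[of w t u] age_nonzero[of w t 0] by (cases "w t = 0") auto

lemma age_flow:
  assumes w: "w \<in> paths S" and st: "s \<ge> 0" "t \<ge> 0"
  shows "age u (s + t) w = age (age u s w) t (shift s w)"
proof -
  have *: "age 0 (s + t) w = age (age 0 s w) t (shift s w)"
    by (rule age_flow_nonneg[OF w st]) simp
  have z: "zero_on w 0 (s + t) \<longleftrightarrow> zero_on w 0 s \<and> zero_on (shift s w) 0 t"
    using zero_on_split[of 0 s "s + t" w] st by (simp add: zero_on_shift)
  show ?thesis
    using * z st age_eq[of "s + t" u w] age_eq[of s u w] age_eq[of t "age u s w" "shift s w"]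
      age_eq[of t "age 0 s w" "shift s w"] by (auto split: if_splits)
qed

lemma hat_X_flow:
  assumes "w \<in> paths S" "s \<ge> 0" "t \<ge> 0"
  shows "hat_X u (s + t) w = hat_X (age u s w) t (shift s w)"
  using age_flow[OF assms] assms by (simp add: hat_X_eq)

lemma age_0: "age u 0 w = (if w 0 = 0 then u else 0)"
  using age_zero_on[of 0 w u] age_nonzero[of w 0 u] by (auto simp: zero_on_def)

lemma age_right:
  assumes w: "w \<in> paths S" and t: "t \<ge> 0"
  obtains e where "e > 0"
    "\<And>r. t \<le> r \<Longrightarrow> r < t + e \<Longrightarrow> w r = w t \<and> age u r w = age u t w + (if w t = 0 then r - t else 0)"
proof -
  obtain e where e: "e > 0" "\<And>r. t \<le> r \<Longrightarrow> r < t + e \<Longrightarrow> w r = w t" using cadlag_right[OF w t] by metis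
  show ?thesis
  proof (rule that[OF e(1)], rule conjI)
    fix r assume r: "t \<le> r" "r < t + e"
    show rt: "w r = w t" by (rule e(2)[OF r])
    show "age u r w = age u t w + (if w t = 0 then r - t else 0)"
    proof (cases "w t = 0")
      case True
      have "zero_on (shift t w) 0 (r - t)"
        unfolding zero_on_def using e(2)[of "t + x" for x] True r by simp
      then show ?thesis using age_flow[OF w t, of "r - t" u] t r True
          age_zero_on[of "r - t" "shift t w" "age u t w"] by simp
    next
      case False
      then show ?thesis using age_nonzero[of w t u, OF False] age_nonzero[of w r u] rt by simp
    qed
  qed
qed

lemma hat_X_right_cont:
  assumes w: "w \<in> paths S" and t: "t \<ge> 0"
  shows "((\<lambda>r. hat_X u r w) \<longlongrightarrow> hat_X u t w) (at_right t)"
proof -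
  obtain e where e: "e > 0"
    "\<And>r. t \<le> r \<Longrightarrow> r < t + e \<Longrightarrow> w r = w t \<and> age u r w = age u t w + (if w t = 0 then r - t else 0)"
    using age_right[OF assms] by metis
  have "((\<lambda>r. (w t, age u t w + (if w t = 0 then r - t else 0))) \<longlongrightarrow> (w t, age u t w + (if w t = 0 then t - t else 0))) (at_right t)"
    by (cases "w t = 0") (auto intro!: tendsto_eq_intros)
  then have "((\<lambda>r. (w t, age u t w + (if w t = 0 then r - t else 0))) \<longlongrightarrow> hat_X u t w) (at_right t)"
    by (cases "w t = 0") (simp_all add: hat_X_eq)
  moreover have "\<forall>\<^sub>F r in at_right t. (w t, age u t w + (if w t = 0 then r - t else 0)) = hat_X u r w"
    unfolding eventually_at_right_field
  proof (intro exI[of _ "t + e"] conjI allI impI)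
    show "t < t + e" using e(1) by simp
    fix r assume "t < r" "r < t + e"
    then show "(w t, age u t w + (if w t = 0 then r - t else 0)) = hat_X u r w"
      using e(2)[of r] by (simp add: hat_X_eq)
  qed
  ultimately show ?thesis by (rule Lim_transform_eventually)
qed

text \<open>A left limit always exists in the plane, but in the second case it may be
  \<open>(0, 1)\<close>, which is outside \<open>hat_S S\<close>. The data on the last stay at 0 are
  kept so that this case can be recognised later.\<close>

lemma hat_X_left_lim:
  assumes w: "w \<in> paths S" and t: "t > 0"
  obtains (away) l where "l \<in> S" "l \<noteq> 0" "((\<lambda>r. hat_X u r w) \<longlongrightarrow> (l, 0)) (at_left t)"
  | (zero) s where "0 \<le> s" "s < t" "\<And>r. s \<le> r \<Longrightarrow> r < t \<Longrightarrow> w r = 0 \<and> age u r w = age u s w + (r - s)"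
      "((\<lambda>r. hat_X u r w) \<longlongrightarrow> (0, age u s w + (t - s))) (at_left t)"
proof -
  from cadlag_left[OF w t] obtain e l where e: "e > 0" "l \<in> S" "\<And>r. t - e < r \<Longrightarrow> r < t \<Longrightarrow> 0 \<le> r \<Longrightarrow> w r = l" by metis
  define s where "s = max 0 (t - e/2)"
  have s: "0 \<le> s" "s < t" using t e(1) by (auto simp: s_def)
  have ws: "w r = l" if "s \<le> r" "r < t" for r using e(1) that e(3)[of r] unfolding s_def by auto
  have ev: "\<forall>\<^sub>F r in at_left t. P r" if "\<And>r. s \<le> r \<Longrightarrow> r < t \<Longrightarrow> P r" for P
    unfolding eventually_at_left_field by (rule exI[of _ s]) (use s that in auto)
  show thesis
  proof (cases "l = 0")
    case False
    have "\<forall>\<^sub>F r in at_left t. (l, 0) = hat_X u r w"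
    proof (rule ev)
      fix r assume "s \<le> r" "r < t"
      then show "(l, 0) = hat_X u r w" using ws[of r] False age_nonzero[of w r u] by (simp add: hat_X_eq)
    qed
    then have "((\<lambda>r. hat_X u r w) \<longlongrightarrow> (l, 0)) (at_left t)"
      by (rule Lim_transform_eventually[OF tendsto_const])
    then show ?thesis using away e(2) False by blast
  next
    case True
    have a: "w r = 0 \<and> age u r w = age u s w + (r - s)" if r: "s \<le> r" "r < t" for r
    proof -
      have "zero_on (shift s w) 0 (r - s)"
        unfolding zero_on_def using ws[of "s + x" for x] True r s by simp
      then show ?thesis using age_flow[OF w s(1), of "r - s" u] t r True ws
          age_zero_on[of "r - s" "shift s w" "age u s w"] by simp
    qed
    have "((\<lambda>r. (0, age u s w + (r - s))) \<longlongrightarrow> (0::nat, age u s w + (t - s))) (at_left t)"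
      by (auto intro!: tendsto_eq_intros)
    moreover have "\<forall>\<^sub>F r in at_left t. (0, age u s w + (r - s)) = hat_X u r w"
    proof (rule ev)
      fix r assume "s \<le> r" "r < t"
      then show "(0, age u s w + (r - s)) = hat_X u r w" using a[of r] by (simp add: hat_X_eq)
    qed
    ultimately have "((\<lambda>r. hat_X u r w) \<longlongrightarrow> (0, age u s w + (t - s))) (at_left t)"
      by (rule Lim_transform_eventually)
    then show ?thesis using zero[OF s a] by simp
  qed
qed

lemma less_tau_iff:
  assumes w: "w \<in> paths S" and t: "t \<ge> 0"
  shows "ereal t < tau u w \<longleftrightarrow> (\<forall>r\<in>{0..t}. age u r w < 1)"
proof -
  have h: "(\<exists>r\<ge>1. holding u w t = Some r) \<longleftrightarrow> 1 \<le> age u t w" for t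
    unfolding age_def hat_X_def by (cases "holding u w t") auto
  have T: "tau u w = Inf (ereal ` {t. 0 \<le> t \<and> 1 \<le> age u t w})" unfolding tau_def h ..
  show ?thesis
  proof (intro iffI ballI)
    fix r assume *: "ereal t < tau u w" and r: "r \<in> {0..t}"
    show "age u r w < 1"
    proof (rule ccontr)
      assume "\<not> ?thesis"
      then have "tau u w \<le> ereal r" unfolding T using r by (intro Inf_lower) auto
      then show False using * r by (metis atLeastAtMost_iff ereal_less_eq(3) leD order_trans)
    qed
  next
    assume A: "\<forall>r\<in>{0..t}. age u r w < 1"
    obtain e where e: "e > 0"
      "\<And>r. t \<le> r \<Longrightarrow> r < t + e \<Longrightarrow> w r = w t \<and> age u r w = age u t w + (if w t = 0 then r - t else 0)"
      using age_right[OF w t] by metis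
    \<comment> \<open>On \<open>[t, t + e)\<close> the state is constant and the age grows at rate
      at most 1, so it stays below 1 for a time \<open>d\<close>. This turns survival up to and
      including \<open>t\<close> into the strict inequality for the infimum.\<close>
    define d where "d = min e (1 - age u t w)"
    have d: "d > 0" using e(1) A[rule_format, of t] t by (simp add: d_def)
    have "ereal (t + d) \<le> tau u w"
      unfolding T
    proof (rule Inf_greatest, clarify)
      fix r assume r: "0 \<le> r" "1 \<le> age u r w"
      show "ereal (t + d) \<le> ereal r"
      proof (rule ccontr)
        assume "\<not> ?thesis"
        then have *: "r < t + d" by simp
        show False
        proof (cases "r \<le> t")
          case True then show False using A[rule_format, of r] r by simp
        next
          case False
          then have "age u r w < 1" using e(2)[of r] * A[rule_format, of t] t unfolding d_def by (cases "w t = 0") auto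
          then show False using r by simp
        qed
      qed
    qed
    then show "ereal t < tau u w" using d by (auto intro: less_le_trans[of _ "ereal (t + d)"])
  qed
qed

text \<open>Since the age obeys a flow, the condition of staying below 1 on
  \<open>[0, s + t]\<close> splits at time \<open>s\<close>. This is why the killed process is
  Markov once the age is part of its state.\<close>

lemma tau_flow:
  assumes w: "w \<in> paths S" and "s \<ge> 0" "t \<ge> 0"
  shows "ereal (s + t) < tau u w \<longleftrightarrow> ereal s < tau u w \<and> ereal t < tau (age u s w) (shift s w)"
proof -
  have sw: "shift s w \<in> paths S" by (rule shift_cadlag[OF w \<open>s \<ge> 0\<close>])
  have "(\<forall>r\<in>{0..s + t}. age u r w < 1) \<longleftrightarrow>
      (\<forall>r\<in>{0..s}. age u r w < 1) \<and> (\<forall>r\<in>{0..t}. age u (s + r) w < 1)" (is "?l \<longleftrightarrow> ?r1 \<and> ?r2")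
  proof (intro iffI conjI ballI; (elim conjE)?)
    fix r assume "?r1" "?r2" "r \<in> {0..s + t}"
    then show "age u r w < 1" using bspec[of "{0..t}" "\<lambda>r. age u (s + r) w < 1" "r - s"] by (cases "r \<le> s") auto
  qed (use assms in auto)
  moreover have "age u (s + r) w = age (age u s w) r (shift s w)" if "r \<in> {0..t}" for r
    using that assms by (intro age_flow[OF w]) auto
  ultimately show ?thesis
    using less_tau_iff[OF w, of "s + t" u] less_tau_iff[OF w, of s u]
      less_tau_iff[OF sw, of t "age u s w"] assms by simp
qed

lemma less_tau_mono: "ereal t < tau u w \<Longrightarrow> s \<le> t \<Longrightarrow> ereal s < tau u w"
  by (meson ereal_less_eq(3) le_less_trans)

lemma hat_X_in_hat_S:
  assumes w: "w \<in> paths S" and "u \<ge> 0" and t: "t \<ge> 0" and a: "ereal t < tau u w"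
  shows "hat_X u t w \<in> hat_S S"
proof -
  have "age u t w < 1" using a less_tau_iff[OF w t, of u] t by simp
  moreover have "0 \<le> age u t w" by (rule age_nonneg[OF w t \<open>u \<ge> 0\<close>])
  ultimately show ?thesis
    using cadlag_in[OF w t] age_nonzero[of w t u] by (cases "w t = 0") (auto simp: hat_S_def hat_X_eq)
qed

lemma hat_S_D: "x \<in> hat_S S \<Longrightarrow> 0 \<in> S \<Longrightarrow> fst x \<in> S \<and> 0 \<le> snd x \<and> snd x < 1 \<and> (fst x \<noteq> 0 \<longrightarrow> snd x = 0)"
  by (auto simp: hat_S_def)

lemma hat_X_0: "x \<in> hat_S S \<Longrightarrow> w 0 = fst x \<Longrightarrow> hat_X (snd x) 0 w = x"
  by (auto simp: hat_S_def hat_X_eq age_0)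

section \<open>Measurability\<close>

lemma cadlag_subset_space: "cadlag_paths {0..} E \<subseteq> space (\<Pi>\<^sub>M t\<in>{0..}. (borel :: 'a::topological_space measure))"
  by (auto simp: cadlag_paths_def space_PiM PiE_iff extensional_def)

lemma space_skorokhod [simp]: "space (skorokhod_space E) = cadlag_paths {0..} E"
  using cadlag_subset_space[of E] by (auto simp: skorokhod_space_def space_restrict_space)

lemma measurable_eval [measurable]:
  "t \<ge> 0 \<Longrightarrow> (\<lambda>w. w t) \<in> skorokhod_space E \<rightarrow>\<^sub>M borel"
  unfolding skorokhod_space_def by (intro measurable_restrict_space1 measurable_component_singleton) simp

lemma measurable_skorokhodI:
  assumes "\<And>x. x \<in> space M \<Longrightarrow> f x \<in> cadlag_paths {0..} E"
    and "\<And>t. t \<ge> 0 \<Longrightarrow> (\<lambda>x. f x t) \<in> M \<rightarrow>\<^sub>M borel"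
  shows "f \<in> M \<rightarrow>\<^sub>M skorokhod_space E"
  unfolding skorokhod_space_def
proof (rule measurable_restrict_space2)
  show "f \<in> space M \<rightarrow> cadlag_paths {0..} E" using assms(1) by auto
  show "f \<in> M \<rightarrow>\<^sub>M (\<Pi>\<^sub>M t\<in>{0..}. borel)"
    by (rule measurable_PiM_single') (use assms cadlag_subset_space[of E] in \<open>auto simp: space_PiM\<close>)
qed

lemma space_path_filtration [simp]: "space (path_filtration E s) = cadlag_paths {0..} E"
  by (simp add: path_filtration_def)

lemma measurable_filtration_eval [measurable]:
  "0 \<le> t \<Longrightarrow> t \<le> s \<Longrightarrow> (\<lambda>w. w t) \<in> path_filtration E s \<rightarrow>\<^sub>M borel"
proof -
  assume t: "0 \<le> t" "t \<le> s"
  have "(\<lambda>w. restrict w {0..s}) \<in> path_filtration E s \<rightarrow>\<^sub>M (\<Pi>\<^sub>M t\<in>{0..s}. borel)"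
    unfolding path_filtration_def by (rule measurable_vimage_algebra1) (auto simp: space_PiM)
  then have "(\<lambda>w. restrict w {0..s} t) \<in> path_filtration E s \<rightarrow>\<^sub>M borel"
    by (rule measurable_compose) (use t in \<open>auto intro!: measurable_component_singleton\<close>)
  then show ?thesis using t by simp
qed

lemma measurable_filtrationI:
  assumes "\<And>x. x \<in> space M \<Longrightarrow> f x \<in> cadlag_paths {0..} E"
    and "\<And>t. 0 \<le> t \<Longrightarrow> t \<le> s \<Longrightarrow> (\<lambda>x. f x t) \<in> M \<rightarrow>\<^sub>M borel"
  shows "f \<in> M \<rightarrow>\<^sub>M path_filtration E s"
  unfolding path_filtration_def
proof (rule measurable_vimage_algebra2)
  show "f \<in> space M \<rightarrow> cadlag_paths {0..} E" using assms(1) by auto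
  show "(\<lambda>x. restrict (f x) {0..s}) \<in> M \<rightarrow>\<^sub>M (\<Pi>\<^sub>M t\<in>{0..s}. borel)"
    by (rule measurable_restrict) (use assms in auto)
qed

lemma measurable_filtration_skorokhod:
  assumes "f \<in> path_filtration E s \<rightarrow>\<^sub>M N"
  shows "f \<in> skorokhod_space E \<rightarrow>\<^sub>M N"
proof -
  have "(\<lambda>w. w) \<in> skorokhod_space E \<rightarrow>\<^sub>M path_filtration E s"
    by (rule measurable_filtrationI) auto
  from measurable_compose[OF this assms] show ?thesis by simp
qed

lemma sets_filtration_skorokhod: "A \<in> sets (path_filtration E s) \<Longrightarrow> A \<in> sets (skorokhod_space E)"
proof -
  have "(\<lambda>w. w) \<in> skorokhod_space E \<rightarrow>\<^sub>M path_filtration E s"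
    by (rule measurable_filtrationI) auto
  moreover assume "A \<in> sets (path_filtration E s)"
  ultimately have "(\<lambda>w. w) -` A \<inter> space (skorokhod_space E) \<in> sets (skorokhod_space E)"
    by (rule measurable_sets)
  moreover have "A \<subseteq> cadlag_paths {0..} E"
    using sets.sets_into_space[OF \<open>A \<in> _\<close>] by simp
  ultimately show ?thesis by (simp add: Int_absorb2)
qed

lemma sets_filtration_mono: "A \<in> sets (path_filtration E s) \<Longrightarrow> s \<le> t \<Longrightarrow> A \<in> sets (path_filtration E t)"
proof -
  assume A: "A \<in> sets (path_filtration E s)" and st: "s \<le> t"
  have "(\<lambda>w. w) \<in> path_filtration E t \<rightarrow>\<^sub>M path_filtration E s"
    by (rule measurable_filtrationI) (use st in auto)
  then have "(\<lambda>w. w) -` A \<inter> space (path_filtration E t) \<in> sets (path_filtration E t)"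
    using A by (rule measurable_sets)
  moreover have "A \<subseteq> cadlag_paths {0..} E"
    using sets.sets_into_space[OF A] by simp
  ultimately show ?thesis by (simp add: Int_absorb2)
qed

lemma measurable_shift [measurable]:
  assumes "s \<ge> 0"
  shows "shift s \<in> skorokhod_space S \<rightarrow>\<^sub>M skorokhod_space S"
  by (rule measurable_skorokhodI) (use assms in \<open>auto intro: shift_cadlag\<close>)

lemma pred_eval_eq:
  fixes M :: "(real \<Rightarrow> nat) measure"
  assumes "(\<lambda>w. w t) \<in> M \<rightarrow>\<^sub>M borel"
  shows "Measurable.pred M (\<lambda>w. w t = j)"
proof -
  have "(\<lambda>w. w t) -` {j} \<inter> space M \<in> sets M" by (rule measurable_sets[OF assms]) simp
  also have "(\<lambda>w. w t) -` {j} \<inter> space M = {w\<in>space M. w t = j}" by auto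
  finally show ?thesis by (simp add: pred_def)
qed

lemma pred_countable_Ball:
  assumes "countable X" "\<And>i. i \<in> X \<Longrightarrow> Measurable.pred M (P i)"
  shows "Measurable.pred M (\<lambda>x. \<forall>i\<in>X. P i x)"
proof (cases "X = {}")
  case False
  then have "(\<Inter>i\<in>X. {x \<in> space M. P i x}) \<in> sets M"
    using assms by (intro sets.countable_INT') (auto simp: pred_def)
  also have "(\<Inter>i\<in>X. {x \<in> space M. P i x}) = {x \<in> space M. \<forall>i\<in>X. P i x}" using False by auto
  finally show ?thesis by (simp add: pred_def)
qed simp

text \<open>Right continuity transports the value at a rational time back to any time just before
  it. This fails at \<open>b\<close>, beyond which nothing may be consulted, so \<open>b\<close> is
  added by hand.\<close>

lemma zero_on_countable:
  assumes w: "w \<in> paths S" and a: "0 \<le> a" "a \<le> b"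
  shows "zero_on w a b \<longleftrightarrow> (\<forall>r\<in>(\<rat> \<inter> {a..b}) \<union> {b}. w r = 0)"
proof
  assume *: "\<forall>r\<in>(\<rat> \<inter> {a..b}) \<union> {b}. w r = 0"
  show "zero_on w a b"
    unfolding zero_on_def
  proof
    fix r assume r: "r \<in> {a..b}"
    show "w r = 0"
    proof (cases "r = b")
      case False
      from cadlag_right[OF w, of r] r a obtain e where e: "e > 0" "\<And>s. r \<le> s \<Longrightarrow> s < r + e \<Longrightarrow> w s = w r"
        by auto
      have "r < min b (r + e)" using e(1) False r by auto
      then obtain s where s: "s \<in> \<rat>" "r < s" "s < min b (r + e)" using Rats_dense_in_real by blast
      then have "w s = 0" using * r by auto
      then show ?thesis using e(2)[of s] s by simp
    qed (use * in auto)
  qed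
qed (use a in \<open>auto simp: zero_on_def\<close>)

lemma pred_zero_on_filtration:
  assumes "0 \<le> a" "b \<le> s" "0 \<le> b"
  shows "Measurable.pred (path_filtration S s) (\<lambda>w. zero_on w a b)"
proof (cases "a \<le> b")
  case True
  have "Measurable.pred (path_filtration S s) (\<lambda>w. \<forall>r\<in>(\<rat> \<inter> {a..b}) \<union> {b}. w r = 0)"
  proof (rule pred_countable_Ball)
    show "countable (\<rat> \<inter> {a..b} \<union> {b})" using countable_rat by auto
    fix r assume "r \<in> \<rat> \<inter> {a..b} \<union> {b}"
    then show "Measurable.pred (path_filtration S s) (\<lambda>w. w r = 0)"
      using assms by (intro pred_eval_eq measurable_filtration_eval) auto
  qed
  moreover have "zero_on w a b \<longleftrightarrow> (\<forall>r\<in>(\<rat> \<inter> {a..b}) \<union> {b}. w r = 0)" 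
    if "w \<in> space (path_filtration S s)" for w
    using that assms True by (intro zero_on_countable) auto
  ultimately show ?thesis by (subst measurable_cong) auto
next
  case False
  then have "zero_on w a b" for w by (simp add: zero_on_def)
  then show ?thesis by simp
qed

lemma pred_zero_on [measurable]:
  "0 \<le> a \<Longrightarrow> 0 \<le> b \<Longrightarrow> Measurable.pred (skorokhod_space S) (\<lambda>w. zero_on w a b)"
  by (rule measurable_filtration_skorokhod, rule pred_zero_on_filtration[of a b b]) auto

lemma measurable_age_filtration:
  assumes t: "0 \<le> t" "t \<le> s"
  shows "age u t \<in> borel_measurable (path_filtration S s)"
proof -
  have 0: "age 0 t \<in> borel_measurable (path_filtration S s)"
  proof (rule borel_measurableI_ge)
    fix a :: real
    show "{w \<in> space (path_filtration S s). a \<le> age 0 t w} \<in> sets (path_filtration S s)"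
    proof (cases "a > 0")
      case True
      note Z = pred_zero_on_filtration[of _ _ s S, unfolded pred_def]
      have "{w \<in> space (path_filtration S s). zero_on w 0 t \<and> a \<le> 0 + t} \<in> sets (path_filtration S s)"
        using t Z[of 0 t] by (cases "a \<le> t") auto
      moreover have "{w \<in> space (path_filtration S s). a \<le> t \<and> zero_on w (t - a) t} \<in> sets (path_filtration S s)"
        using t Z[of "t - a" t] by (cases "a \<le> t") auto
      ultimately have "{w \<in> space (path_filtration S s). zero_on w 0 t \<and> a \<le> 0 + t} \<union>
          {w \<in> space (path_filtration S s). a \<le> t \<and> zero_on w (t - a) t} \<in> sets (path_filtration S s)"
        by (rule sets.Un)
      also have "{w \<in> space (path_filtration S s). zero_on w 0 t \<and> a \<le> 0 + t} \<union>
          {w \<in> space (path_filtration S s). a \<le> t \<and> zero_on w (t - a) t} = {w \<in> space (path_filtration S s). zero_on w 0 t \<and> a \<le> 0 + t \<or> a \<le> t \<and> zero_on w (t - a) t}"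
        by auto
      finally have "{w \<in> space (path_filtration S s). zero_on w 0 t \<and> a \<le> 0 + t \<or> a \<le> t \<and> zero_on w (t - a) t}
        \<in> sets (path_filtration S s)" .
      moreover have "{w \<in> space (path_filtration S s). a \<le> age 0 t w} =
         {w \<in> space (path_filtration S s). zero_on w 0 t \<and> a \<le> 0 + t \<or> a \<le> t \<and> zero_on w (t - a) t}"
        using age_ge_iff[of _ S t 0 a] t True by auto
      ultimately show ?thesis by simp
    next
      case False
      then have "{w \<in> space (path_filtration S s). a \<le> age 0 t w} = space (path_filtration S s)"
        using age_nonneg[of _ S t 0] t by force
      then show ?thesis by (metis sets.top)
    qed
  qed
  have "(\<lambda>w. if zero_on w 0 t then u + t else age 0 t w) \<in> borel_measurable (path_filtration S s)"
    using t by (intro measurable_If 0 pred_zero_on_filtration[unfolded pred_def]) auto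
  also have "(\<lambda>w. if zero_on w 0 t then u + t else age 0 t w) = age u t"
    using age_eq[OF t(1)] by auto
  finally show ?thesis .
qed

lemma measurable_hat_X_filtration:
  assumes t: "0 \<le> t" "t \<le> s"
  shows "hat_X u t \<in> borel_measurable (path_filtration S s)"
proof -
  have "(\<lambda>w. (w t, age u t w)) \<in> borel_measurable (path_filtration S s)"
    by (intro borel_measurable_Pair measurable_filtration_eval measurable_age_filtration t)
  then show ?thesis by (simp add: hat_X_eq[abs_def])
qed

text \<open>Just to the right of a time the age does not decrease, so an age of at least 1 is also
  seen at a nearby rational time. The time \<open>t\<close> is added because the event must depend
  on the path up to \<open>t\<close> only.\<close>

lemma less_tau_countable:
  assumes w: "w \<in> paths S" and t: "t \<ge> 0"
  shows "ereal t < tau u w \<longleftrightarrow> (\<forall>r\<in>(\<rat> \<inter> {0..t}) \<union> {t}. age u r w < 1)"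
  unfolding less_tau_iff[OF w t]
proof
  assume *: "\<forall>r\<in>(\<rat> \<inter> {0..t}) \<union> {t}. age u r w < 1"
  show "\<forall>r\<in>{0..t}. age u r w < 1"
  proof
    fix r assume r: "r \<in> {0..t}"
    show "age u r w < 1"
    proof (cases "r = t")
      case False
      from r age_right[OF w, of r u] obtain e where e: "e > 0"
        "\<And>s. r \<le> s \<Longrightarrow> s < r + e \<Longrightarrow> w s = w r \<and> age u s w = age u r w + (if w r = 0 then s - r else 0)"
        by (metis atLeastAtMost_iff)
      have "r < min t (r + e)" using e(1) False r by auto
      then obtain s where s: "s \<in> \<rat>" "r < s" "s < min t (r + e)" using Rats_dense_in_real by blast
      then have "age u s w < 1" using * r by auto
      then show ?thesis using e(2)[of s] s by (cases "w r = 0") auto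
    qed (use * in auto)
  qed
qed (use t in auto)

lemma countable_Rats_Int: "countable ((\<rat> \<inter> {a..b}) \<union> {b::real})"
  using countable_rat by auto

lemma pred_less_tau_filtration:
  assumes "0 \<le> t" "t \<le> s"
  shows "Measurable.pred (path_filtration S s) (\<lambda>w. ereal t < tau u w)"
proof -
  have "Measurable.pred (path_filtration S s) (\<lambda>w. \<forall>r\<in>(\<rat> \<inter> {0..t}) \<union> {t}. age u r w < 1)"
  proof (rule pred_countable_Ball[OF countable_Rats_Int])
    fix r assume "r \<in> \<rat> \<inter> {0..t} \<union> {t}"
    then have "age u r \<in> borel_measurable (path_filtration S s)"
      using assms by (intro measurable_age_filtration) auto
    then show "Measurable.pred (path_filtration S s) (\<lambda>w. age u r w < 1)" by simp
  qed
  moreover have "ereal t < tau u w \<longleftrightarrow> (\<forall>r\<in>(\<rat> \<inter> {0..t}) \<union> {t}. age u r w < 1)" 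
    if "w \<in> space (path_filtration S s)" for w
    using that assms by (intro less_tau_countable) auto
  ultimately show ?thesis by (subst measurable_cong) auto
qed

text \<open>Restarting the process at time \<open>s\<close> makes the initial age random, so
  measurability is needed jointly in \<open>u\<close> and the path.\<close>

lemma measurable_age_pair [measurable]:
  assumes t: "0 \<le> t"
  shows "(\<lambda>(u, w). age u t w) \<in> borel_measurable (borel \<Otimes>\<^sub>M skorokhod_space S)"
proof -
  have [measurable]: "age 0 t \<in> borel_measurable (skorokhod_space S)"
    by (rule measurable_filtration_skorokhod[OF measurable_age_filtration[OF t order_refl]])
  have "(\<lambda>(u, w). if zero_on w 0 t then u + t else age 0 t w) \<in> borel_measurable (borel \<Otimes>\<^sub>M skorokhod_space S)"
    using t by measurable
  also have "(\<lambda>(u, w). if zero_on w 0 t then u + t else age 0 t w) = (\<lambda>(u, w). age u t w)"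
    using age_eq[OF t] by auto
  finally show ?thesis .
qed

lemma measurable_hat_X_pair [measurable]:
  assumes t: "0 \<le> t"
  shows "(\<lambda>(u, w). hat_X u t w) \<in> borel_measurable (borel \<Otimes>\<^sub>M skorokhod_space S)"
proof -
  have "(\<lambda>x. (snd x t, (\<lambda>(u, w). age u t w) x)) \<in> borel_measurable (borel \<Otimes>\<^sub>M skorokhod_space S)"
    using t by (intro borel_measurable_Pair measurable_age_pair
       measurable_compose[OF measurable_snd measurable_eval]) auto
  then show ?thesis by (simp add: hat_X_eq[abs_def] case_prod_beta)
qed

lemma tau_nonneg: "0 \<le> tau u w"
  unfolding tau_def by (intro Inf_greatest) auto

lemma measurable_tau_pair [measurable]:
  "(\<lambda>(u, w). tau u w) \<in> borel_measurable (borel \<Otimes>\<^sub>M skorokhod_space S)"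
proof (rule borel_measurableI_greater)
  fix y :: ereal
  let ?M = "borel \<Otimes>\<^sub>M skorokhod_space S"
  show "{x \<in> space ?M. y < (case x of (u, w) \<Rightarrow> tau u w)} \<in> sets ?M"
  proof (cases y)
    case (real t)
    show ?thesis
    proof (cases "t \<ge> 0")
      case True
      have "Measurable.pred ?M (\<lambda>x. \<forall>r\<in>(\<rat> \<inter> {0..t}) \<union> {t}. (\<lambda>(u, w). age u r w) x < 1)"
      proof (rule pred_countable_Ball[OF countable_Rats_Int])
        fix r assume "r \<in> \<rat> \<inter> {0..t} \<union> {t}"
        then have "(\<lambda>(u, w). age u r w) \<in> borel_measurable ?M"
          using True by (intro measurable_age_pair) auto
        then show "Measurable.pred ?M (\<lambda>x. (\<lambda>(u, w). age u r w) x < 1)" by measurable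
      qed
      then have "{x \<in> space ?M. \<forall>r\<in>(\<rat> \<inter> {0..t}) \<union> {t}. (\<lambda>(u, w). age u r w) x < 1} \<in> sets ?M"
        by (simp only: pred_def)
      moreover have "y < (case x of (u, w) \<Rightarrow> tau u w) \<longleftrightarrow>
          (\<forall>r\<in>(\<rat> \<inter> {0..t}) \<union> {t}. (\<lambda>(u, w). age u r w) x < 1)" 
        if "x \<in> space ?M" for x
      proof (cases x)
        case (Pair u w)
        then have "w \<in> paths S" using that by (simp add: space_pair_measure)
        from less_tau_countable[OF this True, of u] show ?thesis by (simp only: Pair real prod.case)
      qed
      then have "{x \<in> space ?M. y < (case x of (u, w) \<Rightarrow> tau u w)} =
          {x \<in> space ?M. \<forall>r\<in>(\<rat> \<inter> {0..t}) \<union> {t}. (\<lambda>(u, w). age u r w) x < 1}"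
        by (intro Collect_cong conj_cong refl)
      ultimately show ?thesis by (simp only:)
    next
      case False
      then have "y < tau u w" for u w using tau_nonneg[of u w] real
        by (meson ereal_less(2) less_le_trans not_le ereal_less_eq(5))
      then have "{x \<in> space ?M. y < (case x of (u, w) \<Rightarrow> tau u w)} = space ?M" by auto
      then show ?thesis by (metis sets.top)
    qed
  next
    case MInf
    have "y < tau u w" for u w using tau_nonneg[of u w] MInf by (cases "tau u w") auto
    then have "{x \<in> space ?M. y < (case x of (u, w) \<Rightarrow> tau u w)} = space ?M" by auto
    then show ?thesis by (metis sets.top)
  qed simp
qed

lemma measurable_tau [measurable]: "tau u \<in> borel_measurable (skorokhod_space S)"
  using measurable_compose[OF measurable_Pair1' measurable_tau_pair, of u S] by simp

lemma measurable_hat_X [measurable]: "0 \<le> t \<Longrightarrow> hat_X u t \<in> borel_measurable (skorokhod_space S)"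
  using measurable_compose[OF measurable_Pair1' measurable_hat_X_pair, of u t S] by simp

lemma measurable_right_continuous_process:
  fixes Y :: "real \<Rightarrow> 'w \<Rightarrow> 'b::metric_space"
  assumes m: "\<And>r. 0 \<le> r \<Longrightarrow> Y r \<in> M \<rightarrow>\<^sub>M borel"
    and rc: "\<And>r w. 0 \<le> r \<Longrightarrow> w \<in> space M \<Longrightarrow> ((\<lambda>r. Y r w) \<longlongrightarrow> Y r w) (at_right r)"
  shows "(\<lambda>(r, w). Y (max 0 r) w) \<in> borel \<Otimes>\<^sub>M M \<rightarrow>\<^sub>M borel"
proof -
  \<comment> \<open>The first point of the grid of mesh \<open>1 / (n + 1)\<close> strictly to the
    right of \<open>max 0 r\<close>. Strictness lets the convergence take place along
    \<open>at_right\<close>.\<close>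
  define d where "d n r = (real_of_int \<lfloor>max 0 r * real (Suc n)\<rfloor> + 1) / real (Suc n)" for n :: nat and r :: real
  have d: "max 0 r < d n r" "d n r \<le> max 0 r + 1 / real (Suc n)" "0 \<le> d n r" for n r
  proof -
    have "max 0 r * real (Suc n) < real_of_int \<lfloor>max 0 r * real (Suc n)\<rfloor> + 1" by linarith
    then show 1: "max 0 r < d n r" unfolding d_def by (subst pos_less_divide_eq) simp_all
    have "real_of_int \<lfloor>max 0 r * real (Suc n)\<rfloor> + 1 \<le> max 0 r * real (Suc n) + 1" by linarith
    then have "d n r \<le> (max 0 r * real (Suc n) + 1) / real (Suc n)"
      unfolding d_def by (rule divide_right_mono) simp
    also have "\<dots> = max 0 r + 1 / real (Suc n)" by (simp add: add_divide_distrib)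
    finally show "d n r \<le> max 0 r + 1 / real (Suc n)" .
    show "0 \<le> d n r" using 1 by linarith
  qed
  have meas: "(\<lambda>x. Y (d n (fst x)) (snd x)) \<in> borel \<Otimes>\<^sub>M M \<rightarrow>\<^sub>M borel" for n
  proof -
    have "(\<lambda>x. (\<lambda>k::int. \<lambda>x. Y (max 0 ((real_of_int k + 1) / real (Suc n))) (snd x))
        \<lfloor>max 0 (fst x) * real (Suc n)\<rfloor> x) \<in> borel \<Otimes>\<^sub>M M \<rightarrow>\<^sub>M borel"
    proof (rule measurable_compose_countable[where g = "\<lambda>x. \<lfloor>max 0 (fst x) * real (Suc n)\<rfloor>"
          and f = "\<lambda>k::int. \<lambda>x. Y (max 0 ((real_of_int k + 1) / real (Suc n))) (snd x)"])
      show "(\<lambda>x. \<lfloor>max 0 (fst x) * real (Suc n)\<rfloor>) \<in> borel \<Otimes>\<^sub>M M \<rightarrow>\<^sub>M count_space UNIV"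
        by measurable
      show "(\<lambda>x. Y (max 0 ((real_of_int i + 1) / real (Suc n))) (snd x)) \<in> borel \<Otimes>\<^sub>M M \<rightarrow>\<^sub>M borel" for i
        by (rule measurable_compose[OF measurable_snd m]) simp
    qed
    moreover have "max 0 ((real_of_int \<lfloor>max 0 r * real (Suc n)\<rfloor> + 1) / real (Suc n)) = d n r" for r
      using d(3)[where r = r and n = n] unfolding d_def by (rule max_absorb2)
    ultimately show ?thesis by simp
  qed
  have lim: "(\<lambda>n. Y (d n (fst x)) (snd x)) \<longlonglongrightarrow> Y (max 0 (fst x)) (snd x)" if x: "x \<in> space (borel \<Otimes>\<^sub>M M)" for x
  proof -
    have "(\<lambda>n. max 0 (fst x) + 1 / real (Suc n)) \<longlonglongrightarrow> max 0 (fst x)"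
      using LIMSEQ_inverse_real_of_nat_add[of "max 0 (fst x)"] by (simp add: inverse_eq_divide)
    from tendsto_sandwich[OF _ _ tendsto_const this, of "\<lambda>n. d n (fst x)"]
    have "(\<lambda>n. d n (fst x)) \<longlonglongrightarrow> max 0 (fst x)"
      using d(1,2) by (auto intro: less_imp_le always_eventually)
    then have "filterlim (\<lambda>n. d n (fst x)) (at_right (max 0 (fst x))) sequentially"
      unfolding filterlim_at using d(1) by (auto intro!: always_eventually simp: less_imp_neq[symmetric] dest: less_imp_neq)
    moreover have "((\<lambda>r. Y r (snd x)) \<longlongrightarrow> Y (max 0 (fst x)) (snd x)) (at_right (max 0 (fst x)))"
      using x by (intro rc) (auto simp: space_pair_measure)
    ultimately show ?thesis by (rule filterlim_compose[rotated])
  qed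
  have "(\<lambda>x. Y (max 0 (fst x)) (snd x)) \<in> borel \<Otimes>\<^sub>M M \<rightarrow>\<^sub>M borel"
    by (rule borel_measurable_LIMSEQ_metric[OF meas lim])
  then show ?thesis by (simp add: case_prod_beta)
qed

lemma measurable_hat_X_time [measurable]:
  "(\<lambda>(r, w). hat_X u (max 0 r) w) \<in> borel \<Otimes>\<^sub>M skorokhod_space S \<rightarrow>\<^sub>M borel"
  by (rule measurable_right_continuous_process) (auto intro: hat_X_right_cont)

section \<open>The Markov property on path space\<close>

definition cyl :: "nat set \<Rightarrow> real set \<Rightarrow> (real \<Rightarrow> nat) \<Rightarrow> (real \<Rightarrow> nat) set" where
  "cyl S J b = {w \<in> paths S. \<forall>t\<in>J. w t = b t}"

lemma cyl_filtration:
  assumes "finite J" "J \<subseteq> {0..s}"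
  shows "cyl S J b \<in> sets (path_filtration S s)"
proof -
  have "Measurable.pred (path_filtration S s) (\<lambda>w. \<forall>t\<in>J. w t = b t)"
    using assms by (intro pred_countable_Ball pred_eval_eq measurable_filtration_eval) (auto intro: countable_finite)
  then show ?thesis by (simp add: cyl_def pred_def)
qed

lemma cyl_sets: "finite J \<Longrightarrow> J \<subseteq> {0..} \<Longrightarrow> cyl S J b \<in> sets (skorokhod_space S)"
  by (rule sets_filtration_skorokhod[of _ _ "Max (insert 0 J)"], rule cyl_filtration) auto

text \<open>A rectangle over finitely many times is a countable disjoint union of sets
  \<open>cyl S J b\<close>, because a finite product of subsets of \<open>nat\<close> is countable.
  Hence prescribing single values at finitely many times is enough.\<close>

lemma measure_eqI_cyl:
  assumes sL: "sets L = sets (skorokhod_space S)" and sL': "sets L' = sets (skorokhod_space S)"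
    and fin: "finite_measure L"
    and eq: "\<And>J b. finite J \<Longrightarrow> J \<subseteq> {0..} \<Longrightarrow> emeasure L (cyl S J b) = emeasure L' (cyl S J b)"
  shows "L = L'"
proof -
  let ?PM = "\<Pi>\<^sub>M t\<in>{0::real..}. (borel :: nat measure)"
  have id: "(\<lambda>w. w) \<in> M \<rightarrow>\<^sub>M ?PM" if "sets M = sets (skorokhod_space S)" for M
  proof -
    have "(\<lambda>w. w) \<in> skorokhod_space S \<rightarrow>\<^sub>M ?PM"
      unfolding skorokhod_space_def by (rule measurable_restrict_space1) simp
    then show ?thesis by (simp cong: measurable_cong_sets add: measurable_cong_sets[OF that refl])
  qed
  have spL: "space L = paths S" "space L' = paths S"
    using sets_eq_imp_space_eq[OF sL] sets_eq_imp_space_eq[OF sL'] by auto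
  interpret finite_measure L by fact
  have "distr L ?PM (\<lambda>w. w) = distr L' ?PM (\<lambda>w. w)"
  proof (rule measure_eqI_PiM_infinite[where I = "{0..}" and M = "\<lambda>_. borel"])
    fix A :: "real \<Rightarrow> nat set" and J :: "real set"
    assume J: "finite J" "J \<subseteq> {0..}"
    let ?X = "prod_emb {0..} (\<lambda>_. borel) J (Pi\<^sub>E J A)"
    have X: "?X \<in> sets ?PM" using J by (intro sets_PiM_I) (auto simp: sets_borel_eq_count_space)
    have un: "?X \<inter> paths S = (\<Union>b\<in>PiE J A. cyl S J b)"
    proof (intro equalityI subsetI)
      fix w assume "w \<in> ?X \<inter> paths S"
      then have w: "w \<in> paths S" "restrict w J \<in> PiE J A" by (auto simp: prod_emb_def)
      then have "w \<in> cyl S J (restrict w J)" by (simp add: cyl_def)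
      then show "w \<in> (\<Union>b\<in>PiE J A. cyl S J b)" using w(2) by blast
    next
      fix w assume "w \<in> (\<Union>b\<in>PiE J A. cyl S J b)"
      then obtain b where b: "b \<in> PiE J A" "w \<in> paths S" "\<And>t. t \<in> J \<Longrightarrow> w t = b t" by (auto simp: cyl_def)
      then show "w \<in> ?X \<inter> paths S"
        using cadlag_subset_space[of S] by (auto simp: prod_emb_def PiE_iff space_PiM)
    qed
    have disj: "disjoint_family_on (cyl S J) (PiE J A)"
      unfolding disjoint_family_on_def
    proof (intro ballI impI)
      fix b c assume bc: "b \<in> PiE J A" "c \<in> PiE J A" "b \<noteq> c"
      then obtain t where "t \<in> J" "b t \<noteq> c t" by (metis PiE_ext)
      then show "cyl S J b \<inter> cyl S J c = {}" by (auto simp: cyl_def)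
    qed
    have cnt: "countable (PiE J A)" by (rule countable_PiE[OF J(1)]) simp
    have "emeasure M (?X \<inter> paths S) = (\<integral>\<^sup>+b. emeasure M (cyl S J b) \<partial>count_space (PiE J A))"
      if "sets M = sets (skorokhod_space S)" for M
      unfolding un using cyl_sets[OF J] that cnt disj by (intro emeasure_UN_countable) auto
    then have "emeasure L (?X \<inter> paths S) = emeasure L' (?X \<inter> paths S)"
      using eq[OF J] sL sL' by simp
    then show "emeasure (distr L ?PM (\<lambda>w. w)) ?X = emeasure (distr L' ?PM (\<lambda>w. w)) ?X"
      using X id[OF sL] id[OF sL'] by (simp add: emeasure_distr spL)
  qed (auto intro: finite_measure_distr id[OF sL])
  then have E: "emeasure L (A \<inter> paths S) = emeasure L' (A \<inter> paths S)" if "A \<in> sets ?PM" for A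
    using emeasure_distr[OF id[OF sL] that] emeasure_distr[OF id[OF sL'] that] by (simp add: spL)
  show ?thesis
  proof (rule measure_eqI)
    fix X assume "X \<in> sets L"
    then obtain A where "A \<in> sets ?PM" "X = paths S \<inter> A"
      unfolding sL skorokhod_space_def sets_restrict_space by auto
    then show "emeasure L X = emeasure L' X" using E by (simp add: Int_commute)
  qed (simp add: sL sL')
qed

text \<open>Induction that adds the largest time: the Markov property at the largest of the earlier
  times contributes a factor depending only on the prescribed value there. The first time is reached
  from time 0, where the state is \<open>x\<close> almost surely.\<close>

lemma markov_law_cyl:
  fixes L :: "(real \<Rightarrow> nat) measure"
  assumes L: "markov_law S K x L" and L': "markov_law S K x L'" and J: "finite J" "J \<subseteq> {0..}"
  shows "emeasure L (cyl S J b) = emeasure L' (cyl S J b)"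
  using J
proof (induction J rule: finite_linorder_max_induct)
  case empty
  have "emeasure L (paths S) = 1" if L: "markov_law S K x L" for L
    using L prob_space.emeasure_space_1[of L] sets_eq_imp_space_eq[of L "skorokhod_space S"]
    by (auto simp: markov_law_def)
  from this[OF L] this[OF L'] show ?case by (simp add: cyl_def)
next
  case (insert t J)
  have t: "t \<ge> 0" and J: "J \<subseteq> {0..}" using insert.prems by auto
  note IH = insert.IH[OF J]
  have mk: "emeasure L {w\<in>A. w (s + t) \<in> B} = (\<integral>\<^sup>+w\<in>A. emeasure (K t (w s)) B \<partial>L)"
    if "markov_law S K x L" "s \<ge> 0" "t \<ge> 0" "A \<in> sets (path_filtration S s)" for L A s t and B :: "nat set"
    using that by (auto simp: markov_law_def sets_borel_eq_count_space)
  show ?case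
  proof (cases "J = {}")
    case True
    have "emeasure L (cyl S {t} b) = emeasure (K t x) {b t}" if L: "markov_law S K x L" for L
    proof -
      interpret prob_space L using L by (simp add: markov_law_def)
      have sp: "space L = paths S"
        using L sets_eq_imp_space_eq[of L "skorokhod_space S"] by (simp add: markov_law_def)
      have "paths S \<in> sets (path_filtration S 0)" by (metis sets.top space_path_filtration)
      from mk[OF L order_refl t this, of "{b t}"]
      have "emeasure L (cyl S {t} b) = (\<integral>\<^sup>+w\<in>paths S. emeasure (K t (w 0)) {b t} \<partial>L)"
        by (simp add: cyl_def)
      also have "\<dots> = (\<integral>\<^sup>+w. emeasure (K t x) {b t} \<partial>L)"
      proof (rule nn_integral_cong_AE)
        have "AE w in L. w 0 = x" using L by (simp add: markov_law_def)
        then show "AE w in L. emeasure (K t (w 0)) {b t} * indicator (paths S) w = emeasure (K t x) {b t}"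
          using AE_space by eventually_elim (simp add: sp)
      qed
      finally show ?thesis using emeasure_space_1 by simp
    qed
    from this[OF L] this[OF L'] show ?thesis using True by simp
  next
    case False
    define s where "s = Max J"
    have s: "s \<in> J" "s < t" "J \<subseteq> {0..s}"
      using False insert.hyps J unfolding s_def by auto
    have s0: "s \<ge> 0" using s J by auto
    have A: "cyl S J b \<in> sets (path_filtration S s)" by (rule cyl_filtration) (use s insert.hyps in auto)
    have "emeasure L (cyl S (insert t J) b) = emeasure (K (t - s) (b s)) {b t} * emeasure L (cyl S J b)"
      if L: "markov_law S K x L" for L
    proof -
      have sL: "sets L = sets (skorokhod_space S)" using L by (simp add: markov_law_def)
      have "cyl S (insert t J) b = {w\<in>cyl S J b. w (s + (t - s)) \<in> {b t}}" by (auto simp: cyl_def)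
      then have "emeasure L (cyl S (insert t J) b) = (\<integral>\<^sup>+w\<in>cyl S J b. emeasure (K (t - s) (w s)) {b t} \<partial>L)"
        using mk[OF L s0 _ A, of "t - s" "{b t}"] s by simp
      also have "\<dots> = (\<integral>\<^sup>+w\<in>cyl S J b. emeasure (K (t - s) (b s)) {b t} \<partial>L)"
        using s(1) by (intro nn_integral_cong) (auto simp: cyl_def split: split_indicator)
      also have "\<dots> = emeasure (K (t - s) (b s)) {b t} * emeasure L (cyl S J b)"
        using cyl_sets[of J S b] insert.hyps J sL by (intro nn_integral_cmult_indicator) auto
      finally show ?thesis .
    qed
    from this[OF L] this[OF L'] show ?thesis using IH by simp
  qed
qed

lemma markov_law_unique:
  fixes L :: "(real \<Rightarrow> nat) measure"
  assumes L: "markov_law S K x L" and L': "markov_law S K x L'"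
  shows "L = L'"
proof (rule measure_eqI_cyl[of L S L'])
  show "finite_measure L" using L by (simp add: markov_law_def prob_space.finite_measure)
qed (use L L' markov_law_cyl[OF L L'] in \<open>auto simp: markov_law_def\<close>)

text \<open>Independence of \<open>U\<close> and \<open>V\<close> in integrated form: rectangles
  determine the product measure. \<open>M\<close> may have any finite mass, because it will be a law
  cut down to an event.\<close>

lemma nn_integral_factorize:
  assumes M: "finite_measure M" and N: "prob_space N"
    and U[measurable]: "U \<in> M \<rightarrow>\<^sub>M W" and V[measurable]: "V \<in> M \<rightarrow>\<^sub>M N"
    and eq: "\<And>C B. C \<in> sets W \<Longrightarrow> B \<in> sets N \<Longrightarrow>
       emeasure M (U -` C \<inter> V -` B \<inter> space M) = emeasure M (U -` C \<inter> space M) * emeasure N B"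
    and Phi[measurable]: "Phi \<in> borel_measurable (W \<Otimes>\<^sub>M N)"
  shows "(\<integral>\<^sup>+w. Phi (U w, V w) \<partial>M) = (\<integral>\<^sup>+w. (\<integral>\<^sup>+v. Phi (U w, v) \<partial>N) \<partial>M)"
proof -
  interpret M: finite_measure M by fact
  interpret N: prob_space N by fact
  interpret D: finite_measure "distr M W U" by (rule M.finite_measure_distr[OF U])
  have UV[measurable]: "(\<lambda>w. (U w, V w)) \<in> M \<rightarrow>\<^sub>M W \<Otimes>\<^sub>M N" by measurable
  have "distr M W U \<Otimes>\<^sub>M N = distr M (W \<Otimes>\<^sub>M N) (\<lambda>w. (U w, V w))"
  proof (rule pair_measure_eqI)
    show "sigma_finite_measure (distr M W U)" by unfold_locales
    show "sigma_finite_measure N" by unfold_locales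
    fix C B assume C: "C \<in> sets (distr M W U)" and B: "B \<in> sets N"
    then have "emeasure (distr M (W \<Otimes>\<^sub>M N) (\<lambda>w. (U w, V w))) (C \<times> B) = emeasure M (U -` C \<inter> V -` B \<inter> space M)"
      by (subst emeasure_distr) (auto intro!: arg_cong[where f = "emeasure M"])
    then show "emeasure (distr M W U) C * emeasure N B
        = emeasure (distr M (W \<Otimes>\<^sub>M N) (\<lambda>w. (U w, V w))) (C \<times> B)"
      using C B by (simp add: emeasure_distr eq)
  qed (simp cong: sets_pair_measure_cong)
  then have "(\<integral>\<^sup>+w. Phi (U w, V w) \<partial>M) = (\<integral>\<^sup>+x. Phi x \<partial>(distr M W U \<Otimes>\<^sub>M N))"
    by (simp add: nn_integral_distr)
  also have "\<dots> = (\<integral>\<^sup>+c. (\<integral>\<^sup>+v. Phi (c, v) \<partial>N) \<partial>distr M W U)"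
    by (rule N.nn_integral_fst[symmetric]) (simp cong: measurable_cong_sets sets_pair_measure_cong)
  also have "\<dots> = (\<integral>\<^sup>+w. (\<integral>\<^sup>+v. Phi (U w, v) \<partial>N) \<partial>M)"
    by (rule nn_integral_distr[OF U]) (auto intro!: N.borel_measurable_nn_integral simp: case_prod_beta cong: measurable_cong_sets)
  finally show ?thesis .
qed

locale chain =
  fixes S :: "nat set" and q :: "nat \<Rightarrow> nat \<Rightarrow> real" and P :: "nat \<Rightarrow> (real \<Rightarrow> nat) measure"
  assumes state_space: "S = UNIV \<or> (\<exists>K\<ge>1. S = {0..K})"
    and nonexplosive: "nonexplosive_chain S q P"
    and irreducible: "irreducible_on S (transition P)"
    and recurrent: "recurrent S P"
begin

abbreviation "\<Omega> \<equiv> skorokhod_space S"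

lemma S_0 [simp]: "0 \<in> S" and S_1 [simp]: "1 \<in> S" "Suc 0 \<in> S" using state_space by auto

lemma law: "i \<in> S \<Longrightarrow> markov_law S (transition P) i (P i)"
  using nonexplosive by (simp add: nonexplosive_chain_def)

lemma prob_space_P: "i \<in> S \<Longrightarrow> prob_space (P i)"
  using law by (simp add: markov_law_def)

lemma sets_P [measurable_cong, simp]: "i \<in> S \<Longrightarrow> sets (P i) = sets \<Omega>"
  using law by (simp add: markov_law_def)

lemma space_P [simp]: "i \<in> S \<Longrightarrow> space (P i) = paths S"
  using sets_eq_imp_space_eq[OF sets_P] by simp

lemma measurable_P [simp]: "i \<in> S \<Longrightarrow> P i \<rightarrow>\<^sub>M N = \<Omega> \<rightarrow>\<^sub>M N"
  by (intro measurable_cong_sets sets_P refl)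

lemma AE_start: "i \<in> S \<Longrightarrow> AE w in P i. w 0 = i"
  using law by (simp add: markov_law_def)

lemma markov_step:
  "i \<in> S \<Longrightarrow> s \<ge> 0 \<Longrightarrow> t \<ge> 0 \<Longrightarrow> A \<in> sets (path_filtration S s) \<Longrightarrow>
    emeasure (P i) {w\<in>A. w (s + t) \<in> B} = (\<integral>\<^sup>+w\<in>A. emeasure (transition P t (w s)) B \<partial>P i)"
  using law[of i] by (auto simp: markov_law_def sets_borel_eq_count_space)

lemma shift_in_filtration:
  assumes "s \<ge> 0" "r \<ge> 0" "B \<in> sets (path_filtration S r)"
  shows "shift s -` B \<inter> paths S \<in> sets (path_filtration S (s + r))"
proof -
  have "shift s \<in> path_filtration S (s + r) \<rightarrow>\<^sub>M path_filtration S r"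
    by (rule measurable_filtrationI) (use assms in \<open>auto intro: shift_cadlag\<close>)
  from measurable_sets[OF this assms(3)] show ?thesis by simp
qed

text \<open>\<open>markov_law\<close> speaks of one future time; here it is the whole future path.
  Conditioned on \<open>A\<close>, the shifted path has a Markov law started at \<open>j\<close>,
  and uniqueness identifies that law with \<open>P j\<close>. A null event \<open>A\<close> is
  trivial.\<close>

lemma markov_path:
  assumes i: "i \<in> S" and j: "j \<in> S" and s: "s \<ge> 0"
    and A: "A \<in> sets (path_filtration S s)" and Aj: "\<And>w. w \<in> A \<Longrightarrow> w s = j"
    and B: "B \<in> sets \<Omega>"
  shows "emeasure (P i) (A \<inter> shift s -` B) = emeasure (P i) A * emeasure (P j) B"
proof -
  interpret Pi: prob_space "P i" by (rule prob_space_P[OF i])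
  have AO: "A \<in> sets (P i)" using sets_filtration_skorokhod[OF A] i by simp
  have Asub: "A \<subseteq> paths S" using sets.sets_into_space[OF A] by simp
  have B': "shift s -` B \<inter> paths S \<in> sets \<Omega>"
    using measurable_sets[OF measurable_shift[OF s] B] by simp
  show ?thesis
  proof (cases "emeasure (P i) A = 0")
    case True
    have "emeasure (P i) (A \<inter> shift s -` B) \<le> emeasure (P i) A"
      by (rule emeasure_mono) (use AO in auto)
    then show ?thesis using True by simp
  next
    case False
    define U where "U = distr (uniform_measure (P i) A) \<Omega> (shift s)"
    have fin: "emeasure (P i) A \<noteq> \<infinity>" by simp
    interpret Un: prob_space "uniform_measure (P i) A"
      by (rule prob_space_uniform_measure[OF False fin])
    have sh: "shift s \<in> uniform_measure (P i) A \<rightarrow>\<^sub>M \<Omega>" using measurable_shift[OF s] i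
      by (simp cong: measurable_cong_sets)
    have emU: "emeasure U X = emeasure (P i) (A \<inter> shift s -` X) / emeasure (P i) A" if "X \<in> sets \<Omega>" for X
    proof -
      have X': "shift s -` X \<inter> paths S \<in> sets \<Omega>"
        using measurable_sets[OF measurable_shift[OF s] that] by simp
      have "emeasure U X = emeasure (uniform_measure (P i) A) (shift s -` X \<inter> paths S)"
        unfolding U_def using sh that i by (subst emeasure_distr) simp_all
      also have "\<dots> = emeasure (P i) (A \<inter> (shift s -` X \<inter> paths S)) / emeasure (P i) A"
        using X' i AO by simp
      also have "A \<inter> (shift s -` X \<inter> paths S) = A \<inter> shift s -` X" using Asub by auto
      finally show ?thesis .
    qed
    have "markov_law S (transition P) j U"
      unfolding markov_law_def
    proof (intro conjI allI impI ballI)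
      show "prob_space U" unfolding U_def by (rule Un.prob_space_distr[OF sh])
      show "sets U = sets \<Omega>" by (simp add: U_def)
      show "AE w in U. w 0 = j"
        unfolding U_def
      proof (subst AE_distr_iff[OF sh])
        have "Measurable.pred \<Omega> (\<lambda>w. w 0 = j)" by (rule pred_eval_eq) simp
        then show "{x \<in> space \<Omega>. x 0 = j} \<in> sets \<Omega>" by (simp add: pred_def)
        show "AE w in uniform_measure (P i) A. shift s w 0 = j"
          by (rule AE_uniform_measureI[OF AO]) (use Aj in \<open>auto intro!: AE_I2\<close>)
      qed
      fix r t :: real and A' and B :: "nat set" assume r: "0 \<le> r" "0 \<le> t" "A' \<in> sets (path_filtration S r)"
      let ?A = "A \<inter> shift s -` A'"
      have "A \<inter> (shift s -` A' \<inter> paths S) \<in> sets (path_filtration S (s + r))"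
        by (intro sets.Int sets_filtration_mono[OF A] shift_in_filtration) (use s r in auto)
      also have "A \<inter> (shift s -` A' \<inter> paths S) = ?A" using Asub by auto
      finally have A2: "?A \<in> sets (path_filtration S (s + r))" .
      have A'O: "A' \<in> sets \<Omega>" by (rule sets_filtration_skorokhod[OF r(3)])
      have "{w\<in>A'. w (r + t) \<in> B} = A' \<inter> ((\<lambda>w. w (r + t)) -` B \<inter> space \<Omega>)"
        using sets.sets_into_space[OF A'O] by auto
      moreover have "(\<lambda>w. w (r + t)) -` B \<inter> space \<Omega> \<in> sets \<Omega>"
        using r by (intro measurable_sets[OF measurable_eval]) (auto simp: sets_borel_eq_count_space)
      ultimately have X: "{w\<in>A'. w (r + t) \<in> B} \<in> sets \<Omega>" using A'O by simp
      have "A \<inter> shift s -` {w\<in>A'. w (r + t) \<in> B} = {w\<in>?A. w ((s + r) + t) \<in> B}"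
        using r by (auto simp: add.assoc)
      then have 1: "emeasure U {w\<in>A'. w (r + t) \<in> B} =
          (\<integral>\<^sup>+w\<in>?A. emeasure (transition P t (w (s + r))) B \<partial>P i) / emeasure (P i) A"
        using emU[OF X] markov_step[OF i _ r(2) A2] s r by simp
      have m: "(\<lambda>w. emeasure (transition P t (w r)) B * indicator A' w) \<in> borel_measurable \<Omega>"
        using A'O r(1) by (intro borel_measurable_times_ennreal borel_measurable_indicator
            measurable_compose[OF measurable_eval]) (auto intro: borel_measurable_count_space simp: measurable_def sets_borel_eq_count_space)
      have "(\<integral>\<^sup>+w\<in>A'. emeasure (transition P t (w r)) B \<partial>U) =
         (\<integral>\<^sup>+w. emeasure (transition P t (shift s w r)) B * indicator A' (shift s w) \<partial>uniform_measure (P i) A)"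
        unfolding U_def by (rule nn_integral_distr[OF sh]) (use m in simp)
      also have "\<dots> = (\<integral>\<^sup>+w. emeasure (transition P t (shift s w r)) B * indicator A' (shift s w) * indicator A w \<partial>P i)
          / emeasure (P i) A"
        using measurable_compose[OF measurable_shift[OF s] m] i AO by (intro nn_integral_uniform_measure) auto
      also have "(\<integral>\<^sup>+w. emeasure (transition P t (shift s w r)) B * indicator A' (shift s w) * indicator A w \<partial>P i)
         = (\<integral>\<^sup>+w\<in>?A. emeasure (transition P t (w (s + r))) B \<partial>P i)"
        using r by (intro nn_integral_cong) (auto split: split_indicator)
      finally show "emeasure U {w\<in>A'. w (r + t) \<in> B} = (\<integral>\<^sup>+w\<in>A'. emeasure (transition P t (w r)) B \<partial>U)"
        using 1 by simp
    qed
    then have "U = P j" by (rule markov_law_unique) (rule law[OF j])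
    then have "emeasure (P j) B = emeasure (P i) (A \<inter> shift s -` B) / emeasure (P i) A"
      using emU[OF B] by simp
    then show ?thesis using False fin
      by (metis ennreal_times_divide infinity_ennreal_def mult.commute mult_divide_eq_ennreal)
  qed
qed

lemma nn_integral_split_state:
  assumes i: "i \<in> S" and X: "X \<in> \<Omega> \<rightarrow>\<^sub>M (borel :: nat measure)" and f: "f \<in> borel_measurable \<Omega>"
  shows "(\<integral>\<^sup>+w. f w \<partial>P i) = (\<Sum>j. \<integral>\<^sup>+w. f w * indicator {w. X w = j} w \<partial>P i)"
proof -
  have m: "(\<lambda>w. f w * indicator {w. X w = j} w) \<in> borel_measurable (P i)" for j
  proof -
    have "{w \<in> space \<Omega>. X w = j} = X -` {j} \<inter> space \<Omega>" by auto
    then have "{w \<in> space \<Omega>. X w = j} \<in> sets \<Omega>" using measurable_sets[OF X, of "{j}"] by (simp add: sets_borel_eq_count_space)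
    then have "(\<lambda>w. f w * indicator {w \<in> space \<Omega>. X w = j} w) \<in> borel_measurable \<Omega>"
      using f by (intro borel_measurable_times_ennreal borel_measurable_indicator)
    also have "?this \<longleftrightarrow> (\<lambda>w. f w * indicator {w. X w = j} w) \<in> borel_measurable \<Omega>"
      by (intro measurable_cong) (auto split: split_indicator)
    finally show ?thesis using i by simp
  qed
  have "(\<Sum>j. f w * indicator {w. X w = j} w) = f w" for w
    using suminf_finite[of "{X w}" "\<lambda>j. f w * indicator {w. X w = j} w"] by simp
  then show ?thesis using nn_integral_suminf[of "\<lambda>j w. f w * indicator {w. X w = j} w" "P i"] m by simp
qed

lemma nn_integral_indicator_density:
  assumes "i \<in> S" "f \<in> borel_measurable \<Omega>" "A \<in> sets \<Omega>"
  shows "(\<integral>\<^sup>+w. f w * indicator A w \<partial>P i) = (\<integral>\<^sup>+w. f w \<partial>density (P i) (indicator A))"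
  using assms by (subst nn_integral_density) (auto simp: mult.commute)

lemma emeasure_indicator_density:
  assumes "i \<in> S" "A \<in> sets \<Omega>" "B \<in> sets \<Omega>"
  shows "emeasure (density (P i) (indicator A)) B = emeasure (P i) (A \<inter> B)"
  using assms by (subst emeasure_density) (auto simp: indicator_inter_arith[symmetric])

lemma finite_indicator_density:
  assumes "i \<in> S" "A \<in> sets \<Omega>"
  shows "finite_measure (density (P i) (indicator A))"
proof
  interpret prob_space "P i" using assms by (rule_tac prob_space_P)
  show "emeasure (density (P i) (indicator A)) (space (density (P i) (indicator A))) \<noteq> \<infinity>"
    using assms sets.top[of \<Omega>] by (simp add: emeasure_indicator_density)
qed

text \<open>On the event that the state at \<open>s\<close> is \<open>j\<close>, the shifted path is
  independent of the past with law \<open>P j\<close>. Splitting into these countably many events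
  removes the dependence of the inner measure on the path.\<close>

lemma markov_nn_integral:
  assumes i: "i \<in> S" and s: "s \<ge> 0"
    and Phi[measurable]: "Phi \<in> borel_measurable (path_filtration S s \<Otimes>\<^sub>M \<Omega>)"
  shows "(\<integral>\<^sup>+w. Phi (w, shift s w) \<partial>P i) = (\<integral>\<^sup>+w. (\<integral>\<^sup>+v. Phi (w, v) \<partial>P (w s)) \<partial>P i)"
proof -
  have idm: "(\<lambda>w. w) \<in> \<Omega> \<rightarrow>\<^sub>M path_filtration S s" by (rule measurable_filtrationI) auto
  have sh[measurable]: "shift s \<in> \<Omega> \<rightarrow>\<^sub>M \<Omega>" by (rule measurable_shift[OF s])
  have ev: "(\<lambda>w. w s) \<in> \<Omega> \<rightarrow>\<^sub>M borel" by (rule measurable_eval[OF s])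
  have m1: "(\<lambda>w. Phi (w, shift s w)) \<in> borel_measurable \<Omega>"
    by (rule measurable_compose[OF measurable_Pair[OF idm sh] Phi])
  have mj: "(\<lambda>w. \<integral>\<^sup>+v. Phi (w, v) \<partial>P j) \<in> borel_measurable \<Omega>" if "j \<in> S" for j
  proof -
    interpret prob_space "P j" by (rule prob_space_P[OF that])
    have "(\<lambda>w. \<integral>\<^sup>+v. Phi (w, v) \<partial>P j) \<in> borel_measurable (path_filtration S s)"
      using that by (intro borel_measurable_nn_integral) (simp cong: measurable_cong_sets sets_pair_measure_cong)
    then show ?thesis by (rule measurable_filtration_skorokhod)
  qed
  have m2: "(\<lambda>w. \<integral>\<^sup>+v. Phi (w, v) \<partial>P (w s)) \<in> borel_measurable \<Omega>"
  proof -
    \<comment> \<open>Nothing is known about \<open>P j\<close> for \<open>j\<close> outside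
      \<open>S\<close>, so the family is cut off there; paths never visit such states.\<close>
    have "(\<lambda>w. (\<lambda>j w. if j \<in> S then \<integral>\<^sup>+v. Phi (w, v) \<partial>P j else 0) (w s) w) \<in> borel_measurable \<Omega>"
    proof (rule measurable_compose_countable[where g = "\<lambda>w. w s" and f = "\<lambda>j w. if j \<in> S then \<integral>\<^sup>+v. Phi (w, v) \<partial>P j else 0"])
      show "(\<lambda>w. w s) \<in> \<Omega> \<rightarrow>\<^sub>M count_space UNIV"
        using ev by (simp add: measurable_cong_sets[OF refl sets_borel_eq_count_space])
      show "(\<lambda>w. if j \<in> S then \<integral>\<^sup>+v. Phi (w, v) \<partial>P j else 0) \<in> borel_measurable \<Omega>" for j
        using mj by (cases "j \<in> S") auto
    qed
    also have "?this \<longleftrightarrow> ?thesis" by (intro measurable_cong) (use cadlag_in s in auto)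
    finally show ?thesis .
  qed
  show ?thesis
    unfolding nn_integral_split_state[OF i ev m1] nn_integral_split_state[OF i ev m2]
  proof (rule suminf_cong)
    fix j
    define A where "A = {w \<in> paths S. w s = j}"
    have Af: "A \<in> sets (path_filtration S s)"
      using pred_eval_eq[OF measurable_filtration_eval[OF s order_refl, of S], of j] by (simp add: pred_def A_def)
    have A: "A \<in> sets \<Omega>" by (rule sets_filtration_skorokhod[OF Af])
    have ind: "(\<integral>\<^sup>+w. f w * indicator {w. w s = j} w \<partial>P i) = (\<integral>\<^sup>+w. f w * indicator A w \<partial>P i)" for f
      using i by (intro nn_integral_cong) (auto simp: A_def split: split_indicator)
    show "(\<integral>\<^sup>+w. Phi (w, shift s w) * indicator {w. w s = j} w \<partial>P i) =
      (\<integral>\<^sup>+w. (\<integral>\<^sup>+v. Phi (w, v) \<partial>P (w s)) * indicator {w. w s = j} w \<partial>P i)"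
    proof (cases "j \<in> S")
      case False
      then have "A = {}" using cadlag_in[OF _ s, of _ S] by (auto simp: A_def)
      then show ?thesis unfolding ind by simp
    next
      case j: True
      let ?M = "density (P i) (indicator A)"
      have "(\<integral>\<^sup>+w. Phi (w, shift s w) * indicator {w. w s = j} w \<partial>P i) = (\<integral>\<^sup>+w. Phi (w, shift s w) \<partial>?M)"
        unfolding ind by (rule nn_integral_indicator_density[OF i m1 A])
      also have "\<dots> = (\<integral>\<^sup>+w. (\<integral>\<^sup>+v. Phi (w, v) \<partial>P j) \<partial>?M)"
      proof (rule nn_integral_factorize[where W = "path_filtration S s" and U = "\<lambda>w. w"])
        show "finite_measure ?M" by (rule finite_indicator_density[OF i A])
        show "prob_space (P j)" by (rule prob_space_P[OF j])
        show "(\<lambda>w. w) \<in> ?M \<rightarrow>\<^sub>M path_filtration S s" using idm i by simp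
        have "?M \<rightarrow>\<^sub>M P j = \<Omega> \<rightarrow>\<^sub>M \<Omega>" using i j by (intro measurable_cong_sets) auto
        then show "shift s \<in> ?M \<rightarrow>\<^sub>M P j" using sh by simp
        show "Phi \<in> borel_measurable (path_filtration S s \<Otimes>\<^sub>M P j)"
          using Phi j by (simp cong: measurable_cong_sets sets_pair_measure_cong)
        fix C B assume C: "C \<in> sets (path_filtration S s)" and B: "B \<in> sets (P j)"
        have B': "B \<in> sets \<Omega>" using B j by simp
        have C': "C \<in> sets \<Omega>" by (rule sets_filtration_skorokhod[OF C])
        have Csub: "C \<subseteq> paths S" using sets.sets_into_space[OF C] by simp
        have sB: "shift s -` B \<inter> paths S \<in> sets \<Omega>" using measurable_sets[OF sh B'] by simp
        have "C \<inter> (shift s -` B \<inter> paths S) \<in> sets \<Omega>" using C' sB by (rule sets.Int)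
        moreover have "(\<lambda>w. w) -` C \<inter> shift s -` B \<inter> space ?M = C \<inter> (shift s -` B \<inter> paths S)"
          using i by auto
        ultimately have "emeasure ?M ((\<lambda>w. w) -` C \<inter> shift s -` B \<inter> space ?M)
            = emeasure (P i) (A \<inter> (C \<inter> (shift s -` B \<inter> paths S)))"
          by (simp add: emeasure_indicator_density[OF i A])
        also have "A \<inter> (C \<inter> (shift s -` B \<inter> paths S)) = (A \<inter> C) \<inter> shift s -` B" using Csub by auto
        also have "emeasure (P i) \<dots> = emeasure (P i) (A \<inter> C) * emeasure (P j) B"
          by (rule markov_path[OF i j s sets.Int[OF Af C] _ B']) (simp add: A_def)
        also have "emeasure (P i) (A \<inter> C) = emeasure ?M ((\<lambda>w. w) -` C \<inter> space ?M)"
        proof -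
          have "(\<lambda>w. w) -` C \<inter> space ?M = C" using i Csub by auto
          then show ?thesis by (simp add: emeasure_indicator_density[OF i A C'])
        qed
        finally show "emeasure ?M ((\<lambda>w. w) -` C \<inter> shift s -` B \<inter> space ?M) =
            emeasure ?M ((\<lambda>w. w) -` C \<inter> space ?M) * emeasure (P j) B" .
      qed
      also have "\<dots> = (\<integral>\<^sup>+w. (\<integral>\<^sup>+v. Phi (w, v) \<partial>P j) * indicator A w \<partial>P i)"
        by (rule nn_integral_indicator_density[OF i mj[OF j] A, symmetric])
      also have "\<dots> = (\<integral>\<^sup>+w. (\<integral>\<^sup>+v. Phi (w, v) \<partial>P (w s)) * indicator {w. w s = j} w \<partial>P i)"
        unfolding ind by (intro nn_integral_cong) (auto simp: A_def split: split_indicator)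
      finally show ?thesis .
    qed
  qed
qed

end

section \<open>The strong Markov property at entrance times\<close>

definition hits :: "nat set \<Rightarrow> (real \<Rightarrow> nat) \<Rightarrow> bool" where
  "hits D w \<longleftrightarrow> (\<exists>t\<ge>0. w t \<in> D)"

text \<open>On a path that never meets \<open>D\<close> this is \<open>Inf {}\<close> with an
  unspecified value. Hence the guards \<open>hits D w\<close> and, where a time is required,
  \<open>max 0 (entry D w)\<close>.\<close>

definition entry :: "nat set \<Rightarrow> (real \<Rightarrow> nat) \<Rightarrow> real" where
  "entry D w = Inf {t. 0 \<le> t \<and> w t \<in> D}"

lemma entry:
  assumes w: "w \<in> paths S" and h: "hits D w"
  shows entry_nonneg: "0 \<le> entry D w" and entry_in: "w (entry D w) \<in> D"
    and entry_le: "\<And>t. 0 \<le> t \<Longrightarrow> w t \<in> D \<Longrightarrow> entry D w \<le> t"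
proof -
  let ?A = "{t. 0 \<le> t \<and> w t \<in> D}"
  have ne: "?A \<noteq> {}" using h by (auto simp: hits_def)
  have bd: "bdd_below ?A" by (rule bdd_belowI[of _ 0]) simp
  show 0: "0 \<le> entry D w" unfolding entry_def by (rule cInf_greatest[OF ne]) simp
  show "entry D w \<le> t" if "0 \<le> t" "w t \<in> D" for t
    unfolding entry_def by (rule cInf_lower[OF _ bd]) (use that in simp)
  from cadlag_right[OF w 0] obtain e where e: "e > 0"
    "\<And>r. entry D w \<le> r \<Longrightarrow> r < entry D w + e \<Longrightarrow> w r = w (entry D w)" by metis
  have "Inf ?A < entry D w + e" using e(1) by (simp add: entry_def)
  then obtain t where t: "t \<in> ?A" "t < entry D w + e" using cInf_lessD[OF ne] by metis
  have "entry D w \<le> t" unfolding entry_def by (rule cInf_lower[OF t(1) bd])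
  then show "w (entry D w) \<in> D" using e(2)[of t] t by simp
qed

lemma before_entry:
  assumes w: "w \<in> paths S" and "0 \<le> t" "hits D w \<Longrightarrow> t < entry D w"
  shows "w t \<notin> D"
proof
  assume d: "w t \<in> D"
  then have h: "hits D w" using assms(2) by (auto simp: hits_def)
  from entry_le[OF w h assms(2) d] assms(3)[OF h] show False by simp
qed

text \<open>After its entrance the path remains in \<open>D\<close> for a short while, which
  contains a rational time before \<open>t\<close>. The inequality is strict, so only times before
  \<open>t\<close> are consulted.\<close>

lemma entry_less_countable:
  assumes w: "w \<in> paths S" and t: "t > 0"
  shows "hits D w \<and> entry D w < t \<longleftrightarrow> (\<exists>r\<in>\<rat> \<inter> {0..<t}. w r \<in> D)"
proof
  assume "\<exists>r\<in>\<rat> \<inter> {0..<t}. w r \<in> D"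
  then obtain r where r: "0 \<le> r" "r < t" "w r \<in> D" by auto
  then have h: "hits D w" by (auto simp: hits_def)
  with entry_le[OF w h r(1,3)] r show "hits D w \<and> entry D w < t" by simp
next
  assume *: "hits D w \<and> entry D w < t"
  then have h: "hits D w" by simp
  have 0: "0 \<le> entry D w" by (rule entry_nonneg[OF w h])
  from cadlag_right[OF w 0] obtain e where e: "e > 0"
    "\<And>r. entry D w \<le> r \<Longrightarrow> r < entry D w + e \<Longrightarrow> w r = w (entry D w)" by metis
  have "entry D w < min t (entry D w + e)" using e(1) * by auto
  then obtain s where s: "s \<in> \<rat>" "entry D w < s" "s < min t (entry D w + e)" using Rats_dense_in_real by blast
  then have "w s \<in> D" using e(2)[of s] entry_in[OF w h] by simp
  then show "\<exists>r\<in>\<rat> \<inter> {0..<t}. w r \<in> D" using s 0 by (intro bexI[of _ s]) auto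
qed

lemma pred_eval_in:
  fixes M :: "(real \<Rightarrow> nat) measure"
  assumes "(\<lambda>w. w t) \<in> M \<rightarrow>\<^sub>M borel"
  shows "Measurable.pred M (\<lambda>w. w t \<in> D)"
proof -
  have "(\<lambda>w. w t) -` D \<inter> space M \<in> sets M"
    by (rule measurable_sets[OF assms]) (simp add: sets_borel_eq_count_space)
  also have "(\<lambda>w. w t) -` D \<inter> space M = {w\<in>space M. w t \<in> D}" by auto
  finally show ?thesis by (simp add: pred_def)
qed

lemma pred_entry_less_filtration:
  assumes "0 < t" "t \<le> s"
  shows "Measurable.pred (path_filtration S s) (\<lambda>w. hits D w \<and> entry D w < t)"
proof -
  have "Measurable.pred (path_filtration S s) (\<lambda>w. \<forall>r\<in>\<rat> \<inter> {0..<t}. w r \<in> - D)"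
  proof (rule pred_countable_Ball)
    show "countable (\<rat> \<inter> {0..<t})" using countable_rat by auto
    fix r assume "r \<in> \<rat> \<inter> {0..<t}"
    then show "Measurable.pred (path_filtration S s) (\<lambda>w. w r \<in> - D)"
      using assms by (intro pred_eval_in measurable_filtration_eval) auto
  qed
  then have "Measurable.pred (path_filtration S s) (\<lambda>w. \<not> (\<forall>r\<in>\<rat> \<inter> {0..<t}. w r \<in> - D))"
    by measurable
  moreover have "(\<not> (\<forall>r\<in>\<rat> \<inter> {0..<t}. w r \<in> - D)) \<longleftrightarrow> hits D w \<and> entry D w < t"
    if "w \<in> space (path_filtration S s)" for w
    using that entry_less_countable[of w S t D] assms by simp
  ultimately show ?thesis by (subst measurable_cong[symmetric]) auto
qed

lemma hits_countable:
  assumes w: "w \<in> paths S"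
  shows "hits D w \<longleftrightarrow> (\<exists>n::nat. hits D w \<and> entry D w < real (Suc n))"
  by (metis lessI less_trans of_nat_less_iff reals_Archimedean2)

lemma pred_hits [measurable]: "Measurable.pred (skorokhod_space S) (hits D)"
proof -
  have "Measurable.pred (skorokhod_space S) (\<lambda>w. \<exists>n::nat. hits D w \<and> entry D w < real (Suc n))"
    by (intro pred_intros_countable measurable_filtration_skorokhod[OF pred_entry_less_filtration[OF _ order_refl]]) simp
  then show ?thesis by (subst measurable_cong[OF hits_countable]) auto
qed

lemma measurable_entry [measurable]: "entry D \<in> borel_measurable (skorokhod_space S)"
proof -
  have p: "Measurable.pred (skorokhod_space S) (\<lambda>w. hits D w \<and> entry D w < t)" for t
  proof (cases "t > 0")
    case True
    show ?thesis by (rule measurable_filtration_skorokhod[OF pred_entry_less_filtration[OF True order_refl]])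
  next
    case False
    have "\<not> (hits D w \<and> entry D w < t)" if "w \<in> space (skorokhod_space S)" for w
      using entry_nonneg[of w S D] that False by auto
    then show ?thesis by (subst measurable_cong[where g = "\<lambda>_. False"]) auto
  qed
  \<comment> \<open>Where \<open>D\<close> is not met, \<open>entry\<close> has the constant value
    \<open>Inf {}\<close>; measurability follows whatever that value is.\<close>
  have "Measurable.pred (skorokhod_space S) (\<lambda>w. (if hits D w then hits D w \<and> entry D w < t else Inf {} < t))" for t :: real
    using p[of t] by measurable
  moreover have "(if hits D w then hits D w \<and> entry D w < t else Inf {} < t) \<longleftrightarrow> entry D w < t" for w t
  proof (cases "hits D w")
    case False
    then have "{t. 0 \<le> t \<and> w t \<in> D} = {}" by (auto simp: hits_def)
    then have "entry D w = Inf {}" by (simp only: entry_def)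
    then show ?thesis using False by (simp only: if_False)
  qed simp
  ultimately have "Measurable.pred (skorokhod_space S) (\<lambda>w. entry D w < t)" for t by simp
  then show ?thesis by (intro borel_measurableI_less) (simp add: pred_def)
qed

lemma measurable_eval_time [measurable]:
  "(\<lambda>(r, w). w (max 0 r)) \<in> borel \<Otimes>\<^sub>M skorokhod_space S \<rightarrow>\<^sub>M (borel :: nat measure)"
proof (rule measurable_right_continuous_process[where Y = "\<lambda>r w. w r"])
  fix r :: real and w :: "real \<Rightarrow> nat" assume r: "0 \<le> r" and "w \<in> space (skorokhod_space S)"
  then have "w \<in> paths S" by simp
  from cadlag_right[OF this r] obtain e where e: "e > 0" "\<And>s. r \<le> s \<Longrightarrow> s < r + e \<Longrightarrow> w s = w r" by metis
  have "\<forall>\<^sub>F s in at_right r. w r = w s"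
    unfolding eventually_at_right_field
  proof (intro exI[of _ "r + e"] conjI allI impI)
    show "w r = w s" if "r < s" "s < r + e" for s using e(2)[of s] that by simp
  qed (use e(1) in simp)
  then show "((\<lambda>r. w r) \<longlongrightarrow> w r) (at_right r)"
    by (rule Lim_transform_eventually[OF tendsto_const])
qed simp

definition shift_entry :: "nat set \<Rightarrow> (real \<Rightarrow> nat) \<Rightarrow> real \<Rightarrow> nat" where
  "shift_entry D w = shift (max 0 (entry D w)) w"

lemma measurable_eval_entry [measurable]:
  assumes t: "t \<ge> 0"
  shows "(\<lambda>w. w (max 0 (entry D w) + t)) \<in> skorokhod_space S \<rightarrow>\<^sub>M (borel :: nat measure)"
proof -
  have *: "(\<lambda>w. (max 0 (entry D w) + t, w)) \<in> skorokhod_space S \<rightarrow>\<^sub>M borel \<Otimes>\<^sub>M skorokhod_space S"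
    by measurable
  moreover have "max 0 (max 0 (entry D w) + t) = max 0 (entry D w) + t" for w
    using t by (intro max_absorb2) linarith
  ultimately show ?thesis
    using measurable_compose[OF * measurable_eval_time] by (simp only: split_conv)
qed

lemma measurable_shift_entry [measurable]: "shift_entry D \<in> skorokhod_space S \<rightarrow>\<^sub>M skorokhod_space S"
proof (rule measurable_skorokhodI)
  show "shift_entry D w \<in> paths S" if "w \<in> space (skorokhod_space S)" for w
    using that unfolding shift_entry_def by (intro shift_cadlag) auto
  show "(\<lambda>w. shift_entry D w t) \<in> skorokhod_space S \<rightarrow>\<^sub>M borel" if "0 \<le> t" for t
    unfolding shift_entry_def shift_apply[OF that] by (rule measurable_eval_entry[OF that])
qed

context chain
begin

lemma measure_P_tendsto:
  assumes i: "i \<in> S" and m: "\<And>n. A n \<in> sets \<Omega>" "B \<in> sets \<Omega>"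
    and e: "\<And>w. w \<in> paths S \<Longrightarrow> \<forall>\<^sub>F n in sequentially. w \<in> A n \<longleftrightarrow> w \<in> B"
  shows "(\<lambda>n. measure (P i) (A n)) \<longlonglongrightarrow> measure (P i) B"
proof -
  interpret Pi: prob_space "P i" by (rule prob_space_P[OF i])
  have "(\<lambda>n. \<integral>w. indicator (A n) w \<partial>P i) \<longlonglongrightarrow> (\<integral>w. (indicator B w :: real) \<partial>P i)"
  proof (rule integral_dominated_convergence[where w = "\<lambda>_. 1"])
    show "AE w in P i. (\<lambda>n. indicator (A n) w :: real) \<longlonglongrightarrow> indicator B w"
    proof (rule AE_I2)
      fix w assume "w \<in> space (P i)"
      then have "\<forall>\<^sub>F n in sequentially. w \<in> A n \<longleftrightarrow> w \<in> B" using e i by simp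
      then have "\<forall>\<^sub>F n in sequentially. (indicator B w :: real) = indicator (A n) w"
        by eventually_elim (simp add: indicator_def)
      then show "(\<lambda>n. indicator (A n) w :: real) \<longlonglongrightarrow> indicator B w"
        by (rule Lim_transform_eventually[OF tendsto_const])
    qed
  qed (use m i in \<open>auto simp: indicator_def\<close>)
  moreover have "A n \<inter> paths S = A n" "B \<inter> paths S = B" for n
    using sets.sets_into_space[OF m(1), of n] sets.sets_into_space[OF m(2)] by auto
  ultimately show ?thesis using m i by simp
qed

text \<open>The entrance time is approximated from the right by grid times, at which the simple Markov
  property applies; right continuity of paths identifies the limits.\<close>

lemma strong_markov_cyl:
  fixes D :: "nat set"
  assumes i: "i \<in> S" and j: "j \<in> S" and C: "C \<in> sets borel" and J: "finite J" "J \<subseteq> {0..}"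
  defines "F \<equiv> {w \<in> paths S. hits D w \<and> entry D w \<in> C \<and> w (max 0 (entry D w)) = j}"
  shows "measure (P i) (F \<inter> shift_entry D -` cyl S J b) = measure (P i) F * measure (P j) (cyl S J b)"
proof -
  interpret Pi: prob_space "P i" by (rule prob_space_P[OF i])
  interpret Pj: prob_space "P j" by (rule prob_space_P[OF j])
  define G where "G = {w \<in> paths S. hits D w \<and> entry D w \<in> C}"
  have Gm: "G \<in> sets \<Omega>"
  proof -
    have "Measurable.pred \<Omega> (\<lambda>w. hits D w \<and> entry D w \<in> C)" using C by measurable
    then show ?thesis by (simp add: pred_def G_def)
  qed
  \<comment> \<open>The index of the first point of the grid of mesh \<open>1 / (n + 1)\<close>
    strictly after the entrance time.\<close>
  define k where "k n w = nat (\<lfloor>entry D w * real (Suc n)\<rfloor> + 1)" for n w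
  define s where "s n l = real l / real (Suc n)" for n l :: nat
  have s0: "0 \<le> s n l" for n l by (simp add: s_def)
  have sk: "entry D w < s n (k n w)" "s n (k n w) \<le> entry D w + 1 / real (Suc n)" if "w \<in> G" for n w
  proof -
    have 0: "0 \<le> entry D w" using that entry_nonneg[of w S D] by (simp add: G_def)
    then have "0 \<le> \<lfloor>entry D w * real (Suc n)\<rfloor>" by simp
    then have k: "real (k n w) = real_of_int \<lfloor>entry D w * real (Suc n)\<rfloor> + 1" by (simp add: k_def)
    have "entry D w * real (Suc n) < real (k n w)" unfolding k by linarith
    then show "entry D w < s n (k n w)" unfolding s_def by (subst pos_less_divide_eq) simp_all
    have "real (k n w) \<le> entry D w * real (Suc n) + 1" unfolding k by linarith
    then have "real (k n w) / real (Suc n) \<le> (entry D w * real (Suc n) + 1) / real (Suc n)"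
      by (rule divide_right_mono) simp
    then show "s n (k n w) \<le> entry D w + 1 / real (Suc n)" by (simp add: s_def add_divide_distrib)
  qed
  define Gk where "Gk n l = {w \<in> G. k n w = l}" for n l
  have Gk: "Gk n l \<in> sets (path_filtration S (s n l))" for n l
  proof (cases l)
    case 0
    have "k n w \<noteq> 0" if "w \<in> G" for w
    proof
      assume "k n w = 0"
      then have "entry D w < 0" using sk(1)[OF that, of n] by (simp add: s_def)
      moreover have "0 \<le> entry D w" using entry_nonneg[of w S D] that by (simp add: G_def)
      ultimately show False by simp
    qed
    then have "Gk n l = {}" using 0 by (auto simp: Gk_def)
    then show ?thesis by simp
  next
    case (Suc m)
    have kl: "k n w = l \<longleftrightarrow> s n m \<le> entry D w \<and> entry D w < s n l" if "w \<in> G" for w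
    proof -
      have 0: "0 \<le> entry D w" using that entry_nonneg[of w S D] by (simp add: G_def)
      have "k n w = l \<longleftrightarrow> \<lfloor>entry D w * real (Suc n)\<rfloor> = int m" using 0 Suc by (auto simp: k_def nat_add_distrib)
      also have "\<dots> \<longleftrightarrow> real m \<le> entry D w * real (Suc n) \<and> entry D w * real (Suc n) < real m + 1"
        by (simp add: floor_eq_iff)
      also have "\<dots> \<longleftrightarrow> s n m \<le> entry D w \<and> entry D w < s n l"
        unfolding s_def Suc by (subst pos_divide_le_eq, simp, subst pos_less_divide_eq, simp, simp add: add.commute)
      finally show ?thesis .
    qed
    have sm: "s n m < s n l" "0 < s n l" unfolding s_def Suc by (auto simp: divide_strict_right_mono)
    \<comment> \<open>The entrance time is not known at the grid time \<open>s n l\<close> if it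
      lies later. Its truncation at \<open>s n l\<close> is measurable for the past and agrees with
      it on \<open>Gk n l\<close>.\<close>
    let ?e = "\<lambda>w. if hits D w \<and> entry D w < s n l then entry D w else s n l"
    have em: "?e \<in> borel_measurable (path_filtration S (s n l))"
    proof (rule borel_measurableI_less)
      fix y
      have "Measurable.pred (path_filtration S (s n l)) (\<lambda>w. (hits D w \<and> entry D w < min y (s n l)) \<or> s n l < y)"
      proof (cases "y > 0")
        case True
        have "Measurable.pred (path_filtration S (s n l)) (\<lambda>w. hits D w \<and> entry D w < min y (s n l))"
          by (rule pred_entry_less_filtration) (use True sm in auto)
        then show ?thesis by measurable
      next
        case False
        have "\<not> (hits D w \<and> entry D w < min y (s n l) \<or> s n l < y)" if "w \<in> space (path_filtration S (s n l))" for w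
          using entry_nonneg[of w S D] that False sm by auto
        then show ?thesis by (subst measurable_cong[where g = "\<lambda>_. False"]) auto
      qed
      also have "(\<lambda>w. (hits D w \<and> entry D w < min y (s n l)) \<or> s n l < y) = (\<lambda>w. ?e w < y)" by auto
      finally show "{w \<in> space (path_filtration S (s n l)). ?e w < y} \<in> sets (path_filtration S (s n l))"
        by (simp add: pred_def)
    qed
    have p: "Measurable.pred (path_filtration S (s n l)) (\<lambda>w. hits D w \<and> entry D w < s n l)"
      by (rule pred_entry_less_filtration) (use sm in auto)
    have "Measurable.pred (path_filtration S (s n l))
        (\<lambda>w. (hits D w \<and> entry D w < s n l) \<and> ?e w \<in> C \<and> s n m \<le> ?e w)"
      using p em C by measurable
    also have "(\<lambda>w. (hits D w \<and> entry D w < s n l) \<and> ?e w \<in> C \<and> s n m \<le> ?e w) =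
        (\<lambda>w. hits D w \<and> entry D w \<in> C \<and> s n m \<le> entry D w \<and> entry D w < s n l)" by auto
    finally have "{w \<in> paths S. hits D w \<and> entry D w \<in> C \<and> s n m \<le> entry D w \<and> entry D w < s n l}
      \<in> sets (path_filtration S (s n l))" by (simp add: pred_def)
    also have "{w \<in> paths S. hits D w \<and> entry D w \<in> C \<and> s n m \<le> entry D w \<and> entry D w < s n l} = Gk n l"
      using kl by (auto simp: Gk_def G_def)
    finally show ?thesis .
  qed
  \<comment> \<open>The state is prescribed at the grid time, where the simple Markov property
    applies, and not at the entrance time. For each path the two agree for all large
    \<open>n\<close>.\<close>
  define Fk where "Fk n l = {w \<in> Gk n l. w (s n l) = j}" for n l
  have Fk: "Fk n l \<in> sets (path_filtration S (s n l))" for n l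
  proof -
    have "Measurable.pred (path_filtration S (s n l)) (\<lambda>w. w (s n l) = j)"
      by (intro pred_eval_eq measurable_filtration_eval s0) simp
    then have "{w \<in> paths S. w (s n l) = j} \<in> sets (path_filtration S (s n l))"
      unfolding pred_def space_path_filtration .
    moreover have "Gk n l \<inter> {w \<in> paths S. w (s n l) = j} = Fk n l"
      unfolding Fk_def Gk_def G_def by blast
    ultimately show ?thesis using sets.Int[OF Gk[of n l]] by metis
  qed
  have FkO: "Fk n l \<in> sets (P i)" for n l using sets_filtration_skorokhod[OF Fk] i by simp
  have cO: "cyl S J b \<in> sets \<Omega>" by (rule cyl_sets[OF J])
  have EkO: "Fk n l \<inter> shift (s n l) -` cyl S J b \<in> sets (P i)" for n l
  proof -
    have "shift (s n l) -` cyl S J b \<inter> paths S \<in> sets \<Omega>"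
      using measurable_sets[OF measurable_shift[OF s0] cO, of n l] by simp
    moreover have "Fk n l \<inter> (shift (s n l) -` cyl S J b \<inter> paths S) = Fk n l \<inter> shift (s n l) -` cyl S J b"
      unfolding Fk_def Gk_def G_def by blast
    ultimately show ?thesis using sets.Int[OF FkO[of n l, unfolded sets_P[OF i]]] unfolding sets_P[OF i] by metis
  qed
  define Fn where "Fn n = (\<Union>l. Fk n l)" for n
  define En where "En n = (\<Union>l. Fk n l \<inter> shift (s n l) -` cyl S J b)" for n
  have disj: "disjoint_family (Fk n)" for n by (auto simp: disjoint_family_on_def Fk_def Gk_def)
  have step: "measure (P i) (En n) = measure (P i) (Fn n) * measure (P j) (cyl S J b)" for n
  proof -
    have "emeasure (P i) (En n) = (\<Sum>l. emeasure (P i) (Fk n l \<inter> shift (s n l) -` cyl S J b))"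
      unfolding En_def
    proof (rule suminf_emeasure[symmetric])
      show "disjoint_family (\<lambda>l. Fk n l \<inter> shift (s n l) -` cyl S J b)"
        unfolding disjoint_family_on_def Fk_def Gk_def by blast
    qed (use EkO in auto)
    also have "\<dots> = (\<Sum>l. emeasure (P i) (Fk n l) * emeasure (P j) (cyl S J b))"
      by (intro suminf_cong markov_path[OF i j s0 Fk _ cO]) (auto simp: Fk_def)
    also have "\<dots> = emeasure (P i) (Fn n) * emeasure (P j) (cyl S J b)"
      unfolding Fn_def ennreal_suminf_multc using suminf_emeasure[OF _ disj[of n], of "P i"] FkO by (simp add: image_subset_iff)
    finally show ?thesis
      by (simp add: Pi.emeasure_eq_measure Pj.emeasure_eq_measure ennreal_mult[symmetric])
  qed
  have Fnm: "Fn n \<in> sets (P i)" "En n \<in> sets (P i)" for n unfolding Fn_def En_def using FkO EkO by auto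
  have Fm: "F \<in> sets (P i)"
  proof -
    have "Measurable.pred \<Omega> (\<lambda>w. hits D w \<and> entry D w \<in> C \<and> w (max 0 (entry D w)) = j)"
    proof -
      have [measurable]: "Measurable.pred \<Omega> (\<lambda>w. w (max 0 (entry D w)) = j)"
      proof -
        have "(\<lambda>w. w (max 0 (entry D w) + 0)) -` {j} \<inter> space \<Omega> \<in> sets \<Omega>"
          by (rule measurable_sets[OF measurable_eval_entry]) simp_all
        also have "(\<lambda>w. w (max 0 (entry D w) + 0)) -` {j} \<inter> space \<Omega> = {w\<in>space \<Omega>. w (max 0 (entry D w)) = j}"
          unfolding add_0_right by (rule set_eqI) (simp only: vimage_eq Int_iff mem_Collect_eq singleton_iff conj_commute)
        finally show ?thesis by (simp only: pred_def)
      qed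
      show ?thesis using C by measurable
    qed
    then show ?thesis using i by (simp add: pred_def F_def)
  qed
  have Em: "F \<inter> shift_entry D -` cyl S J b \<in> sets (P i)"
  proof -
    have "shift_entry D -` cyl S J b \<inter> paths S \<in> sets \<Omega>"
      using measurable_sets[OF measurable_shift_entry cO] by simp
    moreover have "F \<inter> (shift_entry D -` cyl S J b \<inter> paths S) = F \<inter> shift_entry D -` cyl S J b"
      unfolding F_def by blast
    ultimately show ?thesis using sets.Int[OF Fm[unfolded sets_P[OF i]]] unfolding sets_P[OF i] by metis
  qed
  \<comment> \<open>Only the finitely many times \<open>0\<close> and \<open>J\<close> after the
    entrance matter. By right continuity the values at the shifted grid times are eventually the
    exact ones, so membership stabilises path by path.\<close>
  have ev: "\<forall>\<^sub>F n in sequentially. (w \<in> Fn n \<longleftrightarrow> w \<in> F) \<and>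
      (w \<in> En n \<longleftrightarrow> w \<in> F \<inter> shift_entry D -` cyl S J b)" if w: "w \<in> paths S" for w
  proof (cases "w \<in> G")
    case False
    then have "w \<notin> Fn n" "w \<notin> En n" "w \<notin> F" for n
      using w by (auto simp: Fn_def En_def F_def Fk_def Gk_def G_def)
    then show ?thesis by simp
  next
    case True
    let ?e = "entry D w"
    have h: "hits D w" using True by (simp add: G_def)
    have e0: "0 \<le> ?e" by (rule entry_nonneg[OF w h])
    have near: "\<forall>\<^sub>F n in sequentially. w (s n (k n w) + t) = w (?e + t)" if "t \<ge> 0" for t
    proof -
      from cadlag_right[OF w, of "?e + t"] e0 that obtain d where d: "d > 0"
        "\<And>r. ?e + t \<le> r \<Longrightarrow> r < ?e + t + d \<Longrightarrow> w r = w (?e + t)" by auto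
      have "\<forall>\<^sub>F n in sequentially. 1 / real (Suc n) < d"
        using order_tendstoD(2)[OF LIMSEQ_inverse_real_of_nat d(1)] by (simp add: inverse_eq_divide)
      then show ?thesis
      proof eventually_elim
        case (elim n)
        show ?case using sk[OF True, of n] elim by (intro d(2)) auto
      qed
    qed
    have "\<forall>\<^sub>F n in sequentially. \<forall>t\<in>insert 0 J. w (s n (k n w) + t) = w (?e + t)"
    proof (rule eventually_ball_finite)
      show "finite (insert 0 J)" using J by simp
      show "\<forall>t\<in>insert 0 J. \<forall>\<^sub>F n in sequentially. w (s n (k n w) + t) = w (?e + t)"
        using J(2) by (intro ballI near) auto
    qed
    then show ?thesis
    proof eventually_elim
      case (elim n)
      have 0: "w (s n (k n w)) = w ?e" using elim by simp
      have FnG: "w \<in> Fn n \<longleftrightarrow> w (s n (k n w)) = j" using True by (auto simp: Fn_def Fk_def Gk_def)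
      have FG: "w \<in> F \<longleftrightarrow> w ?e = j" using True e0 by (auto simp: F_def G_def)
      have cylx: "shift x w \<in> cyl S J b \<longleftrightarrow> (\<forall>t\<in>J. w (x + t) = b t)" if x: "x \<ge> 0" for x
      proof -
        have "(\<forall>t\<in>J. shift x w t = b t) \<longleftrightarrow> (\<forall>t\<in>J. w (x + t) = b t)"
          using J(2) by (intro ball_cong refl) (auto simp: subset_iff)
        then show ?thesis using shift_cadlag[OF w x] unfolding cyl_def by blast
      qed
      have "shift (s n (k n w)) w \<in> cyl S J b \<longleftrightarrow> (\<forall>t\<in>J. w (s n (k n w) + t) = b t)"
        by (rule cylx[OF s0])
      also have "\<dots> \<longleftrightarrow> (\<forall>t\<in>J. w (?e + t) = b t)" using elim by (intro ball_cong) auto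
      also have "\<dots> \<longleftrightarrow> shift_entry D w \<in> cyl S J b"
        using cylx[OF e0] e0 by (simp only: shift_entry_def max_absorb2)
      finally have c: "shift (s n (k n w)) w \<in> cyl S J b \<longleftrightarrow> shift_entry D w \<in> cyl S J b" .
      have "w \<in> En n \<longleftrightarrow> w (s n (k n w)) = j \<and> shift (s n (k n w)) w \<in> cyl S J b"
        using True by (auto simp: En_def Fk_def Gk_def)
      then show ?case using 0 FnG FG c by simp
    qed
  qed
  have "(\<lambda>n. measure (P i) (En n)) \<longlonglongrightarrow> measure (P i) (F \<inter> shift_entry D -` cyl S J b)"
    by (rule measure_P_tendsto[OF i Fnm(2)[unfolded sets_P[OF i]] Em[unfolded sets_P[OF i]]]) (rule eventually_mono[OF ev], auto)
  moreover have "(\<lambda>n. measure (P i) (Fn n)) \<longlonglongrightarrow> measure (P i) F"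
    by (rule measure_P_tendsto[OF i Fnm(1)[unfolded sets_P[OF i]] Fm[unfolded sets_P[OF i]]]) (rule eventually_mono[OF ev], auto)
  then have "(\<lambda>n. measure (P i) (En n)) \<longlonglongrightarrow> measure (P i) F * measure (P j) (cyl S J b)"
    unfolding step by (intro tendsto_intros)
  ultimately show ?thesis by (rule LIMSEQ_unique)
qed

lemma pred_entry_state:
  "{w \<in> paths S. hits D w \<and> w (max 0 (entry D w)) = j} \<in> sets \<Omega>"
proof -
  have "(\<lambda>w. w (max 0 (entry D w) + 0)) -` {j} \<inter> space \<Omega> \<in> sets \<Omega>"
    by (rule measurable_sets[OF measurable_eval_entry]) auto
  moreover have "{w\<in>space \<Omega>. hits D w} \<in> sets \<Omega>" using pred_hits[of D S] by (simp add: pred_def)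
  ultimately have "((\<lambda>w. w (max 0 (entry D w) + 0)) -` {j} \<inter> space \<Omega>) \<inter> {w\<in>space \<Omega>. hits D w} \<in> sets \<Omega>"
    by (rule sets.Int)
  then show ?thesis
    unfolding add_0_right
    by (rule back_subst[of "\<lambda>x. x \<in> _"])
      (auto simp only: vimage_eq Int_iff mem_Collect_eq singleton_iff space_skorokhod)
qed

text \<open>On the event of entering \<open>D\<close> at \<open>j\<close>, the path after the
  entrance is independent of the entrance time and has law \<open>P j\<close>; factorisation then
  handles functionals of both.\<close>

lemma strong_markov:
  fixes D :: "nat set"
  assumes i: "i \<in> S" and j: "j \<in> S" and Phi: "Phi \<in> borel_measurable (borel \<Otimes>\<^sub>M \<Omega>)"
  defines "F \<equiv> {w \<in> paths S. hits D w \<and> w (max 0 (entry D w)) = j}"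
  shows "(\<integral>\<^sup>+w\<in>F. Phi (entry D w, shift_entry D w) \<partial>P i) = (\<integral>\<^sup>+w\<in>F. (\<integral>\<^sup>+v. Phi (entry D w, v) \<partial>P j) \<partial>P i)"
proof -
  interpret Pi: prob_space "P i" by (rule prob_space_P[OF i])
  interpret Pj: prob_space "P j" by (rule prob_space_P[OF j])
  have F: "F \<in> sets \<Omega>" unfolding F_def by (rule pred_entry_state)
  let ?M = "density (P i) (indicator F)"
  have Mm: "?M \<rightarrow>\<^sub>M N = \<Omega> \<rightarrow>\<^sub>M N" for N :: "'x measure" using i by (intro measurable_cong_sets) auto
  have mN: "K \<rightarrow>\<^sub>M P j = K \<rightarrow>\<^sub>M \<Omega>" for K :: "'x measure" using j by (intro measurable_cong_sets) auto
  have Phij: "Phi \<in> borel_measurable (borel \<Otimes>\<^sub>M P j)"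
    using Phi j by (simp cong: measurable_cong_sets sets_pair_measure_cong)
  have m1: "(\<lambda>w. Phi (entry D w, shift_entry D w)) \<in> borel_measurable \<Omega>"
    by (rule measurable_compose[OF _ Phi]) measurable
  have m2: "(\<lambda>w. \<integral>\<^sup>+v. Phi (entry D w, v) \<partial>P j) \<in> borel_measurable \<Omega>"
  proof -
    have "(\<lambda>r. \<integral>\<^sup>+v. Phi (r, v) \<partial>P j) \<in> borel_measurable borel"
      using Phij by (intro Pj.borel_measurable_nn_integral) simp
    from measurable_compose[OF measurable_entry this] show ?thesis .
  qed
  have fin: "finite_measure ?M" by (rule finite_indicator_density[OF i F])
  interpret M: finite_measure ?M by fact
  have "(\<integral>\<^sup>+w. Phi (entry D w, shift_entry D w) \<partial>?M) = (\<integral>\<^sup>+w. (\<integral>\<^sup>+v. Phi (entry D w, v) \<partial>P j) \<partial>?M)"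
  proof (rule nn_integral_factorize[where W = borel])
    show "finite_measure ?M" by fact
    show "prob_space (P j)" by unfold_locales
    show "entry D \<in> borel_measurable ?M" unfolding Mm by measurable
    show "shift_entry D \<in> ?M \<rightarrow>\<^sub>M P j" unfolding mN Mm by measurable
    show "Phi \<in> borel_measurable (borel \<Otimes>\<^sub>M P j)" by fact
    fix C :: "real set" and B assume C: "C \<in> sets borel" and "B \<in> sets (P j)"
    then have B: "B \<in> sets \<Omega>" using j by simp
    let ?C = "entry D -` C \<inter> paths S"
    have Cm: "?C \<in> sets \<Omega>" using measurable_sets[OF measurable_entry C, of D S] by simp
    have FC: "F \<inter> ?C = {w \<in> paths S. hits D w \<and> entry D w \<in> C \<and> w (max 0 (entry D w)) = j}"
      by (auto simp: F_def)
    have FCm: "F \<inter> ?C \<in> sets \<Omega>" using F Cm by (rule sets.Int)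
    let ?M' = "density (P i) (indicator (F \<inter> ?C))"
    have Mm': "?M' \<rightarrow>\<^sub>M N = \<Omega> \<rightarrow>\<^sub>M N" for N :: "'x measure" using i by (intro measurable_cong_sets) auto
    have sh: "shift_entry D \<in> ?M' \<rightarrow>\<^sub>M \<Omega>" unfolding Mm' by measurable
    have em: "emeasure (distr ?M' \<Omega> (shift_entry D)) X = emeasure (P i) (F \<inter> ?C \<inter> shift_entry D -` X)" if X: "X \<in> sets \<Omega>" for X
    proof -
      have X': "shift_entry D -` X \<inter> paths S \<in> sets \<Omega>"
        using measurable_sets[OF measurable_shift_entry X] by simp
      have "emeasure (distr ?M' \<Omega> (shift_entry D)) X = emeasure (P i) (F \<inter> ?C \<inter> (shift_entry D -` X \<inter> paths S))"
        using sh X X' i by (simp add: emeasure_distr emeasure_indicator_density[OF i FCm])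
      also have "F \<inter> ?C \<inter> (shift_entry D -` X \<inter> paths S) = F \<inter> ?C \<inter> shift_entry D -` X" by auto
      finally show ?thesis .
    qed
    \<comment> \<open>Two finite measures that agree on cylinders. Scaling \<open>P j\<close> by the
      mass of the event, instead of conditioning on it, covers null events at no cost.\<close>
    have "distr ?M' \<Omega> (shift_entry D) = scale_measure (emeasure (P i) (F \<inter> ?C)) (P j)"
    proof (rule measure_eqI_cyl[where S = S])
      have "finite_measure ?M'" by (rule finite_indicator_density[OF i FCm])
      then show "finite_measure (distr ?M' \<Omega> (shift_entry D))" by (rule finite_measure.finite_measure_distr[OF _ sh])
      fix J b assume J: "finite J" "J \<subseteq> {0::real..}"
      show "emeasure (distr ?M' \<Omega> (shift_entry D)) (cyl S J b)
        = emeasure (scale_measure (emeasure (P i) (F \<inter> ?C)) (P j)) (cyl S J b)"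
        using strong_markov_cyl[OF i j C J, of D b, folded FC]
        by (simp add: em[OF cyl_sets[OF J]] Pi.emeasure_eq_measure Pj.emeasure_eq_measure ennreal_mult[symmetric])
    qed (use j in auto)
    then have "emeasure (P i) (F \<inter> ?C \<inter> shift_entry D -` B) = emeasure (P i) (F \<inter> ?C) * emeasure (P j) B"
      using em[OF B] by simp
    moreover have "emeasure ?M (entry D -` C \<inter> shift_entry D -` B \<inter> space ?M) = emeasure (P i) (F \<inter> ?C \<inter> shift_entry D -` B)"
    proof -
      have sB: "shift_entry D -` B \<inter> paths S \<in> sets \<Omega>" using measurable_sets[OF measurable_shift_entry B] by simp
      have "entry D -` C \<inter> shift_entry D -` B \<inter> space ?M = ?C \<inter> (shift_entry D -` B \<inter> paths S)" using i by auto
      moreover have "F \<inter> (?C \<inter> (shift_entry D -` B \<inter> paths S)) = F \<inter> ?C \<inter> shift_entry D -` B" by auto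
      ultimately show ?thesis using emeasure_indicator_density[OF i F sets.Int[OF Cm sB]] by simp
    qed
    moreover have "emeasure ?M (entry D -` C \<inter> space ?M) = emeasure (P i) (F \<inter> ?C)"
      using emeasure_indicator_density[OF i F Cm] i by simp
    ultimately show "emeasure ?M (entry D -` C \<inter> shift_entry D -` B \<inter> space ?M)
       = emeasure ?M (entry D -` C \<inter> space ?M) * emeasure (P j) B" by simp
  qed
  then show ?thesis
    unfolding nn_integral_indicator_density[OF i m1 F] nn_integral_indicator_density[OF i m2 F] .
qed

lemma strong_markov_measure:
  fixes D :: "nat set"
  assumes i: "i \<in> S" and j: "j \<in> S" and C: "C \<in> sets borel" and B: "B \<in> sets \<Omega>"
  shows "measure (P i) {w \<in> paths S. hits D w \<and> w (max 0 (entry D w)) = j \<and> entry D w \<in> C \<and> shift_entry D w \<in> B}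
    = measure (P i) {w \<in> paths S. hits D w \<and> w (max 0 (entry D w)) = j \<and> entry D w \<in> C} * measure (P j) B"
proof -
  interpret Pi: prob_space "P i" by (rule prob_space_P[OF i])
  interpret Pj: prob_space "P j" by (rule prob_space_P[OF j])
  let ?F = "{w \<in> paths S. hits D w \<and> w (max 0 (entry D w)) = j}"
  let ?FC = "{w \<in> paths S. hits D w \<and> w (max 0 (entry D w)) = j \<and> entry D w \<in> C}"
  let ?FCB = "{w \<in> paths S. hits D w \<and> w (max 0 (entry D w)) = j \<and> entry D w \<in> C \<and> shift_entry D w \<in> B}"
  let ?e = "entry D -` C \<inter> space \<Omega>" and ?s = "shift_entry D -` B \<inter> space \<Omega>"
  have "?F \<inter> ?e \<in> sets \<Omega>"
    by (intro sets.Int pred_entry_state measurable_sets[OF measurable_entry C])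
  also have "?F \<inter> ?e = ?FC" unfolding space_skorokhod by blast
  finally have FC: "?FC \<in> sets \<Omega>" .
  have "?F \<inter> ?e \<inter> ?s \<in> sets \<Omega>"
    by (intro sets.Int pred_entry_state measurable_sets[OF measurable_entry C] measurable_sets[OF measurable_shift_entry B])
  also have "?F \<inter> ?e \<inter> ?s = ?FCB" unfolding space_skorokhod by blast
  finally have FCB: "?FCB \<in> sets \<Omega>" .
  have "emeasure (P i) ?FCB = (\<integral>\<^sup>+w\<in>?F. indicator (C \<times> B) (entry D w, shift_entry D w) \<partial>P i)"
  proof -
    have "emeasure (P i) ?FCB = (\<integral>\<^sup>+w. indicator ?FCB w \<partial>P i)"
      by (rule nn_integral_indicator[symmetric]) (use FCB sets_P[OF i] in blast)
    also have "\<dots> = (\<integral>\<^sup>+w\<in>?F. indicator (C \<times> B) (entry D w, shift_entry D w) \<partial>P i)"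
      unfolding indicator_def mem_Collect_eq mem_Sigma_iff by (intro nn_integral_cong) (simp, blast)
    finally show ?thesis .
  qed
  also have "\<dots> = (\<integral>\<^sup>+w\<in>?F. (\<integral>\<^sup>+v. indicator (C \<times> B) (entry D w, v) \<partial>P j) \<partial>P i)"
    by (rule strong_markov[OF i j]) (use C B in auto)
  also have "\<dots> = (\<integral>\<^sup>+w. emeasure (P j) B * indicator ?FC w \<partial>P i)"
  proof (intro nn_integral_cong)
    fix w assume "w \<in> space (P i)"
    have "(\<integral>\<^sup>+v. indicator (C \<times> B) (entry D w, v) \<partial>P j) = (\<integral>\<^sup>+v. indicator C (entry D w) * indicator B v \<partial>P j)"
      by (intro nn_integral_cong) (simp add: indicator_def)
    also have "\<dots> = indicator C (entry D w) * emeasure (P j) B"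
      using B j by (intro nn_integral_cmult_indicator) simp
    finally show "(\<integral>\<^sup>+v. indicator (C \<times> B) (entry D w, v) \<partial>P j) * indicator ?F w = emeasure (P j) B * indicator ?FC w"
      unfolding indicator_def mem_Collect_eq by (simp, blast)
  qed
  also have "\<dots> = emeasure (P j) B * emeasure (P i) ?FC"
    by (rule nn_integral_cmult_indicator) (use FC sets_P[OF i] in blast)
  finally show ?thesis
    by (simp add: Pi.emeasure_eq_measure Pj.emeasure_eq_measure ennreal_mult[symmetric] mult.commute)
qed

end

section \<open>Exit from and entrance into the state 0\<close>

abbreviation (input) away :: "nat set" where "away \<equiv> - {0}"

lemma zero_on_entry:
  assumes w: "w \<in> paths S" and t: "0 \<le> t"
  shows "zero_on w 0 t \<longleftrightarrow> (hits away w \<longrightarrow> t < entry away w)"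
proof
  assume z: "zero_on w 0 t"
  show "hits away w \<longrightarrow> t < entry away w"
  proof
    assume h: "hits away w"
    show "t < entry away w"
    proof (rule ccontr)
      assume "\<not> ?thesis"
      then have "w (entry away w) = 0" by (intro zero_onD[OF z] entry_nonneg[OF w h]) simp
      then show False using entry_in[OF w h] by simp
    qed
  qed
next
  assume *: "hits away w \<longrightarrow> t < entry away w"
  show "zero_on w 0 t"
    unfolding zero_on_def
  proof
    fix r assume r: "r \<in> {0..t}"
    have "w r \<notin> away" by (rule before_entry[OF w]) (use r * in auto)
    then show "w r = 0" by simp
  qed
qed

lemma entry_away_shift:
  assumes w: "w \<in> paths S" and t: "0 \<le> t" and z: "zero_on w 0 t"
  shows "hits away (shift t w) \<longleftrightarrow> hits away w"
    and "hits away w \<Longrightarrow> entry away w = t + entry away (shift t w)"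
proof -
  have sw: "shift t w \<in> paths S" by (rule shift_cadlag[OF w t])
  have 1: "hits away (shift t w)" if h: "hits away w"
  proof -
    have "t < entry away w" using zero_on_entry[OF w t] z h by simp
    then show ?thesis unfolding hits_def using entry_in[OF w h]
      by (intro exI[of _ "entry away w - t"]) simp
  qed
  have 2: "hits away w" if "hits away (shift t w)"
    using that t unfolding hits_def by (metis add_nonneg_nonneg shift_apply)
  show eq: "hits away (shift t w) \<longleftrightarrow> hits away w" using 1 2 by blast
  assume h: "hits away w"
  have h': "hits away (shift t w)" using h eq by simp
  have lt: "t < entry away w" using zero_on_entry[OF w t] z h by simp
  show "entry away w = t + entry away (shift t w)"
  proof (rule antisym)
    show "entry away w \<le> t + entry away (shift t w)"
      using entry_in[OF sw h'] entry_nonneg[OF sw h'] t by (intro entry_le[OF w h]) auto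
    have "entry away (shift t w) \<le> entry away w - t"
      using entry_in[OF w h] lt by (intro entry_le[OF sw h']) auto
    then show "t + entry away (shift t w) \<le> entry away w" by simp
  qed
qed

context chain
begin

definition q0 :: real where "q0 = - q 0 0"

lemma measure_transition: "i \<in> S \<Longrightarrow> t \<ge> 0 \<Longrightarrow> measure (transition P t i) B = measure (P i) {w \<in> paths S. w t \<in> B}"
  unfolding transition_def by (subst measure_distr) (auto simp: sets_borel_eq_count_space vimage_def Int_def conj_commute)

lemma measure_le_1: "i \<in> S \<Longrightarrow> measure (P i) A \<le> 1"
  using prob_space.prob_le_1[OF prob_space_P] .

lemma measure_P_mono: "i \<in> S \<Longrightarrow> A \<subseteq> B \<Longrightarrow> B \<in> sets \<Omega> \<Longrightarrow> measure (P i) A \<le> measure (P i) B"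
  using finite_measure.finite_measure_mono[OF prob_space.finite_measure[OF prob_space_P], of i A B] by simp

lemma measure_markov_path:
  assumes "i \<in> S" "j \<in> S" "s \<ge> 0" "A \<in> sets (path_filtration S s)" "\<And>w. w \<in> A \<Longrightarrow> w s = j" "B \<in> sets \<Omega>"
  shows "measure (P i) (A \<inter> shift s -` B) = measure (P i) A * measure (P j) B"
  using markov_path[of i j s A B] assms unfolding measure_def by (simp add: enn2real_mult)

lemma eval_in_filtration: "0 \<le> t \<Longrightarrow> t \<le> s \<Longrightarrow> {w \<in> paths S. w t \<in> B} \<in> sets (path_filtration S s)"
  using pred_eval_in[OF measurable_filtration_eval[of t s S], of B] by (simp add: pred_def)

lemma eval_in_sets: "0 \<le> t \<Longrightarrow> {w \<in> paths S. w t \<in> B} \<in> sets \<Omega>"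
  by (rule sets_filtration_skorokhod[OF eval_in_filtration[OF _ order_refl]])

lemma eval_eq_sets: "0 \<le> t \<Longrightarrow> {w \<in> paths S. w t = j} \<in> sets \<Omega>"
  using eval_in_sets[of t "{j}"] unfolding singleton_iff .

lemma measure_start: "i \<in> S \<Longrightarrow> measure (P i) {w \<in> paths S. w 0 = i} = 1"
proof -
  assume i: "i \<in> S"
  interpret prob_space "P i" by (rule prob_space_P[OF i])
  have "{w \<in> space (P i). w 0 \<in> {i}} \<in> events"
    unfolding space_P[OF i] sets_P[OF i] by (rule eval_in_sets) simp
  then have "{w \<in> space (P i). w 0 = i} \<in> events" by (simp only: singleton_iff)
  from prob_Collect_eq_1[OF this] AE_start[OF i] have "prob {w \<in> space (P i). w 0 = i} = 1" by blast
  then show ?thesis unfolding space_P[OF i] .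
qed

lemma q_lim: "i \<in> S \<Longrightarrow> j \<in> S \<Longrightarrow>
    ((\<lambda>t. (measure (transition P t i) {j} - of_bool (i = j)) / t) \<longlongrightarrow> q i j) (at_right 0)"
  using nonexplosive by (simp add: nonexplosive_chain_def)

lemma Q: "Q_matrix S q" using nonexplosive by (simp add: nonexplosive_chain_def)

lemma seq_at_right: "c > 0 \<Longrightarrow> filterlim (\<lambda>n. c / real (Suc n)) (at_right 0) sequentially"
  unfolding filterlim_at
proof (intro conjI always_eventually allI)
  show "(\<lambda>n. c / real (Suc n)) \<longlonglongrightarrow> 0"
    using tendsto_mult[OF tendsto_const[of c] LIMSEQ_inverse_real_of_nat] by (simp add: divide_inverse)
qed auto

text \<open>Sampling at the times $kt/n$ gives $p_{00}(t/n)^n \to e^{q_{00} t}$.\<close>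

lemma zero_on_prob:
  assumes t: "t \<ge> 0"
  shows "measure (P 0) {w \<in> paths S. zero_on w 0 t} = exp (- q0 * t)"
proof (cases "t = 0")
  case True
  then show ?thesis using measure_start[of 0] by (simp add: zero_on_def)
next
  case False
  with t have t: "t > 0" by simp
  define d where "d n = t / real (Suc n)" for n
  have d: "d n > 0" for n using t by (simp add: d_def)
  define p where "p n = measure (transition P (d n) 0) {0}" for n
  define E where "E n m = {w \<in> paths S. \<forall>k\<le>m. w (real k * d n) = 0}" for n m
  have Ef: "E n m \<in> sets (path_filtration S (real m * d n))" for n m
  proof -
    have "cyl S ((\<lambda>k. real k * d n) ` {..m}) (\<lambda>_. 0) \<in> sets (path_filtration S (real m * d n))"
      using d[of n] by (intro cyl_filtration) (auto intro: mult_right_mono)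
    also have "cyl S ((\<lambda>k. real k * d n) ` {..m}) (\<lambda>_. 0) = E n m" by (auto simp: cyl_def E_def)
    finally show ?thesis .
  qed
  have Em: "measure (P 0) (E n m) = p n ^ m" for n m
  proof (induction m)
    case 0
    show ?case using measure_start[of 0] by (simp add: E_def)
  next
    case (Suc m)
    have "E n (Suc m) = E n m \<inter> shift (real m * d n) -` {w \<in> paths S. w (d n) \<in> {0}}"
      using d[of n] shift_cadlag[of _ S "real m * d n"] unfolding E_def
      by (auto simp: le_Suc_eq algebra_simps)
    also have "measure (P 0) \<dots> = measure (P 0) (E n m) * measure (P 0) {w \<in> paths S. w (d n) \<in> {0}}"
      using d[of n] by (intro measure_markov_path Ef eval_in_sets) (auto simp: E_def)
    also have "\<dots> = p n ^ Suc m"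
      using Suc.IH d[of n] by (simp add: p_def measure_transition)
    finally show ?case .
  qed
  have lim1: "(\<lambda>n. measure (P 0) (E n (Suc n))) \<longlonglongrightarrow> measure (P 0) {w \<in> paths S. zero_on w 0 t}"
  proof (rule measure_P_tendsto)
    show "E n (Suc n) \<in> sets \<Omega>" for n by (rule sets_filtration_skorokhod[OF Ef])
    show "{w \<in> paths S. zero_on w 0 t} \<in> sets \<Omega>"
      using pred_zero_on[of 0 t S] t by (simp add: pred_def)
    fix w assume w: "w \<in> paths S"
    show "\<forall>\<^sub>F n in sequentially. w \<in> E n (Suc n) \<longleftrightarrow> w \<in> {w \<in> paths S. zero_on w 0 t}"
    proof (cases "zero_on w 0 t")
      case True
      have "w \<in> E n (Suc n)" for n
      proof -
        have "w (real k * d n) = 0" if "k \<le> Suc n" for k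
        proof (rule zero_onD[OF True])
          have "real k * d n \<le> real (Suc n) * d n" using that d[of n] by (intro mult_right_mono) auto
          then show "real k * d n \<le> t" by (simp add: d_def)
        qed (use d[of n] in simp)
        then show ?thesis using w by (simp add: E_def)
      qed
      then show ?thesis using True w by simp
    next
      case False
      then obtain r where r: "0 \<le> r" "r \<le> t" "w r \<noteq> 0" by (auto simp: zero_on_def)
      have "\<forall>\<^sub>F n in sequentially. w \<notin> E n (Suc n)"
      proof (cases "r = t")
        case True
        then have "w \<notin> E n (Suc n)" for n using r unfolding E_def d_def by auto
        then show ?thesis by simp
      next
        case False
        from cadlag_right[OF w r(1)] obtain e where e: "e > 0" "\<And>s. r \<le> s \<Longrightarrow> s < r + e \<Longrightarrow> w s = w r" by metis
        have "(\<lambda>n. d n) \<longlonglongrightarrow> 0" using seq_at_right[OF t] by (simp add: d_def filterlim_at)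
        then have "\<forall>\<^sub>F n in sequentially. d n < e" using order_tendstoD(2) e(1) by blast
        then show ?thesis
        proof eventually_elim
          case (elim n)
          \<comment> \<open>The first grid point at or after \<open>r\<close> is at distance less
            than \<open>d n\<close> from it, hence still in the interval where the path keeps the
            nonzero value \<open>w r\<close>. The time \<open>t\<close> itself, treated before, is
            the last grid point.\<close>
          define k where "k = nat \<lceil>r / d n\<rceil>"
          have "0 \<le> r / d n" using r d[of n] by simp
          then have k: "r / d n \<le> real k" "real k < r / d n + 1" unfolding k_def by linarith+
          have "r \<le> real k * d n" using k(1) d[of n] by (simp add: pos_divide_le_eq)
          moreover have "real k * d n < (r / d n + 1) * d n" using k(2) d[of n] by (intro mult_strict_right_mono)
          then have "real k * d n < r + d n" using d[of n] by (simp add: distrib_right)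
          ultimately have "w (real k * d n) \<noteq> 0" using e(2)[of "real k * d n"] elim r by auto
          moreover have "r / d n \<le> real (Suc n)"
            using r(2) d[of n] t mult_right_mono[OF r(2), of "real (Suc n)"]
            by (simp add: d_def pos_divide_le_eq mult.commute)
          then have "real k < real (Suc n) + 1" using k(2) by linarith
          then have "k \<le> Suc n" by linarith
          ultimately show ?case by (auto simp: E_def)
        qed
      qed
      then show ?thesis using False by (auto elim: eventually_mono)
    qed
  qed simp
  have plim: "(\<lambda>n. (p n - 1) / d n) \<longlonglongrightarrow> - q0"
    using filterlim_compose[OF q_lim[of 0 0] seq_at_right[OF t]] by (simp add: p_def d_def q0_def)
  have dlim: "(\<lambda>n. d n) \<longlonglongrightarrow> 0" using seq_at_right[OF t] by (simp add: d_def filterlim_at)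
  have "(\<lambda>n. (p n - 1) / d n * d n + 1) \<longlonglongrightarrow> - q0 * 0 + 1" by (intro tendsto_intros plim dlim)
  then have p1: "p \<longlonglongrightarrow> 1" using d less_imp_neq[OF d] by simp
  \<comment> \<open>The inequality 1 + y <= exp y, used for y = \<open>p n - 1\<close> and for y =
    \<open>1 / p n - 1\<close>, squeezes \<open>p n ^ Suc n\<close> between two exponentials with
    the same limit.\<close>
  have x: "real (Suc n) * (p n - 1) = t * ((p n - 1) / d n)" for n using t by (simp add: d_def)
  have up: "(\<lambda>n. exp (t * ((p n - 1) / d n))) \<longlonglongrightarrow> exp (t * (- q0))" by (intro tendsto_intros plim)
  have lo: "(\<lambda>n. exp (t * ((p n - 1) / d n) / p n)) \<longlonglongrightarrow> exp (t * (- q0) / 1)" by (intro tendsto_intros plim p1) simp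
  have "(\<lambda>n. p n ^ Suc n) \<longlonglongrightarrow> exp (t * (- q0))"
  proof (rule tendsto_sandwich[OF _ _ _ up])
    show "(\<lambda>n. exp (t * ((p n - 1) / d n) / p n)) \<longlonglongrightarrow> exp (t * (- q0))" using lo by simp
    show "\<forall>\<^sub>F n in sequentially. p n ^ Suc n \<le> exp (t * ((p n - 1) / d n))"
    proof (rule always_eventually, rule allI)
      fix n
      have "p n \<le> exp (p n - 1)" using exp_ge_add_one_self[of "p n - 1"] by simp
      then have "p n ^ Suc n \<le> exp (p n - 1) ^ Suc n" by (rule power_mono) (simp add: p_def)
      also have "\<dots> = exp (real (Suc n) * (p n - 1))" by (rule exp_of_nat_mult[symmetric])
      finally show "p n ^ Suc n \<le> exp (t * ((p n - 1) / d n))" unfolding x .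
    qed
    have "\<forall>\<^sub>F n in sequentially. p n > 0" using order_tendstoD(1)[OF p1, of 0] by simp
    then show "\<forall>\<^sub>F n in sequentially. exp (t * ((p n - 1) / d n) / p n) \<le> p n ^ Suc n"
    proof eventually_elim
      case (elim n)
      have "1 / p n \<le> exp (1 / p n - 1)" using exp_ge_add_one_self[of "1 / p n - 1"] by simp
      then have "inverse (exp (1 / p n - 1)) \<le> inverse (1 / p n)" using elim by (intro le_imp_inverse_le) auto
      then have "exp (1 - 1 / p n) \<le> p n" by (simp add: exp_minus[symmetric])
      then have "exp (1 - 1 / p n) ^ Suc n \<le> p n ^ Suc n" by (intro power_mono) auto
      also have "exp (1 - 1 / p n) ^ Suc n = exp (real (Suc n) * (1 - 1 / p n))" by (rule exp_of_nat_mult[symmetric])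
      also have "real (Suc n) * (1 - 1 / p n) = real (Suc n) * (p n - 1) / p n" using elim by (simp add: field_simps)
      finally show ?case unfolding x .
    qed
  qed
  with lim1 have "measure (P 0) {w \<in> paths S. zero_on w 0 t} = exp (t * (- q0))"
    unfolding Em by (rule LIMSEQ_unique)
  then show ?thesis by (simp add: mult.commute)
qed

lemma zero_on_sets: "0 \<le> t \<Longrightarrow> {w \<in> paths S. zero_on w 0 t} \<in> sets (path_filtration S t)"
  using pred_zero_on_filtration[of 0 t t S] by (simp add: pred_def)

lemma zero_on_sets': "0 \<le> t \<Longrightarrow> {w \<in> paths S. zero_on w 0 t} \<in> sets \<Omega>"
  by (rule sets_filtration_skorokhod[OF zero_on_sets])

text \<open>Otherwise the chain would almost surely stay at 0 for any length of time, although
  irreducibility lets it be at 1 at some time with positive probability.\<close>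

lemma q0_pos: "q0 > 0"
proof (rule ccontr)
  assume "\<not> q0 > 0"
  then have ge: "exp (- q0 * t) \<ge> 1" if "t \<ge> 0" for t
    using that by (simp add: mult_nonpos_nonneg)
  obtain t where t: "t \<ge> 0" "measure (transition P t 0) {1} > 0"
    using irreducible unfolding irreducible_on_def by (meson S_0 S_1(1))
  interpret prob_space "P 0" by (rule prob_space_P) simp
  have "prob {w \<in> paths S. zero_on w 0 t} = 1"
    using ge[OF t(1)] zero_on_prob[OF t(1)] prob_le_1[of "{w \<in> paths S. zero_on w 0 t}"] by linarith
  moreover have "prob ({w \<in> paths S. zero_on w 0 t} \<union> {w \<in> paths S. w t \<in> {1}}) =
     prob {w \<in> paths S. zero_on w 0 t} + prob {w \<in> paths S. w t \<in> {1}}"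
  proof (rule finite_measure_Union)
    show "{w \<in> paths S. zero_on w 0 t} \<inter> {w \<in> paths S. w t \<in> {1}} = {}"
      using zero_onD[OF _ t(1) order_refl] by fastforce
    show "{w \<in> paths S. zero_on w 0 t} \<in> events" "{w \<in> paths S. w t \<in> {1}} \<in> events"
      unfolding sets_P[OF S_0] by (rule zero_on_sets'[OF t(1)], rule eval_in_sets[OF t(1)])
  qed
  moreover have "prob ({w \<in> paths S. zero_on w 0 t} \<union> {w \<in> paths S. w t \<in> {1}}) \<le> 1"
    by (rule prob_le_1)
  moreover have "prob {w \<in> paths S. w t \<in> {1}} > 0"
    using t(2) measure_transition[OF S_0 t(1), of "{1}"] by linarith
  ultimately show False by linarith
qed

definition exit_prob :: "nat \<Rightarrow> real" where
  "exit_prob j = measure (P 0) {w \<in> paths S. hits away w \<and> w (max 0 (entry away w)) = j}"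

lemma exit_prob_nonneg: "0 \<le> exit_prob j" by (simp add: exit_prob_def)

text \<open>Lack of memory: while the chain is at 0, the shift does not change the exit state. So
  the time of the exit and the state entered are independent.\<close>

lemma exit_after:
  assumes t: "0 \<le> t"
  shows "measure (P 0) {w \<in> paths S. zero_on w 0 t \<and> hits away w \<and> w (max 0 (entry away w)) = j}
    = exp (- q0 * t) * exit_prob j"
proof -
  let ?A = "{w \<in> paths S. zero_on w 0 t}"
  let ?B = "{w \<in> paths S. hits away w \<and> w (max 0 (entry away w)) = j}"
  have "{w \<in> paths S. zero_on w 0 t \<and> hits away w \<and> w (max 0 (entry away w)) = j} = ?A \<inter> shift t -` ?B"
  proof (rule set_eqI)
    fix w
    show "w \<in> {w \<in> paths S. zero_on w 0 t \<and> hits away w \<and> w (max 0 (entry away w)) = j} \<longleftrightarrow> w \<in> ?A \<inter> shift t -` ?B"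
    proof (cases "w \<in> paths S \<and> zero_on w 0 t \<and> hits away w")
      case True
      then have w: "w \<in> paths S" and z: "zero_on w 0 t" and h: "hits away w" by auto
      note e = entry_away_shift[OF w t z]
      have sw: "shift t w \<in> paths S" by (rule shift_cadlag[OF w t])
      have h': "hits away (shift t w)" using e(1) h by simp
      have "shift t w (max 0 (entry away (shift t w))) = w (max 0 (entry away w))"
        using e(2)[OF h] entry_nonneg[OF sw h'] t by (simp add: max_absorb2)
      then show ?thesis using w z h h' sw by simp
    next
      case False
      then show ?thesis using entry_away_shift(1)[of w S t] t by blast
    qed
  qed
  then have "measure (P 0) {w \<in> paths S. zero_on w 0 t \<and> hits away w \<and> w (max 0 (entry away w)) = j}
    = measure (P 0) ?A * measure (P 0) ?B"
    using measure_markov_path[OF S_0 S_0 t zero_on_sets[OF t] _ pred_entry_state[of away j]]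
      zero_onD[OF _ t order_refl] by (simp only: mem_Collect_eq)
  then show ?thesis by (simp add: zero_on_prob[OF t] exit_prob_def)
qed

lemma exit_before:
  assumes t: "0 \<le> t"
  shows "measure (P 0) {w \<in> paths S. hits away w \<and> w (max 0 (entry away w)) = j \<and> entry away w \<in> {..t}}
    = (1 - exp (- q0 * t)) * exit_prob j"
proof -
  interpret prob_space "P 0" by (rule prob_space_P) simp
  let ?A = "{w \<in> paths S. zero_on w 0 t \<and> hits away w \<and> w (max 0 (entry away w)) = j}"
  let ?B = "{w \<in> paths S. hits away w \<and> w (max 0 (entry away w)) = j}"
  have A: "?A \<in> sets \<Omega>"
  proof -
    have "{w \<in> paths S. zero_on w 0 t} \<inter> ?B \<in> sets \<Omega>" by (intro sets.Int zero_on_sets' t pred_entry_state)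
    also have "{w \<in> paths S. zero_on w 0 t} \<inter> ?B = ?A" by blast
    finally show ?thesis .
  qed
  have eq: "{w \<in> paths S. hits away w \<and> w (max 0 (entry away w)) = j \<and> entry away w \<in> {..t}} = ?B - ?A"
    (is "?C = _")
  proof (rule set_eqI)
    fix w
    show "w \<in> ?C \<longleftrightarrow> w \<in> ?B - ?A"
      using zero_on_entry[of w S t] t unfolding Diff_iff mem_Collect_eq atMost_iff by (meson not_le)
  qed
  have "prob (?B - ?A) = prob ?B - prob ?A"
  proof (rule finite_measure_Diff)
    show "?B \<in> events" "?A \<in> events" unfolding sets_P[OF S_0] by (rule pred_entry_state, rule A)
    show "?A \<subseteq> ?B" by (rule subsetI) (simp only: mem_Collect_eq)
  qed
  then show ?thesis
    unfolding eq exit_after[OF t] exit_prob_def[symmetric] left_diff_distrib mult_1_left .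
qed

lemma zero_on_all_null: "measure (P 0) {w \<in> paths S. \<not> hits away w} = 0"
proof -
  interpret prob_space "P 0" by (rule prob_space_P) simp
  have "prob {w \<in> paths S. \<not> hits away w} \<le> exp (- q0 * real n)" for n
  proof -
    have "prob {w \<in> paths S. \<not> hits away w} \<le> prob {w \<in> paths S. zero_on w 0 (real n)}"
    proof (rule measure_P_mono[OF S_0 _ zero_on_sets'])
      show "{w \<in> paths S. \<not> hits away w} \<subseteq> {w \<in> paths S. zero_on w 0 (real n)}"
      proof (rule subsetI)
        fix w assume "w \<in> {w \<in> paths S. \<not> hits away w}"
        then have w: "w \<in> paths S" and h: "\<not> hits away w" by blast+
        then show "w \<in> {w \<in> paths S. zero_on w 0 (real n)}"
          using zero_on_entry[OF w, of "real n"] by simp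
      qed
    qed simp_all
    then show ?thesis using zero_on_prob[of "real n"] by simp
  qed
  moreover have "(\<lambda>n. exp (- q0 * real n)) \<longlonglongrightarrow> 0"
  proof -
    have "(\<lambda>n. (exp (- q0)) ^ n) \<longlonglongrightarrow> 0" using q0_pos by (intro LIMSEQ_power_zero) simp
    then show ?thesis by (simp add: exp_of_nat_mult[symmetric] mult.commute)
  qed
  ultimately have "prob {w \<in> paths S. \<not> hits away w} \<le> 0"
    by (intro LIMSEQ_le_const[of _ 0]) auto
  then show ?thesis using measure_nonneg[of "P 0"] by (simp add: antisym)
qed

text \<open>Leaving 0 for \<open>j\<close> before a short time \<open>d\<close> and then resting at
  \<open>j\<close> forces the chain to be at \<open>j\<close> at time \<open>d\<close>. Dividing by
  \<open>d\<close> and letting it tend to 0 gives one inequality; other ways to reach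
  \<open>j\<close> are ignored.\<close>

lemma exit_prob_le:
  assumes j: "j \<in> S" "j \<noteq> 0"
  shows "q0 * exit_prob j \<le> q 0 j"
proof -
  interpret prob_space "P 0" by (rule prob_space_P) simp
  interpret Pj: prob_space "P j" by (rule prob_space_P[OF j(1)])
  define d where "d n = 1 / real (Suc n)" for n
  have d: "d n > 0" for n by (simp add: d_def)
  have dlim: "filterlim d (at_right 0) sequentially" using seq_at_right[of 1] by (simp add: d_def[abs_def])
  \<comment> \<open>After the exit at most \<open>d n\<close> remains until time \<open>d n\<close>;
    the factor 2 makes room for the strict inequality.\<close>
  define A where "A n = {w \<in> paths S. \<not> (hits (- {j}) w \<and> entry (- {j}) w < 2 * d n)}" for n
  have A: "A n \<in> sets \<Omega>" for n
  proof -
    have "Measurable.pred \<Omega> (\<lambda>w. hits (- {j}) w \<and> entry (- {j}) w < 2 * d n)"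
      by (rule measurable_filtration_skorokhod[OF pred_entry_less_filtration[OF _ order_refl]]) (use d in simp)
    then have "Measurable.pred \<Omega> (\<lambda>w. \<not> (hits (- {j}) w \<and> entry (- {j}) w < 2 * d n))" by measurable
    then show ?thesis unfolding A_def pred_def space_skorokhod .
  qed
  have stay: "(\<lambda>n. measure (P j) (A n)) \<longlonglongrightarrow> 1"
  proof -
    have "(\<lambda>n. measure (P j) (A n)) \<longlonglongrightarrow> measure (P j) {w \<in> paths S. w 0 = j}"
    proof (rule measure_P_tendsto[OF j(1) A])
      show "{w \<in> paths S. w 0 = j} \<in> sets \<Omega>" by (rule eval_eq_sets[OF order_refl])
      fix w assume w: "w \<in> paths S"
      show "\<forall>\<^sub>F n in sequentially. w \<in> A n \<longleftrightarrow> w \<in> {w \<in> paths S. w 0 = j}"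
      proof (cases "w 0 = j")
        case True
        from cadlag_right[OF w order_refl] obtain e where e: "e > 0" "\<And>s. 0 \<le> s \<Longrightarrow> s < 0 + e \<Longrightarrow> w s = w 0" by metis
        have "d \<longlonglongrightarrow> 0" using dlim by (simp add: filterlim_at)
        then have "\<forall>\<^sub>F n in sequentially. d n < e / 2" by (rule order_tendstoD(2)) (use e(1) in simp)
        then show ?thesis
        proof eventually_elim
          case (elim n)
          have "\<not> (hits (- {j}) w \<and> entry (- {j}) w < 2 * d n)"
          proof
            assume h: "hits (- {j}) w \<and> entry (- {j}) w < 2 * d n"
            then have "w (entry (- {j}) w) = w 0" using elim by (intro e(2) entry_nonneg[OF w]) auto
            then show False using entry_in[OF w, of "- {j}"] h True by simp
          qed
          then show ?case using True w by (simp add: A_def)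
        qed
      next
        case False
        then have h: "hits (- {j}) w" by (auto simp: hits_def)
        have "entry (- {j}) w \<le> 0" by (rule entry_le[OF w h]) (use False in auto)
        then have "entry (- {j}) w < 2 * d n" for n using d[of n] by linarith
        then show ?thesis using False h by (simp add: A_def)
      qed
    qed
    then show ?thesis using measure_start[OF j(1)] by simp
  qed
  have low: "(1 - exp (- q0 * d n)) * exit_prob j * measure (P j) (A n) \<le> measure (transition P (d n) 0) {j}" for n
  proof -
    have "(1 - exp (- q0 * d n)) * exit_prob j * measure (P j) (A n) =
      prob {w \<in> paths S. hits away w \<and> w (max 0 (entry away w)) = j \<and> entry away w \<in> {..d n} \<and> shift_entry away w \<in> A n}"
      using strong_markov_measure[OF S_0 j(1) _ A[of n], of "{..d n}" away] exit_before[of "d n" j] d[of n] by simp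
    also have "\<dots> \<le> prob {w \<in> paths S. w (d n) \<in> {j}}"
    proof (intro measure_P_mono eval_in_sets S_0)
      show "0 \<le> d n" using d[of n] by simp
      show "{w \<in> paths S. hits away w \<and> w (max 0 (entry away w)) = j \<and> entry away w \<in> {..d n} \<and> shift_entry away w \<in> A n}
        \<subseteq> {w \<in> paths S. w (d n) \<in> {j}}"
      proof (rule subsetI)
        fix w assume "w \<in> {w \<in> paths S. hits away w \<and> w (max 0 (entry away w)) = j \<and>
          entry away w \<in> {..d n} \<and> shift_entry away w \<in> A n}"
        then have w: "w \<in> paths S" and h: "hits away w" and e: "entry away w \<in> {..d n}"
          and a: "shift_entry away w \<in> A n" by blast+
        have e0: "0 \<le> entry away w" by (rule entry_nonneg[OF w h])
        have sw: "shift (entry away w) w \<in> paths S" by (rule shift_cadlag[OF w e0])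
        have a': "\<not> (hits (- {j}) (shift (entry away w) w) \<and> entry (- {j}) (shift (entry away w) w) < 2 * d n)"
          using a e0 by (simp add: A_def shift_entry_def max_absorb2)
        have "shift (entry away w) w (d n - entry away w) \<notin> - {j}"
          by (rule before_entry[OF sw]) (use e e0 a' d[of n] in auto)
        then have "w (d n) \<in> {j}" using e by simp
        then show "w \<in> {w \<in> paths S. w (d n) \<in> {j}}" using w by blast
      qed
    qed
    also have "\<dots> = measure (transition P (d n) 0) {j}" using d[of n] by (simp add: measure_transition)
    finally show ?thesis .
  qed
  have l1: "(\<lambda>n. measure (transition P (d n) 0) {j} / d n) \<longlonglongrightarrow> q 0 j"
    using filterlim_compose[OF q_lim[OF S_0 j(1)] dlim] j(2) by simp
  have "((\<lambda>x::real. (1 - exp (- q0 * x)) / x) \<longlongrightarrow> q0) (at_right 0)"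
  proof -
    have "((\<lambda>x. exp (- q0 * x)) has_real_derivative - q0) (at 0)" by (auto intro!: derivative_eq_intros)
    then have "((\<lambda>x. (exp (- q0 * (0 + x)) - exp (- q0 * 0)) / x) \<longlongrightarrow> - q0) (at 0)" unfolding DERIV_def .
    then have "((\<lambda>x. - ((exp (- q0 * x) - 1) / x)) \<longlongrightarrow> - (- q0)) (at 0)" by (intro tendsto_minus) simp
    then show ?thesis by (intro tendsto_within_subset[where S = UNIV and T = "{0<..}"]) (auto simp: minus_divide_left)
  qed
  from filterlim_compose[OF this dlim]
  have "(\<lambda>n. (1 - exp (- q0 * d n)) / d n) \<longlonglongrightarrow> q0" .
  then have l2: "(\<lambda>n. (1 - exp (- q0 * d n)) / d n * exit_prob j * measure (P j) (A n)) \<longlonglongrightarrow> q0 * exit_prob j * 1"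
    by (intro tendsto_intros stay)
  have "q0 * exit_prob j * 1 \<le> q 0 j"
  proof (rule LIMSEQ_le[OF l2 l1], intro exI allI impI)
    fix n
    show "(1 - exp (- q0 * d n)) / d n * exit_prob j * measure (P j) (A n) \<le> measure (transition P (d n) 0) {j} / d n"
      using divide_right_mono[OF low[of n] less_imp_le[OF d[of n]]] by (simp add: mult.assoc times_divide_eq_left)
  qed
  then show ?thesis by simp
qed

lemma exit_prob_outside: "j \<notin> S \<or> j = 0 \<Longrightarrow> exit_prob j = 0"
proof -
  assume j: "j \<notin> S \<or> j = 0"
  have "\<not> (w \<in> paths S \<and> hits away w \<and> w (max 0 (entry away w)) = j)" for w
  proof
    assume *: "w \<in> paths S \<and> hits away w \<and> w (max 0 (entry away w)) = j"
    then have w: "w \<in> paths S" and h: "hits away w" by auto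
    have "w (entry away w) = j" using * entry_nonneg[OF w h] by (simp add: max_absorb2)
    then show False using entry_in[OF w h] cadlag_in[OF w entry_nonneg[OF w h]] j by auto
  qed
  then show ?thesis unfolding exit_prob_def by (metis (mono_tags, lifting) Collect_empty_eq measure_empty)
qed

lemma exit_prob_sum: "(\<lambda>n. \<Sum>j\<le>n. exit_prob j) \<longlonglongrightarrow> 1"
proof -
  interpret prob_space "P 0" by (rule prob_space_P) simp
  let ?X = "\<lambda>j. {w \<in> paths S. hits away w \<and> w (max 0 (entry away w)) = j}"
  have "(\<Sum>j\<le>n. exit_prob j) = prob (\<Union>j\<le>n. ?X j)" for n
    unfolding exit_prob_def
  proof (rule finite_measure_finite_Union[symmetric])
    show "disjoint_family_on ?X {..n}" unfolding disjoint_family_on_def by blast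
    show "?X ` {..n} \<subseteq> events" unfolding sets_P[OF S_0] using pred_entry_state[of away] by blast
  qed simp
  moreover have "(\<lambda>n. prob (\<Union>j\<le>n. ?X j)) \<longlonglongrightarrow> prob {w \<in> paths S. hits away w}"
  proof (rule measure_P_tendsto)
    show "(\<Union>j\<le>n. ?X j) \<in> sets \<Omega>" for n by (intro sets.finite_UN pred_entry_state) simp
    show "{w \<in> paths S. hits away w} \<in> sets \<Omega>" using pred_hits[of away S] by (simp add: pred_def)
    fix w assume "w \<in> paths S"
    show "\<forall>\<^sub>F n in sequentially. w \<in> (\<Union>j\<le>n. ?X j) \<longleftrightarrow> w \<in> {w \<in> paths S. hits away w}"
      by (rule eventually_mono[OF eventually_ge_at_top[of "w (max 0 (entry away w))"]]) blast
  qed simp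
  moreover have "prob {w \<in> paths S. hits away w} = 1"
  proof -
    have "{w \<in> paths S. hits away w} \<in> events" using pred_hits[of away S] by (simp add: pred_def)
    from prob_compl[OF this] have "prob (paths S - {w \<in> paths S. hits away w}) = 1 - prob {w \<in> paths S. hits away w}" by simp
    moreover have "paths S - {w \<in> paths S. hits away w} = {w \<in> paths S. \<not> hits away w}" by blast
    ultimately show ?thesis using zero_on_all_null by simp
  qed
  ultimately show ?thesis by simp
qed

lemma q_sum_le: "(\<Sum>j\<in>{..n} \<inter> (S - {0}). q 0 j) \<le> q0"
proof -
  have hs: "((\<lambda>j. q 0 j) has_sum 0) S" using Q by (auto simp: Q_matrix_def)
  have hs': "((\<lambda>j. q 0 j) has_sum (0 - q 0 0)) (S - {0})"
    using has_sum_Diff[OF hs has_sum_finite[of "{0}" "\<lambda>j. q 0 j"]] by simp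
  have "(\<Sum>j\<in>{..n} \<inter> (S - {0}). q 0 j) \<le> 0 - q 0 0"
    by (rule finite_sum_le_has_sum[OF hs']) (use Q in \<open>auto simp: Q_matrix_def\<close>)
  then show ?thesis by (simp add: q0_def)
qed

text \<open>The inequalities \<open>exit_prob_le\<close> leave no slack: the exit probabilities add
  up to 1, while the rates \<open>q 0 k\<close> add up to at most \<open>q0\<close>.\<close>

lemma exit_prob_eq:
  assumes j: "j \<in> S" "j \<noteq> 0"
  shows "exit_prob j = q 0 j / q0"
proof -
  have "q 0 j \<le> q0 * (1 - (\<Sum>k\<le>n. exit_prob k)) + q0 * exit_prob j" if n: "n \<ge> j" for n
  proof -
    let ?F = "{..n} \<inter> (S - {0})"
    have jF: "j \<in> ?F" using j n by auto
    have "(\<Sum>k\<le>n. exit_prob k) = (\<Sum>k\<in>?F. exit_prob k)"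
      using exit_prob_outside by (intro sum.mono_neutral_right) auto
    also have "\<dots> = exit_prob j + (\<Sum>k\<in>?F - {j}. exit_prob k)" by (rule sum.remove) (use jF in auto)
    finally have e: "(\<Sum>k\<le>n. exit_prob k) = exit_prob j + (\<Sum>k\<in>?F - {j}. exit_prob k)" .
    have 1: "(\<Sum>k\<in>?F. q 0 k) \<le> q0" by (rule q_sum_le)
    have 2: "(\<Sum>k\<in>?F. q 0 k) = q 0 j + (\<Sum>k\<in>?F - {j}. q 0 k)" by (rule sum.remove) (use jF in auto)
    have "(\<Sum>k\<in>?F - {j}. q0 * exit_prob k) \<le> (\<Sum>k\<in>?F - {j}. q 0 k)"
      by (intro sum_mono exit_prob_le) auto
    then have 3: "q0 * (\<Sum>k\<in>?F - {j}. exit_prob k) \<le> (\<Sum>k\<in>?F - {j}. q 0 k)"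
      by (simp only: sum_distrib_left)
    have "q0 * (1 - (\<Sum>k\<le>n. exit_prob k)) + q0 * exit_prob j = q0 - q0 * (\<Sum>k\<in>?F - {j}. exit_prob k)"
      unfolding e by (simp add: right_diff_distrib distrib_left)
    then show ?thesis using 1 2 3 by linarith
  qed
  moreover have "(\<lambda>n. q0 * (1 - (\<Sum>k\<le>n. exit_prob k)) + q0 * exit_prob j) \<longlonglongrightarrow> q0 * (1 - 1) + q0 * exit_prob j"
    by (intro tendsto_intros exit_prob_sum)
  ultimately have "q 0 j \<le> q0 * exit_prob j" by (intro LIMSEQ_le_const[of _ _ "q 0 j"]) auto
  with exit_prob_le[OF j] show ?thesis using q0_pos by (simp add: field_simps)
qed

text \<open>Recurrence as assumed speaks of returns to the starting point. Started at 0, the chain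
  is at \<open>i\<close> at some time with positive probability; if it could avoid 0 from
  \<open>i\<close>, it would with positive probability never return to 0.\<close>

lemma AE_hits_0:
  assumes i: "i \<in> S"
  shows "AE w in P i. hits {0} w"
proof -
  interpret P0: prob_space "P 0" by (rule prob_space_P) simp
  interpret Pi: prob_space "P i" by (rule prob_space_P[OF i])
  obtain t where t: "t \<ge> 0" "measure (transition P t 0) {i} > 0"
    using irreducible i unfolding irreducible_on_def by (meson S_0)
  let ?A = "{w \<in> paths S. w t \<in> {i}}" and ?B = "{w \<in> paths S. \<not> hits {0} w}"
  have B: "?B \<in> sets \<Omega>"
  proof -
    have "Measurable.pred \<Omega> (\<lambda>w. \<not> hits {0} w)" by measurable
    then show ?thesis unfolding pred_def space_skorokhod .
  qed
  have "P0.prob (?A \<inter> shift t -` ?B) = P0.prob ?A * Pi.prob ?B"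
    by (rule measure_markov_path[OF S_0 i t(1) eval_in_filtration[OF t(1) order_refl] _ B]) blast
  moreover have "P0.prob (?A \<inter> shift t -` ?B) = 0"
  proof -
    have "AE w in P 0. \<forall>T\<ge>0. \<exists>s\<ge>T. w s = 0" using recurrent by (simp add: recurrent_def)
    then have "AE w in P 0. w \<notin> ?A \<inter> shift t -` ?B"
    proof eventually_elim
      case (elim w)
      then obtain s where s: "s \<ge> t" "w s = 0" using t(1) by blast
      then have "hits {0} (shift t w)" unfolding hits_def by (intro exI[of _ "s - t"]) simp
      then show ?case by simp
    qed
    then have "emeasure (P 0) (?A \<inter> shift t -` ?B) = 0"
    proof (rule AE_iff_measurable[THEN iffD1, rotated 2])
      have "shift t -` ?B \<inter> space \<Omega> \<in> sets \<Omega>" by (rule measurable_sets[OF measurable_shift[OF t(1)] B])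
      from sets.Int[OF eval_in_sets[OF t(1), of "{i}"] this]
      have "?A \<inter> (shift t -` ?B \<inter> space \<Omega>) \<in> sets (P 0)" unfolding sets_P[OF S_0] .
      moreover have "?A \<inter> (shift t -` ?B \<inter> space \<Omega>) = ?A \<inter> shift t -` ?B" unfolding space_skorokhod by blast
      ultimately show "?A \<inter> shift t -` ?B \<in> sets (P 0)" by metis
      show "{w \<in> space (P 0). \<not> w \<notin> ?A \<inter> shift t -` ?B} = ?A \<inter> shift t -` ?B"
        unfolding space_P[OF S_0] by blast
    qed
    then show ?thesis by (simp add: measure_def)
  qed
  ultimately have "Pi.prob ?B = 0" using t measure_transition[of 0 t "{i}"] by simp
  then have "emeasure (P i) ?B = 0" by (simp add: Pi.emeasure_eq_measure)
  then show ?thesis by (intro AE_I[of _ _ ?B]) (use i B in auto)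
qed

end

section \<open>Heavy tails of the killing time\<close>

text \<open>The first exit from 0 comes before either age can reach 1, and from then on the two ages
  coincide.\<close>

lemma tau_indep_age:
  assumes w: "w \<in> paths S" and nz: "\<not> zero_on w 0 d" and "u + d \<le> 1" "u' + d \<le> 1" and t: "0 \<le> t"
  shows "ereal t < tau u w \<longleftrightarrow> ereal t < tau u' w"
proof -
  have "age u r w < 1 \<longleftrightarrow> age u' r w < 1" if "r \<in> {0..t}" for r
  proof (cases "zero_on w 0 r")
    case True
    have "r < d"
    proof (rule ccontr)
      assume "\<not> r < d"
      then have "zero_on w 0 d" using zero_on_mono[OF True, of 0 d] by simp
      then show False using nz by simp
    qed
    then show ?thesis using True that assms by (simp add: age_zero_on)
  next
    case False
    then show ?thesis using that age_eq[of r u w] age_eq[of r u' w] by simp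
  qed
  then show ?thesis unfolding less_tau_iff[OF w t] by blast
qed

lemma tau_le_1: "w \<in> paths S \<Longrightarrow> zero_on w 0 1 \<Longrightarrow> 1 \<le> t \<Longrightarrow> 0 \<le> u \<Longrightarrow> \<not> ereal t < tau u w"
proof
  assume w: "w \<in> paths S" and z: "zero_on w 0 1" and t: "1 \<le> t" "0 \<le> u" and a: "ereal t < tau u w"
  have "age u 1 w < 1" using a t less_tau_iff[OF w, of t u] by simp
  then show False using age_zero_on[OF _ z, of u] t by simp
qed

context chain
begin

definition sv :: "nat \<times> real \<Rightarrow> real \<Rightarrow> real" where "sv = surv P"

lemma sv_eq: "fst x \<in> S \<Longrightarrow> sv x t = measure (P (fst x)) {w \<in> paths S. ereal t < tau (snd x) w}"
  by (simp add: surv_def sv_def)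

lemma tau_sets: "{w \<in> paths S. ereal t < tau u w} \<in> sets \<Omega>"
proof -
  have "Measurable.pred \<Omega> (\<lambda>w. ereal t < tau u w)" by measurable
  then show ?thesis unfolding pred_def space_skorokhod .
qed

lemma sv_antimono: "fst x \<in> S \<Longrightarrow> s \<le> t \<Longrightarrow> sv x t \<le> sv x s"
  unfolding sv_eq by (intro measure_P_mono tau_sets) (auto intro: less_tau_mono)

lemma sv_nonneg: "0 \<le> sv x t" by (simp add: sv_def surv_def)

lemma sv_le_1: "fst x \<in> S \<Longrightarrow> sv x t \<le> 1" unfolding sv_eq by (rule measure_le_1)

text \<open>The share of the survival probability from \<open>(0, 0)\<close> on paths that leave 0
  by time \<open>d\<close>. For \<open>d = 1\<close> and \<open>t >= 1\<close> it is all of it,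
  since a full unit of time at 0 kills.\<close>

definition early :: "real \<Rightarrow> real \<Rightarrow> real" where
  "early d t = measure (P 0) {w \<in> paths S. \<not> zero_on w 0 d \<and> ereal t < tau 0 w}"

lemma early_sets: "0 \<le> d \<Longrightarrow> {w \<in> paths S. \<not> zero_on w 0 d \<and> ereal t < tau u w} \<in> sets \<Omega>"
proof -
  assume "0 \<le> d"
  then have "Measurable.pred \<Omega> (\<lambda>w. \<not> zero_on w 0 d \<and> ereal t < tau u w)" by measurable
  then show ?thesis unfolding pred_def space_skorokhod .
qed

lemma early_antimono: "0 \<le> d \<Longrightarrow> s \<le> t \<Longrightarrow> early d t \<le> early d s"
  unfolding early_def
proof (rule measure_P_mono[OF S_0 _ early_sets])
  assume "s \<le> t"
  then show "{w \<in> paths S. \<not> zero_on w 0 d \<and> ereal t < tau 0 w} \<subseteq> {w \<in> paths S. \<not> zero_on w 0 d \<and> ereal s < tau 0 w}"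
    using less_tau_mono[of t 0 _ s] by blast
qed

lemma early_mono: "0 \<le> d \<Longrightarrow> d \<le> d' \<Longrightarrow> early d t \<le> early d' t"
  unfolding early_def
proof (rule measure_P_mono[OF S_0 _ early_sets])
  assume "d \<le> d'"
  then show "{w \<in> paths S. \<not> zero_on w 0 d \<and> ereal t < tau 0 w} \<subseteq> {w \<in> paths S. \<not> zero_on w 0 d' \<and> ereal t < tau 0 w}"
    using zero_on_mono[of _ 0 d' 0 d] by blast
qed simp

lemma sv_zero_split:
  assumes u: "0 \<le> u" "u < 1" "u \<le> t"
  shows "sv (0, 0) t = early u t + exp (- q0 * u) * sv (0, u) (t - u)"
proof -
  interpret prob_space "P 0" by (rule prob_space_P) simp
  let ?A = "{w \<in> paths S. zero_on w 0 u}" and ?B = "{w \<in> paths S. ereal (t - u) < tau u w}"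
  have eq: "{w \<in> paths S. zero_on w 0 u \<and> ereal t < tau 0 w} = ?A \<inter> shift u -` ?B"
  proof (rule set_eqI)
    fix w
    show "w \<in> {w \<in> paths S. zero_on w 0 u \<and> ereal t < tau 0 w} \<longleftrightarrow> w \<in> ?A \<inter> shift u -` ?B"
    proof (cases "w \<in> paths S \<and> zero_on w 0 u")
      case True
      then have w: "w \<in> paths S" and z: "zero_on w 0 u" by auto
      have a: "age 0 u w = u" using age_zero_on[OF u(1) z, of 0] by simp
      have "ereal u < tau 0 w"
        unfolding less_tau_iff[OF w u(1)]
      proof
        fix r assume "r \<in> {0..u}"
        then show "age 0 r w < 1" using age_zero_on[of r w 0] zero_on_mono[OF z, of 0 r] u by simp
      qed
      then have "ereal t < tau 0 w \<longleftrightarrow> ereal (t - u) < tau u (shift u w)"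
        using tau_flow[OF w u(1), of "t - u" 0] u a by simp
      then show ?thesis using w z shift_cadlag[OF w u(1)] by blast
    qed blast
  qed
  have m: "prob (?A \<inter> shift u -` ?B) = prob ?A * prob ?B"
    by (rule measure_markov_path[OF S_0 S_0 u(1) zero_on_sets[OF u(1)] _ tau_sets])
      (use zero_onD[OF _ u(1) order_refl] in blast)
  have zt: "{w \<in> paths S. zero_on w 0 u \<and> ereal t < tau 0 w} \<in> sets \<Omega>"
  proof -
    have "Measurable.pred \<Omega> (\<lambda>w. zero_on w 0 u \<and> ereal t < tau 0 w)" using u(1) by measurable
    then show ?thesis unfolding pred_def space_skorokhod .
  qed
  have "prob ({w \<in> paths S. \<not> zero_on w 0 u \<and> ereal t < tau 0 w} \<union> {w \<in> paths S. zero_on w 0 u \<and> ereal t < tau 0 w})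
     = early u t + prob {w \<in> paths S. zero_on w 0 u \<and> ereal t < tau 0 w}"
    unfolding early_def
    by (rule finite_measure_Union) (use early_sets[OF u(1)] zt sets_P[OF S_0] in blast)+
  also have "{w \<in> paths S. \<not> zero_on w 0 u \<and> ereal t < tau 0 w} \<union> {w \<in> paths S. zero_on w 0 u \<and> ereal t < tau 0 w}
    = {w \<in> paths S. ereal t < tau 0 w}" by blast
  finally show ?thesis unfolding eq m zero_on_prob[OF u(1)] by (simp add: sv_eq)
qed

text \<open>The increment belongs to paths that rest at 0 until \<open>u\<close> and leave within
  the next \<open>d\<close>. As \<open>u + d <= 1\<close>, the age \<open>u\<close> gathered before
  can be forgotten by \<open>tau_indep_age\<close>, which makes all increments of the same
  kind.\<close>

lemma early_step:
  assumes d: "0 \<le> d" "0 \<le> u" "u + d \<le> 1" "0 < d" and t: "u + d \<le> t"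
  shows "early (u + d) t = early u t + exp (- q0 * u) * early d (t - u)"
proof -
  interpret prob_space "P 0" by (rule prob_space_P) simp
  let ?A = "{w \<in> paths S. zero_on w 0 u}" and ?B = "{w \<in> paths S. \<not> zero_on w 0 d \<and> ereal (t - u) < tau 0 w}"
  let ?X = "{w \<in> paths S. \<not> zero_on w 0 (u + d) \<and> ereal t < tau 0 w}"
  let ?Y = "{w \<in> paths S. \<not> zero_on w 0 u \<and> ereal t < tau 0 w}"
  have eq: "?X - ?Y = ?A \<inter> shift u -` ?B"
  proof (rule set_eqI)
    fix w
    show "w \<in> ?X - ?Y \<longleftrightarrow> w \<in> ?A \<inter> shift u -` ?B"
    proof (cases "w \<in> paths S \<and> zero_on w 0 u")
      case True
      then have w: "w \<in> paths S" and z: "zero_on w 0 u" by auto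
      have sw: "shift u w \<in> paths S" by (rule shift_cadlag[OF w d(2)])
      have a: "age 0 u w = u" using age_zero_on[OF d(2) z, of 0] by simp
      have zz: "zero_on w 0 (u + d) \<longleftrightarrow> zero_on (shift u w) 0 d"
        using zero_on_split[of 0 u "u + d" w] z d by (simp add: zero_on_shift)
      have "ereal u < tau 0 w"
        unfolding less_tau_iff[OF w d(2)]
      proof
        fix r assume "r \<in> {0..u}"
        then show "age 0 r w < 1" using age_zero_on[of r w 0] zero_on_mono[OF z, of 0 r] d by simp
      qed
      then have "ereal t < tau 0 w \<longleftrightarrow> ereal (t - u) < tau u (shift u w)"
        using tau_flow[OF w d(2), of "t - u" 0] t d a by simp
      moreover have "ereal (t - u) < tau u (shift u w) \<longleftrightarrow> ereal (t - u) < tau 0 (shift u w)"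
        if "\<not> zero_on (shift u w) 0 d"
        by (rule tau_indep_age[OF sw that]) (use d t in auto)
      ultimately show ?thesis using w z zz sw by blast
    next
      case False
      have "zero_on w 0 (u + d) \<Longrightarrow> zero_on w 0 u" using d by (auto intro: zero_on_mono)
      then show ?thesis using False by blast
    qed
  qed
  have "prob (?X - ?Y) = prob ?X - prob ?Y"
  proof (rule finite_measure_Diff)
    show "?X \<in> events" "?Y \<in> events"
      unfolding sets_P[OF S_0] by (rule early_sets, use d in simp)+
    have "zero_on w 0 (u + d) \<Longrightarrow> zero_on w 0 u" for w using d by (auto intro: zero_on_mono)
    then show "?Y \<subseteq> ?X" by blast
  qed
  moreover have "prob (?A \<inter> shift u -` ?B) = prob ?A * prob ?B"
    by (rule measure_markov_path[OF S_0 S_0 d(2) zero_on_sets[OF d(2)] _ early_sets[OF d(1)]])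
      (use zero_onD[OF _ d(2) order_refl] in blast)
  ultimately show ?thesis unfolding eq zero_on_prob[OF d(2)] early_def by simp
qed

lemma early_0: "early 0 t = 0"
proof -
  interpret prob_space "P 0" by (rule prob_space_P) simp
  let ?X = "{w \<in> paths S. \<not> zero_on w 0 0}"
  have 1: "{w \<in> paths S. zero_on w 0 0} = {w \<in> paths S. w 0 = 0}" by (simp add: zero_on_def)
  have "early 0 t \<le> prob ?X"
    unfolding early_def
  proof (rule measure_P_mono[OF S_0])
    have "paths S - {w \<in> paths S. zero_on w 0 0} \<in> sets \<Omega>"
      using sets.compl_sets[OF zero_on_sets'[OF order_refl]] unfolding space_skorokhod .
    moreover have "paths S - {w \<in> paths S. zero_on w 0 0} = ?X" by blast
    ultimately show "?X \<in> sets \<Omega>" by metis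
  qed blast
  also have "?X = paths S - {w \<in> paths S. zero_on w 0 0}" by blast
  also have "prob \<dots> = 1 - prob {w \<in> paths S. zero_on w 0 0}"
    using prob_compl[of "{w \<in> paths S. zero_on w 0 0}"] zero_on_sets'[OF order_refl] by simp
  also have "\<dots> = 0" using measure_start[of 0] unfolding 1 by simp
  finally show ?thesis using measure_nonneg[of "P 0"] unfolding early_def by (simp add: antisym)
qed

lemma early_1: "t \<ge> 1 \<Longrightarrow> early 1 t = sv (0, 0) t"
proof -
  assume "t \<ge> 1"
  then have "{w \<in> paths S. \<not> zero_on w 0 1 \<and> ereal t < tau 0 w} = {w \<in> paths S. ereal t < tau 0 w}"
    using tau_le_1[of _ S t 0] by blast
  then show ?thesis by (simp add: early_def sv_eq)
qed

lemma early_multiple: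
  assumes d: "0 < d" "real k * d \<le> 1" and t: "t \<ge> 1"
  shows "early (real k * d) t = (\<Sum>l<k. exp (- q0 * (real l * d)) * early d (t - real l * d))"
  using d(2)
proof (induction k)
  case (Suc k)
  have e: "real (Suc k) * d = real k * d + d" by (simp add: algebra_simps)
  have "early (real k * d + d) t = early (real k * d) t + exp (- q0 * (real k * d)) * early d (t - real k * d)"
    using d Suc.prems t unfolding e by (intro early_step) auto
  then show ?case using Suc d unfolding e by simp
qed (simp add: early_0)

lemma geometric_exp:
  assumes "0 < d"
  shows "(\<Sum>l<k. exp (- q0 * (real l * d))) = (1 - exp (- q0 * (real k * d))) / (1 - exp (- q0 * d))"
proof -
  have e: "exp (- q0 * (real l * d)) = exp (- q0 * d) ^ l" for l
    by (simp add: exp_of_nat_mult[symmetric] mult_ac)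
  have "exp (- q0 * d) < 1" using q0_pos assms by simp
  then have "(\<Sum>l<k. exp (- q0 * d) ^ l) = (exp (- q0 * d) ^ k - 1) / (exp (- q0 * d) - 1)"
    by (intro geometric_sum) linarith
  also have "\<dots> = (1 - exp (- q0 * d) ^ k) / (1 - exp (- q0 * d))"
    by (metis minus_diff_eq minus_divide_divide)
  finally show ?thesis unfolding e .
qed

definition long_tailed :: "(real \<Rightarrow> real) \<Rightarrow> bool" where
  "long_tailed f \<longleftrightarrow> (\<forall>s\<ge>0. ((\<lambda>t. f (t + s) / f t) \<longlongrightarrow> 1) at_top)"

end

lemma at_top_shift: "filterlim (\<lambda>t::real. t - s) at_top at_top"
  using filterlim_tendsto_add_at_top[of "\<lambda>_. - s" "- s" at_top "\<lambda>t. t"] by (simp add: filterlim_ident)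

lemma tendsto_shift_at_top:
  fixes f :: "real \<Rightarrow> real"
  assumes "(f \<longlongrightarrow> l) at_top"
  shows "((\<lambda>t. f (t - s)) \<longlongrightarrow> l) at_top"
  by (rule filterlim_compose[OF assms at_top_shift])

context chain
begin

lemma long_tailed_back:
  assumes "long_tailed f" "s \<ge> 0"
  shows "((\<lambda>t. f (t - s) / f t) \<longlongrightarrow> 1) at_top"
proof -
  have "((\<lambda>t. f (t - s + s) / f (t - s)) \<longlongrightarrow> 1) at_top"
    using assms unfolding long_tailed_def by (intro tendsto_shift_at_top[where f = "\<lambda>t. f (t + s) / f t"]) blast
  from tendsto_inverse[OF this] show ?thesis by (simp add: inverse_eq_divide)
qed

lemma long_tailed_nonzero:
  assumes "long_tailed f"
  shows "\<forall>\<^sub>F t in at_top. f t \<noteq> 0"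
proof -
  have "((\<lambda>t. f (t + 0) / f t) \<longlongrightarrow> 1) at_top" using assms unfolding long_tailed_def by blast
  then have "\<forall>\<^sub>F t in at_top. f (t + 0) / f t > 0" by (rule order_tendstoD) simp
  then show ?thesis by eventually_elim auto
qed

text \<open>The ratio of the probabilities that a stay at 0 ends before age 1, given age
  \<open>u\<close> and given age 0.\<close>

definition hz :: "real \<Rightarrow> real" where
  "hz u = (1 - exp (- q0 * (1 - u))) / (1 - exp (- q0))"

lemma exp_q0: "0 < exp (- q0)" "exp (- q0) < 1" "0 < 1 - exp (- q0)" using q0_pos by auto

lemma hz_pos: "u < 1 \<Longrightarrow> 0 < hz u"
  using exp_q0 q0_pos by (simp add: hz_def)

lemma hz_0: "hz 0 = 1" using exp_q0 by (simp add: hz_def)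

text \<open>Cutting $[0,1]$ into steps of length $d$ expresses \<open>sv (0, 0) t\<close> through the values of
  \<open>early d\<close> at nearby times, which are comparable by monotonicity and the long tail.\<close>

lemma early_limit_fraction:
  assumes lt: "long_tailed (sv (0, 0))" and N: "N > 0" and k: "k \<le> N"
  shows "((\<lambda>t. early (real k / real N) t / sv (0, 0) t) \<longlongrightarrow> (1 - exp (- q0 * (real k / real N))) / (1 - exp (- q0))) at_top"
proof -
  define d where "d = 1 / real N"
  have d: "0 < d" "real N * d = 1" "real k * d \<le> 1" "d \<le> 1" using N k by (auto simp: d_def)
  let ?s = "sv (0, 0)"
  define c where "c m = (\<Sum>l<m. exp (- q0 * (real l * d)))" for m
  have c: "c m = (1 - exp (- q0 * (real m * d))) / (1 - exp (- q0 * d))" for m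
    unfolding c_def by (rule geometric_exp[OF d(1)])
  have cN: "c N > 0" unfolding c using d q0_pos by simp
  have pos: "\<forall>\<^sub>F t in at_top. ?s t > 0"
    using long_tailed_nonzero[OF lt] by eventually_elim (simp add: sv_nonneg less_le)
  have lo: "c m * early d t \<le> early (real m * d) t" and up: "early (real m * d) t \<le> c m * early d (t - 1)"
    if "t \<ge> 1" "real m * d \<le> 1" for t m
  proof -
    have l: "early d t \<le> early d (t - real l * d)" "early d (t - real l * d) \<le> early d (t - 1)" if "l < m" for l
    proof -
      have "real l * d \<le> real m * d" using that d by (intro mult_right_mono) auto
      then have "real l * d \<le> 1" using \<open>real m * d \<le> 1\<close> by (rule order_trans)
      then show "early d t \<le> early d (t - real l * d)" "early d (t - real l * d) \<le> early d (t - 1)"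
        using d(1) by (auto intro!: early_antimono)
    qed
    show "c m * early d t \<le> early (real m * d) t"
      unfolding early_multiple[OF d(1) that(2,1)] c_def sum_distrib_right
      using l by (intro sum_mono mult_left_mono) auto
    show "early (real m * d) t \<le> c m * early d (t - 1)"
      unfolding early_multiple[OF d(1) that(2,1)] c_def sum_distrib_right
      using l by (intro sum_mono mult_left_mono) auto
  qed
  \<comment> \<open>For \<open>m = N\<close> the left side of the two bounds is
    \<open>sv (0, 0)\<close> itself, so \<open>early d\<close> is caught between shifts of
    \<open>sv (0, 0)\<close> divided by \<open>c N\<close>.\<close>
  have ed_up: "early d t \<le> ?s t / c N" if "t \<ge> 1" for t
    using lo[OF that, of N] d cN early_1[OF that] by (simp add: pos_le_divide_eq mult.commute)
  have ed_lo: "?s (t + 1) / c N \<le> early d t" if "t \<ge> 1" for t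
    using up[of "t + 1" N] d cN early_1[of "t + 1"] that by (simp add: pos_divide_le_eq mult.commute)
  have L: "((\<lambda>t. c k / c N * (?s (t + 1) / ?s t)) \<longlongrightarrow> c k / c N * 1) at_top"
    using lt unfolding long_tailed_def by (intro tendsto_mult tendsto_const) simp
  have U: "((\<lambda>t. c k / c N * (?s (t - 1) / ?s t)) \<longlongrightarrow> c k / c N * 1) at_top"
    by (intro tendsto_mult tendsto_const long_tailed_back[OF lt]) simp
  have ck: "0 \<le> c k" by (simp add: c_def sum_nonneg)
  have "((\<lambda>t. early (real k * d) t / ?s t) \<longlongrightarrow> c k / c N * 1) at_top"
  proof (rule tendsto_sandwich[OF _ _ L U])
    show "\<forall>\<^sub>F t in at_top. c k / c N * (?s (t + 1) / ?s t) \<le> early (real k * d) t / ?s t"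
      using pos eventually_ge_at_top[of 1]
    proof eventually_elim
      case (elim t)
      have "c k * (?s (t + 1) / c N) \<le> c k * early d t" using ed_lo[of t] elim ck by (intro mult_left_mono) auto
      also have "\<dots> \<le> early (real k * d) t" by (rule lo) (use elim d in auto)
      finally have "c k * (?s (t + 1) / c N) / ?s t \<le> early (real k * d) t / ?s t"
        using elim by (intro divide_right_mono) auto
      then show ?case by (simp add: mult_ac)
    qed
    show "\<forall>\<^sub>F t in at_top. early (real k * d) t / ?s t \<le> c k / c N * (?s (t - 1) / ?s t)"
      using pos eventually_ge_at_top[of 2]
    proof eventually_elim
      case (elim t)
      have "early (real k * d) t \<le> c k * early d (t - 1)" by (rule up) (use elim d in auto)
      also have "\<dots> \<le> c k * (?s (t - 1) / c N)" using ed_up[of "t - 1"] elim ck by (intro mult_left_mono) auto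
      finally have "early (real k * d) t / ?s t \<le> c k * (?s (t - 1) / c N) / ?s t"
        using elim by (intro divide_right_mono) auto
      then show ?case by (simp add: mult_ac)
    qed
  qed
  moreover have "c k / c N = (1 - exp (- q0 * (real k * d))) / (1 - exp (- q0))"
    unfolding c d(2) using d(1) q0_pos by simp
  ultimately show ?thesis by (simp add: d_def)
qed

text \<open>\<open>early u t\<close> increases with \<open>u\<close>, so it is squeezed between
  neighbouring fractions \<open>k / N\<close>; the limit is continuous in \<open>u\<close>.\<close>

lemma early_limit:
  assumes lt: "long_tailed (sv (0, 0))" and u: "0 \<le> u" "u < 1"
  shows "((\<lambda>t. early u t / sv (0, 0) t) \<longlongrightarrow> (1 - exp (- q0 * u)) / (1 - exp (- q0))) at_top"
proof (rule tendstoI)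
  fix e :: real assume e: "e > 0"
  let ?f = "\<lambda>u. (1 - exp (- q0 * u)) / (1 - exp (- q0))"
  have pos: "\<forall>\<^sub>F t in at_top. sv (0, 0) t > 0"
    using long_tailed_nonzero[OF lt] by eventually_elim (simp add: sv_nonneg less_le)
  have "isCont ?f u" using exp_q0 by (intro continuous_intros) auto
  then obtain \<delta> where \<delta>: "\<delta> > 0" "\<And>v. \<bar>v - u\<bar> < \<delta> \<Longrightarrow> \<bar>?f v - ?f u\<bar> < e / 2"
    unfolding continuous_at_eps_delta dist_real_def using e by (metis half_gt_zero)
  \<comment> \<open>The mesh is below \<open>1 - u\<close> as well, so that the fraction above
    \<open>u\<close> does not exceed 1.\<close>
  obtain N :: nat where N: "1 / real (Suc N) < min \<delta> (1 - u)"
    using nat_approx_posE[of "min \<delta> (1 - u)"] \<delta>(1) u by (metis diff_gt_0_iff_gt min_less_iff_conj)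
  let ?N = "Suc N"
  define k where "k = nat \<lfloor>u * real ?N\<rfloor>"
  have "0 \<le> u * real ?N" using u by simp
  then have k: "real k \<le> u * real ?N" "u * real ?N < real k + 1" unfolding k_def by linarith+
  have k1: "real k / real ?N \<le> u" using k(1) by (simp add: pos_divide_le_eq)
  have k2: "u \<le> real (Suc k) / real ?N" using k(2) by (simp add: pos_le_divide_eq)
  have k3: "real (Suc k) / real ?N = real k / real ?N + 1 / real ?N" by (simp add: add_divide_distrib)
  have "real (Suc k) / real ?N < u + (1 - u)" using k1 k3 N by linarith
  then have "real (Suc k) < real ?N" by (simp add: pos_divide_less_eq)
  then have kN: "Suc k \<le> ?N" by linarith
  have c1: "\<bar>?f (real k / real ?N) - ?f u\<bar> < e / 2" by (rule \<delta>(2)) (use k1 k2 k3 N in linarith)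
  have c2: "\<bar>?f (real (Suc k) / real ?N) - ?f u\<bar> < e / 2" by (rule \<delta>(2)) (use k1 k2 k3 N in linarith)
  have l1: "\<forall>\<^sub>F t in at_top. dist (early (real k / real ?N) t / sv (0, 0) t) (?f (real k / real ?N)) < e / 2"
    by (rule tendstoD[OF early_limit_fraction[OF lt]]) (use kN e in auto)
  have l2: "\<forall>\<^sub>F t in at_top. dist (early (real (Suc k) / real ?N) t / sv (0, 0) t) (?f (real (Suc k) / real ?N)) < e / 2"
    by (rule tendstoD[OF early_limit_fraction[OF lt]]) (use kN e in auto)
  from l1 l2 pos show "\<forall>\<^sub>F t in at_top. dist (early u t / sv (0, 0) t) (?f u) < e"
  proof eventually_elim
    case (elim t)
    have "early (real k / real ?N) t / sv (0, 0) t \<le> early u t / sv (0, 0) t"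
      using elim k1 by (intro divide_right_mono early_mono) auto
    moreover have "early u t / sv (0, 0) t \<le> early (real (Suc k) / real ?N) t / sv (0, 0) t"
      using elim k2 u by (intro divide_right_mono early_mono) auto
    ultimately show ?case using elim c1 c2 unfolding dist_real_def by linarith
  qed
qed

text \<open>Solve the splitting at age \<open>u\<close>, \<open>sv_zero_split\<close>, for the
  survival function from \<open>(0, u)\<close>. The factor \<open>exp (q0 * u)\<close> undoes the
  probability of resting at 0 until then.\<close>

lemma sv_zero_limit:
  assumes lt: "long_tailed (sv (0, 0))" and u: "0 \<le> u" "u < 1"
  shows "((\<lambda>t. sv (0, u) t / sv (0, 0) t) \<longlongrightarrow> hz u) at_top"
proof -
  let ?s = "sv (0, 0)"
  have pos: "\<forall>\<^sub>F t in at_top. ?s t \<noteq> 0" by (rule long_tailed_nonzero[OF lt])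
  have pos': "\<forall>\<^sub>F t in at_top. ?s (t + u) \<noteq> 0"
    using eventually_compose_filterlim[OF pos at_top_shift[of "- u"]] by simp
  have e: "((\<lambda>t. early u (t + u) / ?s (t + u)) \<longlongrightarrow> (1 - exp (- q0 * u)) / (1 - exp (- q0))) at_top"
    using tendsto_shift_at_top[OF early_limit[OF lt u], of "- u"] by simp
  have "((\<lambda>t. ?s (t + u) / ?s t) \<longlongrightarrow> 1) at_top" using lt u by (simp add: long_tailed_def)
  then have lim: "((\<lambda>t. exp (q0 * u) * ((1 - early u (t + u) / ?s (t + u)) * (?s (t + u) / ?s t))) \<longlongrightarrow>
     exp (q0 * u) * ((1 - (1 - exp (- q0 * u)) / (1 - exp (- q0))) * 1)) at_top"
    by (intro tendsto_intros e)
  have val: "exp (q0 * u) * ((1 - (1 - exp (- q0 * u)) / (1 - exp (- q0))) * 1) = hz u"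
  proof -
    have "exp (q0 * u) * exp (- q0 * u) = 1" by (simp add: exp_minus)
    moreover have "exp (q0 * u) * exp (- q0) = exp (- q0 * (1 - u))" by (simp add: exp_add[symmetric] algebra_simps)
    moreover have "1 - (1 - exp (- q0 * u)) / (1 - exp (- q0)) = (exp (- q0 * u) - exp (- q0)) / (1 - exp (- q0))"
      using exp_q0 by (simp add: field_simps)
    ultimately show ?thesis by (simp add: hz_def right_diff_distrib)
  qed
  have ev: "\<forall>\<^sub>F t in at_top. exp (q0 * u) * ((1 - early u (t + u) / ?s (t + u)) * (?s (t + u) / ?s t)) = sv (0, u) t / ?s t"
    using pos pos' eventually_ge_at_top[of 0]
  proof eventually_elim
    case (elim t)
    have "?s (t + u) = early u (t + u) + exp (- q0 * u) * sv (0, u) t"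
      using sv_zero_split[of u "t + u"] u elim by simp
    then have *: "?s (t + u) - early u (t + u) = exp (- q0 * u) * sv (0, u) t" by simp
    have "(1 - early u (t + u) / ?s (t + u)) * (?s (t + u) / ?s t) = (?s (t + u) - early u (t + u)) / ?s t"
      using elim by (simp add: diff_divide_distrib left_diff_distrib)
    also have "\<dots> = exp (- q0 * u) * sv (0, u) t / ?s t" unfolding * ..
    finally have X: "exp (q0 * u) * ((1 - early u (t + u) / ?s (t + u)) * (?s (t + u) / ?s t)) =
        (exp (q0 * u) * exp (- q0 * u)) * (sv (0, u) t / ?s t)"
      by (simp only: mult.assoc times_divide_eq_right)
    have e1: "exp (q0 * u) * exp (- q0 * u) = 1" by (simp add: exp_minus)
    show ?case using X unfolding e1 mult_1_left .
  qed
  show ?thesis using Lim_transform_eventually[OF lim ev] unfolding val .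
qed

lemma heavy_tails_ratio:
  assumes c: "comparable_heavy_tails S P c"
  shows "long_tailed (sv (0, 0))"
    and "x \<in> hat_S S \<Longrightarrow> ((\<lambda>t. sv x t / sv (0, 0) t) \<longlongrightarrow> h_fun q c x) at_top"
    and "x \<in> hat_S S \<Longrightarrow> 0 < h_fun q c x"
proof -
  show lt: "long_tailed (sv (0, 0))" using c by (simp add: comparable_heavy_tails_def long_tailed_def sv_def)
  assume x: "x \<in> hat_S S"
  have h0: "h_fun q c (0, u) = hz u" for u by (simp add: h_fun_def hz_def q0_def Let_def)
  show "((\<lambda>t. sv x t / sv (0, 0) t) \<longlongrightarrow> h_fun q c x) at_top"
  proof (cases "fst x = 0")
    case True
    have "x = (0, snd x)" using True by (simp add: prod_eq_iff)
    moreover have "((\<lambda>t. sv (0, snd x) t / sv (0, 0) t) \<longlongrightarrow> h_fun q c (0, snd x)) at_top"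
      unfolding h0 using hat_S_D[OF x S_0] by (intro sv_zero_limit[OF lt]) auto
    ultimately show ?thesis by metis
  next
    case False
    then have xe: "x = (fst x, 0)" and i: "fst x \<in> S" using hat_S_D[OF x S_0] by (auto simp: prod_eq_iff)
    have ae: "sv (fst x, 0) \<sim>[at_top] (\<lambda>t. c (fst x) * sv (0, 0) t)"
      using c i by (simp add: comparable_heavy_tails_def sv_def)
    have cpos: "c (fst x) > 0" using c i by (simp add: comparable_heavy_tails_def)
    have ev: "\<forall>\<^sub>F t in at_top. sv (fst x, 0) t \<noteq> 0 \<or> c (fst x) * sv (0, 0) t \<noteq> 0"
      using long_tailed_nonzero[OF lt] by eventually_elim (use cpos in simp)
    have *: "((\<lambda>t. sv (fst x, 0) t / (c (fst x) * sv (0, 0) t)) \<longlongrightarrow> 1) at_top"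
      by (rule asymp_equivD_strong[OF ae ev])
    from tendsto_mult[OF tendsto_const[of "c (fst x)"] *]
    have "((\<lambda>t. sv (fst x, 0) t / sv (0, 0) t) \<longlongrightarrow> c (fst x)) at_top" using cpos by simp
    moreover have "h_fun q c x = c (fst x)" using False by (simp add: h_fun_def Let_def)
    moreover have "sv x = sv (fst x, 0)" by (subst xe) (rule refl)
    ultimately show ?thesis by simp
  qed
  show "0 < h_fun q c x"
  proof (cases "fst x = 0")
    case True
    have "x = (0, snd x)" using True by (simp add: prod_eq_iff)
    then show ?thesis using h0[of "snd x"] hz_pos[of "snd x"] hat_S_D[OF x S_0] by metis
  next
    case False
    then show ?thesis using c hat_S_D[OF x S_0] by (simp add: h_fun_def comparable_heavy_tails_def)
  qed
qed

lemma heavy_tails_survival_ratio: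
  assumes c: "comparable_heavy_tails S P c"
  shows "survival_ratio_limit S P (h_fun q c)"
  unfolding survival_ratio_limit_def
proof (intro allI impI ballI)
  fix v :: real and x y assume v: "v \<ge> 0" and x: "x \<in> hat_S S" and y: "y \<in> hat_S S"
  let ?s = "sv (0, 0)"
  note H = heavy_tails_ratio[OF c]
  have "((\<lambda>t. sv y (t - v) / ?s (t - v)) \<longlongrightarrow> h_fun q c y) at_top" by (rule tendsto_shift_at_top[OF H(2)[OF y]])
  from tendsto_divide[OF tendsto_mult[OF this long_tailed_back[OF H(1) v]] H(2)[OF x]] H(3)[OF x]
  have "((\<lambda>t. sv y (t - v) / ?s (t - v) * (?s (t - v) / ?s t) / (sv x t / ?s t)) \<longlongrightarrow> h_fun q c y / h_fun q c x) at_top" by simp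
  moreover have "\<forall>\<^sub>F t in at_top. sv y (t - v) / ?s (t - v) * (?s (t - v) / ?s t) / (sv x t / ?s t) = sv y (t - v) / sv x t"
    using long_tailed_nonzero[OF H(1)] eventually_compose_filterlim[OF long_tailed_nonzero[OF H(1)] at_top_shift[of v]]
    by eventually_elim simp
  ultimately have "((\<lambda>t. sv y (t - v) / sv x t) \<longlongrightarrow> h_fun q c y / h_fun q c x) at_top"
    by (rule Lim_transform_eventually)
  then show "((\<lambda>t. surv P y (t - v) / surv P x t) \<longlongrightarrow> h_fun q c y / h_fun q c x) at_top"
    by (simp add: sv_def)
qed

end

section \<open>Subexponential tails\<close>

declare measurable_eval [measurable del] measurable_filtration_eval [measurable del]

text \<open>For positive \<open>phi\<close> this says that the limes superior of
  \<open>psi / phi\<close> is at most \<open>l\<close>, in a form that adds up and needs no extended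
  reals.\<close>

definition asymp_le :: "(real \<Rightarrow> real) \<Rightarrow> real \<Rightarrow> (real \<Rightarrow> real) \<Rightarrow> bool" where
  "asymp_le psi l phi \<longleftrightarrow> (\<forall>e>0. \<forall>\<^sub>F t in at_top. psi t \<le> (l + e) * phi t)"

lemma asymp_leI_ratio:
  assumes "((\<lambda>t. psi t / phi t) \<longlongrightarrow> l) at_top" and pos: "\<And>t. 0 < phi t"
  shows "asymp_le psi l phi"
  unfolding asymp_le_def
proof (intro allI impI)
  fix e :: real assume "e > 0"
  then have "\<forall>\<^sub>F t in at_top. psi t / phi t < l + e" by (intro order_tendstoD(2)[OF assms(1)]) simp
  then show "\<forall>\<^sub>F t in at_top. psi t \<le> (l + e) * phi t"
    by eventually_elim (use pos in \<open>simp add: pos_divide_less_eq less_imp_le\<close>)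
qed

lemma asymp_le_trans_ratio:
  assumes d: "asymp_le psi l phi" and l: "((\<lambda>t. phi t / \<theta> t) \<longlongrightarrow> c) at_top" and pos: "\<And>t. 0 < \<theta> t" and c: "c \<ge> 0"
  shows "asymp_le psi (l * c) \<theta>"
  unfolding asymp_le_def
proof (intro allI impI)
  fix e :: real assume e: "e > 0"
  \<comment> \<open>Chosen so that \<open>(l + \<delta>) * c < l * c + e\<close>; the summand 1 in
    the denominator takes care of \<open>c = 0\<close>.\<close>
  define \<delta> where "\<delta> = e / (2 * (c + 1))"
  have \<delta>: "\<delta> > 0" using e c by (simp add: \<delta>_def)
  have "\<delta> * c \<le> \<delta> * (c + 1)" using \<delta> by simp
  also have "\<dots> = e / 2"
  proof -
    have "2 * c + 2 \<noteq> 0" "c + 1 \<noteq> 0" using c by auto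
    then show ?thesis by (simp add: \<delta>_def field_simps)
  qed
  also have "\<dots> < e" using e by simp
  finally have lt: "(l + \<delta>) * c < l * c + e" by (simp add: distrib_right)
  have "((\<lambda>t. (l + \<delta>) * (phi t / \<theta> t)) \<longlongrightarrow> (l + \<delta>) * c) at_top" by (intro tendsto_intros l)
  then have "\<forall>\<^sub>F t in at_top. (l + \<delta>) * (phi t / \<theta> t) < l * c + e" by (rule order_tendstoD(2)[OF _ lt])
  moreover have "\<forall>\<^sub>F t in at_top. psi t \<le> (l + \<delta>) * phi t" using d \<delta> by (simp add: asymp_le_def)
  ultimately show "\<forall>\<^sub>F t in at_top. psi t \<le> (l * c + e) * \<theta> t"
  proof eventually_elim
    case (elim t)
    have "(l + \<delta>) * phi t < (l * c + e) * \<theta> t" using elim(1) pos[of t] by (simp add: pos_divide_less_eq)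
    then show ?case using elim(2) by simp
  qed
qed

lemma asymp_le_add:
  assumes "asymp_le psi l phi" "asymp_le psi' l' phi"
  shows "asymp_le (\<lambda>t. psi t + psi' t) (l + l') phi"
  unfolding asymp_le_def
proof (intro allI impI)
  fix e :: real assume "e > 0"
  then have "\<forall>\<^sub>F t in at_top. psi t \<le> (l + e/2) * phi t" "\<forall>\<^sub>F t in at_top. psi' t \<le> (l' + e/2) * phi t"
    using assms by (simp_all add: asymp_le_def)
  then show "\<forall>\<^sub>F t in at_top. psi t + psi' t \<le> (l + l' + e) * phi t"
    by eventually_elim (simp add: algebra_simps)
qed

lemma asymp_le_cmult:
  assumes d: "asymp_le psi l phi" and c: "c \<ge> 0" and pos: "\<And>t. 0 < phi t"
  shows "asymp_le (\<lambda>t. c * psi t) (c * l) phi"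
  unfolding asymp_le_def
proof (intro allI impI)
  fix e :: real assume e: "e > 0"
  have "\<forall>\<^sub>F t in at_top. psi t \<le> (l + e / (c + 1)) * phi t" using d c e by (simp add: asymp_le_def)
  then show "\<forall>\<^sub>F t in at_top. c * psi t \<le> (c * l + e) * phi t"
  proof eventually_elim
    case (elim t)
    have "c * psi t \<le> c * ((l + e / (c + 1)) * phi t)" using elim c by (intro mult_left_mono) auto
    also have "\<dots> = (c * l + c * (e / (c + 1))) * phi t" by (simp add: algebra_simps)
    also have "\<dots> \<le> (c * l + e) * phi t"
      using c e pos[of t] by (intro mult_right_mono add_left_mono) (auto simp: field_simps)
    finally show ?case .
  qed
qed

lemma asymp_le_sum:
  assumes "finite J" "\<And>j. j \<in> J \<Longrightarrow> asymp_le (psi j) (l j) phi" and pos: "\<And>t. 0 < phi t"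
  shows "asymp_le (\<lambda>t. \<Sum>j\<in>J. psi j t) (\<Sum>j\<in>J. l j) phi"
  using assms(1,2)
proof (induction J rule: finite_induct)
  case empty
  then show ?case using pos by (auto simp: asymp_le_def less_imp_le)
next
  case (insert j J)
  then show ?case using asymp_le_add[of "psi j" "l j" phi] by simp
qed

lemma asymp_le_mono:
  assumes "asymp_le psi l phi" "\<And>t. t \<ge> b \<Longrightarrow> \<theta> t \<le> psi t"
  shows "asymp_le \<theta> l phi"
  unfolding asymp_le_def
proof (intro allI impI)
  fix e :: real assume "e > 0"
  then have "\<forall>\<^sub>F t in at_top. psi t \<le> (l + e) * phi t" using assms(1) by (simp add: asymp_le_def)
  then show "\<forall>\<^sub>F t in at_top. \<theta> t \<le> (l + e) * phi t"
    using eventually_ge_at_top[of b] by eventually_elim (use assms(2) in force)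
qed

section \<open>Convolution estimates for a subexponential law\<close>

definition tail :: "real measure \<Rightarrow> real \<Rightarrow> real" where
  "tail F t = measure F {t<..}"

text \<open>If Z has law \<open>F\<close> and \<open>psi\<close> is the tail of an independent Y,
  this is the probability that Z <= t < Z + Y.\<close>

definition conv :: "real measure \<Rightarrow> (real \<Rightarrow> real) \<Rightarrow> real \<Rightarrow> ennreal" where
  "conv F psi t = (\<integral>\<^sup>+y\<in>{..t}. ennreal (psi (t - y)) \<partial>F)"

locale subexp_law =
  fixes F :: "real measure"
  assumes subexp: "subexponential F"
begin

sublocale prob_space F using subexp by (simp add: subexponential_def)

lemma sets_F [measurable_cong, simp]: "sets F = sets borel" using subexp by (simp add: subexponential_def)

lemma space_F [simp]: "space F = UNIV" using sets_eq_imp_space_eq[OF sets_F] by simp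

lemma measurable_F [simp]: "F \<rightarrow>\<^sub>M N = borel \<rightarrow>\<^sub>M N"
  by (rule measurable_cong_sets) auto

lemma AE_nonneg: "AE y in F. 0 \<le> y" using subexp by (simp add: subexponential_def)

lemma tail_antimono: "s \<le> t \<Longrightarrow> tail F t \<le> tail F s"
  unfolding tail_def by (rule finite_measure_mono) auto

lemma tail_nonneg: "0 \<le> tail F t" by (simp add: tail_def)

lemma tail_le_1: "tail F t \<le> 1" by (simp add: tail_def)

lemma tail_neg: "t < 0 \<Longrightarrow> tail F t = 1"
proof -
  assume t: "t < 0"
  have "AE y in F. y \<in> {t<..}" using AE_nonneg by eventually_elim (use t in auto)
  then show ?thesis unfolding tail_def by (subst prob_eq_1) auto
qed

lemma tail_measurable [measurable]: "tail F \<in> borel_measurable borel"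
proof -
  have "mono (\<lambda>t. - tail F t)" by (intro monoI) (use tail_antimono in auto)
  then have "(\<lambda>t. - tail F t) \<in> borel_measurable borel" by (rule borel_measurable_mono)
  then have "(\<lambda>t. - (- tail F t)) \<in> borel_measurable borel" by (rule borel_measurable_uminus)
  then show ?thesis by simp
qed

text \<open>If the tail vanished somewhere, the quotient for \<open>n = 1\<close> would be a
  division by zero from there on, hence 0, and could not tend to 1.\<close>

lemma tail_pos: "0 < tail F t"
proof (rule ccontr)
  assume "\<not> ?thesis"
  then have 0: "tail F t = 0" using tail_nonneg[of t] by simp
  have "\<forall>\<^sub>F s in at_top. measure (convolution_power F 1) {s<..} / measure F {s<..} = 0"
    using eventually_ge_at_top[of t]
  proof eventually_elim
    case (elim s)
    have "tail F s = 0" using tail_antimono[OF elim] 0 tail_nonneg[of s] by simp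
    then show ?case by (simp add: tail_def)
  qed
  then have "((\<lambda>s. measure (convolution_power F 1) {s<..} / measure F {s<..}) \<longlongrightarrow> 0) at_top"
    by (simp add: tendsto_eventually)
  moreover have "((\<lambda>s. measure (convolution_power F 1) {s<..} / measure F {s<..}) \<longlongrightarrow> real 1) at_top"
    using subexp unfolding subexponential_def by blast
  ultimately show False using tendsto_unique[OF trivial_limit_at_top_linorder] by fastforce
qed

lemma emeasure_tail: "emeasure F {t<..} = ennreal (tail F t)"
  by (simp add: tail_def emeasure_eq_measure)

lemma tail_interval: "s \<le> t \<Longrightarrow> emeasure F {s<..t} = ennreal (tail F s - tail F t)"
proof -
  assume "s \<le> t"
  have "measure F ({s<..} - {t<..}) = tail F s - tail F t"
    unfolding tail_def by (rule finite_measure_Diff) (use \<open>s \<le> t\<close> in auto)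
  moreover have "{s<..} - {t<..} = {s<..t}" using \<open>s \<le> t\<close> by auto
  ultimately show ?thesis by (simp add: emeasure_eq_measure)
qed

lemma tail_atMost: "emeasure F {..t} = ennreal (1 - tail F t)"
proof -
  have "measure F (space F - {t<..}) = 1 - tail F t"
    unfolding tail_def by (rule prob_compl) auto
  moreover have "space F - {t<..} = {..t}" by auto
  ultimately show ?thesis by (simp add: emeasure_eq_measure)
qed

text \<open>Two independent summands exceed \<open>t\<close> in total if the first does so alone, as
  the second is nonnegative, or if the first is at most \<open>t\<close> and the second makes up the
  difference.\<close>

lemma convolution_power_2:
  assumes t: "t \<ge> 0"
  shows "emeasure (convolution_power F 2) {t<..} = ennreal (tail F t) + conv F (tail F) t"
proof -
  have p1: "prob_space (return borel (0::real))" by (rule prob_space_return) simp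
  have s1: "sets (convolution F (return borel 0)) = sets borel" by simp
  have f1: "finite_measure (convolution F (return borel 0))"
    by (rule convolution_finite) (use p1 in \<open>auto intro: finite_measure_axioms prob_space.finite_measure\<close>)
  have fin: "finite_measure (return borel (0::real))" using p1 by (rule prob_space.finite_measure)
  have eq: "convolution_power F 2 = convolution F (convolution F (return borel 0))"
    by (simp add: numeral_2_eq_2)
  have "emeasure (convolution_power F 2) {t<..} = (\<integral>\<^sup>+x. indicator {t<..} x \<partial>convolution F (convolution F (return borel 0)))"
    unfolding eq by (subst nn_integral_indicator) auto
  also have "\<dots> = (\<integral>\<^sup>+x. \<integral>\<^sup>+y. indicator {t<..} (x + y) \<partial>convolution F (return borel 0) \<partial>F)"
    by (rule nn_integral_convolution) (use f1 finite_measure_axioms in auto)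
  also have "\<dots> = (\<integral>\<^sup>+x. \<integral>\<^sup>+y. indicator {t<..} (x + y) \<partial>F \<partial>F)"
  proof (rule nn_integral_cong)
    fix x
    have "(\<integral>\<^sup>+y. indicator {t<..} (x + y) \<partial>convolution F (return borel 0))
      = (\<integral>\<^sup>+y. \<integral>\<^sup>+z. indicator {t<..} (x + (y + z)) \<partial>return borel 0 \<partial>F)"
      by (rule nn_integral_convolution) (use fin finite_measure_axioms in auto)
    also have "\<dots> = (\<integral>\<^sup>+y. indicator {t<..} (x + y) \<partial>F)"
      by (intro nn_integral_cong) (subst nn_integral_return, auto)
    finally show "(\<integral>\<^sup>+y. indicator {t<..} (x + y) \<partial>convolution F (return borel 0)) = (\<integral>\<^sup>+y. indicator {t<..} (x + y) \<partial>F)" .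
  qed
  also have "\<dots> = (\<integral>\<^sup>+x. ennreal (tail F (t - x)) \<partial>F)"
  proof (rule nn_integral_cong)
    fix x
    have "(\<integral>\<^sup>+y. indicator {t<..} (x + y) \<partial>F) = (\<integral>\<^sup>+y. indicator {t - x<..} y \<partial>F)"
      by (intro nn_integral_cong) (auto split: split_indicator)
    then show "(\<integral>\<^sup>+y. indicator {t<..} (x + y) \<partial>F) = ennreal (tail F (t - x))" by (simp add: emeasure_tail)
  qed
  also have "\<dots> = (\<integral>\<^sup>+x. indicator {t<..} x + ennreal (tail F (t - x)) * indicator {..t} x \<partial>F)"
    by (intro nn_integral_cong) (auto simp: tail_neg split: split_indicator)
  also have "\<dots> = ennreal (tail F t) + conv F (tail F) t"
    unfolding conv_def by (subst nn_integral_add) (auto simp: emeasure_tail)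
  finally show ?thesis .
qed

lemma conv_le_1:
  assumes "\<And>t. psi t \<le> 1"
  shows "conv F psi t \<le> 1"
proof -
  have "conv F psi t \<le> (\<integral>\<^sup>+y. 1 \<partial>F)"
    unfolding conv_def using assms by (intro nn_integral_mono) (auto split: split_indicator)
  then show ?thesis by (simp add: emeasure_space_1[simplified])
qed

lemma conv_tail_ratio: "((\<lambda>t. enn2real (conv F (tail F) t) / tail F t) \<longlongrightarrow> 1) at_top"
proof -
  have "((\<lambda>t. measure (convolution_power F 2) {t<..} / tail F t) \<longlongrightarrow> real 2) at_top"
    using subexp unfolding subexponential_def tail_def by blast
  then have "((\<lambda>t. measure (convolution_power F 2) {t<..} / tail F t - 1) \<longlongrightarrow> real 2 - 1) at_top"
    by (intro tendsto_intros)
  moreover have "\<forall>\<^sub>F t in at_top. measure (convolution_power F 2) {t<..} / tail F t - 1 = enn2real (conv F (tail F) t) / tail F t"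
    using eventually_ge_at_top[of 0]
  proof eventually_elim
    case (elim t)
    have "conv F (tail F) t \<le> 1" by (rule conv_le_1[OF tail_le_1])
    then have fin: "conv F (tail F) t < \<top>" by (rule le_less_trans) simp
    have "measure (convolution_power F 2) {t<..} = tail F t + enn2real (conv F (tail F) t)"
      unfolding measure_def convolution_power_2[OF elim] using fin tail_nonneg[of t]
      by (simp add: enn2real_plus)
    then show ?case using tail_pos[of t] by (simp add: add_divide_distrib)
  qed
  ultimately show ?thesis using Lim_transform_eventually by fastforce
qed

text \<open>Split the first summand at \<open>A\<close>: up to \<open>A\<close> the second must
  cover at most \<open>t\<close>, beyond \<open>A\<close> at most \<open>t - A\<close>. Monotonicity
  of the tail replaces both by constants.\<close>

lemma conv_tail_lower:
  assumes A: "0 \<le> A" "A \<le> t"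
  shows "tail F t * (1 - tail F A) + tail F (t - A) * (tail F A - tail F t) \<le> enn2real (conv F (tail F) t)"
proof -
  have "conv F (tail F) t \<le> 1" by (rule conv_le_1[OF tail_le_1])
  then have fin: "conv F (tail F) t < \<top>" by (rule le_less_trans) simp
  have nn: "0 \<le> 1 - tail F A" "0 \<le> tail F A - tail F t" using tail_le_1[of A] tail_antimono[OF A(2)] by auto
  have "ennreal (tail F t * (1 - tail F A) + tail F (t - A) * (tail F A - tail F t))
     = ennreal (tail F t) * emeasure F {..A} + ennreal (tail F (t - A)) * emeasure F {A<..t}"
    using nn tail_nonneg by (simp add: tail_atMost tail_interval[OF A(2)] ennreal_mult)
  also have "\<dots> = (\<integral>\<^sup>+y. ennreal (tail F t) * indicator {..A} y + ennreal (tail F (t - A)) * indicator {A<..t} y \<partial>F)"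
    by (subst nn_integral_add) (auto simp: nn_integral_cmult_indicator)
  also have "\<dots> \<le> conv F (tail F) t"
    unfolding conv_def
  proof (rule nn_integral_mono_AE)
    show "AE y in F. ennreal (tail F t) * indicator {..A} y + ennreal (tail F (t - A)) * indicator {A<..t} y
        \<le> ennreal (tail F (t - y)) * indicator {..t} y"
      using AE_nonneg
    proof eventually_elim
      case (elim y)
      then show ?case using A tail_antimono[of "t - y" t] tail_antimono[of "t - y" "t - A"]
        by (auto split: split_indicator intro!: ennreal_leI)
    qed
  qed
  finally have "ennreal (tail F t * (1 - tail F A) + tail F (t - A) * (tail F A - tail F t)) \<le> ennreal (enn2real (conv F (tail F) t))"
    using fin by simp
  then show ?thesis by (simp add: ennreal_le_iff)
qed

lemma tail_tendsto_0: "(tail F \<longlongrightarrow> 0) at_top"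
proof (rule decreasing_tendsto)
  show "\<forall>\<^sub>F t in at_top. 0 \<le> tail F t" using tail_nonneg by simp
  fix x :: real assume x: "0 < x"
  have "(\<lambda>n. measure F {real n<..}) \<longlonglongrightarrow> measure F (\<Inter>n. {real n<..})"
    by (rule finite_Lim_measure_decseq) (auto simp: decseq_def)
  moreover have "(\<Inter>n. {real n<..}) = {}"
    using reals_Archimedean2 by (auto dest: less_asym)
  ultimately have "(\<lambda>n. tail F (real n)) \<longlonglongrightarrow> 0" by (simp add: tail_def)
  then have "\<forall>\<^sub>F n in sequentially. tail F (real n) < x" using x by (rule order_tendstoD(2))
  then obtain n where n: "tail F (real n) < x" by (auto simp: eventually_sequentially)
  show "\<forall>\<^sub>F t in at_top. tail F t < x"
    using eventually_ge_at_top[of "real n"] by eventually_elim (use n tail_antimono in \<open>metis le_less_trans\<close>)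
qed

text \<open>Subexponential laws are long-tailed. Solving \<open>conv_tail_lower\<close> for
  \<open>tail F (t - A)\<close> bounds its ratio to \<open>tail F t\<close> by an expression that
  tends to 1, because the convolution is asymptotic to the tail.\<close>

lemma tail_back:
  assumes A: "A \<ge> 0"
  shows "((\<lambda>t. tail F (t - A) / tail F t) \<longlongrightarrow> 1) at_top"
proof (rule tendsto_sandwich)
  show "\<forall>\<^sub>F t in at_top. 1 \<le> tail F (t - A) / tail F t"
    using tail_antimono[of "t - A" t for t] tail_pos A by (intro always_eventually) (simp add: pos_le_divide_eq)
  let ?u = "\<lambda>t. (enn2real (conv F (tail F) t) / tail F t - (1 - tail F A)) / (tail F A - tail F t)"
  have "(?u \<longlongrightarrow> (1 - (1 - tail F A)) / (tail F A - 0)) at_top"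
    using tail_pos[of A] by (intro tendsto_intros conv_tail_ratio tail_tendsto_0) auto
  then show "(?u \<longlongrightarrow> 1) at_top" using tail_pos[of A] by simp
  have "\<forall>\<^sub>F t in at_top. tail F t < tail F A" using tail_tendsto_0 tail_pos[of A] by (rule order_tendstoD(2))
  then show "\<forall>\<^sub>F t in at_top. tail F (t - A) / tail F t \<le> ?u t"
    using eventually_ge_at_top[of A]
  proof eventually_elim
    case (elim t)
    have "(tail F t * (1 - tail F A) + tail F (t - A) * (tail F A - tail F t)) / tail F t \<le> enn2real (conv F (tail F) t) / tail F t"
      using conv_tail_lower[OF A elim(2)] tail_pos[of t] by (intro divide_right_mono) auto
    then have "(1 - tail F A) + tail F (t - A) / tail F t * (tail F A - tail F t) \<le> enn2real (conv F (tail F) t) / tail F t"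
      using tail_pos[of t] by (simp add: add_divide_distrib)
    then show ?case using elim(1) by (simp add: pos_le_divide_eq)
  qed
qed simp

text \<open>As long as \<open>t - y >= A\<close>, the bound on \<open>psi\<close> applies and gives
  a multiple of the convolution of the tail. The remaining \<open>y\<close> have mass
  \<open>tail F (t - A) - tail F t\<close>, negligible by the long tail, and there
  \<open>psi <= 1\<close> suffices.\<close>

lemma conv_asymp_le:
  assumes psi: "\<And>t. 0 \<le> psi t" "\<And>t. psi t \<le> 1" and m: "psi \<in> borel_measurable borel" and d: "asymp_le psi l (tail F)" and l: "l \<ge> 0"
  shows "asymp_le (\<lambda>t. enn2real (conv F psi t)) l (tail F)"
  unfolding asymp_le_def
proof (intro allI impI)
  fix e :: real assume e: "e > 0"
  obtain A0 where A0: "\<And>t. t \<ge> A0 \<Longrightarrow> psi t \<le> (l + e/4) * tail F t"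
    using d e unfolding asymp_le_def eventually_at_top_linorder by (meson divide_pos_pos zero_less_numeral)
  define A where "A = max 0 A0"
  have A: "A \<ge> 0" "\<And>t. t \<ge> A \<Longrightarrow> psi t \<le> (l + e/4) * tail F t" using A0 by (auto simp: A_def)
  have bound: "enn2real (conv F psi t) \<le> (l + e/4) * enn2real (conv F (tail F) t) + (tail F (t - A) - tail F t)" for t
  proof -
    have "conv F (tail F) t \<le> 1" by (rule conv_le_1[OF tail_le_1])
    then have fin: "conv F (tail F) t < \<top>" by (rule le_less_trans) simp
    have nn: "0 \<le> tail F (t - A) - tail F t" using tail_antimono[of "t - A" t] A by simp
    have "conv F psi t \<le> (\<integral>\<^sup>+y. ennreal (l + e/4) * (ennreal (tail F (t - y)) * indicator {..t} y) + indicator {t - A<..t} y \<partial>F)"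
      unfolding conv_def
    proof (rule nn_integral_mono)
      fix y
      show "ennreal (psi (t - y)) * indicator {..t} y \<le>
        ennreal (l + e/4) * (ennreal (tail F (t - y)) * indicator {..t} y) + indicator {t - A<..t} y"
      proof (cases "y \<le> t - A")
        case True
        then have "psi (t - y) \<le> (l + e/4) * tail F (t - y)" by (intro A(2)) simp
        then have "ennreal (psi (t - y)) \<le> ennreal (l + e/4) * ennreal (tail F (t - y))"
          using l e tail_nonneg ennreal_mult[of "l + e/4" "tail F (t - y)"] ennreal_leI[of "psi (t - y)"] by force
        then show ?thesis using True by (auto split: split_indicator)
      next
        case False
        then show ?thesis using psi(2)[of "t - y"] by (auto split: split_indicator intro!: add_increasing)
      qed
    qed
    also have "\<dots> = ennreal (l + e/4) * conv F (tail F) t + emeasure F {t - A<..t}"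
      unfolding conv_def by (subst nn_integral_add) (auto simp: nn_integral_cmult)
    also have "\<dots> = ennreal ((l + e/4) * enn2real (conv F (tail F) t) + (tail F (t - A) - tail F t))"
      using fin nn l e A by (simp add: tail_interval ennreal_mult ennreal_plus)
    finally show ?thesis using nn l e by (intro enn2real_leI) auto
  qed
  have "((\<lambda>t. (l + e/4) * (enn2real (conv F (tail F) t) / tail F t) + (tail F (t - A) / tail F t - 1)) \<longlongrightarrow> (l + e/4) * 1 + (1 - 1)) at_top"
    by (intro tendsto_intros conv_tail_ratio tail_back A)
  then have "\<forall>\<^sub>F t in at_top. (l + e/4) * (enn2real (conv F (tail F) t) / tail F t) + (tail F (t - A) / tail F t - 1) < l + e"
    by (rule order_tendstoD(2)) (use e in simp)
  then show "\<forall>\<^sub>F t in at_top. enn2real (conv F psi t) \<le> (l + e) * tail F t"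
  proof eventually_elim
    case (elim t)
    have "((l + e/4) * (enn2real (conv F (tail F) t) / tail F t) + (tail F (t - A) / tail F t - 1)) * tail F t
       = (l + e/4) * enn2real (conv F (tail F) t) + (tail F (t - A) - tail F t)"
      using tail_pos[of t] by (simp add: field_simps)
    moreover have "((l + e/4) * (enn2real (conv F (tail F) t) / tail F t) + (tail F (t - A) / tail F t - 1)) * tail F t \<le> (l + e) * tail F t"
      using elim tail_pos[of t] by (intro mult_right_mono) auto
    ultimately show ?case using bound[of t] by linarith
  qed
qed

lemma conv_lower:
  assumes psi: "\<And>s. psi s \<le> 1" "0 \<le> psi t" and mono: "\<And>s. s \<le> t \<Longrightarrow> psi t \<le> psi s"
  shows "psi t * (1 - tail F t) \<le> enn2real (conv F psi t)"
proof -
  have "conv F psi t \<le> 1" by (rule conv_le_1[OF psi(1)])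
  then have fin: "conv F psi t < \<top>" by (rule le_less_trans) simp
  have "ennreal (psi t * (1 - tail F t)) = (\<integral>\<^sup>+y. ennreal (psi t) * indicator {..t} y \<partial>F)"
    using tail_le_1[of t] psi(2) by (simp add: nn_integral_cmult_indicator tail_atMost ennreal_mult)
  also have "\<dots> \<le> conv F psi t"
    unfolding conv_def
  proof (rule nn_integral_mono_AE)
    show "AE y in F. ennreal (psi t) * indicator {..t} y \<le> ennreal (psi (t - y)) * indicator {..t} y"
      using AE_nonneg by eventually_elim (auto intro!: ennreal_leI mono split: split_indicator)
  qed
  finally have "ennreal (psi t * (1 - tail F t)) \<le> ennreal (enn2real (conv F psi t))" using fin by simp
  then show ?thesis by (simp add: ennreal_le_iff)
qed

text \<open>The comparison is required on \<open>[0, t]\<close> only, since the law lives on the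
  nonnegative reals. This locality in time makes induction over time possible.\<close>

lemma conv_mono_scaled:
  assumes M: "M \<ge> 0" and le: "\<And>r. 0 \<le> r \<Longrightarrow> r \<le> t \<Longrightarrow> psi r \<le> M * phi r" and phi: "\<And>r. 0 \<le> phi r" "\<And>r. phi r \<le> 1"
    and m: "phi \<in> borel_measurable borel"
  shows "enn2real (conv F psi t) \<le> M * enn2real (conv F phi t)"
proof -
  have "conv F phi t \<le> 1" by (rule conv_le_1[OF phi(2)])
  then have fin: "conv F phi t < \<top>" by (rule le_less_trans) simp
  have "conv F psi t \<le> (\<integral>\<^sup>+y. ennreal M * (ennreal (phi (t - y)) * indicator {..t} y) \<partial>F)"
    unfolding conv_def
  proof (rule nn_integral_mono_AE)
    show "AE y in F. ennreal (psi (t - y)) * indicator {..t} y \<le> ennreal M * (ennreal (phi (t - y)) * indicator {..t} y)"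
      using AE_nonneg
    proof eventually_elim
      case (elim y)
      then show ?case using le[of "t - y"] M phi(1)
        by (auto split: split_indicator simp: ennreal_mult[symmetric] intro!: ennreal_leI)
    qed
  qed
  also have "\<dots> = ennreal M * conv F phi t"
    unfolding conv_def by (rule nn_integral_cmult) (use m in measurable)
  also have "\<dots> = ennreal (M * enn2real (conv F phi t))"
    using fin M by (simp add: ennreal_mult)
  finally show ?thesis using M by (intro enn2real_leI) auto
qed

end

section \<open>Decomposition of paths at the first visit to 0 and at the exit from 0\<close>

lemma hit0_eq:
  assumes w: "w \<in> paths S"
  shows "hit0 w = (if hits {0} w then ereal (entry {0} w) else \<infinity>)"
proof (cases "hits {0} w")
  case True
  have "hit0 w = ereal (entry {0} w)"
    unfolding hit0_def
  proof (rule antisym)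
    show "Inf (ereal ` {t. 0 \<le> t \<and> w t = 0}) \<le> ereal (entry {0} w)"
      using entry_in[OF w True] entry_nonneg[OF w True] by (intro Inf_lower) auto
    show "ereal (entry {0} w) \<le> Inf (ereal ` {t. 0 \<le> t \<and> w t = 0})"
      using entry_le[OF w True] by (intro Inf_greatest) auto
  qed
  then show ?thesis using True by simp
next
  case False
  then have "{t. 0 \<le> t \<and> w t = 0} = {}" by (auto simp: hits_def)
  then have "hit0 w = Inf (ereal ` {})" by (simp only: hit0_def)
  then show ?thesis using False by (simp add: top_ereal_def)
qed

lemma less_hit0_iff:
  assumes w: "w \<in> paths S"
  shows "ereal t < hit0 w \<longleftrightarrow> (hits {0} w \<longrightarrow> t < entry {0} w)"
  using hit0_eq[OF w] by simp

text \<open>The hitting time itself is included: a positive age there would require the path to be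
  at 0 strictly earlier.\<close>

lemma age_before_hit:
  assumes w: "w \<in> paths S" and r: "0 \<le> r" "hits {0} w \<Longrightarrow> r \<le> entry {0} w"
  shows "age 0 r w = 0"
proof (cases "w r = 0")
  case False
  then show ?thesis by (rule age_nonzero)
next
  case True
  then have h: "hits {0} w" using r by (auto simp: hits_def)
  have "entry {0} w \<le> r" by (rule entry_le[OF w h r(1)]) (use True in simp)
  then have re: "r = entry {0} w" using r(2)[OF h] by simp
  have nb: "w s \<noteq> 0" if "0 \<le> s" "s < r" for s
    using before_entry[OF w that(1), of "{0}"] that(2) re by auto
  show ?thesis
  proof (rule nonneg_eqI)
    fix a :: real assume a: "a > 0"
    have "\<not> a \<le> age 0 r w"
      unfolding age_ge_iff[OF w r(1) order_refl a]
    proof (rule notI, elim disjE conjE)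
      assume z: "zero_on w 0 r" and "a \<le> 0 + r"
      then show False using zero_onD[OF z, of 0] nb[of 0] a r by auto
    next
      assume z: "zero_on w (r - a) r" and "a \<le> r"
      then show False using zero_onD[OF z, of "r - a"] nb[of "r - a"] a by auto
    qed
    then show "a \<le> age 0 r w \<longleftrightarrow> a \<le> 0" using a by simp
  qed (use age_nonneg[OF w r(1), of 0] in auto)
qed

lemma tau_after_hit:
  assumes w: "w \<in> paths S" and h: "hits {0} w" and t: "entry {0} w \<le> t"
  shows "ereal t < tau 0 w \<longleftrightarrow> ereal (t - entry {0} w) < tau 0 (shift_entry {0} w)"
proof -
  let ?e = "entry {0} w"
  have e: "0 \<le> ?e" by (rule entry_nonneg[OF w h])
  have "ereal ?e < tau 0 w"
    unfolding less_tau_iff[OF w e]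
  proof
    fix r assume "r \<in> {0..?e}"
    then show "age 0 r w < 1" using age_before_hit[OF w, of r] by simp
  qed
  then show ?thesis
    using tau_flow[OF w e, of "t - ?e" 0] t e age_before_hit[OF w e] by (simp add: shift_entry_def max_absorb2)
qed

lemma tau_before_hit:
  assumes w: "w \<in> paths S" and t: "0 \<le> t" "hits {0} w \<Longrightarrow> t < entry {0} w"
  shows "ereal t < tau 0 w"
  unfolding less_tau_iff[OF w t(1)]
proof
  fix r assume "r \<in> {0..t}"
  then show "age 0 r w < 1" using age_before_hit[OF w, of r] t by fastforce
qed

lemma age_at_exit:
  assumes w: "w \<in> paths S" and h: "hits away w"
  shows "age u (entry away w) w = 0"
  using entry_in[OF w h] by (intro age_nonzero) simp

lemma tau_after_exit:
  assumes w: "w \<in> paths S" and h: "hits away w" and e1: "u + entry away w \<le> 1" and t: "entry away w \<le> t"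
  shows "ereal t < tau u w \<longleftrightarrow> ereal (t - entry away w) < tau 0 (shift_entry away w)"
proof -
  let ?e = "entry away w"
  have e: "0 \<le> ?e" by (rule entry_nonneg[OF w h])
  have "ereal ?e < tau u w"
    unfolding less_tau_iff[OF w e]
  proof
    fix r assume r: "r \<in> {0..?e}"
    show "age u r w < 1"
    proof (cases "r = ?e")
      case True
      then show ?thesis using age_at_exit[OF w h, of u] by simp
    next
      case False
      then have "zero_on w 0 r" using zero_on_entry[OF w, of r] r h by auto
      then show ?thesis using age_zero_on[of r w u] r e1 False by auto
    qed
  qed
  then show ?thesis
    using tau_flow[OF w e, of "t - ?e" u] t e age_at_exit[OF w h, of u] by (simp add: shift_entry_def max_absorb2)
qed

context chain
begin

lemma hit0_sets: "{w \<in> paths S. ereal t < hit0 w} \<in> sets \<Omega>"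
proof -
  have "Measurable.pred \<Omega> (\<lambda>w. hits {0} w \<longrightarrow> t < entry {0} w)" by measurable
  then have "{w \<in> paths S. hits {0} w \<longrightarrow> t < entry {0} w} \<in> sets \<Omega>"
    unfolding pred_def space_skorokhod .
  moreover have "{w \<in> paths S. hits {0} w \<longrightarrow> t < entry {0} w} = {w \<in> paths S. ereal t < hit0 w}"
    using less_hit0_iff by blast
  ultimately show ?thesis by simp
qed

definition hit_law :: "nat \<Rightarrow> real measure" where "hit_law i = distr (P i) borel (entry {0})"

lemma hit0_law_eq: "i \<in> S \<Longrightarrow> hit0_law P i = hit_law i"
  unfolding hit0_law_def hit_law_def
proof (rule distr_cong_AE)
  assume i: "i \<in> S"
  show "AE w in P i. real_of_ereal (hit0 w) = entry {0} w"
    using AE_hits_0[OF i] AE_space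
  proof eventually_elim
    case (elim w)
    then show ?case using hit0_eq[of w S] i by simp
  qed
  have "(\<lambda>w. if hits {0} w then entry {0} w else 0) \<in> borel_measurable \<Omega>" by measurable
  then show "(\<lambda>w. real_of_ereal (hit0 w)) \<in> borel_measurable (P i)"
    unfolding measurable_P[OF i]
    by (rule measurable_cong[THEN iffD1, rotated]) (simp add: hit0_eq)
qed (auto simp: measurable_P)

lemma hit0_tail_eq:
  assumes i: "i \<in> S"
  shows "hit0_tail P i t = tail (hit_law i) t"
proof -
  have "tail (hit_law i) t = measure (P i) (entry {0} -` {t<..} \<inter> paths S)"
    unfolding tail_def hit_law_def using i by (subst measure_distr) auto
  also have "\<dots> = measure (P i) {w \<in> paths S. ereal t < hit0 w}"
  proof (rule measure_eq_AE)
    show "AE w in P i. w \<in> entry {0} -` {t<..} \<inter> paths S \<longleftrightarrow> w \<in> {w \<in> paths S. ereal t < hit0 w}"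
      using AE_hits_0[OF i] by eventually_elim (use less_hit0_iff in auto)
    show "entry {0} -` {t<..} \<inter> paths S \<in> sets (P i)"
      using measurable_sets[OF measurable_entry[of "{0}" S], of "{t<..}"] i by simp
    show "{w \<in> paths S. ereal t < hit0 w} \<in> sets (P i)" unfolding sets_P[OF i] by (rule hit0_sets)
  qed
  finally show ?thesis using i by (simp add: hit0_tail_def)
qed

lemma hit_state: "w \<in> paths S \<Longrightarrow> hits {0} w \<Longrightarrow> w (max 0 (entry {0} w)) = 0"
  using entry_in[of w S "{0}"] entry_nonneg[of w S "{0}"] by (simp add: max_absorb2)

text \<open>Decomposition at the hitting time of 0: afterwards the path is a fresh copy started at 0.\<close>

lemma hit_decomposition:
  assumes i: "i \<in> S" and Phi: "Phi \<in> borel_measurable (borel \<Otimes>\<^sub>M \<Omega>)"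
  shows "(\<integral>\<^sup>+w\<in>{w. hits {0} w}. Phi (entry {0} w, shift_entry {0} w) \<partial>P i) = (\<integral>\<^sup>+y. (\<integral>\<^sup>+v. Phi (y, v) \<partial>P 0) \<partial>hit_law i)"
proof -
  interpret P0: prob_space "P 0" by (rule prob_space_P) simp
  let ?F = "{w \<in> paths S. hits {0} w \<and> w (max 0 (entry {0} w)) = 0}"
  have F: "w \<in> ?F \<longleftrightarrow> hits {0} w" if "w \<in> space (P i)" for w using that hit_state i by auto
  have "(\<integral>\<^sup>+w\<in>{w. hits {0} w}. Phi (entry {0} w, shift_entry {0} w) \<partial>P i) = (\<integral>\<^sup>+w\<in>?F. Phi (entry {0} w, shift_entry {0} w) \<partial>P i)"
    by (intro nn_integral_cong) (use F in \<open>auto simp: indicator_def\<close>)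
  also have "\<dots> = (\<integral>\<^sup>+w\<in>?F. (\<integral>\<^sup>+v. Phi (entry {0} w, v) \<partial>P 0) \<partial>P i)"
    by (rule strong_markov[OF i S_0 Phi])
  also have "\<dots> = (\<integral>\<^sup>+w. (\<integral>\<^sup>+v. Phi (entry {0} w, v) \<partial>P 0) \<partial>P i)"
  proof (rule nn_integral_cong_AE)
    show "AE w in P i. (\<integral>\<^sup>+v. Phi (entry {0} w, v) \<partial>P 0) * indicator ?F w = (\<integral>\<^sup>+v. Phi (entry {0} w, v) \<partial>P 0)"
      using AE_hits_0[OF i] AE_space
    proof eventually_elim
      case (elim w)
      then have "w \<in> ?F" using F by blast
      then show ?case by simp
    qed
  qed
  also have "\<dots> = (\<integral>\<^sup>+y. (\<integral>\<^sup>+v. Phi (y, v) \<partial>P 0) \<partial>hit_law i)"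
    unfolding hit_law_def
  proof (rule nn_integral_distr[symmetric])
    show "entry {0} \<in> P i \<rightarrow>\<^sub>M borel" using i by simp
    have "Phi \<in> borel_measurable (borel \<Otimes>\<^sub>M P 0)" using Phi by (simp cong: measurable_cong_sets sets_pair_measure_cong)
    then show "(\<lambda>y. \<integral>\<^sup>+v. Phi (y, v) \<partial>P 0) \<in> borel_measurable (distr (P i) borel (entry {0}))"
      by (intro P0.borel_measurable_nn_integral) simp
  qed
  finally show ?thesis .
qed

text \<open>Before the first visit to 0 there is no killing, and at that visit the process is in
  \<open>(0, 0)\<close> and starts afresh. Survival thus means no visit by time \<open>t\<close>, or
  a visit at \<open>y <= t\<close> and survival of the fresh copy for \<open>t - y\<close>.\<close>

lemma sv_hit:
  assumes i: "i \<in> S" and t: "0 \<le> t"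
  shows "ennreal (sv (i, 0) t) = ennreal (hit0_tail P i t) + conv (hit_law i) (sv (0, 0)) t"
proof -
  interpret Pi: prob_space "P i" by (rule prob_space_P[OF i])
  interpret P0: prob_space "P 0" by (rule prob_space_P) simp
  let ?A = "{w \<in> paths S. ereal t < hit0 w}" and ?T = "{w \<in> paths S. ereal t < tau 0 w}"
  let ?Phi = "\<lambda>(y, v). indicator {..t} y * (if ereal (t - y) < tau 0 v then 1 else 0) :: ennreal"
  have m: "?Phi \<in> borel_measurable (borel \<Otimes>\<^sub>M \<Omega>)" by measurable
  have "emeasure (P i) ?T = (\<integral>\<^sup>+w. indicator ?T w \<partial>P i)"
    using tau_sets i by (intro nn_integral_indicator[symmetric]) simp
  also have "\<dots> = (\<integral>\<^sup>+w. indicator ?A w + ?Phi (entry {0} w, shift_entry {0} w) * indicator {w. hits {0} w} w \<partial>P i)"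
  proof (rule nn_integral_cong)
    fix w assume "w \<in> space (P i)"
    then have w: "w \<in> paths S" using i by simp
    show "indicator ?T w = indicator ?A w + ?Phi (entry {0} w, shift_entry {0} w) * indicator {w. hits {0} w} w"
    proof (cases "hits {0} w \<and> entry {0} w \<le> t")
      case True
      then show ?thesis using w tau_after_hit[OF w, of t] less_hit0_iff[OF w, of t] by (simp add: indicator_def)
    next
      case False
      then have b: "hits {0} w \<Longrightarrow> t < entry {0} w" by auto
      then show ?thesis using w tau_before_hit[OF w t b] less_hit0_iff[OF w, of t] by (auto simp: indicator_def)
    qed
  qed
  also have "\<dots> = emeasure (P i) ?A + (\<integral>\<^sup>+w\<in>{w. hits {0} w}. ?Phi (entry {0} w, shift_entry {0} w) \<partial>P i)"
  proof (subst nn_integral_add)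
    have A: "?A \<in> sets (P i)" unfolding sets_P[OF i] by (rule hit0_sets)
    then show "indicator ?A \<in> borel_measurable (P i)" by (rule borel_measurable_indicator)
    have h: "{w \<in> space \<Omega>. hits {0} w} \<in> sets \<Omega>" using pred_hits[of "{0}" S] unfolding pred_def .
    have "(\<lambda>w. (entry {0} w, shift_entry {0} w)) \<in> \<Omega> \<rightarrow>\<^sub>M borel \<Otimes>\<^sub>M \<Omega>" by measurable
    from measurable_compose[OF this m]
    have "(\<lambda>w. ?Phi (entry {0} w, shift_entry {0} w) * indicator {w \<in> space \<Omega>. hits {0} w} w) \<in> borel_measurable \<Omega>"
      by (intro borel_measurable_times_ennreal borel_measurable_indicator h)
    then show "(\<lambda>w. ?Phi (entry {0} w, shift_entry {0} w) * indicator {w. hits {0} w} w) \<in> borel_measurable (P i)"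
      unfolding measurable_P[OF i] by (rule measurable_cong[THEN iffD1, rotated]) (simp add: indicator_def)
  qed (use hit0_sets i in \<open>simp add: nn_integral_indicator\<close>)
  also have "(\<integral>\<^sup>+w\<in>{w. hits {0} w}. ?Phi (entry {0} w, shift_entry {0} w) \<partial>P i) = (\<integral>\<^sup>+y. (\<integral>\<^sup>+v. ?Phi (y, v) \<partial>P 0) \<partial>hit_law i)"
    by (rule hit_decomposition[OF i m])
  also have "\<dots> = conv (hit_law i) (sv (0, 0)) t"
    unfolding conv_def
  proof (rule nn_integral_cong)
    fix y
    have "(\<integral>\<^sup>+v. ?Phi (y, v) \<partial>P 0) = (\<integral>\<^sup>+v. indicator {..t} y * indicator {w \<in> paths S. ereal (t - y) < tau 0 w} v \<partial>P 0)"
      by (intro nn_integral_cong) (simp add: indicator_def)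
    also have "\<dots> = indicator {..t} y * emeasure (P 0) {w \<in> paths S. ereal (t - y) < tau 0 w}"
      by (rule nn_integral_cmult_indicator) (simp add: tau_sets)
    finally show "(\<integral>\<^sup>+v. ?Phi (y, v) \<partial>P 0) = ennreal (sv (0, 0) (t - y)) * indicator {..t} y"
      by (simp add: sv_eq P0.emeasure_eq_measure mult.commute)
  qed
  finally show ?thesis using i by (simp add: sv_eq Pi.emeasure_eq_measure hit0_tail_def)
qed

lemma sv_00_measurable: "sv (0, 0) \<in> borel_measurable borel"
proof -
  have "mono (\<lambda>t. - sv (0, 0) t)" by (intro monoI) (simp add: sv_antimono)
  then have "(\<lambda>t. - sv (0, 0) t) \<in> borel_measurable borel" by (rule borel_measurable_mono)
  then have "(\<lambda>t. - (- sv (0, 0) t)) \<in> borel_measurable borel" by (rule borel_measurable_uminus)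
  then show ?thesis by simp
qed

text \<open>The exit happens within one unit of time, so the time that remains lies between
  \<open>t - 1\<close> and \<open>t\<close>. Replacing it by these endpoints separates the exit from
  the later path; a long tail will not notice the difference.\<close>

lemma exit_bounds:
  assumes j: "j \<in> S" and t: "t \<ge> 1"
  shows "measure (P 0) {w \<in> paths S. w (max 0 (entry away w)) = j \<and> hits away w \<and> entry away w \<in> {..1} \<and> ereal t < tau 0 w}
      \<le> (1 - exp (- q0)) * exit_prob j * sv (j, 0) (t - 1)"
    and "(1 - exp (- q0)) * exit_prob j * sv (j, 0) t \<le>
     measure (P 0) {w \<in> paths S. w (max 0 (entry away w)) = j \<and> hits away w \<and> entry away w \<in> {..1} \<and> ereal t < tau 0 w}"
    and "{w \<in> paths S. w (max 0 (entry away w)) = j \<and> hits away w \<and> entry away w \<in> {..1} \<and> ereal t < tau 0 w} \<in> sets \<Omega>"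
proof -
  let ?X = "{w \<in> paths S. w (max 0 (entry away w)) = j \<and> hits away w \<and> entry away w \<in> {..1} \<and> ereal t < tau 0 w}"
  let ?B = "\<lambda>t. {w \<in> paths S. ereal t < tau 0 w}"
  let ?Y = "\<lambda>t. {w \<in> paths S. hits away w \<and> w (max 0 (entry away w)) = j \<and> entry away w \<in> {..1} \<and> shift_entry away w \<in> ?B t}"
  have Y: "measure (P 0) (?Y t) = (1 - exp (- q0)) * exit_prob j * sv (j, 0) t" for t
    using strong_markov_measure[OF S_0 j _ tau_sets, of "{..1}" away t 0] exit_before[of 1 j] sv_eq[of "(j, 0)" t] j by simp
  have e1: "{w \<in> paths S. hits away w \<and> w (max 0 (entry away w)) = j} \<inter> (entry away -` {..1} \<inter> space \<Omega>) \<in> sets \<Omega>"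
    by (intro sets.Int pred_entry_state measurable_sets[OF measurable_entry]) simp
  from sets.Int[OF this tau_sets[of t 0]]
  have "{w \<in> paths S. hits away w \<and> w (max 0 (entry away w)) = j} \<inter> (entry away -` {..1} \<inter> space \<Omega>) \<inter> ?B t \<in> sets \<Omega>" .
  moreover have "{w \<in> paths S. hits away w \<and> w (max 0 (entry away w)) = j} \<inter> (entry away -` {..1} \<inter> space \<Omega>) \<inter> ?B t = ?X"
    unfolding space_skorokhod by blast
  ultimately show X: "?X \<in> sets \<Omega>" by metis
  have Ym: "?Y s \<in> sets \<Omega>" for s
  proof -
    have "{w \<in> paths S. hits away w \<and> w (max 0 (entry away w)) = j} \<inter> (entry away -` {..1} \<inter> space \<Omega>) \<inter>
      (shift_entry away -` ?B s \<inter> space \<Omega>) \<in> sets \<Omega>"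
      by (intro sets.Int[OF e1] measurable_sets[OF measurable_shift_entry] tau_sets)
    moreover have "{w \<in> paths S. hits away w \<and> w (max 0 (entry away w)) = j} \<inter> (entry away -` {..1} \<inter> space \<Omega>) \<inter>
      (shift_entry away -` ?B s \<inter> space \<Omega>) = ?Y s" unfolding space_skorokhod by blast
    ultimately show ?thesis by metis
  qed
  have key: "ereal t < tau 0 w \<longleftrightarrow> ereal (t - entry away w) < tau 0 (shift_entry away w)"
    and e0: "0 \<le> entry away w" and sw: "shift_entry away w \<in> paths S"
    if "w \<in> paths S" "hits away w" "entry away w \<in> {..1}" for w
    using tau_after_exit[OF that(1,2), of 0 t] that(3) t entry_nonneg[OF that(1,2)] 
      shift_cadlag[OF that(1), of "max 0 (entry away w)"] by (auto simp: shift_entry_def)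
  have "?X \<subseteq> ?Y (t - 1)"
  proof (rule subsetI)
    fix w assume x: "w \<in> ?X"
    then have *: "w \<in> paths S" "hits away w" "entry away w \<in> {..1}" by blast+
    have "ereal (t - entry away w) < tau 0 (shift_entry away w)" using key[OF *] x by blast
    then have "ereal (t - 1) < tau 0 (shift_entry away w)" by (rule less_tau_mono) (use * in simp)
    then show "w \<in> ?Y (t - 1)" using x sw[OF *] by blast
  qed
  then show "measure (P 0) ?X \<le> (1 - exp (- q0)) * exit_prob j * sv (j, 0) (t - 1)"
    unfolding Y[symmetric] by (rule measure_P_mono[OF S_0 _ Ym])
  have "?Y t \<subseteq> ?X"
  proof (rule subsetI)
    fix w assume x: "w \<in> ?Y t"
    then have *: "w \<in> paths S" "hits away w" "entry away w \<in> {..1}" by blast+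
    have "ereal t < tau 0 (shift_entry away w)" using x by blast
    then have "ereal (t - entry away w) < tau 0 (shift_entry away w)" by (rule less_tau_mono) (use e0[OF *] in simp)
    then show "w \<in> ?X" using x key[OF *] by blast
  qed
  then show "(1 - exp (- q0)) * exit_prob j * sv (j, 0) t \<le> measure (P 0) ?X"
    unfolding Y[symmetric] by (rule measure_P_mono[OF S_0 _ X])
qed

end

section \<open>Survival from 0 when only finitely many states are entered from 0\<close>

locale finite_exit_chain = chain +
  fixes n_exit :: nat
  assumes finite_exit: "\<And>i. i \<in> S \<Longrightarrow> i > n_exit \<Longrightarrow> q 0 i = 0"
begin

definition J :: "nat set" where "J = {..n_exit} \<inter> (S - {0})"

lemma J: "finite J" "J \<subseteq> S - {0}" by (auto simp: J_def)

lemma exit_prob_outside_J: "j \<notin> J \<Longrightarrow> exit_prob j = 0"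
  using exit_prob_outside[of j] exit_prob_eq[of j] finite_exit[of j]
  by (cases "j \<in> S \<and> j \<noteq> 0") (auto simp: J_def not_le)

lemma exit_prob_sum_J: "(\<Sum>j\<in>J. exit_prob j) = 1"
proof -
  have "(\<Sum>j\<le>m. exit_prob j) = (\<Sum>j\<in>J. exit_prob j)" if "m \<ge> n_exit" for m
    using that J exit_prob_outside_J by (intro sum.mono_neutral_right) (auto simp: J_def)
  then have "\<forall>\<^sub>F m in sequentially. (\<Sum>j\<le>m. exit_prob j) = (\<Sum>j\<in>J. exit_prob j)"
    by (auto simp: eventually_sequentially)
  then have "(\<lambda>m. \<Sum>j\<le>m. exit_prob j) \<longlonglongrightarrow> (\<Sum>j\<in>J. exit_prob j)" by (rule tendsto_eventually)
  then show ?thesis using exit_prob_sum by (rule LIMSEQ_unique)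
qed

lemma exit_in_J_AE: "AE w in P 0. hits away w \<and> w (max 0 (entry away w)) \<in> J"
proof -
  interpret prob_space "P 0" by (rule prob_space_P) simp
  let ?X = "\<lambda>j. {w \<in> paths S. hits away w \<and> w (max 0 (entry away w)) = j}"
  have U: "(\<Union>j\<in>J. ?X j) \<in> events"
    unfolding sets_P[OF S_0] by (intro sets.finite_UN pred_entry_state J)
  have "prob (\<Union>j\<in>J. ?X j) = (\<Sum>j\<in>J. prob (?X j))"
  proof (rule finite_measure_finite_Union)
    show "disjoint_family_on ?X J" unfolding disjoint_family_on_def by blast
    show "?X ` J \<subseteq> events" unfolding sets_P[OF S_0] using pred_entry_state[of away] by blast
  qed (rule J)
  then have "prob (\<Union>j\<in>J. ?X j) = 1" unfolding exit_prob_def[symmetric] exit_prob_sum_J .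
  from AE_prob_1[OF this] show ?thesis by eventually_elim blast
qed

text \<open>Resting at 0 for one unit of time is fatal, so survival past \<open>t >= 1\<close>
  forces an exit by time 1, almost surely into \<open>J\<close>. The sum of
  \<open>exit_bounds\<close> over the exit states is finite.\<close>

lemma sv_00_bounds:
  assumes t: "t \<ge> 1"
  shows "sv (0, 0) t \<le> (1 - exp (- q0)) * (\<Sum>j\<in>J. exit_prob j * sv (j, 0) (t - 1))"
    and "(1 - exp (- q0)) * (\<Sum>j\<in>J. exit_prob j * sv (j, 0) t) \<le> sv (0, 0) t"
proof -
  interpret prob_space "P 0" by (rule prob_space_P) simp
  let ?X = "\<lambda>j. {w \<in> paths S. w (max 0 (entry away w)) = j \<and> hits away w \<and> entry away w \<in> {..1} \<and> ereal t < tau 0 w}"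
  have X: "?X j \<in> events" for j
    unfolding sets_P[OF S_0]
  proof (cases "j \<in> S")
    case True
    show "?X j \<in> sets \<Omega>" by (rule exit_bounds(3)[OF True t])
  next
    case False
    have "w (max 0 (entry away w)) \<in> S" if "w \<in> paths S" for w by (rule cadlag_in[OF that]) simp
    then have "?X j = {}" using False by blast
    then show "?X j \<in> sets \<Omega>" by (metis sets.empty_sets)
  qed
  have U: "prob (\<Union>j\<in>J. ?X j) = (\<Sum>j\<in>J. prob (?X j))"
  proof (rule finite_measure_finite_Union)
    show "disjoint_family_on ?X J" unfolding disjoint_family_on_def by blast
    show "?X ` J \<subseteq> events" using X by blast
  qed (rule J)
  have "sv (0, 0) t = prob {w \<in> paths S. ereal t < tau 0 w}" by (simp add: sv_eq)
  also have "\<dots> = prob (\<Union>j\<in>J. ?X j)"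
  proof (rule measure_eq_AE)
    show "{w \<in> paths S. ereal t < tau 0 w} \<in> events" unfolding sets_P[OF S_0] by (rule tau_sets)
    show "(\<Union>j\<in>J. ?X j) \<in> events" by (intro sets.finite_UN J X)
    show "AE w in P 0. w \<in> {w \<in> paths S. ereal t < tau 0 w} \<longleftrightarrow> w \<in> (\<Union>j\<in>J. ?X j)"
      using exit_in_J_AE
    proof eventually_elim
      case (elim w)
      have "entry away w \<in> {..1}" if w: "w \<in> paths S" and a: "ereal t < tau 0 w"
      proof (rule ccontr)
        assume "\<not> ?thesis"
        then have "zero_on w 0 1" using zero_on_entry[OF w, of 1] by simp
        then show False using tau_le_1[OF w _ t] a by blast
      qed
      then show ?case using elim by blast
    qed
  qed
  finally have eq: "sv (0, 0) t = (\<Sum>j\<in>J. prob (?X j))" using U by simp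
  show "sv (0, 0) t \<le> (1 - exp (- q0)) * (\<Sum>j\<in>J. exit_prob j * sv (j, 0) (t - 1))"
    unfolding eq sum_distrib_left mult.assoc[symmetric]
    by (intro sum_mono exit_bounds(1) t) (use J in blast)
  show "(1 - exp (- q0)) * (\<Sum>j\<in>J. exit_prob j * sv (j, 0) t) \<le> sv (0, 0) t"
    unfolding eq sum_distrib_left mult.assoc[symmetric]
    by (intro sum_mono exit_bounds(2) t) (use J in blast)
qed

end

section \<open>Survival functions compared with the tail of the hitting time\<close>

locale subexp_chain = finite_exit_chain +
  fixes a :: "nat \<Rightarrow> real"
  assumes comparable: "comparable_subexponential_tails S P a" and a_0: "a 0 = 0"
begin

abbreviation "phi \<equiv> hit0_tail P"

lemma subexp_hit: "j \<in> S - {0} \<Longrightarrow> subexp_law (hit_law j)"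
proof -
  assume j: "j \<in> S - {0}"
  then have "subexponential (hit0_law P j)" using comparable unfolding comparable_subexponential_tails_def by blast
  then show ?thesis unfolding subexp_law_def using hit0_law_eq[of j] j by simp
qed

lemma a_pos: "j \<in> S - {0} \<Longrightarrow> 0 < a j"
  using comparable by (simp add: comparable_subexponential_tails_def)

lemma phi_eq: "j \<in> S - {0} \<Longrightarrow> phi j = tail (hit_law j)"
  by (intro ext) (use hit0_tail_eq in auto)

lemma phi_pos: "j \<in> S - {0} \<Longrightarrow> 0 < phi j t"
  unfolding phi_eq by (rule subexp_law.tail_pos[OF subexp_hit])

lemma phi_le_1: "j \<in> S - {0} \<Longrightarrow> phi j t \<le> 1"
  unfolding phi_eq by (rule subexp_law.tail_le_1[OF subexp_hit])

lemma phi_antimono: "j \<in> S - {0} \<Longrightarrow> s \<le> t \<Longrightarrow> phi j t \<le> phi j s"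
  unfolding phi_eq by (rule subexp_law.tail_antimono[OF subexp_hit])

lemma phi_measurable: "j \<in> S - {0} \<Longrightarrow> phi j \<in> borel_measurable borel"
  unfolding phi_eq by (rule subexp_law.tail_measurable[OF subexp_hit])

lemma one_in: "1 \<in> S - {0}" by simp

lemma phi_ratio: "j \<in> S - {0} \<Longrightarrow> ((\<lambda>t. phi j t / phi 1 t) \<longlongrightarrow> a j) at_top"
proof -
  assume j: "j \<in> S - {0}"
  have ae: "phi j \<sim>[at_top] (\<lambda>t. a j * phi 1 t)" using comparable j by (simp add: comparable_subexponential_tails_def)
  have "\<forall>\<^sub>F t in at_top. phi j t \<noteq> 0 \<or> a j * phi 1 t \<noteq> 0"
    by (rule always_eventually) (use phi_pos[OF j] in \<open>auto simp: less_imp_neq[symmetric]\<close>)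
  from asymp_equivD_strong[OF ae this]
  have "((\<lambda>t. phi j t / (a j * phi 1 t)) \<longlongrightarrow> 1) at_top" .
  from tendsto_mult[OF tendsto_const[of "a j"] this] show ?thesis using a_pos[OF j] by simp
qed

lemma phi_ratio': "j \<in> S - {0} \<Longrightarrow> ((\<lambda>t. phi 1 t / phi j t) \<longlongrightarrow> 1 / a j) at_top"
  using tendsto_inverse[OF phi_ratio[of j]] a_pos[of j] by (simp add: inverse_eq_divide)

lemma phi_back: "A \<ge> 0 \<Longrightarrow> ((\<lambda>t. phi 1 (t - A) / phi 1 t) \<longlongrightarrow> 1) at_top"
  unfolding phi_eq[OF one_in] by (rule subexp_law.tail_back[OF subexp_hit[OF one_in]])

lemma phi_long: "A \<ge> 0 \<Longrightarrow> ((\<lambda>t. phi 1 (t + A) / phi 1 t) \<longlongrightarrow> 1) at_top"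
  using tendsto_inverse[OF tendsto_shift_at_top[OF phi_back, of A "- A"]] by (simp add: inverse_eq_divide)

lemma phi_0: "j \<in> S - {0} \<Longrightarrow> (phi j \<longlongrightarrow> 0) at_top"
  unfolding phi_eq by (rule subexp_law.tail_tendsto_0[OF subexp_hit])

abbreviation "s0 \<equiv> sv (0, 0)"

lemma s0: "0 \<le> s0 t" "s0 t \<le> 1" "s \<le> t \<Longrightarrow> s0 t \<le> s0 s"
  by (rule sv_nonneg, rule sv_le_1, simp, rule sv_antimono) auto

definition cs :: "nat \<Rightarrow> (real \<Rightarrow> real) \<Rightarrow> real \<Rightarrow> real" where
  "cs j psi t = enn2real (conv (hit_law j) psi t)"

lemma sv_decomp:
  assumes j: "j \<in> S - {0}" and t: "t \<ge> 0"
  shows "sv (j, 0) t = phi j t + cs j s0 t"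
proof -
  interpret subexp_law "hit_law j" by (rule subexp_hit[OF j])
  have "conv (hit_law j) s0 t \<le> 1" by (rule conv_le_1) (rule s0)
  then have fin: "conv (hit_law j) s0 t < \<top>" by (rule le_less_trans) simp
  have "ennreal (sv (j, 0) t) = ennreal (phi j t + cs j s0 t)"
    using sv_hit[of j t] j t fin phi_pos[OF j, of t] by (simp add: cs_def less_imp_le)
  moreover have "0 \<le> phi j t + cs j s0 t" using phi_pos[OF j, of t] by (simp add: cs_def)
  ultimately show ?thesis using ennreal_inj[OF sv_nonneg] by blast
qed

text \<open>The convolution estimate needs the tail of the very law that is convolved. Comparability
  carries the bound from \<open>phi 1\<close> to \<open>phi j\<close> and back, and the factors
  \<open>1 / a j\<close> and \<open>a j\<close> cancel.\<close>

lemma cs_asymp_le: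
  assumes j: "j \<in> S - {0}" and psi: "\<And>t. 0 \<le> psi t" "\<And>t. psi t \<le> 1" "psi \<in> borel_measurable borel"
    and d: "asymp_le psi l (phi 1)" and l: "l \<ge> 0"
  shows "asymp_le (cs j psi) l (phi 1)"
proof -
  interpret subexp_law "hit_law j" by (rule subexp_hit[OF j])
  have "asymp_le psi (l * (1 / a j)) (phi j)"
    by (rule asymp_le_trans_ratio[OF d phi_ratio'[OF j] phi_pos[OF j]]) (use a_pos[OF j] in simp)
  then have "asymp_le (cs j psi) (l * (1 / a j)) (phi j)"
    unfolding cs_def phi_eq[OF j] by (intro conv_asymp_le psi) (use l a_pos[OF j] in auto)
  then have "asymp_le (cs j psi) (l * (1 / a j) * a j) (phi 1)"
    by (rule asymp_le_trans_ratio[OF _ phi_ratio[OF j] phi_pos[OF one_in]]) (use a_pos[OF j] in simp)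
  then show ?thesis using a_pos[OF j] by simp
qed

text \<open>\<open>p\<close> is the probability that a stay at 0 ends before age 1, \<open>m\<close>
  is the mean of \<open>a\<close> at the exit, and \<open>L\<close> is the solution of l = p (m +
  l).\<close>

definition p :: real where "p = 1 - exp (- q0)"
definition m :: real where "m = (\<Sum>j\<in>J. exit_prob j * a j)"
definition L :: real where "L = p * m / (1 - p)"

lemma p: "0 < p" "p < 1" using exp_q0 by (auto simp: p_def)

lemma J_in: "j \<in> J \<Longrightarrow> j \<in> S - {0}" using J by blast

lemma m_pos: "0 < m"
proof -
  obtain j where j: "j \<in> J" "exit_prob j \<noteq> 0"
    using exit_prob_sum_J by (metis sum.neutral zero_neq_one)
  have "0 < exit_prob j * a j" using j exit_prob_nonneg[of j] a_pos[OF J_in[OF j(1)]] by (simp add: less_le)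
  also have "\<dots> \<le> m" unfolding m_def
    using j J a_pos[OF J_in] exit_prob_nonneg by (intro member_le_sum) (auto simp: less_imp_le)
  finally show ?thesis .
qed

lemma L_pos: "0 < L" using p m_pos by (simp add: L_def)

lemma L_fixed: "p * (m + l) \<ge> l \<Longrightarrow> l \<le> L"
  using p by (simp add: L_def pos_le_divide_eq algebra_simps)

text \<open>One round of the recursion: a bound \<open>l\<close> from \<open>(0, 0)\<close> gives
  \<open>a j + l\<close> from the exit state \<open>j\<close>; averaging over the exit and
  multiplying by \<open>p\<close> leads back to \<open>(0, 0)\<close>. The loss of one time unit is
  absorbed by the long tail.\<close>

lemma s0_upper_step:
  assumes d: "asymp_le s0 l (phi 1)" and l: "l \<ge> 0"
  shows "asymp_le s0 (p * (m + l)) (phi 1)"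
proof -
  have "asymp_le (\<lambda>t. exit_prob j * sv (j, 0) (t - 1)) (exit_prob j * (a j + l)) (phi 1)" if j: "j \<in> J" for j
  proof (rule asymp_le_cmult[OF _ exit_prob_nonneg phi_pos[OF one_in]])
    note j' = J_in[OF j]
    have "asymp_le (\<lambda>t. phi j t + cs j s0 t) (a j + l) (phi 1)"
      by (intro asymp_le_add asymp_leI_ratio phi_ratio[OF j'] phi_pos[OF one_in] cs_asymp_le[OF j'] d l s0 sv_00_measurable)
    then have "asymp_le (\<lambda>t. sv (j, 0) t) (a j + l) (phi 1)"
      by (rule asymp_le_mono[where b = 0]) (use sv_decomp[OF j'] in simp)
    then have sh: "asymp_le (\<lambda>t. sv (j, 0) (t - 1)) (a j + l) (\<lambda>t. phi 1 (t - 1))"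
      unfolding asymp_le_def using eventually_compose_filterlim[OF _ at_top_shift[of 1]] by blast
    have "asymp_le (\<lambda>t. sv (j, 0) (t - 1)) ((a j + l) * 1) (phi 1)"
      by (rule asymp_le_trans_ratio[OF sh phi_back phi_pos[OF one_in]]) auto
    then show "asymp_le (\<lambda>t. sv (j, 0) (t - 1)) (a j + l) (phi 1)" by simp
  qed
  then have "asymp_le (\<lambda>t. \<Sum>j\<in>J. exit_prob j * sv (j, 0) (t - 1)) (\<Sum>j\<in>J. exit_prob j * (a j + l)) (phi 1)"
    by (intro asymp_le_sum J phi_pos[OF one_in])
  then have "asymp_le (\<lambda>t. p * (\<Sum>j\<in>J. exit_prob j * sv (j, 0) (t - 1))) (p * (\<Sum>j\<in>J. exit_prob j * (a j + l))) (phi 1)"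
    by (rule asymp_le_cmult[OF _ less_imp_le[OF p(1)] phi_pos[OF one_in]])
  then have "asymp_le s0 (p * (\<Sum>j\<in>J. exit_prob j * (a j + l))) (phi 1)"
    by (rule asymp_le_mono[where b = 1]) (use sv_00_bounds(1) p_def in auto)
  moreover have "(\<Sum>j\<in>J. exit_prob j * (a j + l)) = m + l"
    using exit_prob_sum_J by (simp add: m_def distrib_left sum.distrib sum_distrib_right[symmetric])
  ultimately show ?thesis by simp
qed

text \<open>A contraction argument: on an interval where \<open>s0\<close> is at most \<open>M\<close> times the reference tail it is at most
  \<open>C + p' M\<close> times that tail one time unit later, with a fixed \<open>p' < 1\<close>.\<close>

lemma s0_bounded_ratio: "\<exists>M\<ge>0. asymp_le s0 M (phi 1)"
proof -
  \<comment> \<open>Strictly between \<open>p\<close> and 1: the gap to \<open>p\<close> absorbs the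
    error in the asymptotic bound \<open>p\<close>, the gap to 1 keeps the contraction. In the same
    way the summand 1 in \<open>C\<close> absorbs the error in \<open>p * m\<close>.\<close>
  define p' where "p' = (p + 1) / 2"
  have p': "p < p'" "p' < 1" "0 < p'" using p by (auto simp: p'_def)
  define C where "C = p * m + 1"
  have "asymp_le (\<lambda>t. exit_prob j * phi j t) (exit_prob j * a j) (phi 1)" if "j \<in> J" for j
    by (intro asymp_le_cmult asymp_leI_ratio phi_ratio J_in that phi_pos one_in exit_prob_nonneg)
  then have A: "asymp_le (\<lambda>t. \<Sum>j\<in>J. exit_prob j * phi j t) m (phi 1)"
    unfolding m_def by (intro asymp_le_sum J phi_pos[OF one_in])
  have "asymp_le (\<lambda>t. exit_prob j * cs j (phi 1) t) (exit_prob j * 1) (phi 1)" if "j \<in> J" for j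
  proof (intro asymp_le_cmult cs_asymp_le J_in[OF that] phi_pos[OF one_in] exit_prob_nonneg phi_measurable[OF one_in])
    show "0 \<le> phi 1 t" "phi 1 t \<le> 1" for t using phi_pos[OF one_in, of t] phi_le_1[OF one_in, of t] by auto
    show "asymp_le (phi 1) 1 (phi 1)"
      using phi_pos[OF one_in] by (auto simp: asymp_le_def less_imp_le distrib_right intro!: always_eventually)
  qed simp
  then have "asymp_le (\<lambda>t. \<Sum>j\<in>J. exit_prob j * cs j (phi 1) t) (\<Sum>j\<in>J. exit_prob j * 1) (phi 1)"
    by (intro asymp_le_sum J phi_pos[OF one_in])
  then have B: "asymp_le (\<lambda>t. \<Sum>j\<in>J. exit_prob j * cs j (phi 1) t) 1 (phi 1)" using exit_prob_sum_J by simp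
  have step_back: "asymp_le (\<lambda>t. p * f (t - 1)) (p * l) (phi 1)" if "asymp_le f l (phi 1)" for f l
  proof -
    have sh: "asymp_le (\<lambda>t. f (t - 1)) l (\<lambda>t. phi 1 (t - 1))"
      using that unfolding asymp_le_def using eventually_compose_filterlim[OF _ at_top_shift[of 1]] by blast
    have "asymp_le (\<lambda>t. f (t - 1)) (l * 1) (phi 1)"
      by (rule asymp_le_trans_ratio[OF sh phi_back phi_pos[OF one_in]]) auto
    then show ?thesis using asymp_le_cmult[OF _ less_imp_le[OF p(1)] phi_pos[OF one_in]] by simp
  qed
  have "\<forall>\<^sub>F t in at_top. p * (\<Sum>j\<in>J. exit_prob j * phi j (t - 1)) \<le> C * phi 1 t"
    using step_back[OF A] unfolding asymp_le_def C_def by (meson zero_less_one)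
  moreover have "\<forall>\<^sub>F t in at_top. p * (\<Sum>j\<in>J. exit_prob j * cs j (phi 1) (t - 1)) \<le> p' * phi 1 t"
  proof -
    have "p' - p > 0" using p' by simp
    then have "\<forall>\<^sub>F t in at_top. p * (\<Sum>j\<in>J. exit_prob j * cs j (phi 1) (t - 1)) \<le> (p * 1 + (p' - p)) * phi 1 t"
      using step_back[OF B] unfolding asymp_le_def by blast
    then show ?thesis by simp
  qed
  ultimately have "\<forall>\<^sub>F t in at_top. 1 \<le> t \<and> p * (\<Sum>j\<in>J. exit_prob j * phi j (t - 1)) \<le> C * phi 1 t \<and>
      p * (\<Sum>j\<in>J. exit_prob j * cs j (phi 1) (t - 1)) \<le> p' * phi 1 t"
    using eventually_ge_at_top[of 1] by eventually_elim simp
  then obtain t0 where t0: "\<And>t. t \<ge> t0 \<Longrightarrow> 1 \<le> t \<and> p * (\<Sum>j\<in>J. exit_prob j * phi j (t - 1)) \<le> C * phi 1 t \<and>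
      p * (\<Sum>j\<in>J. exit_prob j * cs j (phi 1) (t - 1)) \<le> p' * phi 1 t"
    unfolding eventually_at_top_linorder by blast
  \<comment> \<open>The first term makes the bound trivial up to \<open>t0\<close>, where
    \<open>s0 <= 1\<close> is enough. The second ensures \<open>C + M * p' <= M\<close>, so that a
    step of the induction reproduces \<open>M\<close>.\<close>
  define M where "M = max (1 / phi 1 t0) (C / (1 - p'))"
  have M1: "1 \<le> M * phi 1 t0" using phi_pos[OF one_in, of t0] by (simp add: M_def pos_divide_le_eq[symmetric])
  have M2: "C + M * p' \<le> M"
  proof -
    have "C / (1 - p') \<le> M" by (simp add: M_def)
    then have "C \<le> M * (1 - p')" using p' by (simp add: pos_divide_le_eq)
    then show ?thesis by (simp add: algebra_simps)
  qed
  have M0: "0 \<le> M" using phi_pos[OF one_in, of t0] by (simp add: M_def le_max_iff_disj)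
  have claim: "\<forall>t. t \<le> t0 + real k \<longrightarrow> s0 t \<le> M * phi 1 t" for k :: nat
  proof (induction k)
    case 0
    show ?case
    proof (intro allI impI)
      fix t assume "t \<le> t0 + real 0"
      then have "M * phi 1 t0 \<le> M * phi 1 t" using phi_antimono[OF one_in, of t t0] M0 by (intro mult_left_mono) auto
      then show "s0 t \<le> M * phi 1 t" using s0(2)[of t] M1 by linarith
    qed
  next
    case (Suc k)
    show ?case
    proof (intro allI impI)
      fix t assume t: "t \<le> t0 + real (Suc k)"
      show "s0 t \<le> M * phi 1 t"
      proof (cases "t \<le> t0 + real k")
        case True
        then show ?thesis using Suc by blast
      next
        case False
        then have tt: "t0 \<le> t" by linarith
        note T = t0[OF tt]
        \<comment> \<open>The convolution at \<open>t - 1\<close> involves \<open>s0\<close> on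
          \<open>[0, t - 1]\<close> only, which the induction hypothesis covers. This is why the
          induction advances by whole units.\<close>
        have cj: "cs j s0 (t - 1) \<le> M * cs j (phi 1) (t - 1)" if j: "j \<in> J" for j
          unfolding cs_def
        proof (rule subexp_law.conv_mono_scaled[OF subexp_hit[OF J_in[OF j]] M0])
          show "s0 r \<le> M * phi 1 r" if "0 \<le> r" "r \<le> t - 1" for r using Suc.IH that t by auto
        qed (use phi_pos[OF one_in] phi_le_1[OF one_in] phi_measurable[OF one_in] in \<open>auto simp: less_imp_le\<close>)
        have "s0 t \<le> p * (\<Sum>j\<in>J. exit_prob j * sv (j, 0) (t - 1))"
          unfolding p_def by (rule sv_00_bounds(1)) (use T in simp)
        also have "(\<Sum>j\<in>J. exit_prob j * sv (j, 0) (t - 1)) \<le> (\<Sum>j\<in>J. exit_prob j * phi j (t - 1) + M * (exit_prob j * cs j (phi 1) (t - 1)))"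
        proof (rule sum_mono)
          fix j assume j: "j \<in> J"
          have "exit_prob j * sv (j, 0) (t - 1) = exit_prob j * phi j (t - 1) + exit_prob j * cs j s0 (t - 1)"
            using sv_decomp[OF J_in[OF j], of "t - 1"] T by (simp add: distrib_left)
          also have "\<dots> \<le> exit_prob j * phi j (t - 1) + exit_prob j * (M * cs j (phi 1) (t - 1))"
            by (intro add_left_mono mult_left_mono cj j exit_prob_nonneg)
          finally show "exit_prob j * sv (j, 0) (t - 1) \<le> exit_prob j * phi j (t - 1) + M * (exit_prob j * cs j (phi 1) (t - 1))"
            by (simp add: mult_ac)
        qed
        also have "p * (\<Sum>j\<in>J. exit_prob j * phi j (t - 1) + M * (exit_prob j * cs j (phi 1) (t - 1)))
          = p * (\<Sum>j\<in>J. exit_prob j * phi j (t - 1)) + M * (p * (\<Sum>j\<in>J. exit_prob j * cs j (phi 1) (t - 1)))"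
          by (simp add: sum.distrib sum_distrib_left[symmetric] distrib_left mult_ac)
        also have "\<dots> \<le> C * phi 1 t + M * (p' * phi 1 t)"
          using T M0 by (intro add_mono mult_left_mono) auto
        also have "\<dots> = (C + M * p') * phi 1 t" by (simp add: algebra_simps)
        also have "\<dots> \<le> M * phi 1 t" using M2 phi_pos[OF one_in, of t] by (intro mult_right_mono) auto
        finally show ?thesis using p(1) by simp
      qed
    qed
  qed
  have le: "s0 t \<le> M * phi 1 t" for t
  proof -
    obtain k :: nat where "t - t0 \<le> real k" using real_arch_simple by blast
    then show ?thesis using claim[of k] by (simp add: diff_le_eq add.commute)
  qed
  have "asymp_le s0 M (phi 1)"
    unfolding asymp_le_def
  proof (intro allI impI always_eventually)
    fix e t :: real assume "e > 0"
    then have "M * phi 1 t \<le> (M + e) * phi 1 t" using phi_pos[OF one_in, of t] by (intro mult_right_mono) auto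
    then show "s0 t \<le> (M + e) * phi 1 t" using le[of t] by linarith
  qed
  then show ?thesis using M0 by blast
qed

text \<open>The infimum of the admissible constants is a real number by
  \<open>s0_bounded_ratio\<close>, and it is admissible itself. One more round cannot improve on it,
  so l <= p (m + l), which means \<open>l <= L\<close>.\<close>

lemma s0_upper: "asymp_le s0 L (phi 1)"
proof -
  let ?A = "{l. 0 \<le> l \<and> asymp_le s0 l (phi 1)}"
  have ne: "?A \<noteq> {}" using s0_bounded_ratio by blast
  have bd: "bdd_below ?A" by (rule bdd_belowI[of _ 0]) simp
  define l where "l = Inf ?A"
  have l0: "0 \<le> l" unfolding l_def by (rule cInf_greatest[OF ne]) simp
  have dl: "asymp_le s0 l (phi 1)"
    unfolding asymp_le_def
  proof (intro allI impI)
    fix e :: real assume e: "e > 0"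
    have "Inf ?A < l + e / 2" using e by (simp add: l_def)
    then obtain l' where l': "l' \<in> ?A" "l' < l + e / 2" using cInf_lessD[OF ne] by blast
    have "\<forall>\<^sub>F t in at_top. s0 t \<le> (l' + e / 2) * phi 1 t" using l'(1) e by (simp add: asymp_le_def)
    then show "\<forall>\<^sub>F t in at_top. s0 t \<le> (l + e) * phi 1 t"
    proof eventually_elim
      case (elim t)
      have "(l' + e / 2) * phi 1 t \<le> (l + e) * phi 1 t" using l'(2) phi_pos[OF one_in, of t] by (intro mult_right_mono) auto
      then show ?case using elim by linarith
    qed
  qed
  have "l \<le> p * (m + l)"
    unfolding l_def
    by (rule cInf_lower[OF _ bd]) (use s0_upper_step[OF dl l0] p m_pos l0 in \<open>auto simp: l_def\<close>)
  then have "l \<le> L" by (intro L_fixed)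
  then show ?thesis
    using dl unfolding asymp_le_def
  proof (intro allI impI)
    fix e :: real assume e: "e > 0" and "\<forall>e>0. \<forall>\<^sub>F t in at_top. s0 t \<le> (l + e) * phi 1 t"
    then have "\<forall>\<^sub>F t in at_top. s0 t \<le> (l + e) * phi 1 t" by blast
    then show "\<forall>\<^sub>F t in at_top. s0 t \<le> (L + e) * phi 1 t"
    proof eventually_elim
      case (elim t)
      have "(l + e) * phi 1 t \<le> (L + e) * phi 1 t" using \<open>l \<le> L\<close> phi_pos[OF one_in, of t] by (intro mult_right_mono) auto
      then show ?case using elim by linarith
    qed
  qed
qed

lemma ratio_tendsto:
  assumes "asymp_le psi l (phi 1)" and low: "(g \<longlongrightarrow> l) at_top" "\<forall>\<^sub>F t in at_top. g t \<le> psi t / phi 1 t"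
  shows "((\<lambda>t. psi t / phi 1 t) \<longlongrightarrow> l) at_top"
proof (rule order_tendstoI)
  fix y assume "y < l"
  with low(1) have "\<forall>\<^sub>F t in at_top. y < g t" by (rule order_tendstoD(1))
  with low(2) show "\<forall>\<^sub>F t in at_top. y < psi t / phi 1 t" by eventually_elim linarith
next
  fix y assume y: "l < y"
  then have "\<forall>\<^sub>F t in at_top. psi t \<le> (l + (y - l) / 2) * phi 1 t" using assms(1) by (simp add: asymp_le_def)
  then show "\<forall>\<^sub>F t in at_top. psi t / phi 1 t < y"
  proof eventually_elim
    case (elim t)
    then have "psi t / phi 1 t \<le> l + (y - l) / 2" using phi_pos[OF one_in, of t] by (simp add: pos_divide_le_eq)
    also have "l + (y - l) / 2 < y" using y by (simp add: field_simps)
    finally show ?case .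
  qed
qed

lemma cs_lower: "j \<in> S - {0} \<Longrightarrow> s0 t * (1 - phi j t) \<le> cs j s0 t"
  unfolding cs_def phi_eq by (rule subexp_law.conv_lower[OF subexp_hit]) (auto intro: s0)

text \<open>No limes inferior is needed for the lower bound. As \<open>s0\<close> is decreasing, its
  convolution at \<open>t\<close> is at least \<open>s0 t * (1 - phi j t)\<close>; the resulting
  linear inequality is solved for \<open>s0 t\<close>, with a denominator that tends to
  \<open>1 - p\<close>.\<close>

lemma s0_ratio: "((\<lambda>t. s0 t / phi 1 t) \<longlongrightarrow> L) at_top"
proof (rule ratio_tendsto[OF s0_upper])
  let ?D = "\<lambda>t. 1 - p * (\<Sum>j\<in>J. exit_prob j * (1 - phi j t))"
  let ?g = "\<lambda>t. p * (\<Sum>j\<in>J. exit_prob j * (phi j t / phi 1 t)) / ?D t"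
  have D: "(?D \<longlongrightarrow> 1 - p * (\<Sum>j\<in>J. exit_prob j * (1 - 0))) at_top"
    by (intro tendsto_intros phi_0 J_in)
  then have D': "(?D \<longlongrightarrow> 1 - p) at_top" using exit_prob_sum_J by simp
  have "(?g \<longlongrightarrow> p * (\<Sum>j\<in>J. exit_prob j * a j) / (1 - p)) at_top"
    by (intro tendsto_divide D' tendsto_mult tendsto_const tendsto_sum phi_ratio J_in) (use p in auto)
  then show "(?g \<longlongrightarrow> L) at_top" by (simp add: L_def m_def)
  have "\<forall>\<^sub>F t in at_top. 0 < ?D t" using D' by (rule order_tendstoD(1)) (use p in simp)
  then show "\<forall>\<^sub>F t in at_top. ?g t \<le> s0 t / phi 1 t"
    using eventually_ge_at_top[of 1]
  proof eventually_elim
    case (elim t)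
    have "p * (\<Sum>j\<in>J. exit_prob j * (phi j t + s0 t * (1 - phi j t))) \<le> p * (\<Sum>j\<in>J. exit_prob j * sv (j, 0) t)"
      using p elim cs_lower[OF J_in] sv_decomp[OF J_in] exit_prob_nonneg
      by (intro mult_left_mono sum_mono) auto
    also have "\<dots> \<le> s0 t" unfolding p_def by (rule sv_00_bounds(2)) (use elim in simp)
    finally have "p * (\<Sum>j\<in>J. exit_prob j * phi j t) + s0 t * (p * (\<Sum>j\<in>J. exit_prob j * (1 - phi j t))) \<le> s0 t"
      by (simp add: distrib_left sum.distrib sum_distrib_left mult_ac)
    then have "p * (\<Sum>j\<in>J. exit_prob j * phi j t) \<le> s0 t * ?D t" by (simp add: right_diff_distrib)
    then have "p * (\<Sum>j\<in>J. exit_prob j * phi j t) / phi 1 t \<le> s0 t * ?D t / phi 1 t"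
      using phi_pos[OF one_in, of t] by (intro divide_right_mono) auto
    moreover have "p * (\<Sum>j\<in>J. exit_prob j * (phi j t / phi 1 t)) = p * (\<Sum>j\<in>J. exit_prob j * phi j t) / phi 1 t"
      by (simp only: times_divide_eq_right sum_divide_distrib[symmetric])
    ultimately have "p * (\<Sum>j\<in>J. exit_prob j * (phi j t / phi 1 t)) \<le> s0 t / phi 1 t * ?D t"
      by (simp only: times_divide_eq_left)
    then show ?case using elim by (simp add: pos_divide_le_eq)
  qed
qed

lemma sv_ratio:
  assumes j: "j \<in> S"
  shows "((\<lambda>t. sv (j, 0) t / phi 1 t) \<longlongrightarrow> a j + L) at_top"
proof (cases "j = 0")
  case True
  then show ?thesis using s0_ratio a_0 by simp
next
  case False
  then have j: "j \<in> S - {0}" using j by simp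
  show ?thesis
  proof (rule ratio_tendsto)
    have "asymp_le (\<lambda>t. phi j t + cs j s0 t) (a j + L) (phi 1)"
      by (intro asymp_le_add asymp_leI_ratio phi_ratio[OF j] phi_pos[OF one_in] cs_asymp_le[OF j] s0_upper s0 sv_00_measurable
          less_imp_le[OF L_pos])
    then show "asymp_le (sv (j, 0)) (a j + L) (phi 1)"
      by (rule asymp_le_mono[where b = 0]) (use sv_decomp[OF j] in simp)
    have "((\<lambda>t. phi j t / phi 1 t + s0 t / phi 1 t * (1 - phi j t)) \<longlongrightarrow> a j + L * (1 - 0)) at_top"
      by (intro tendsto_intros phi_ratio[OF j] s0_ratio phi_0[OF j])
    then show "((\<lambda>t. phi j t / phi 1 t + s0 t / phi 1 t * (1 - phi j t)) \<longlongrightarrow> a j + L) at_top" by simp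
    show "\<forall>\<^sub>F t in at_top. phi j t / phi 1 t + s0 t / phi 1 t * (1 - phi j t) \<le> sv (j, 0) t / phi 1 t"
      using eventually_ge_at_top[of 0]
    proof eventually_elim
      case (elim t)
      have "(phi j t + s0 t * (1 - phi j t)) / phi 1 t \<le> sv (j, 0) t / phi 1 t"
        using cs_lower[OF j, of t] sv_decomp[OF j elim] phi_pos[OF one_in, of t] by (intro divide_right_mono) auto
      then show ?case by (simp add: add_divide_distrib)
    qed
  qed
qed

text \<open>The limit of \<open>sv (i, 0) t / s0 t\<close>, which is \<open>(a i + L) / L\<close> by
  \<open>sv_ratio\<close>.\<close>

definition c :: "nat \<Rightarrow> real" where "c i = 1 + a i / L"

lemma sv_long_tailed:
  assumes j: "j \<in> S"
  shows "long_tailed (sv (j, 0))"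
  unfolding long_tailed_def
proof (intro allI impI)
  fix s :: real assume s: "s \<ge> 0"
  let ?l = "a j + L"
  have l: "?l > 0" using L_pos a_pos[of j] a_0 j by (cases "j = 0") (auto simp: add_pos_pos)
  have 1: "((\<lambda>t. sv (j, 0) (t + s) / phi 1 (t + s)) \<longlongrightarrow> ?l) at_top"
    using tendsto_shift_at_top[OF sv_ratio[OF j], of "- s"] by simp
  have "((\<lambda>t. sv (j, 0) (t + s) / phi 1 (t + s) * (phi 1 (t + s) / phi 1 t) / (sv (j, 0) t / phi 1 t)) \<longlongrightarrow> ?l * 1 / ?l) at_top"
    by (intro tendsto_divide tendsto_mult 1 phi_long s sv_ratio[OF j]) (use l in simp)
  moreover have eq: "sv (j, 0) (t + s) / phi 1 (t + s) * (phi 1 (t + s) / phi 1 t) / (sv (j, 0) t / phi 1 t) = sv (j, 0) (t + s) / sv (j, 0) t" for t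
    using phi_pos[OF one_in, of t] phi_pos[OF one_in, of "t + s"] by simp
  moreover have "?l * 1 / ?l = 1" using l by simp
  ultimately show "((\<lambda>t. sv (j, 0) (t + s) / sv (j, 0) t) \<longlongrightarrow> 1) at_top" by (simp only:)
qed

lemma heavy: "comparable_heavy_tails S P c"
  unfolding comparable_heavy_tails_def sv_def[symmetric]
proof (intro ballI conjI)
  fix i assume i: "i \<in> S"
  have ai: "0 \<le> a i" using a_pos[of i] a_0 i by (cases "i = 0") (auto simp: less_imp_le)
  show ci: "0 < c i" using L_pos ai by (simp add: c_def add_pos_nonneg)
  show "\<forall>s\<ge>0. ((\<lambda>t. sv (i, 0) (t + s) / sv (i, 0) t) \<longlongrightarrow> 1) at_top"
    using sv_long_tailed[OF i] by (simp add: long_tailed_def)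
  have "((\<lambda>t. (sv (i, 0) t / phi 1 t) / (c i * (s0 t / phi 1 t))) \<longlongrightarrow> (a i + L) / (c i * L)) at_top"
    by (intro tendsto_intros sv_ratio[OF i] s0_ratio) (use ci L_pos in simp)
  moreover have "(sv (i, 0) t / phi 1 t) / (c i * (s0 t / phi 1 t)) = sv (i, 0) t / (c i * s0 t)" for t
    using phi_pos[OF one_in, of t] by simp
  moreover have "(a i + L) / (c i * L) = 1"
  proof -
    have "c i * L = a i + L" using L_pos by (simp add: c_def distrib_right)
    then show ?thesis using ai L_pos by simp
  qed
  ultimately have "((\<lambda>t. sv (i, 0) t / (c i * s0 t)) \<longlongrightarrow> 1) at_top" by (simp only:)
  then show "sv (i, 0) \<sim>[at_top] (\<lambda>t. c i * s0 t)" by (rule asymp_equivI')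
qed

definition h :: "nat \<times> real \<Rightarrow> real" where "h = h_fun q c"

text \<open>The constant of the theorem is \<open>L\<close> in disguise:
  \<open>exp q0 - 1 = p / (1 - p)\<close>, and the weights \<open>q 0 i / q0\<close> are the exit
  probabilities, which vanish outside the finite set \<open>J\<close>.\<close>

lemma h_subexp_eq: "h_subexp S q a = h"
proof -
  have "(\<Sum>\<^sub>\<infinity>i\<in>S - {0}. q 0 i * a i / q0) = (\<Sum>\<^sub>\<infinity>i\<in>J. q 0 i * a i / q0)"
    by (rule infsum_cong_neutral) (use J finite_exit in \<open>auto simp: J_def not_le\<close>)
  also have "\<dots> = (\<Sum>i\<in>J. q 0 i * a i / q0)" using J by simp
  also have "\<dots> = m" unfolding m_def by (intro sum.cong refl) (use exit_prob_eq J_in in auto)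
  finally have mm: "(\<Sum>\<^sub>\<infinity>i\<in>S - {0}. q 0 i * a i / q0) = m" .
  have "p / (1 - p) = exp q0 - 1" by (simp add: p_def exp_minus field_simps)
  then have "(exp q0 - 1) * m = p / (1 - p) * m" by (simp only:)
  also have "\<dots> = L" by (simp add: L_def)
  finally have "(exp q0 - 1) * m = L" .
  then show ?thesis using mm by (simp add: h_subexp_def h_def c_def[abs_def] q0_def Let_def)
qed

lemma part2: "survival_ratio_limit S P h"
  unfolding h_def by (rule heavy_tails_survival_ratio[OF heavy])

end

section \<open>Superharmonicity and harmonicity\<close>

lemma less_hit0_zero_free:
  assumes w: "w \<in> paths S" and t: "0 \<le> t"
  shows "ereal t < hit0 w \<longleftrightarrow> (\<forall>r\<in>{0..t}. w r \<noteq> 0)"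
proof
  assume "ereal t < hit0 w"
  then show "\<forall>r\<in>{0..t}. w r \<noteq> 0"
    using before_entry[OF w, of _ "{0}"] less_hit0_iff[OF w, of t] by fastforce
next
  assume *: "\<forall>r\<in>{0..t}. w r \<noteq> 0"
  show "ereal t < hit0 w"
    unfolding less_hit0_iff[OF w]
  proof
    assume h: "hits {0} w"
    show "t < entry {0} w"
      using * entry_nonneg[OF w h] entry_in[OF w h] by (metis atLeastAtMost_iff not_le singletonD)
  qed
qed

lemma hit0_flow:
  assumes w: "w \<in> paths S" and st: "0 \<le> s" "0 \<le> t"
  shows "ereal (s + t) < hit0 w \<longleftrightarrow> ereal s < hit0 w \<and> ereal t < hit0 (shift s w)"
proof -
  have "(\<forall>r\<in>{0..s + t}. w r \<noteq> 0) \<longleftrightarrow> (\<forall>r\<in>{0..s}. w r \<noteq> 0) \<and> (\<forall>r\<in>{0..t}. w (s + r) \<noteq> 0)" (is "?l \<longleftrightarrow> ?r1 \<and> ?r2")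
  proof (intro iffI conjI ballI; (elim conjE)?)
    fix r assume "?r1" "?r2" "r \<in> {0..s + t}"
    then show "w r \<noteq> 0" using bspec[of "{0..t}" "\<lambda>r. w (s + r) \<noteq> 0" "r - s"] by (cases "r \<le> s") auto
  qed (use st in auto)
  then show ?thesis
    using less_hit0_zero_free[OF w, of "s + t"] less_hit0_zero_free[OF w st(1)]
      less_hit0_zero_free[OF shift_cadlag[OF w st(1)] st(2)] st by simp
qed

lemma nn_integral_limit_le:
  fixes f :: "nat \<Rightarrow> 'a \<Rightarrow> ennreal"
  assumes m: "\<And>n. f n \<in> borel_measurable M" and l: "\<And>x. x \<in> space M \<Longrightarrow> (\<lambda>n. f n x) \<longlonglongrightarrow> g x"
    and c: "(\<lambda>n. \<integral>\<^sup>+x. f n x \<partial>M) \<longlonglongrightarrow> c"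
  shows "(\<integral>\<^sup>+x. g x \<partial>M) \<le> c"
proof -
  have "(\<integral>\<^sup>+x. g x \<partial>M) = (\<integral>\<^sup>+x. liminf (\<lambda>n. f n x) \<partial>M)"
    by (intro nn_integral_cong) (simp add: lim_imp_Liminf[OF _ l])
  also have "\<dots> \<le> liminf (\<lambda>n. \<integral>\<^sup>+x. f n x \<partial>M)" by (rule nn_integral_liminf[OF m])
  also have "\<dots> = c" by (rule lim_imp_Liminf[OF _ c]) simp
  finally show ?thesis .
qed

lemma measurable_fst_nat: "f \<in> borel_measurable borel" for f :: "nat \<Rightarrow> 'b::topological_space"
  by (simp add: measurable_cong_sets[OF sets_borel_eq_count_space refl])

lemma borel_fst [measurable]: "(fst :: nat \<times> real \<Rightarrow> nat) \<in> borel_measurable borel"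
  by (intro borel_measurable_continuous_onI continuous_intros)

lemma borel_snd [measurable]: "(snd :: nat \<times> real \<Rightarrow> real) \<in> borel_measurable borel"
  by (intro borel_measurable_continuous_onI continuous_intros)

lemma hat_S_borel: "hat_S S \<in> sets borel"
proof -
  have 1: "fst -` A \<inter> space borel \<in> sets (borel :: (nat \<times> real) measure)" for A :: "nat set"
    by (rule measurable_sets[OF borel_fst]) (simp add: sets_borel_eq_count_space)
  have 2: "snd -` A \<inter> space borel \<in> sets (borel :: (nat \<times> real) measure)" if "A \<in> sets borel" for A :: "real set"
    by (rule measurable_sets[OF borel_snd that])
  have "hat_S S = ((fst -` (S - {0}) \<inter> space borel) \<inter> (snd -` {0} \<inter> space borel)) \<union>
      ((fst -` {0} \<inter> space borel) \<inter> (snd -` {0..<1} \<inter> space borel))"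
    by (auto simp: hat_S_def image_iff)
  also have "\<dots> \<in> sets borel" by (intro sets.Un sets.Int 1 2) auto
  finally show ?thesis .
qed

context chain
begin

text \<open>The semigroup of the killed process applied to \<open>f\<close>, written as an integral
  over paths of the chain so that the Markov property on path space applies directly; see
  \<open>nn_integral_hat_P\<close>.\<close>

definition W :: "(nat \<times> real \<Rightarrow> ennreal) \<Rightarrow> nat \<times> real \<Rightarrow> real \<Rightarrow> ennreal" where
  "W f x t = (\<integral>\<^sup>+w. (if ereal t < tau (snd x) w then f (hat_X (snd x) t w) else 0) \<partial>P (fst x))"

lemma W_eq: "W f x t = (\<integral>\<^sup>+w. (if ereal t < tau (snd x) w then f (hat_X (snd x) t w) else 0) \<partial>P (fst x))"
  by (simp add: W_def)

lemma nn_integral_hat_P: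
  assumes i: "fst x \<in> S" and t: "0 \<le> t" and f: "f \<in> borel_measurable borel"
  shows "(\<integral>\<^sup>+y. f y \<partial>hat_P P t x) = W f x t"
proof -
  have A: "{w. ereal t < tau (snd x) w} \<inter> space (P (fst x)) \<in> sets (P (fst x))"
  proof -
    have "{w. ereal t < tau (snd x) w} \<inter> space (P (fst x)) = {w \<in> paths S. ereal t < tau (snd x) w}"
      using i by auto
    then show ?thesis using tau_sets[of t "snd x"] i by simp
  qed
  have "(\<integral>\<^sup>+y. f y \<partial>hat_P P t x) = (\<integral>\<^sup>+w. f (hat_X (snd x) t w) \<partial>restrict_space (P (fst x)) {w. ereal t < tau (snd x) w})"
    unfolding hat_P_def
    by (rule nn_integral_distr) (use i t f in \<open>auto intro: measurable_restrict_space1\<close>)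
  also have "\<dots> = (\<integral>\<^sup>+w. f (hat_X (snd x) t w) * indicator {w. ereal t < tau (snd x) w} w \<partial>P (fst x))"
    by (rule nn_integral_restrict_space[OF A])
  also have "\<dots> = W f x t" unfolding W_def by (intro nn_integral_cong) (simp add: indicator_def)
  finally show ?thesis .
qed

lemma nn_integral_tilde_P:
  assumes i: "i \<in> S" and t: "0 \<le> t"
  shows "(\<integral>\<^sup>+y. f y \<partial>tilde_P P t i) = (\<integral>\<^sup>+w. f (w t) * indicator {w. ereal t < hit0 w} w \<partial>P i)"
proof -
  have A: "{w. ereal t < hit0 w} \<inter> space (P i) \<in> sets (P i)"
  proof -
    have "{w. ereal t < hit0 w} \<inter> space (P i) = {w \<in> paths S. ereal t < hit0 w}"
      using i by auto
    then show ?thesis using hit0_sets[of t] i by simp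
  qed
  have "(\<integral>\<^sup>+y. f y \<partial>tilde_P P t i) = (\<integral>\<^sup>+w. f (w t) \<partial>restrict_space (P i) {w. ereal t < hit0 w})"
    unfolding tilde_P_def
  proof (rule nn_integral_distr)
    show "(\<lambda>w. w t) \<in> restrict_space (P i) {w. ereal t < hit0 w} \<rightarrow>\<^sub>M borel"
      by (rule measurable_restrict_space1) (simp only: measurable_P[OF i] measurable_eval[OF t])
    show "f \<in> borel_measurable (distr (restrict_space (P i) {w. ereal t < hit0 w}) borel (\<lambda>w. w t))"
      unfolding measurable_distr_eq1 by (rule measurable_fst_nat)
  qed
  also have "\<dots> = (\<integral>\<^sup>+w. f (w t) * indicator {w. ereal t < hit0 w} w \<partial>P i)"
    by (rule nn_integral_restrict_space[OF A])
  finally show ?thesis .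
qed

lemma measurable_state_pair:
  assumes g: "g \<in> borel_measurable (borel \<Otimes>\<^sub>M \<Omega>)"
  shows "(\<lambda>(x :: nat \<times> real, v). g (snd x, v)) \<in> borel_measurable (borel \<Otimes>\<^sub>M \<Omega>)"
proof -
  have "(\<lambda>z :: (nat \<times> real) \<times> (real \<Rightarrow> nat). (snd (fst z), snd z)) \<in> borel \<Otimes>\<^sub>M \<Omega> \<rightarrow>\<^sub>M borel \<Otimes>\<^sub>M \<Omega>"
    by (intro measurable_Pair measurable_snd measurable_compose[OF measurable_fst borel_snd])
  from measurable_compose[OF this g] show ?thesis by (simp add: case_prod_beta)
qed

text \<open>The process with initial age is a functional of the chain. At time \<open>s\<close> only
  the state \<open>w s\<close> selects the new law; the age reached is handed on as an argument of
  \<open>Psi\<close>.\<close>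

lemma markov_hat:
  assumes i: "i \<in> S" and s: "0 \<le> s" and A: "A \<in> borel_measurable (path_filtration S s)"
    and Psi: "Psi \<in> borel_measurable (borel \<Otimes>\<^sub>M \<Omega>)"
  shows "(\<integral>\<^sup>+w. A w * Psi (hat_X u s w, shift s w) \<partial>P i) =
    (\<integral>\<^sup>+w. A w * (\<integral>\<^sup>+v. Psi (hat_X u s w, v) \<partial>P (w s)) \<partial>P i)"
proof -
  have "(\<lambda>z. (hat_X u s (fst z), snd z)) \<in> path_filtration S s \<Otimes>\<^sub>M \<Omega> \<rightarrow>\<^sub>M borel \<Otimes>\<^sub>M \<Omega>"
    by (intro measurable_Pair measurable_snd measurable_compose[OF measurable_fst measurable_hat_X_filtration[OF s order_refl]])
  from measurable_compose[OF this Psi]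
  have "(\<lambda>z. A (fst z) * Psi (hat_X u s (fst z), snd z)) \<in> borel_measurable (path_filtration S s \<Otimes>\<^sub>M \<Omega>)"
    by (intro borel_measurable_times_ennreal measurable_compose[OF measurable_fst A])
  from markov_nn_integral[OF i s this]
  have "(\<integral>\<^sup>+w. A w * Psi (hat_X u s w, shift s w) \<partial>P i) = (\<integral>\<^sup>+w. \<integral>\<^sup>+v. A w * Psi (hat_X u s w, v) \<partial>P (w s) \<partial>P i)"
    by simp
  also have "\<dots> = (\<integral>\<^sup>+w. A w * (\<integral>\<^sup>+v. Psi (hat_X u s w, v) \<partial>P (w s)) \<partial>P i)"
  proof (rule nn_integral_cong)
    fix w assume "w \<in> space (P i)"
    then have j: "w s \<in> S" using i s cadlag_in[of w S s] by simp
    have "(\<lambda>v. Psi (hat_X u s w, v)) \<in> borel_measurable \<Omega>"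
      by (rule measurable_compose[OF measurable_Pair1' Psi]) simp
    then show "(\<integral>\<^sup>+v. A w * Psi (hat_X u s w, v) \<partial>P (w s)) = A w * (\<integral>\<^sup>+v. Psi (hat_X u s w, v) \<partial>P (w s))"
      by (intro nn_integral_cmult) (simp add: j)
  qed
  finally show ?thesis .
qed

definition alive :: "real \<Rightarrow> real \<Rightarrow> (real \<Rightarrow> nat) \<Rightarrow> ennreal" where
  "alive u t w = (if ereal t < tau u w then 1 else 0)"

lemma alive_filtration: "0 \<le> t \<Longrightarrow> t \<le> s \<Longrightarrow> alive u t \<in> borel_measurable (path_filtration S s)"
  unfolding alive_def
  by (intro measurable_If measurable_const pred_less_tau_filtration[unfolded pred_def]) simp_all

lemma alive_flow:
  assumes "w \<in> paths S" "0 \<le> s" "0 \<le> t"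
  shows "alive u (s + t) w = alive u s w * alive (age u s w) t (shift s w)"
  using tau_flow[OF assms, of u] by (auto simp: alive_def)

lemma W_alive: "W f x t = (\<integral>\<^sup>+w. alive (snd x) t w * f (hat_X (snd x) t w) \<partial>P (fst x))"
  unfolding W_eq alive_def by (intro nn_integral_cong) simp

lemma alive_pair_measurable:
  assumes t: "0 \<le> t" and f: "f \<in> borel_measurable borel"
  shows "(\<lambda>(u, v). alive u t v * f (hat_X u t v)) \<in> borel_measurable (borel \<Otimes>\<^sub>M \<Omega>)"
proof -
  have "(\<lambda>x. f ((\<lambda>(u, v). hat_X u t v) x)) \<in> borel_measurable (borel \<Otimes>\<^sub>M \<Omega>)"
    by (rule measurable_compose[OF measurable_hat_X_pair[OF t] f])
  moreover have "(\<lambda>x. if ereal t < (\<lambda>(u, v). tau u v) x then 1 else 0 :: ennreal) \<in> borel_measurable (borel \<Otimes>\<^sub>M \<Omega>)"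
    using measurable_tau_pair[of S] by measurable
  ultimately have "(\<lambda>x. (if ereal t < (\<lambda>(u, v). tau u v) x then 1 else 0 :: ennreal) * f ((\<lambda>(u, v). hat_X u t v) x)) \<in> borel_measurable (borel \<Otimes>\<^sub>M \<Omega>)"
    by (rule borel_measurable_times_ennreal[rotated])
  then show ?thesis by (simp add: alive_def case_prod_beta)
qed

text \<open>The Chapman-Kolmogorov equation under a weight \<open>A\<close> that may depend on the
  path up to \<open>s\<close>. The weight is what later turns statements about the semigroup into
  densities on path space.\<close>

lemma W_semigroup:
  assumes i: "fst x \<in> S" and st: "0 \<le> s" "0 \<le> t" and f: "f \<in> borel_measurable borel"
    and A: "A \<in> borel_measurable (path_filtration S s)"
  shows "(\<integral>\<^sup>+w. A w * (alive (snd x) (s + t) w * f (hat_X (snd x) (s + t) w)) \<partial>P (fst x)) =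
    (\<integral>\<^sup>+w. A w * (alive (snd x) s w * W f (hat_X (snd x) s w) t) \<partial>P (fst x))"
proof -
  let ?u = "snd x"
  let ?Psi = "\<lambda>(x :: nat \<times> real, v). (\<lambda>(u, v). alive u t v * f (hat_X u t v)) (snd x, v)"
  have Psi: "?Psi \<in> borel_measurable (borel \<Otimes>\<^sub>M \<Omega>)"
    by (rule measurable_state_pair[OF alive_pair_measurable[OF st(2) f]])
  have Am: "(\<lambda>w. A w * alive ?u s w) \<in> borel_measurable (path_filtration S s)"
    by (intro borel_measurable_times_ennreal A alive_filtration st(1)) simp
  have "(\<integral>\<^sup>+w. A w * (alive ?u (s + t) w * f (hat_X ?u (s + t) w)) \<partial>P (fst x)) =
     (\<integral>\<^sup>+w. A w * alive ?u s w * ?Psi (hat_X ?u s w, shift s w) \<partial>P (fst x))"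
  proof (rule nn_integral_cong)
    fix w assume "w \<in> space (P (fst x))"
    then have w: "w \<in> paths S" using i by simp
    show "A w * (alive ?u (s + t) w * f (hat_X ?u (s + t) w)) = A w * alive ?u s w * ?Psi (hat_X ?u s w, shift s w)"
      by (simp add: alive_flow[OF w st] hat_X_flow[OF w st] age_def[symmetric] mult.assoc)
  qed
  also have "\<dots> = (\<integral>\<^sup>+w. A w * alive ?u s w * (\<integral>\<^sup>+v. ?Psi (hat_X ?u s w, v) \<partial>P (w s)) \<partial>P (fst x))"
    by (rule markov_hat[OF i st(1) Am Psi])
  also have "\<dots> = (\<integral>\<^sup>+w. A w * (alive ?u s w * W f (hat_X ?u s w) t) \<partial>P (fst x))"
    by (intro nn_integral_cong) (simp add: W_alive hat_X_eq mult.assoc)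
  finally show ?thesis .
qed

lemma W_1: "fst x \<in> S \<Longrightarrow> W (\<lambda>_. 1) x t = ennreal (sv x t)"
proof -
  assume i: "fst x \<in> S"
  interpret prob_space "P (fst x)" by (rule prob_space_P[OF i])
  have "W (\<lambda>_. 1) x t = (\<integral>\<^sup>+w. indicator {w \<in> paths S. ereal t < tau (snd x) w} w \<partial>P (fst x))"
    unfolding W_eq by (intro nn_integral_cong) (use i in \<open>auto simp: indicator_def\<close>)
  also have "\<dots> = emeasure (P (fst x)) {w \<in> paths S. ereal t < tau (snd x) w}"
    by (rule nn_integral_indicator) (use tau_sets i in simp)
  finally show ?thesis using i by (simp add: sv_eq emeasure_eq_measure)
qed

lemma sv_markov:
  assumes i: "fst x \<in> S" and st: "0 \<le> s" "0 \<le> t" and A: "A \<in> borel_measurable (path_filtration S s)"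
  shows "(\<integral>\<^sup>+w. A w * alive (snd x) (s + t) w \<partial>P (fst x)) =
    (\<integral>\<^sup>+w. A w * (alive (snd x) s w * ennreal (sv (hat_X (snd x) s w) t)) \<partial>P (fst x))"
proof -
  have "(\<integral>\<^sup>+w. A w * alive (snd x) (s + t) w \<partial>P (fst x)) = (\<integral>\<^sup>+w. A w * (alive (snd x) s w * W (\<lambda>_. 1) (hat_X (snd x) s w) t) \<partial>P (fst x))"
    using W_semigroup[OF i st _ A, of "\<lambda>_. 1"] by simp
  also have "\<dots> = (\<integral>\<^sup>+w. A w * (alive (snd x) s w * ennreal (sv (hat_X (snd x) s w) t)) \<partial>P (fst x))"
    by (intro nn_integral_cong) (use cadlag_in st(1) i in \<open>simp add: W_1 hat_X_eq\<close>)
  finally show ?thesis .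
qed

lemma alive_measurable: "alive u t \<in> borel_measurable \<Omega>"
  unfolding alive_def using measurable_tau[of u S] by measurable

lemma sv_measurable: "0 \<le> t \<Longrightarrow> (\<lambda>x. if fst x \<in> S then sv x t else 0) \<in> borel_measurable borel"
proof -
  assume t: "0 \<le> t"
  have "(\<lambda>x. (\<lambda>j x. if j \<in> S then enn2real (W (\<lambda>_. 1) (j, snd x) t) else 0) (fst x) x) \<in> borel_measurable (borel :: (nat \<times> real) measure)"
  proof (rule measurable_compose_countable[where g = fst and f = "\<lambda>j x. if j \<in> S then enn2real (W (\<lambda>_. 1) (j, snd x) t) else 0"])
    show "fst \<in> (borel :: (nat \<times> real) measure) \<rightarrow>\<^sub>M count_space UNIV"
      using borel_fst by (simp add: measurable_cong_sets[OF refl sets_borel_eq_count_space])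
    fix j
    show "(\<lambda>x :: nat \<times> real. if j \<in> S then enn2real (W (\<lambda>_. 1) (j, snd x) t) else 0) \<in> borel_measurable borel"
    proof (cases "j \<in> S")
      case True
      interpret prob_space "P j" by (rule prob_space_P[OF True])
      have "(\<lambda>(u, v). alive u t v * (\<lambda>_. 1) (hat_X u t v)) \<in> borel_measurable (borel \<Otimes>\<^sub>M P j)"
        using alive_pair_measurable[OF t, of "\<lambda>_. 1"] True by (simp cong: measurable_cong_sets sets_pair_measure_cong)
      then have "(\<lambda>u. \<integral>\<^sup>+v. alive u t v * (\<lambda>_. 1) (hat_X u t v) \<partial>P j) \<in> borel_measurable borel"
        by (intro borel_measurable_nn_integral) simp
      from measurable_compose[OF borel_snd this]
      have "(\<lambda>x :: nat \<times> real. W (\<lambda>_. 1) (j, snd x) t) \<in> borel_measurable borel" by (simp add: W_alive)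
      then show ?thesis using True by (simp add: borel_measurable_enn2real)
    qed simp
  qed
  also have "(\<lambda>x. (\<lambda>j x. if j \<in> S then enn2real (W (\<lambda>_. 1) (j, snd x) t) else 0) (fst x) x) =
     (\<lambda>x. if fst x \<in> S then sv x t else 0)"
  proof
    fix x :: "nat \<times> real"
    show "(if fst x \<in> S then enn2real (W (\<lambda>_. 1) (fst x, snd x) t) else 0) = (if fst x \<in> S then sv x t else 0)"
      using W_1[of x t] sv_nonneg[of x t] by simp
  qed
  finally show ?thesis .
qed

lemma sv_hat_measurable:
  assumes "0 \<le> s" "0 \<le> t"
  shows "(\<lambda>w. sv (hat_X u s w) t) \<in> borel_measurable \<Omega>"
proof -
  have "(\<lambda>w. if fst (hat_X u s w) \<in> S then sv (hat_X u s w) t else 0) \<in> borel_measurable \<Omega>"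
    by (rule measurable_compose[OF measurable_hat_X[OF assms(1)] sv_measurable[OF assms(2)]])
  then show ?thesis
    by (rule measurable_cong[THEN iffD1, rotated]) (use cadlag_in assms(1) in \<open>simp add: hat_X_eq\<close>)
qed

end

lemma ennreal_divide_cmult: "0 < c \<Longrightarrow> 0 \<le> x \<Longrightarrow> ennreal (x / c) = ennreal x * ennreal (1 / c)"
  by (simp add: ennreal_mult[symmetric])

context subexp_chain
begin

lemma h_0: "h (0, u) = hz u" by (simp add: h_def h_fun_def hz_def q0_def Let_def)

lemma h_C: "i \<noteq> 0 \<Longrightarrow> h (i, u) = 1 + a i / L" by (simp add: h_def h_fun_def c_def Let_def)

lemma h_pos: "x \<in> hat_S S \<Longrightarrow> 0 < h x"
  unfolding h_def by (rule heavy_tails_ratio(3)[OF heavy])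

lemma sv_h_ratio: "x \<in> hat_S S \<Longrightarrow> ((\<lambda>t. sv x t / s0 t) \<longlongrightarrow> h x) at_top"
  unfolding h_def by (rule heavy_tails_ratio(2)[OF heavy])

lemma s0_long: "long_tailed s0" using sv_long_tailed[of 0] by simp

lemma s0_pos: "0 < s0 t"
proof -
  obtain T where T: "\<And>t. t \<ge> T \<Longrightarrow> s0 t \<noteq> 0"
    using long_tailed_nonzero[OF s0_long] unfolding eventually_at_top_linorder by blast
  have "0 < s0 (max t T)" using T[of "max t T"] s0(1)[of "max t T"] by (simp add: less_le)
  also have "\<dots> \<le> s0 t" by (rule s0) simp
  finally show ?thesis .
qed

lemma h_measurable [measurable]: "h \<in> borel_measurable borel"
proof -
  have "(\<lambda>x. if fst x = 0 then hz (snd x) else c (fst x)) \<in> borel_measurable borel"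
  proof (rule measurable_If)
    show "(\<lambda>x :: nat \<times> real. hz (snd x)) \<in> borel_measurable borel"
      unfolding hz_def by (intro borel_measurable_continuous_onI continuous_intros) (use exp_q0 in auto)
    show "(\<lambda>x :: nat \<times> real. c (fst x)) \<in> borel_measurable borel"
      by (rule measurable_compose[OF borel_fst measurable_fst_nat])
    have "fst -` {0} \<inter> space borel \<in> sets (borel :: (nat \<times> real) measure)"
      by (rule measurable_sets[OF borel_fst]) simp
    also have "fst -` {0} \<inter> space borel = {x \<in> space (borel :: (nat \<times> real) measure). fst x = 0}" by auto
    finally show "{x \<in> space (borel :: (nat \<times> real) measure). fst x = 0} \<in> sets borel" .
  qed
  also have "(\<lambda>x. if fst x = 0 then hz (snd x) else c (fst x)) = h"
    by (auto simp: h_def h_fun_def Let_def hz_def q0_def)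
  finally show ?thesis .
qed

definition wh :: "nat \<times> real \<Rightarrow> real \<Rightarrow> ennreal" where "wh = W (\<lambda>y. ennreal (h y))"

text \<open>Fatou's lemma for the quotients \<open>sv (X t) n / s0 n\<close>, which tend to
  \<open>h\<close> at the state at time \<open>t\<close>. By the Markov property their integral is
  \<open>sv x (n + t) / s0 n\<close>, and the long tail sends this to \<open>h x\<close>.\<close>

lemma w_le:
  assumes x: "x \<in> hat_S S" and t: "0 \<le> t"
  shows "wh x t \<le> ennreal (h x)"
proof -
  have i: "fst x \<in> S" and u: "0 \<le> snd x" using hat_S_D[OF x S_0] by auto
  have lt: "((\<lambda>T. s0 (T + t) / s0 T) \<longlongrightarrow> 1) at_top" using s0_long t unfolding long_tailed_def by blast
  have r: "((\<lambda>T. sv x (T + t) / s0 (T + t)) \<longlongrightarrow> h x) at_top"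
    using tendsto_shift_at_top[OF sv_h_ratio[OF x], of "- t"] by simp
  have "((\<lambda>T. sv x (T + t) / s0 (T + t) * (s0 (T + t) / s0 T)) \<longlongrightarrow> h x * 1) at_top"
    by (rule tendsto_mult[OF r lt])
  moreover have "sv x (T + t) / s0 (T + t) * (s0 (T + t) / s0 T) = sv x (T + t) / s0 T" for T
    using s0_pos[of "T + t"] by simp
  ultimately have "((\<lambda>T. sv x (T + t) / s0 T) \<longlongrightarrow> h x) at_top" by (simp only: mult_1_right)
  then have lim: "(\<lambda>n. sv x (real n + t) / s0 (real n)) \<longlonglongrightarrow> h x"
    by (rule filterlim_compose[OF _ filterlim_real_sequentially])
  let ?f = "\<lambda>n w. alive (snd x) t w * ennreal (sv (hat_X (snd x) t w) (real n) / s0 (real n))"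
  have "wh x t = (\<integral>\<^sup>+w. alive (snd x) t w * ennreal (h (hat_X (snd x) t w)) \<partial>P (fst x))"
    by (simp add: wh_def W_alive)
  also have "\<dots> \<le> ennreal (h x)"
  proof (rule nn_integral_limit_le[where f = ?f])
    show "?f n \<in> borel_measurable (P (fst x))" for n
      unfolding measurable_P[OF i]
      by (intro borel_measurable_times_ennreal alive_measurable measurable_compose[OF _ measurable_ennreal]
          borel_measurable_divide sv_hat_measurable t borel_measurable_const) simp
    show "(\<lambda>n. ?f n w) \<longlonglongrightarrow> alive (snd x) t w * ennreal (h (hat_X (snd x) t w))"
      if "w \<in> space (P (fst x))" for w
    proof (cases "ereal t < tau (snd x) w")
      case True
      have w: "w \<in> paths S" using that i by simp
      have "hat_X (snd x) t w \<in> hat_S S" by (rule hat_X_in_hat_S[OF w u t True])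
      from filterlim_compose[OF sv_h_ratio[OF this] filterlim_real_sequentially]
      show ?thesis using True by (simp add: alive_def tendsto_ennrealI)
    qed (simp add: alive_def)
    have "(\<integral>\<^sup>+w. ?f n w \<partial>P (fst x)) = ennreal (sv x (real n + t) / s0 (real n))" for n
    proof -
      have "(\<integral>\<^sup>+w. ?f n w \<partial>P (fst x)) = (\<integral>\<^sup>+w. ennreal (1 / s0 (real n)) * (alive (snd x) t w * ennreal (sv (hat_X (snd x) t w) (real n))) \<partial>P (fst x))"
        by (intro nn_integral_cong) (simp only: ennreal_divide_cmult[OF s0_pos sv_nonneg] mult_ac)
      also have "\<dots> = (\<integral>\<^sup>+w. ennreal (1 / s0 (real n)) * alive (snd x) (t + real n) w \<partial>P (fst x))"
        by (rule sv_markov[OF i t, symmetric]) auto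
      also have "\<dots> = ennreal (1 / s0 (real n)) * (\<integral>\<^sup>+w. alive (snd x) (t + real n) w \<partial>P (fst x))"
        by (rule nn_integral_cmult) (simp add: measurable_P[OF i] alive_measurable)
      also have "(\<integral>\<^sup>+w. alive (snd x) (t + real n) w \<partial>P (fst x)) = ennreal (sv x (t + real n))"
        using W_1[OF i, of "t + real n"] by (simp add: W_alive)
      finally show ?thesis by (simp only: ennreal_divide_cmult[OF s0_pos sv_nonneg] mult.commute add.commute)
    qed
    then show "(\<lambda>n. \<integral>\<^sup>+w. ?f n w \<partial>P (fst x)) \<longlonglongrightarrow> ennreal (h x)"
      using tendsto_ennrealI[OF lim] by simp
  qed
  finally show ?thesis .
qed

text \<open>The event is known at time \<open>t\<close>, although it says that 0 is hit strictly
  later: it means no entrance before \<open>t\<close> and a nonzero state at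
  \<open>t\<close>.\<close>

lemma hit0_filtration:
  assumes t: "0 \<le> t"
  shows "{w \<in> paths S. ereal t < hit0 w} \<in> sets (path_filtration S t)"
proof -
  have "{w \<in> space (path_filtration S t). \<not> (hits {0} w \<and> entry {0} w < t)} \<in> sets (path_filtration S t)"
  proof (cases "t > 0")
    case True
    have "Measurable.pred (path_filtration S t) (\<lambda>w. \<not> (hits {0} w \<and> entry {0} w < t))"
      using pred_entry_less_filtration[OF True order_refl, of "{0}" S] by (rule pred_intros_logic(2))
    then show ?thesis unfolding pred_def .
  next
    case False
    have "\<not> (hits {0} w \<and> entry {0} w < t)" if "w \<in> paths S" for w
      using entry_nonneg[OF that, of "{0}"] False by auto
    then have "{w \<in> space (path_filtration S t). \<not> (hits {0} w \<and> entry {0} w < t)} = space (path_filtration S t)"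
      unfolding space_path_filtration by blast
    then show ?thesis by (metis sets.top)
  qed
  moreover have "{w \<in> paths S. w t \<in> away} \<in> sets (path_filtration S t)"
    by (rule eval_in_filtration[OF t order_refl])
  ultimately have "{w \<in> space (path_filtration S t). \<not> (hits {0} w \<and> entry {0} w < t)} \<inter> {w \<in> paths S. w t \<in> away} \<in> sets (path_filtration S t)"
    by (rule sets.Int)
  moreover have "{w \<in> space (path_filtration S t). \<not> (hits {0} w \<and> entry {0} w < t)} \<inter> {w \<in> paths S. w t \<in> away}
    = {w \<in> paths S. ereal t < hit0 w}"
  proof (rule set_eqI)
    fix w
    show "w \<in> {w \<in> space (path_filtration S t). \<not> (hits {0} w \<and> entry {0} w < t)} \<inter> {w \<in> paths S. w t \<in> away} \<longleftrightarrow>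
       w \<in> {w \<in> paths S. ereal t < hit0 w}"
    proof (cases "w \<in> paths S")
      case w: True
      have "w t \<in> away" if "hits {0} w \<Longrightarrow> t < entry {0} w"
        using before_entry[OF w t that] by simp
      moreover have "t < entry {0} w" if "hits {0} w" "\<not> entry {0} w < t" "w t \<in> away"
        using that entry_in[OF w that(1)] by (cases "entry {0} w = t") auto
      ultimately show ?thesis using less_hit0_iff[OF w, of t] w unfolding space_path_filtration by fastforce
    qed simp
  qed
  ultimately show ?thesis by metis
qed

lemma a_superharmonic: "superharmonic (S - {0}) (tilde_P P) a"
  unfolding superharmonic_def
proof (intro conjI ballI allI impI)
  show "0 \<le> a i" if "i \<in> S - {0}" for i using a_pos[OF that] by simp
  fix t :: real and i assume t: "0 \<le> t" and i': "i \<in> S - {0}"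
  then have i: "i \<in> S" by simp
  interpret prob_space "P i" by (rule prob_space_P[OF i])
  let ?A = "{w \<in> paths S. ereal t < hit0 w}"
  let ?f = "\<lambda>(n::nat) w. ennreal (phi (w t) (real n) / phi 1 (real n)) * indicator ?A w"
  have Am: "?A \<in> sets \<Omega>" by (rule hit0_sets)
  have inC: "w t \<in> S - {0}" if "w \<in> ?A" for w
    using that less_hit0_zero_free[of w S t] cadlag_in[of w S t] t by auto
  have "(\<integral>\<^sup>+y. ennreal (a y) \<partial>tilde_P P t i) = (\<integral>\<^sup>+w. ennreal (a (w t)) * indicator ?A w \<partial>P i)"
    unfolding nn_integral_tilde_P[OF i t] by (intro nn_integral_cong) (use i in \<open>simp add: indicator_def\<close>)
  also have "\<dots> \<le> ennreal (a i)"
  proof (rule nn_integral_limit_le[where f = ?f])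
    show "?f n \<in> borel_measurable (P i)" for n
      unfolding measurable_P[OF i]
      by (intro borel_measurable_times_ennreal borel_measurable_indicator Am
          measurable_compose[OF measurable_eval[OF t] measurable_fst_nat])
    show "(\<lambda>n. ?f n w) \<longlonglongrightarrow> ennreal (a (w t)) * indicator ?A w" for w
    proof (cases "w \<in> ?A")
      case True
      have "(\<lambda>n. ennreal (phi (w t) (real n) / phi 1 (real n))) \<longlonglongrightarrow> ennreal (a (w t))"
        by (rule tendsto_ennrealI[OF filterlim_compose[OF phi_ratio[OF inC[OF True]] filterlim_real_sequentially]])
      then show ?thesis unfolding indicator_simps(1)[OF True] mult_1_right .
    next
      case False
      show ?thesis unfolding indicator_simps(2)[OF False] mult_zero_right by (rule tendsto_const)
    qed
    have ph: "0 < phi 1 (real n)" for n by (rule phi_pos[OF one_in])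
    have "(\<integral>\<^sup>+w. ?f n w \<partial>P i) = ennreal (phi i (t + real n) / phi 1 (real n))" for n
    proof -
      \<comment> \<open>The Markov property at time \<open>t\<close> joins the two avoidance events
        to the avoidance of 0 up to \<open>t + n\<close>, so the integral becomes a quotient of
        tails with limit \<open>a i\<close>.\<close>
      let ?B = "{w \<in> paths S. ereal (real n) < hit0 w}"
      let ?Phi = "\<lambda>(w, v). ennreal (1 / phi 1 (real n)) * (indicator ?A w * indicator ?B v) :: ennreal"
      have m1: "(\<lambda>z. indicator ?A (fst z) * indicator ?B (snd z) :: ennreal) \<in> borel_measurable (path_filtration S t \<Otimes>\<^sub>M \<Omega>)"
        by (intro borel_measurable_times_ennreal measurable_compose[OF measurable_fst borel_measurable_indicator]
            measurable_compose[OF measurable_snd borel_measurable_indicator] hit0_filtration t hit0_sets)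
      have m: "?Phi \<in> borel_measurable (path_filtration S t \<Otimes>\<^sub>M \<Omega>)"
        unfolding case_prod_beta by (rule borel_measurable_times_ennreal[OF borel_measurable_const m1])
      have "(\<integral>\<^sup>+w. ?f n w \<partial>P i) = (\<integral>\<^sup>+w. \<integral>\<^sup>+v. ?Phi (w, v) \<partial>P (w t) \<partial>P i)"
      proof (rule nn_integral_cong)
        fix w assume "w \<in> space (P i)"
        then have j: "w t \<in> S" using i t cadlag_in[of w S t] by simp
        interpret Pj: prob_space "P (w t)" by (rule prob_space_P[OF j])
        have Bm: "?B \<in> sets (P (w t))" unfolding sets_P[OF j] by (rule hit0_sets)
        have "(\<integral>\<^sup>+v. ?Phi (w, v) \<partial>P (w t)) = (\<integral>\<^sup>+v. (ennreal (1 / phi 1 (real n)) * indicator ?A w) * indicator ?B v \<partial>P (w t))"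
          by (simp only: prod.case mult.assoc)
        also have "\<dots> = (ennreal (1 / phi 1 (real n)) * indicator ?A w) * emeasure (P (w t)) ?B"
          by (rule nn_integral_cmult_indicator[OF Bm])
        also have "emeasure (P (w t)) ?B = ennreal (phi (w t) (real n))"
          using j by (simp add: hit0_tail_def Pj.emeasure_eq_measure)
        finally show "?f n w = (\<integral>\<^sup>+v. ?Phi (w, v) \<partial>P (w t))"
          using ph[of n] by (subst ennreal_divide_cmult) (auto simp: hit0_tail_def mult_ac)
      qed
      also have "\<dots> = (\<integral>\<^sup>+w. ?Phi (w, shift t w) \<partial>P i)" by (rule markov_nn_integral[OF i t m, symmetric])
      also have "\<dots> = (\<integral>\<^sup>+w. ennreal (1 / phi 1 (real n)) * indicator {w \<in> paths S. ereal (t + real n) < hit0 w} w \<partial>P i)"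
      proof (rule nn_integral_cong)
        fix w assume "w \<in> space (P i)"
        then have wp: "w \<in> paths S" using i by simp
        show "?Phi (w, shift t w) = ennreal (1 / phi 1 (real n)) * indicator {w \<in> paths S. ereal (t + real n) < hit0 w} w"
          using hit0_flow[OF wp t, of "real n"] shift_cadlag[OF wp t] wp by (simp add: indicator_def)
      qed
      also have "\<dots> = ennreal (1 / phi 1 (real n)) * emeasure (P i) {w \<in> paths S. ereal (t + real n) < hit0 w}"
        by (rule nn_integral_cmult_indicator) (use hit0_sets sets_P[OF i] in blast)
      also have "emeasure (P i) {w \<in> paths S. ereal (t + real n) < hit0 w} = ennreal (phi i (t + real n))"
        using i by (simp add: hit0_tail_def emeasure_eq_measure)
      finally show ?thesis
        using ph[of n] phi_pos[OF i', of "t + real n"] by (subst ennreal_divide_cmult) (auto simp: mult_ac)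
    qed
    moreover have "(\<lambda>n. phi i (t + real n) / phi 1 (real n)) \<longlonglongrightarrow> a i"
    proof -
      have "((\<lambda>T. phi i (T + t) / phi 1 (T + t) * (phi 1 (T + t) / phi 1 T)) \<longlongrightarrow> a i * 1) at_top"
        using tendsto_shift_at_top[OF phi_ratio[OF i'], of "- t"] phi_long[OF t] by (intro tendsto_mult) auto
      moreover have "phi i (T + t) / phi 1 (T + t) * (phi 1 (T + t) / phi 1 T) = phi i (t + T) / phi 1 T" for T
        using phi_pos[OF one_in, of "T + t"] by (simp add: add.commute)
      ultimately have "((\<lambda>T. phi i (t + T) / phi 1 T) \<longlongrightarrow> a i) at_top" by (simp only: mult_1_right)
      then show ?thesis by (rule filterlim_compose[OF _ filterlim_real_sequentially])
    qed
    ultimately show "(\<lambda>n. \<integral>\<^sup>+w. ?f n w \<partial>P i) \<longlonglongrightarrow> ennreal (a i)" by (simp add: tendsto_ennrealI)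
  qed
  finally show "(\<integral>\<^sup>+y. ennreal (a y) \<partial>tilde_P P t i) \<le> ennreal (a i)" .
qed

end

section \<open>Harmonicity of \<open>h\<close>\<close>

locale harmonic_chain = subexp_chain +
  assumes a_harmonic: "harmonic (S - {0}) (tilde_P P) a"
begin

text \<open>The time left after a restart is \<open>t - y\<close> with random \<open>y\<close>, so
  measurability in time and path together is needed; \<open>max 0\<close> keeps the time argument
  where paths are controlled.\<close>

lemma time_functional_measurable:
  assumes b: "0 \<le> b"
  shows "(\<lambda>(y, v). indicator {..b} y * (alive 0 (max 0 (t - y)) v * ennreal (h (hat_X 0 (max 0 (t - y)) v))))
    \<in> borel_measurable (borel \<Otimes>\<^sub>M \<Omega>)"
proof -
  have "(\<lambda>z :: real \<times> (real \<Rightarrow> nat). (t - fst z, snd z)) \<in> borel \<Otimes>\<^sub>M \<Omega> \<rightarrow>\<^sub>M borel \<Otimes>\<^sub>M \<Omega>"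
    by measurable
  from measurable_compose[OF this measurable_hat_X_time]
  have X: "(\<lambda>z. hat_X 0 (max 0 (t - fst z)) (snd z)) \<in> borel \<Otimes>\<^sub>M \<Omega> \<rightarrow>\<^sub>M borel" by (simp add: case_prod_beta)
  have T: "(\<lambda>z :: real \<times> (real \<Rightarrow> nat). tau 0 (snd z)) \<in> borel_measurable (borel \<Otimes>\<^sub>M \<Omega>)"
    by (rule measurable_compose[OF measurable_snd measurable_tau])
  have A: "(\<lambda>z :: real \<times> (real \<Rightarrow> nat). alive 0 (max 0 (t - fst z)) (snd z)) \<in> borel_measurable (borel \<Otimes>\<^sub>M \<Omega>)"
    unfolding alive_def using T by measurable
  have H: "(\<lambda>z. ennreal (h (hat_X 0 (max 0 (t - fst z)) (snd z)))) \<in> borel_measurable (borel \<Otimes>\<^sub>M \<Omega>)"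
    by (rule measurable_compose[OF measurable_compose[OF X h_measurable] measurable_ennreal])
  show ?thesis
    unfolding case_prod_beta
    by (intro borel_measurable_times_ennreal A H measurable_compose[OF measurable_fst borel_measurable_indicator]) simp
qed

lemma time_functional_integral:
  assumes j: "j \<in> S" and y: "y \<le> t"
  shows "(\<integral>\<^sup>+v. indicator {..b} y * (alive 0 (max 0 (t - y)) v * ennreal (h (hat_X 0 (max 0 (t - y)) v))) \<partial>P j)
    = indicator {..b} y * wh (j, 0) (t - y)"
proof -
  have "(\<lambda>v. alive 0 (max 0 (t - y)) v * ennreal (h (hat_X 0 (max 0 (t - y)) v))) \<in> borel_measurable (P j)"
    unfolding measurable_P[OF j]
    by (intro borel_measurable_times_ennreal alive_measurable measurable_compose[OF _ measurable_ennreal]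
        measurable_compose[OF measurable_hat_X h_measurable]) simp
  then have "(\<integral>\<^sup>+v. indicator {..b} y * (alive 0 (max 0 (t - y)) v * ennreal (h (hat_X 0 (max 0 (t - y)) v))) \<partial>P j)
    = indicator {..b} y * (\<integral>\<^sup>+v. alive 0 (max 0 (t - y)) v * ennreal (h (hat_X 0 (max 0 (t - y)) v)) \<partial>P j)"
    by (rule nn_integral_cmult)
  then show ?thesis using y by (simp add: wh_def W_alive max_absorb2)
qed

text \<open>A deficit at \<open>(0, 0)\<close> that is uniform in time is not enlarged when the
  process starts in \<open>i\<close>. Paths that avoid 0 contribute \<open>phi i t + a i / L\<close>
  exactly, by harmonicity of \<open>a\<close>; the others restart at 0 and contribute at least
  \<open>(1 - D) * (1 - phi i t)\<close>.\<close>

lemma w_lower_C: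
  assumes i': "i \<in> S - {0}" and t: "0 \<le> t" and D: "0 \<le> D" "D \<le> 1"
    and low: "\<And>r. 0 \<le> r \<Longrightarrow> ennreal (1 - D) \<le> wh (0, 0) r"
  shows "ennreal (h (i, 0) - D) \<le> wh (i, 0) t"
proof -
  have i: "i \<in> S" using i' by simp
  interpret F: subexp_law "hit_law i" by (rule subexp_hit[OF i'])
  interpret Pi: prob_space "P i" by (rule prob_space_P[OF i])
  let ?A = "{w \<in> paths S. ereal t < hit0 w}"
  let ?Phi = "\<lambda>(y, v). indicator {..t} y * (alive 0 (max 0 (t - y)) v * ennreal (h (hat_X 0 (max 0 (t - y)) v)))"
  have Phi: "?Phi \<in> borel_measurable (borel \<Otimes>\<^sub>M \<Omega>)" by (rule time_functional_measurable[OF t])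
  have Am: "?A \<in> sets \<Omega>" by (rule hit0_sets)
  have AP: "?A \<in> sets (P i)" unfolding sets_P[OF i] by (rule Am)
  have am: "(\<lambda>w. ennreal (a (w t)) * indicator ?A w) \<in> borel_measurable (P i)"
    unfolding measurable_P[OF i]
    by (intro borel_measurable_times_ennreal borel_measurable_indicator Am measurable_compose[OF measurable_eval[OF t] measurable_fst_nat])
  have g1: "(\<integral>\<^sup>+w. indicator ?A w * ennreal (h (w t, 0)) \<partial>P i) = ennreal (phi i t + a i / L)"
  proof -
    have "(\<integral>\<^sup>+w. indicator ?A w * ennreal (h (w t, 0)) \<partial>P i) =
      (\<integral>\<^sup>+w. indicator ?A w + ennreal (1 / L) * (ennreal (a (w t)) * indicator ?A w) \<partial>P i)"
    proof (rule nn_integral_cong)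
      fix w assume "w \<in> space (P i)"
      then have wp: "w \<in> paths S" using i by simp
      show "indicator ?A w * ennreal (h (w t, 0)) = indicator ?A w + ennreal (1 / L) * (ennreal (a (w t)) * indicator ?A w)"
      proof (cases "w \<in> ?A")
        case True
        then have nz: "w t \<noteq> 0" using less_hit0_zero_free[OF wp t] t by auto
        then have "0 \<le> a (w t)" using a_pos[of "w t"] cadlag_in[OF wp t] by (simp add: less_imp_le)
        then have "ennreal (h (w t, 0)) = 1 + ennreal (1 / L) * ennreal (a (w t))"
          using h_C[OF nz, of 0] L_pos by (simp add: ennreal_mult[symmetric] ennreal_1[symmetric] del: ennreal_1)
        then show ?thesis unfolding indicator_simps(1)[OF True] by simp
      next
        case False
        show ?thesis unfolding indicator_simps(2)[OF False] by simp
      qed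
    qed
    also have "\<dots> = emeasure (P i) ?A + ennreal (1 / L) * (\<integral>\<^sup>+w. ennreal (a (w t)) * indicator ?A w \<partial>P i)"
      using am AP by (subst nn_integral_add) (auto simp: nn_integral_cmult)
    also have "(\<integral>\<^sup>+w. ennreal (a (w t)) * indicator ?A w \<partial>P i) = (\<integral>\<^sup>+y. ennreal (a y) \<partial>tilde_P P t i)"
      unfolding nn_integral_tilde_P[OF i t] by (intro nn_integral_cong) (use i in \<open>simp add: indicator_def\<close>)
    also have "\<dots> = ennreal (a i)" using a_harmonic i' t by (simp add: harmonic_def)
    also have "emeasure (P i) ?A = ennreal (phi i t)" using i by (simp add: hit0_tail_def Pi.emeasure_eq_measure)
    finally show ?thesis
      using L_pos a_pos[OF i'] phi_pos[OF i', of t] by (simp add: ennreal_mult[symmetric] ennreal_plus[symmetric] del: ennreal_plus)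
  qed
  have g2: "ennreal ((1 - D) * (1 - phi i t)) \<le> (\<integral>\<^sup>+w\<in>{w. hits {0} w}. ?Phi (entry {0} w, shift_entry {0} w) \<partial>P i)"
  proof -
    have "ennreal ((1 - D) * (1 - phi i t)) = (\<integral>\<^sup>+y. ennreal (1 - D) * indicator {..t} y \<partial>hit_law i)"
      using D phi_le_1[OF i', of t] by (simp add: nn_integral_cmult_indicator F.tail_atMost phi_eq[OF i'] ennreal_mult)
    also have "\<dots> \<le> (\<integral>\<^sup>+y. (\<integral>\<^sup>+v. ?Phi (y, v) \<partial>P 0) \<partial>hit_law i)"
    proof (rule nn_integral_mono)
      fix y
      show "ennreal (1 - D) * indicator {..t} y \<le> (\<integral>\<^sup>+v. ?Phi (y, v) \<partial>P 0)"
      proof (cases "y \<le> t")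
        case True
        have "(\<integral>\<^sup>+v. ?Phi (y, v) \<partial>P 0) = indicator {..t} y * wh (0, 0) (t - y)"
          unfolding prod.case by (rule time_functional_integral[OF S_0 True])
        then show ?thesis using low[of "t - y"] True by simp
      qed simp
    qed
    also have "\<dots> = (\<integral>\<^sup>+w\<in>{w. hits {0} w}. ?Phi (entry {0} w, shift_entry {0} w) \<partial>P i)"
      by (rule hit_decomposition[OF i Phi, symmetric])
    finally show ?thesis .
  qed
  have "ennreal (h (i, 0) - D) \<le> ennreal ((phi i t + a i / L) + (1 - D) * (1 - phi i t))"
  proof (rule ennreal_leI)
    have "0 \<le> D * phi i t" using D phi_pos[OF i', of t] by simp
    then show "h (i, 0) - D \<le> (phi i t + a i / L) + (1 - D) * (1 - phi i t)"
      using i' by (simp add: h_C algebra_simps)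
  qed
  also have "\<dots> = ennreal (phi i t + a i / L) + ennreal ((1 - D) * (1 - phi i t))"
    using D L_pos a_pos[OF i'] phi_pos[OF i', of t] phi_le_1[OF i', of t] by (intro ennreal_plus) auto
  also have "\<dots> \<le> (\<integral>\<^sup>+w. indicator ?A w * ennreal (h (w t, 0)) \<partial>P i) +
      (\<integral>\<^sup>+w\<in>{w. hits {0} w}. ?Phi (entry {0} w, shift_entry {0} w) \<partial>P i)"
    unfolding g1 by (rule add_left_mono[OF g2])
  also have "\<dots> = (\<integral>\<^sup>+w. indicator ?A w * ennreal (h (w t, 0)) + ?Phi (entry {0} w, shift_entry {0} w) * indicator {w. hits {0} w} w \<partial>P i)"
  proof (rule nn_integral_add[symmetric])
    show "(\<lambda>w. indicator ?A w * ennreal (h (w t, 0))) \<in> borel_measurable (P i)"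
      unfolding measurable_P[OF i]
      by (intro borel_measurable_times_ennreal borel_measurable_indicator Am measurable_compose[OF measurable_eval[OF t] measurable_fst_nat])
    have hm: "{w \<in> space \<Omega>. hits {0} w} \<in> sets \<Omega>" using pred_hits[of "{0}" S] unfolding pred_def .
    have "(\<lambda>w. (entry {0} w, shift_entry {0} w)) \<in> \<Omega> \<rightarrow>\<^sub>M borel \<Otimes>\<^sub>M \<Omega>" by measurable
    from measurable_compose[OF this Phi]
    have "(\<lambda>w. ?Phi (entry {0} w, shift_entry {0} w) * indicator {w \<in> space \<Omega>. hits {0} w} w) \<in> borel_measurable \<Omega>"
      by (intro borel_measurable_times_ennreal borel_measurable_indicator hm)
    then show "(\<lambda>w. ?Phi (entry {0} w, shift_entry {0} w) * indicator {w. hits {0} w} w) \<in> borel_measurable (P i)"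
      unfolding measurable_P[OF i] by (rule measurable_cong[THEN iffD1, rotated]) (simp add: indicator_def)
  qed
  also have "\<dots> = wh (i, 0) t"
    unfolding wh_def W_alive fst_conv snd_conv
  proof (rule nn_integral_cong)
    fix w assume "w \<in> space (P i)"
    then have wp: "w \<in> paths S" using i by simp
    show "indicator ?A w * ennreal (h (w t, 0)) + ?Phi (entry {0} w, shift_entry {0} w) * indicator {w. hits {0} w} w
        = alive 0 t w * ennreal (h (hat_X 0 t w))"
    proof (cases "hits {0} w \<and> entry {0} w \<le> t")
      case True
      then have hh: "hits {0} w" and le: "entry {0} w \<le> t" by auto
      have e0: "0 \<le> entry {0} w" by (rule entry_nonneg[OF wp hh])
      have nA: "w \<notin> ?A" using less_hit0_iff[OF wp, of t] hh le by auto
      have "hat_X 0 t w = hat_X 0 (t - entry {0} w) (shift_entry {0} w)"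
        using hat_X_flow[OF wp e0, of "t - entry {0} w" 0] le e0 age_before_hit[OF wp e0, of ]
        by (simp add: shift_entry_def max_absorb2)
      moreover have "alive 0 t w = alive 0 (t - entry {0} w) (shift_entry {0} w)"
        unfolding alive_def using tau_after_hit[OF wp hh le] by simp
      ultimately show ?thesis unfolding indicator_simps(2)[OF nA] using hh le by (simp add: max_absorb2)
    next
      case False
      then have b: "hits {0} w \<Longrightarrow> t < entry {0} w" by auto
      have A: "w \<in> ?A" using less_hit0_iff[OF wp, of t] b wp by blast
      have "alive 0 t w = 1" unfolding alive_def using tau_before_hit[OF wp t b] by simp
      moreover have "hat_X 0 t w = (w t, 0)" using age_before_hit[OF wp t] b by (simp add: hat_X_eq less_imp_le)
      moreover have "?Phi (entry {0} w, shift_entry {0} w) * indicator {w. hits {0} w} w = 0"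
        using b by (auto simp: indicator_def)
      ultimately show ?thesis unfolding indicator_simps(1)[OF A] by simp
    qed
  qed
  finally show ?thesis .
qed

text \<open>The balance of \<open>hz\<close> during a stay at 0 when an exit is worth
  \<open>1 / p\<close>, the mean of \<open>h\<close> at the exit by \<open>mean_h\<close>. The
  second equation is the case in which age 1 is reached first.\<close>

lemma hz_identity:
  assumes "0 \<le> t"
  shows "u + t < 1 \<Longrightarrow> exp (- q0 * t) * hz (u + t) + (1 - exp (- q0 * t)) / p = hz u"
    and "(1 - exp (- q0 * (1 - u))) / p = hz u"
proof -
  show "(1 - exp (- q0 * (1 - u))) / p = hz u" by (simp add: hz_def p_def)
  have "exp (- q0 * t) * exp (- q0 * (1 - (u + t))) = exp (- q0 * (1 - u))"
    by (simp add: exp_add[symmetric] algebra_simps)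
  then have "exp (- q0 * t) * (1 - exp (- q0 * (1 - (u + t)))) + (1 - exp (- q0 * t)) = 1 - exp (- q0 * (1 - u))"
    by (simp only: right_diff_distrib mult_1_right)
  then show "exp (- q0 * t) * hz (u + t) + (1 - exp (- q0 * t)) / p = hz u"
    unfolding hz_def p_def times_divide_eq_right add_divide_distrib[symmetric] by (simp only:)
qed

text \<open>This is the fixed point equation for \<open>L\<close> in another form: the mean is
  \<open>1 + m / L\<close>.\<close>

lemma mean_h: "(\<Sum>j\<in>J. exit_prob j * h (j, 0)) = 1 / p"
proof -
  have "(\<Sum>j\<in>J. exit_prob j * h (j, 0)) = (\<Sum>j\<in>J. exit_prob j + exit_prob j * a j / L)"
  proof (rule sum.cong[OF refl])
    fix j assume "j \<in> J"
    then show "exit_prob j * h (j, 0) = exit_prob j + exit_prob j * a j / L"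
      using J_in[of j] by (simp add: h_C distrib_left)
  qed
  also have "\<dots> = 1 + m / L" by (simp add: sum.distrib exit_prob_sum_J m_def sum_divide_distrib[symmetric])
  also have "m / L = (1 - p) / p" using m_pos p by (simp add: L_def)
  also have "1 + (1 - p) / p = 1 / p" using p by (simp add: field_simps)
  finally show ?thesis .
qed

text \<open>Here the factor \<open>p\<close> is gained. While the process rests at 0 there is no
  deficit; a deficit can enter only through an exit before age 1, whose probability is at most
  \<open>p\<close>.\<close>

lemma w_lower_0:
  assumes u: "0 \<le> u" "u < 1" and t: "0 \<le> t" and D: "0 \<le> D" "D \<le> 1"
    and low: "\<And>j r. j \<in> J \<Longrightarrow> 0 \<le> r \<Longrightarrow> ennreal (h (j, 0) - D) \<le> wh (j, 0) r"
  shows "ennreal (hz u - p * D) \<le> wh (0, u) t"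
proof -
  interpret P0: prob_space "P 0" by (rule prob_space_P) simp
  \<comment> \<open>Exits count if they come by time \<open>t\<close> and before the age reaches 1,
    whichever bound is smaller.\<close>
  define b where "b = min t (1 - u)"
  have b: "0 \<le> b" "b \<le> t" "b \<le> 1 - u" using u t by (auto simp: b_def)
  define Z where "Z = {w \<in> paths S. zero_on w 0 t \<and> u + t < 1}"
  have Zm: "Z \<in> sets \<Omega>"
  proof (cases "u + t < 1")
    case True
    then show ?thesis using zero_on_sets'[OF t] by (simp add: Z_def)
  qed (simp add: Z_def)
  let ?F = "\<lambda>j. {w \<in> paths S. hits away w \<and> w (max 0 (entry away w)) = j}"
  let ?Phi = "\<lambda>(y, v). indicator {..b} y * (alive 0 (max 0 (t - y)) v * ennreal (h (hat_X 0 (max 0 (t - y)) v)))"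
  have Phi: "?Phi \<in> borel_measurable (borel \<Otimes>\<^sub>M \<Omega>)" by (rule time_functional_measurable[OF b(1)])
  have hj: "0 \<le> h (j, 0) - D" if "j \<in> J" for j
    using h_C[of j 0] J_in[OF that] a_pos[OF J_in[OF that]] L_pos D by (simp add: add_increasing2)
  have gj: "ennreal ((h (j, 0) - D) * ((1 - exp (- q0 * b)) * exit_prob j)) \<le>
      (\<integral>\<^sup>+w\<in>?F j. ?Phi (entry away w, shift_entry away w) \<partial>P 0)" if j: "j \<in> J" for j
  proof -
    have jS: "j \<in> S" using J_in[OF j] by simp
    let ?Fb = "{w \<in> paths S. hits away w \<and> w (max 0 (entry away w)) = j \<and> entry away w \<in> {..b}}"
    have "?F j \<inter> (entry away -` {..b} \<inter> space \<Omega>) \<in> sets \<Omega>"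
      by (intro sets.Int pred_entry_state measurable_sets[OF measurable_entry]) simp
    moreover have "?F j \<inter> (entry away -` {..b} \<inter> space \<Omega>) = ?Fb" unfolding space_skorokhod by blast
    ultimately have Fb: "?Fb \<in> sets (P 0)" unfolding sets_P[OF S_0] by metis
    have "ennreal ((h (j, 0) - D) * ((1 - exp (- q0 * b)) * exit_prob j)) = ennreal (h (j, 0) - D) * emeasure (P 0) ?Fb"
      unfolding P0.emeasure_eq_measure exit_before[OF b(1)] by (rule ennreal_mult'[OF hj[OF j]])
    also have "\<dots> = (\<integral>\<^sup>+w. ennreal (h (j, 0) - D) * indicator ?Fb w \<partial>P 0)"
      by (rule nn_integral_cmult_indicator[OF Fb, symmetric])
    also have "\<dots> \<le> (\<integral>\<^sup>+w\<in>?F j. (\<integral>\<^sup>+v. ?Phi (entry away w, v) \<partial>P j) \<partial>P 0)"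
    proof (rule nn_integral_mono)
      fix w assume "w \<in> space (P 0)"
      show "ennreal (h (j, 0) - D) * indicator ?Fb w \<le> (\<integral>\<^sup>+v. ?Phi (entry away w, v) \<partial>P j) * indicator (?F j) w"
      proof (cases "w \<in> ?Fb")
        case True
        then have F: "w \<in> ?F j" and e: "entry away w \<le> b" by (blast, blast)
        have "(\<integral>\<^sup>+v. ?Phi (entry away w, v) \<partial>P j) = indicator {..b} (entry away w) * wh (j, 0) (t - entry away w)"
          unfolding prod.case by (rule time_functional_integral[OF jS]) (use e b in simp)
        then show ?thesis
          unfolding indicator_simps(1)[OF True] indicator_simps(1)[OF F]
          using e b low[OF j, of "t - entry away w"] by simp
      next
        case False
        show ?thesis unfolding indicator_simps(2)[OF False] by simp
      qed
    qed
    also have "\<dots> = (\<integral>\<^sup>+w\<in>?F j. ?Phi (entry away w, shift_entry away w) \<partial>P 0)"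
      by (rule strong_markov[OF S_0 jS Phi, symmetric])
    finally show ?thesis .
  qed
  have g0: "(\<integral>\<^sup>+w. ennreal (hz (u + t)) * indicator Z w \<partial>P 0) = ennreal (if u + t < 1 then exp (- q0 * t) * hz (u + t) else 0)"
  proof -
    have "(\<integral>\<^sup>+w. ennreal (hz (u + t)) * indicator Z w \<partial>P 0) = ennreal (hz (u + t)) * emeasure (P 0) Z"
      by (rule nn_integral_cmult_indicator) (use Zm in simp)
    also have "\<dots> = ennreal (if u + t < 1 then exp (- q0 * t) * hz (u + t) else 0)"
    proof (cases "u + t < 1")
      case True
      then have "Z = {w \<in> paths S. zero_on w 0 t}" by (simp add: Z_def)
      then show ?thesis
        using True hz_pos[OF True] by (simp add: P0.emeasure_eq_measure zero_on_prob[OF t] ennreal_mult[symmetric] mult.commute del: minus_mult_left mult_minus_left)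
    qed (simp add: Z_def)
    finally show ?thesis .
  qed
  define B where "B = (if u + t < 1 then exp (- q0 * t) * hz (u + t) else 0)"
  have B0: "0 \<le> B" using hz_pos[of "u + t"] by (auto simp: B_def)
  have eb: "0 \<le> 1 - exp (- q0 * b)" using b q0_pos by simp
  have e1: "B + (1 - exp (- q0 * b)) / p = hz u"
  proof (cases "u + t < 1")
    case True
    then have "b = t" by (simp add: b_def)
    then show ?thesis using hz_identity(1)[OF t True] True by (simp add: B_def)
  next
    case False
    then have "b = 1 - u" by (simp add: b_def)
    then show ?thesis using hz_identity(2)[OF t, of u] False by (simp add: B_def)
  qed
  have e2: "(\<Sum>j\<in>J. (h (j, 0) - D) * ((1 - exp (- q0 * b)) * exit_prob j)) = (1 - exp (- q0 * b)) / p - D * (1 - exp (- q0 * b))"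
  proof -
    have "(\<Sum>j\<in>J. (h (j, 0) - D) * ((1 - exp (- q0 * b)) * exit_prob j)) =
        (1 - exp (- q0 * b)) * ((\<Sum>j\<in>J. exit_prob j * h (j, 0)) - D * (\<Sum>j\<in>J. exit_prob j))"
      by (simp add: sum_distrib_left sum_subtractf[symmetric] algebra_simps)
    also have "\<dots> = (1 - exp (- q0 * b)) * (1 / p) - (1 - exp (- q0 * b)) * D"
      by (simp only: mean_h exit_prob_sum_J mult_1_right right_diff_distrib)
    finally show ?thesis by (simp only: times_divide_eq_right mult_1_right mult.commute[of D])
  qed
  have e3: "D * (1 - exp (- q0 * b)) \<le> D * p"
  proof -
    have "exp (- q0) \<le> exp (- q0 * b)" using b u q0_pos by simp
    then show ?thesis using D by (intro mult_left_mono) (auto simp: p_def)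
  qed
  have "hz u - p * D \<le> B + (\<Sum>j\<in>J. (h (j, 0) - D) * ((1 - exp (- q0 * b)) * exit_prob j))"
    unfolding e2 using e1 e3 by (simp only: mult.commute[of p D])
  then have "ennreal (hz u - p * D) \<le> ennreal (B + (\<Sum>j\<in>J. (h (j, 0) - D) * ((1 - exp (- q0 * b)) * exit_prob j)))"
    by (rule ennreal_leI)
  also have "\<dots> = ennreal B + (\<Sum>j\<in>J. ennreal ((h (j, 0) - D) * ((1 - exp (- q0 * b)) * exit_prob j)))"
  proof -
    have nn: "0 \<le> (h (j, 0) - D) * ((1 - exp (- q0 * b)) * exit_prob j)" if "j \<in> J" for j
      using hj[OF that] eb exit_prob_nonneg by simp
    then show ?thesis using B0 by (simp only: sum_ennreal ennreal_plus[OF B0 sum_nonneg])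
  qed
  also have "\<dots> \<le> ennreal B + (\<Sum>j\<in>J. \<integral>\<^sup>+w\<in>?F j. ?Phi (entry away w, shift_entry away w) \<partial>P 0)"
    by (intro add_left_mono sum_mono gj)
  also have "\<dots> = (\<integral>\<^sup>+w. ennreal (hz (u + t)) * indicator Z w \<partial>P 0) + (\<integral>\<^sup>+w. (\<Sum>j\<in>J. ?Phi (entry away w, shift_entry away w) * indicator (?F j) w) \<partial>P 0)"
  proof -
    have "(\<lambda>w. (entry away w, shift_entry away w)) \<in> \<Omega> \<rightarrow>\<^sub>M borel \<Otimes>\<^sub>M \<Omega>" by measurable
    from measurable_compose[OF this Phi]
    have "(\<lambda>w. ?Phi (entry away w, shift_entry away w) * indicator (?F j) w) \<in> borel_measurable (P 0)" for j
      unfolding measurable_P[OF S_0] by (intro borel_measurable_times_ennreal borel_measurable_indicator pred_entry_state)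
    then show ?thesis unfolding g0 B_def by (subst nn_integral_sum) auto
  qed
  also have "\<dots> = (\<integral>\<^sup>+w. ennreal (hz (u + t)) * indicator Z w + (\<Sum>j\<in>J. ?Phi (entry away w, shift_entry away w) * indicator (?F j) w) \<partial>P 0)"
  proof (rule nn_integral_add[symmetric])
    show "(\<lambda>w. ennreal (hz (u + t)) * indicator Z w) \<in> borel_measurable (P 0)"
      unfolding measurable_P[OF S_0] by (intro borel_measurable_times_ennreal borel_measurable_indicator Zm) simp
    have "(\<lambda>w. (entry away w, shift_entry away w)) \<in> \<Omega> \<rightarrow>\<^sub>M borel \<Otimes>\<^sub>M \<Omega>" by measurable
    from measurable_compose[OF this Phi]
    show "(\<lambda>w. \<Sum>j\<in>J. ?Phi (entry away w, shift_entry away w) * indicator (?F j) w) \<in> borel_measurable (P 0)"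
      unfolding measurable_P[OF S_0] by (intro borel_measurable_sum borel_measurable_times_ennreal borel_measurable_indicator pred_entry_state)
  qed
  also have "\<dots> \<le> wh (0, u) t"
    unfolding wh_def W_alive fst_conv snd_conv
  proof (rule nn_integral_mono)
    fix w assume "w \<in> space (P 0)"
    then have wp: "w \<in> paths S" by simp
    let ?s = "\<Sum>j\<in>J. ?Phi (entry away w, shift_entry away w) * indicator (?F j) w"
    show "ennreal (hz (u + t)) * indicator Z w + ?s \<le> alive u t w * ennreal (h (hat_X u t w))"
    proof (cases "hits away w \<and> entry away w \<le> b")
      case True
      then have hh: "hits away w" and le: "entry away w \<le> b" by auto
      have e0: "0 \<le> entry away w" by (rule entry_nonneg[OF wp hh])
      have nZ: "w \<notin> Z" using zero_on_entry[OF wp t] hh le b by (auto simp: Z_def)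
      have "?s \<le> ?Phi (entry away w, shift_entry away w)"
      proof -
        have "?s = ?Phi (entry away w, shift_entry away w) * (\<Sum>j\<in>J. indicator (?F j) w)"
          by (rule sum_distrib_left[symmetric])
        also have "(\<Sum>j\<in>J. indicator (?F j) w :: ennreal) \<le> (\<Sum>j\<in>J. if j = w (max 0 (entry away w)) then 1 else 0)"
          unfolding indicator_def by (intro sum_mono) (simp, blast?)
        also have "\<dots> \<le> 1" by (subst sum.delta[OF J(1)]) simp
        finally show ?thesis by (simp add: mult_left_mono)
      qed
      also have "?Phi (entry away w, shift_entry away w) = alive u t w * ennreal (h (hat_X u t w))"
      proof -
        have ag: "age u (entry away w) w = 0" by (rule age_at_exit[OF wp hh])
        have "hat_X u t w = hat_X 0 (t - entry away w) (shift_entry away w)"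
          using hat_X_flow[OF wp e0, of "t - entry away w" u] le b e0 ag
          by (simp add: shift_entry_def max_absorb2)
        moreover have "alive u t w = alive 0 (t - entry away w) (shift_entry away w)"
          unfolding alive_def using tau_after_exit[OF wp hh, of u t] le b by simp
        ultimately show ?thesis using le b by (simp add: max_absorb2)
      qed
      finally show ?thesis unfolding indicator_simps(2)[OF nZ] by simp
    next
      case False
      have "?s = 0"
      proof (rule sum.neutral, rule ballI)
        fix j
        show "?Phi (entry away w, shift_entry away w) * indicator (?F j) w = 0"
        proof (cases "hits away w")
          case True
          then have "entry away w \<notin> {..b}" using False by simp
          then show ?thesis by simp
        next
          case nh: False
          then have "w \<notin> ?F j" by blast
          then show ?thesis unfolding indicator_simps(2)[OF \<open>w \<notin> ?F j\<close>] by (simp only: mult_zero_right)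
        qed
      qed
      moreover have "ennreal (hz (u + t)) * indicator Z w \<le> alive u t w * ennreal (h (hat_X u t w))"
      proof (cases "w \<in> Z")
        case True
        then have z: "zero_on w 0 t" and ut: "u + t < 1" by (auto simp: Z_def)
        have "ereal t < tau u w"
          unfolding less_tau_iff[OF wp t]
        proof
          fix r assume "r \<in> {0..t}"
          then show "age u r w < 1" using age_zero_on[of r w u] zero_on_mono[OF z, of 0 r] ut by simp
        qed
        moreover have "hat_X u t w = (0, u + t)"
          using age_zero_on[OF t z, of u] zero_onD[OF z t order_refl] by (simp add: hat_X_eq)
        ultimately show ?thesis using True by (simp add: alive_def h_0)
      qed simp
      ultimately show ?thesis by (simp only: add_0_right)
    qed
  qed
  finally show ?thesis .
qed

text \<open>The deficits at \<open>(0, 0)\<close> admissible for all times include 1, since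
  \<open>h (0, 0) = 1\<close>. One passage through the exit states turns \<open>D\<close> into
  \<open>p * D\<close>; iterating leaves deficit 0, which then spreads to every state. The reverse
  inequality is \<open>w_le\<close>.\<close>

lemma w_eq_h:
  assumes x: "x \<in> hat_S S" and t: "0 \<le> t"
  shows "wh x t = ennreal (h x)"
proof -
  have x0: "(0, 0) \<in> hat_S S" by (simp add: hat_S_def)
  define A where "A = {D. 0 \<le> D \<and> D \<le> 1 \<and> (\<forall>r\<ge>0. ennreal (1 - D) \<le> wh (0, 0) r)}"
  have step: "p * D \<in> A" if "D \<in> A" for D
  proof -
    have D: "0 \<le> D" "D \<le> 1" "\<And>r. 0 \<le> r \<Longrightarrow> ennreal (1 - D) \<le> wh (0, 0) r" using that by (auto simp: A_def)
    have "ennreal (hz 0 - p * D) \<le> wh (0, 0) r" if "0 \<le> r" for r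
      by (rule w_lower_0[OF _ _ that D(1,2) w_lower_C[OF J_in _ D]]) auto
    then show ?thesis using D p by (simp add: A_def hz_0 mult_le_one)
  qed
  have "p ^ n \<in> A" for n
  proof (induction n)
    case 0
    show ?case by (simp add: A_def)
  qed (use step in simp)
  moreover have "(\<lambda>n. p ^ n) \<longlonglongrightarrow> 0" by (rule LIMSEQ_power_zero) (use p in simp)
  ultimately have low0: "ennreal 1 \<le> wh (0, 0) r" if "0 \<le> r" for r
  proof -
    have "(\<lambda>n. ennreal (1 - p ^ n)) \<longlonglongrightarrow> ennreal (1 - 0)"
      by (intro tendsto_ennrealI tendsto_intros \<open>(\<lambda>n. p ^ n) \<longlonglongrightarrow> 0\<close>)
    then have "ennreal (1 - 0) \<le> wh (0, 0) r"
      by (rule LIMSEQ_le_const2) (use \<open>\<And>n. p ^ n \<in> A\<close> that in \<open>auto simp: A_def\<close>)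
    then show ?thesis by simp
  qed
  have C: "ennreal (h (i, 0)) \<le> wh (i, 0) r" if "i \<in> S - {0}" "0 \<le> r" for i r
    using w_lower_C[OF that, of 0] low0 by simp
  have "ennreal (h x) \<le> wh x t"
  proof (cases "fst x = 0")
    case True
    then have xe: "x = (0, snd x)" by (simp add: prod_eq_iff)
    have "ennreal (hz (snd x) - p * 0) \<le> wh (0, snd x) t"
      by (rule w_lower_0[OF _ _ t]) (use C J_in hat_S_D[OF x S_0] in auto)
    then show ?thesis by (subst (1 2) xe) (simp add: h_0)
  next
    case False
    then have xe: "x = (fst x, 0)" and "fst x \<in> S - {0}" using hat_S_D[OF x S_0] by (auto simp: prod_eq_iff)
    then show ?thesis using C[of "fst x" t] t by (subst (1 2) xe) simp
  qed
  then show ?thesis using w_le[OF x t] by (rule antisym[rotated])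
qed

lemma h_harmonic: "harmonic (hat_S S) (hat_P P) h"
  unfolding harmonic_def
proof (intro conjI ballI allI impI)
  fix x assume x: "x \<in> hat_S S"
  then show "0 \<le> h x" using h_pos by (simp add: less_imp_le)
  fix t :: real assume t: "0 \<le> t"
  have "(\<lambda>y. ennreal (h y)) \<in> borel_measurable borel" by measurable
  then show "(\<integral>\<^sup>+y. ennreal (h y) \<partial>hat_P P t x) = ennreal (h x)"
    using nn_integral_hat_P[of x t "\<lambda>y. ennreal (h y)"] hat_S_D[OF x S_0] t w_eq_h[OF x t] by (simp add: wh_def)
qed

abbreviation "K \<equiv> h_transform (hat_P P) h"

lemma emeasure_K:
  assumes x: "x \<in> hat_S S" and t: "0 \<le> t" and B: "B \<in> sets borel"
  shows "emeasure (K t x) B = W (\<lambda>y. ennreal (h y) * indicator B y) x t * ennreal (1 / h x)"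
proof -
  have i: "fst x \<in> S" using hat_S_D[OF x S_0] by simp
  have sets: "sets (hat_P P t x) = sets borel" by (simp add: hat_P_def)
  have m: "(\<lambda>y. ennreal (h y / h x)) \<in> borel_measurable borel" by measurable
  have mB: "(\<lambda>y. ennreal (h y) * indicator B y) \<in> borel_measurable borel" using B by measurable
  have "emeasure (K t x) B = (\<integral>\<^sup>+y. ennreal (h y / h x) * indicator B y \<partial>hat_P P t x)"
    unfolding h_transform_def
    by (rule emeasure_density) (use m B sets in \<open>auto cong: measurable_cong_sets\<close>)
  also have "\<dots> = (\<integral>\<^sup>+y. (ennreal (h y) * indicator B y) * ennreal (1 / h x) \<partial>hat_P P t x)"
  proof (rule nn_integral_cong)
    fix y
    have "ennreal (h y / h x) = ennreal (h y) * ennreal (1 / h x)"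
    \<comment> \<open>Outside \<open>hat_S S\<close> the formula for \<open>h\<close> can be
      negative, for instance at \<open>(0, r)\<close> with \<open>r > 1\<close>. Both sides are 0
      there.\<close>
    proof (cases "0 \<le> h y")
      case True
      then show ?thesis by (rule ennreal_divide_cmult[OF h_pos[OF x]])
    next
      case False
      then have "h y / h x \<le> 0" using h_pos[OF x] by (simp add: divide_le_0_iff)
      then show ?thesis using False by (simp add: ennreal_neg)
    qed
    then show "ennreal (h y / h x) * indicator B y = (ennreal (h y) * indicator B y) * ennreal (1 / h x)"
      by (simp only: mult_ac)
  qed
  also have "\<dots> = (\<integral>\<^sup>+y. ennreal (h y) * indicator B y \<partial>hat_P P t x) * ennreal (1 / h x)"
    by (rule nn_integral_multc) (use mB sets in \<open>simp cong: measurable_cong_sets\<close>)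
  also have "(\<integral>\<^sup>+y. ennreal (h y) * indicator B y \<partial>hat_P P t x) = W (\<lambda>y. ennreal (h y) * indicator B y) x t"
    by (rule nn_integral_hat_P[OF i t mB])
  finally show ?thesis .
qed

lemma W_hat_S:
  assumes x: "x \<in> hat_S S" and t: "0 \<le> t" and eq: "\<And>y. y \<in> hat_S S \<Longrightarrow> f y = g y"
  shows "W f x t = W g x t"
proof -
  have i: "fst x \<in> S" and u: "0 \<le> snd x" using hat_S_D[OF x S_0] by auto
  show ?thesis
    unfolding W_eq
  proof (intro nn_integral_cong)
    fix w assume "w \<in> space (P (fst x))"
    then have "w \<in> paths S" using i by simp
    from hat_X_in_hat_S[OF this u t]
    show "(if ereal t < tau (snd x) w then f (hat_X (snd x) t w) else 0) = (if ereal t < tau (snd x) w then g (hat_X (snd x) t w) else 0)"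
      using eq by simp
  qed
qed

lemma K_stochastic: "stochastic (hat_S S) K"
  unfolding stochastic_def
proof (intro allI impI ballI conjI)
  fix t :: real and x assume t: "0 \<le> t" and x: "x \<in> hat_S S"
  have one: "ennreal (h x) * ennreal (1 / h x) = 1"
    using h_pos[OF x] by (simp add: ennreal_mult[symmetric])
  have "W (\<lambda>y. ennreal (h y) * indicator (hat_S S) y) x t = wh x t"
    unfolding wh_def by (rule W_hat_S[OF x t]) simp
  then show "emeasure (K t x) (hat_S S) = 1"
    using emeasure_K[OF x t hat_S_borel[of S]] one by (simp add: w_eq_h[OF x t])
  have "W (\<lambda>y. ennreal (h y) * indicator UNIV y) x t = wh x t" unfolding wh_def by simp
  then have "emeasure (K t x) UNIV = 1"
    using emeasure_K[OF x t, of UNIV] one by (simp add: w_eq_h[OF x t])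
  moreover have "space (K t x) = UNIV" by (simp add: h_transform_def hat_P_def)
  ultimately show "prob_space (K t x)" by (intro prob_spaceI) simp
qed

end

section \<open>The h-transformed process\<close>

lemma sets_Int3: "A \<in> sets M \<Longrightarrow> B \<in> sets M \<Longrightarrow> C \<in> sets M \<Longrightarrow> A \<inter> B \<inter> C \<in> sets M"
  by blast

context chain
begin

lemma state_integral_measurable:
  assumes G: "G \<in> borel_measurable ((borel :: real measure) \<Otimes>\<^sub>M \<Omega>)"
  shows "(\<lambda>x. if fst x \<in> S then \<integral>\<^sup>+v. G (snd x, v) \<partial>P (fst x) else 0) \<in> borel_measurable borel"
proof (rule measurable_compose_countable[where g = fst and f = "\<lambda>j x. if j \<in> S then \<integral>\<^sup>+v. G (snd x, v) \<partial>P j else 0"])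
  show "fst \<in> (borel :: (nat \<times> real) measure) \<rightarrow>\<^sub>M count_space UNIV"
    using borel_fst by (simp add: measurable_cong_sets[OF refl sets_borel_eq_count_space])
  fix j
  show "(\<lambda>x :: nat \<times> real. if j \<in> S then \<integral>\<^sup>+v. G (snd x, v) \<partial>P j else 0) \<in> borel_measurable borel"
  proof (cases "j \<in> S")
    case True
    interpret prob_space "P j" by (rule prob_space_P[OF True])
    have "G \<in> borel_measurable (borel \<Otimes>\<^sub>M P j)"
      using G True by (simp cong: measurable_cong_sets sets_pair_measure_cong)
    then have "(\<lambda>u. \<integral>\<^sup>+v. G (u, v) \<partial>P j) \<in> borel_measurable borel"
      by (intro borel_measurable_nn_integral) simp
    from measurable_compose[OF borel_snd this] True show ?thesis by simp
  qed simp
qed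

text \<open>The event lies in the difference of resting at 0 until \<open>z\<close> and until
  \<open>y\<close>, for every \<open>z < y\<close>. Its probability is a difference of exponentials,
  which vanishes as \<open>z\<close> tends to \<open>y\<close>.\<close>

lemma exit_time_atomless:
  "emeasure (P 0) {w \<in> paths S. hits away w \<and> entry away w = y} = 0"
proof -
  interpret prob_space "P 0" by (rule prob_space_P) simp
  let ?E = "{w \<in> paths S. hits away w \<and> entry away w = y}"
  have "{w \<in> space \<Omega>. hits away w} \<inter> (entry away -` {y} \<inter> space \<Omega>) \<in> sets \<Omega>"
    using pred_hits[of away S] unfolding pred_def by (intro sets.Int measurable_sets[OF measurable_entry]) auto
  moreover have "{w \<in> space \<Omega>. hits away w} \<inter> (entry away -` {y} \<inter> space \<Omega>) = ?E" by auto
  ultimately have E: "?E \<in> events" by simp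
  have "prob ?E \<le> 0"
  proof (cases "y > 0")
    case False
    have "?E \<subseteq> {w \<in> paths S. \<not> zero_on w 0 0}"
      using zero_on_entry[of _ S 0] False by auto
    moreover have "prob {w \<in> paths S. \<not> zero_on w 0 0} = 0"
    proof -
      have "prob (space (P 0) - {w \<in> paths S. zero_on w 0 0}) = 1 - prob {w \<in> paths S. zero_on w 0 0}"
        by (rule prob_compl) (use zero_on_sets'[OF order_refl] sets_P[OF S_0] in blast)
      also have "\<dots> = 0" using zero_on_prob[OF order_refl] by simp
      finally have "prob (space (P 0) - {w \<in> paths S. zero_on w 0 0}) = 0" .
      moreover have "space (P 0) - {w \<in> paths S. zero_on w 0 0} = {w \<in> paths S. \<not> zero_on w 0 0}"
        unfolding space_P[OF S_0] by blast
      ultimately show ?thesis by metis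
    qed
    moreover have "{w \<in> paths S. \<not> zero_on w 0 0} \<in> sets \<Omega>"
    proof -
      have "space \<Omega> - {w \<in> paths S. zero_on w 0 0} \<in> sets \<Omega>" by (rule sets.compl_sets[OF zero_on_sets'[OF order_refl]])
      moreover have "space \<Omega> - {w \<in> paths S. zero_on w 0 0} = {w \<in> paths S. \<not> zero_on w 0 0}"
        unfolding space_skorokhod by blast
      ultimately show ?thesis by metis
    qed
    ultimately show ?thesis using measure_P_mono[OF S_0, of ?E "{w \<in> paths S. \<not> zero_on w 0 0}"] by linarith
  next
    case True
    have "prob ?E \<le> exp (- q0 * (y - y / real (Suc n))) - exp (- q0 * y)" for n
    proof -
      define z where "z = y - y / real (Suc n)"
      have z: "0 \<le> z" "z < y" using True by (auto simp: z_def pos_divide_le_eq mult_left_le)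
      have "prob ?E \<le> prob ({w \<in> paths S. zero_on w 0 z} - {w \<in> paths S. zero_on w 0 y})"
      proof (rule measure_P_mono[OF S_0])
        show "?E \<subseteq> {w \<in> paths S. zero_on w 0 z} - {w \<in> paths S. zero_on w 0 y}"
          using zero_on_entry[of _ S z] zero_on_entry[of _ S y] z by auto
        show "{w \<in> paths S. zero_on w 0 z} - {w \<in> paths S. zero_on w 0 y} \<in> sets \<Omega>"
          by (intro sets.Diff zero_on_sets') (use z in auto)
      qed
      also have "\<dots> = prob {w \<in> paths S. zero_on w 0 z} - prob {w \<in> paths S. zero_on w 0 y}"
      proof (rule finite_measure_Diff)
        show "{w \<in> paths S. zero_on w 0 z} \<in> events" "{w \<in> paths S. zero_on w 0 y} \<in> events"
          unfolding sets_P[OF S_0] by (rule zero_on_sets', use z in simp)+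
        have "zero_on w 0 y \<Longrightarrow> zero_on w 0 z" for w by (rule zero_on_mono) (use z in auto)
        then show "{w \<in> paths S. zero_on w 0 y} \<subseteq> {w \<in> paths S. zero_on w 0 z}" by blast
      qed
      also have "\<dots> = exp (- q0 * z) - exp (- q0 * y)" using z by (simp add: zero_on_prob)
      finally show ?thesis by (simp add: z_def)
    qed
    moreover have "(\<lambda>n. exp (- q0 * (y - y / real (Suc n))) - exp (- q0 * y)) \<longlonglongrightarrow> exp (- q0 * (y - 0)) - exp (- q0 * y)"
      using seq_at_right[OF True] by (intro tendsto_intros) (simp add: filterlim_at)
    ultimately have "prob ?E \<le> exp (- q0 * (y - 0)) - exp (- q0 * y)" by (intro LIMSEQ_le_const) auto
    then show ?thesis by simp
  qed
  then show ?thesis using measure_nonneg[of "P 0" ?E] by (simp add: emeasure_eq_measure)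
qed

text \<open>Leaving 0 exactly when the age reaches 1 would make \<open>(0, 1)\<close> a left limit of the path, which lies
  outside \<open>hat_S S\<close>; the time of such an exit is determined by any earlier rational time.\<close>

definition late_exit :: "real \<Rightarrow> real \<Rightarrow> (real \<Rightarrow> nat) \<Rightarrow> bool" where
  "late_exit r u w \<longleftrightarrow> w r = 0 \<and> hits away (shift r w) \<and> age u r w + entry away (shift r w) = 1"

text \<open>Given the path up to \<open>r\<close>, the remaining stay at 0 would have to equal
  \<open>1 - age\<close> exactly, and its law has no atoms.\<close>

lemma late_exit_null:
  assumes i: "i \<in> S" and r: "0 \<le> r"
  shows "(\<integral>\<^sup>+w. (if late_exit r u w then 1 else 0) \<partial>P i) = 0"
proof -
  let ?B = "\<lambda>(x :: nat \<times> real, v). if fst x = 0 \<and> hits away v \<and> snd x + entry away v = 1 then 1 else 0 :: ennreal"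
  have Bm: "?B \<in> borel_measurable (borel \<Otimes>\<^sub>M \<Omega>)"
  proof -
    have f: "(\<lambda>z. fst (fst z)) \<in> (borel :: (nat \<times> real) measure) \<Otimes>\<^sub>M \<Omega> \<rightarrow>\<^sub>M borel"
      by (rule measurable_compose[OF measurable_fst borel_fst])
    have s: "(\<lambda>z. snd (fst z) + entry away (snd z)) \<in> (borel :: (nat \<times> real) measure) \<Otimes>\<^sub>M \<Omega> \<rightarrow>\<^sub>M borel"
      by (intro borel_measurable_add measurable_compose[OF measurable_fst borel_snd] measurable_compose[OF measurable_snd measurable_entry])
    have "(\<lambda>z. fst (fst z)) -` {0} \<inter> space (borel \<Otimes>\<^sub>M \<Omega>) \<in> sets ((borel :: (nat \<times> real) measure) \<Otimes>\<^sub>M \<Omega>)"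
      by (rule measurable_sets[OF f]) simp
    moreover have "(\<lambda>z. snd (fst z) + entry away (snd z)) -` {1} \<inter> space (borel \<Otimes>\<^sub>M \<Omega>) \<in> sets ((borel :: (nat \<times> real) measure) \<Otimes>\<^sub>M \<Omega>)"
      by (rule measurable_sets[OF s]) simp
    moreover have "snd -` {w \<in> space \<Omega>. hits away w} \<inter> space (borel \<Otimes>\<^sub>M \<Omega>) \<in> sets ((borel :: (nat \<times> real) measure) \<Otimes>\<^sub>M \<Omega>)"
      by (rule measurable_sets[OF measurable_snd]) (use pred_hits[of away S] in \<open>simp add: pred_def\<close>)
    ultimately have "((\<lambda>z. fst (fst z)) -` {0} \<inter> space (borel \<Otimes>\<^sub>M \<Omega>)) \<inter> ((\<lambda>z. snd (fst z) + entry away (snd z)) -` {1} \<inter> space (borel \<Otimes>\<^sub>M \<Omega>)) \<inter>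
        (snd -` {w \<in> space \<Omega>. hits away w} \<inter> space (borel \<Otimes>\<^sub>M \<Omega>)) \<in> sets ((borel :: (nat \<times> real) measure) \<Otimes>\<^sub>M \<Omega>)" (is "?X \<in> _")
      by (rule sets_Int3)
    then have "(\<lambda>z. indicator ?X z :: ennreal) \<in> borel_measurable ((borel :: (nat \<times> real) measure) \<Otimes>\<^sub>M \<Omega>)"
      by (rule borel_measurable_indicator)
    then show ?thesis
      by (rule measurable_cong[THEN iffD1, rotated]) (auto simp: indicator_def space_pair_measure)
  qed
  have "(\<integral>\<^sup>+w. (if late_exit r u w then 1 else 0) \<partial>P i) = (\<integral>\<^sup>+w. 1 * ?B (hat_X u r w, shift r w) \<partial>P i)"
    by (intro nn_integral_cong) (simp add: late_exit_def hat_X_eq)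
  also have "\<dots> = (\<integral>\<^sup>+w. 1 * (\<integral>\<^sup>+v. ?B (hat_X u r w, v) \<partial>P (w r)) \<partial>P i)"
    by (rule markov_hat[OF i r _ Bm]) simp
  also have "\<dots> = (\<integral>\<^sup>+w. 0 \<partial>P i)"
  proof (rule nn_integral_cong)
    fix w assume "w \<in> space (P i)"
    show "1 * (\<integral>\<^sup>+v. ?B (hat_X u r w, v) \<partial>P (w r)) = 0"
    proof (cases "w r = 0")
      case True
      let ?E = "{v \<in> paths S. hits away v \<and> entry away v = 1 - age u r w}"
      have "AE v in P 0. v \<notin> ?E"
      proof (rule AE_I)
        show "{v \<in> space (P 0). \<not> v \<notin> ?E} \<subseteq> ?E" by blast
        show "emeasure (P 0) ?E = 0" by (rule exit_time_atomless)
        have "{w \<in> space \<Omega>. hits away w} \<inter> (entry away -` {1 - age u r w} \<inter> space \<Omega>) \<in> sets \<Omega>"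
          using pred_hits[of away S] unfolding pred_def by (intro sets.Int measurable_sets[OF measurable_entry]) auto
        moreover have "{w \<in> space \<Omega>. hits away w} \<inter> (entry away -` {1 - age u r w} \<inter> space \<Omega>) = ?E" by auto
        ultimately show "?E \<in> sets (P 0)" by simp
      qed
      then have "(\<integral>\<^sup>+v. ?B (hat_X u r w, v) \<partial>P 0) = (\<integral>\<^sup>+v. 0 \<partial>P 0)"
        using AE_space by (intro nn_integral_cong_AE, eventually_elim) (auto simp: hat_X_eq)
      then show ?thesis using True by simp
    qed (simp add: hat_X_eq)
  qed
  finally show ?thesis by simp
qed

section \<open>Joining unit segments to paths in the extended state space\<close>

abbreviation "Seg \<equiv> (borel :: real measure) \<Otimes>\<^sub>M \<Omega>"

lemma space_Seg: "space Seg = UNIV \<times> paths S" by (simp add: space_pair_measure)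

text \<open>The strict inequality makes the segment survive up to and including time 1, so its end
  state is again in \<open>hat_S S\<close>. Rational \<open>r\<close> keep the exceptional event a
  countable union of null events, and one of them lies in the last stay before any late
  exit.\<close>

definition good :: "real \<times> (real \<Rightarrow> nat) \<Rightarrow> bool" where
  "good = (\<lambda>(u, w). 0 \<le> u \<and> ereal 1 < tau u w \<and> (\<forall>r\<in>\<rat> \<inter> {0..<1}. \<not> late_exit r u w))"

lemma late_exit_measurable:
  assumes r: "0 \<le> r"
  shows "Measurable.pred Seg (\<lambda>(u, w). late_exit r u w)"
proof -
  have sh: "(\<lambda>z. shift r (snd z)) \<in> Seg \<rightarrow>\<^sub>M \<Omega>"
    by (rule measurable_compose[OF measurable_snd measurable_shift[OF r]])
  have 1: "(\<lambda>z. snd z r) \<in> Seg \<rightarrow>\<^sub>M (borel :: nat measure)"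
    by (rule measurable_compose[OF measurable_snd measurable_eval[OF r]])
  have 2: "(\<lambda>z. age (fst z) r (snd z) + entry away (shift r (snd z))) \<in> borel_measurable Seg"
    using measurable_age_pair[OF r, of S]
    by (intro borel_measurable_add measurable_compose[OF sh measurable_entry]) (simp add: case_prod_beta)
  have "(\<lambda>z. snd z r) -` {0} \<inter> space Seg \<in> sets Seg" by (rule measurable_sets[OF 1]) simp
  moreover have "(\<lambda>z. age (fst z) r (snd z) + entry away (shift r (snd z))) -` {1} \<inter> space Seg \<in> sets Seg"
    by (rule measurable_sets[OF 2]) simp
  moreover have "(\<lambda>z. shift r (snd z)) -` {w \<in> space \<Omega>. hits away w} \<inter> space Seg \<in> sets Seg"
    by (rule measurable_sets[OF sh]) (use pred_hits[of away S] in \<open>simp add: pred_def\<close>)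
  ultimately have "((\<lambda>z. snd z r) -` {0} \<inter> space Seg) \<inter> ((\<lambda>z. age (fst z) r (snd z) + entry away (shift r (snd z))) -` {1} \<inter> space Seg)
     \<inter> ((\<lambda>z. shift r (snd z)) -` {w \<in> space \<Omega>. hits away w} \<inter> space Seg) \<in> sets Seg"
    by (rule sets_Int3)
  moreover have "((\<lambda>z. snd z r) -` {0} \<inter> space Seg) \<inter> ((\<lambda>z. age (fst z) r (snd z) + entry away (shift r (snd z))) -` {1} \<inter> space Seg)
     \<inter> ((\<lambda>z. shift r (snd z)) -` {w \<in> space \<Omega>. hits away w} \<inter> space Seg) = {z \<in> space Seg. (\<lambda>(u, w). late_exit r u w) z}"
    using shift_cadlag[OF _ r, of _ S] unfolding late_exit_def space_Seg space_skorokhod by auto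
  ultimately show ?thesis unfolding pred_def by metis
qed

lemma good_measurable: "Measurable.pred Seg good"
proof -
  have t: "Measurable.pred Seg (\<lambda>z. ereal 1 < (\<lambda>(u, w). tau u w) z)"
    using measurable_tau_pair[of S] by measurable
  have l: "Measurable.pred Seg (\<lambda>z. \<forall>r\<in>\<rat> \<inter> {0..<1}. \<not> (\<lambda>(u, w). late_exit r u w) z)"
  proof (rule pred_countable_Ball)
    show "countable (\<rat> \<inter> {0..<1::real})" using countable_rat by auto
    show "Measurable.pred Seg (\<lambda>z. \<not> (\<lambda>(u, w). late_exit r u w) z)" if "r \<in> \<rat> \<inter> {0..<1}" for r
      by (rule pred_intros_logic(2)[OF late_exit_measurable]) (use that in simp)
  qed
  have u: "Measurable.pred Seg (\<lambda>z. 0 \<le> fst z)" by measurable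
  have "Measurable.pred Seg (\<lambda>z. 0 \<le> fst z \<and> ereal 1 < (\<lambda>(u, w). tau u w) z \<and> (\<forall>r\<in>\<rat> \<inter> {0..<1}. \<not> (\<lambda>(u, w). late_exit r u w) z))"
    by (rule pred_intros_logic(3)[OF u pred_intros_logic(3)[OF t l]])
  then show ?thesis by (simp add: good_def case_prod_beta')
qed

text \<open>The only dangerous limit is \<open>(0, 1)\<close>. If the state at \<open>t\<close> were
  still 0, its age would be 1 and the process killed; otherwise the path leaves 0 exactly at age 1,
  and any rational time in the stay just ended shows a late exit.\<close>

lemma good_left_limit:
  assumes g: "good (u, w)" and w: "w \<in> paths S" and t: "0 < t" "t \<le> 1"
  shows "\<exists>l\<in>hat_S S. ((\<lambda>r. hat_X u r w) \<longlongrightarrow> l) (at_left t)"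
proof -
  have u: "0 \<le> u" and al: "ereal 1 < tau u w" and nl: "\<And>r. r \<in> \<rat> \<Longrightarrow> 0 \<le> r \<Longrightarrow> r < 1 \<Longrightarrow> \<not> late_exit r u w"
    using g by (auto simp: good_def)
  have age1: "age u r w < 1" if "0 \<le> r" "r \<le> 1" for r
    using al less_tau_iff[OF w, of 1 u] that by simp
  show ?thesis
  proof (rule hat_X_left_lim[OF w t(1), of u])
    fix l assume "l \<in> S" "l \<noteq> 0" "((\<lambda>r. hat_X u r w) \<longlongrightarrow> (l, 0)) (at_left t)"
    then show ?thesis by (intro bexI[of _ "(l, 0)"]) (auto simp: hat_S_def)
  next
    fix s assume s: "0 \<le> s" "s < t" and z: "\<And>r. s \<le> r \<Longrightarrow> r < t \<Longrightarrow> w r = 0 \<and> age u r w = age u s w + (r - s)"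
      and lim: "((\<lambda>r. hat_X u r w) \<longlongrightarrow> (0, age u s w + (t - s))) (at_left t)"
    have a0: "0 \<le> age u s w" by (rule age_nonneg[OF w s(1) u])
    have "age u s w + (t - s) \<le> 1"
    proof (rule field_le_epsilon)
      fix e :: real assume e: "0 < e"
      define r where "r = max s (t - e)"
      have "age u r w < 1" "age u r w = age u s w + (r - s)"
        using age1[of r] z[of r] s t e by (auto simp: r_def)
      then show "age u s w + (t - s) \<le> 1 + e" by (auto simp: r_def)
    qed
    moreover have "age u s w + (t - s) \<noteq> 1"
    proof
      assume eq: "age u s w + (t - s) = 1"
      obtain r where r: "r \<in> \<rat>" "s < r" "r < t" using Rats_dense_in_real[OF s(2)] by blast
      have r0: "0 \<le> r" using r s by simp
      have ar: "w r = 0" "age u r w + (t - r) = 1" using z[of r] r eq by auto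
      have sw: "shift r w \<in> paths S" by (rule shift_cadlag[OF w r0])
      have wt: "w t \<noteq> 0"
      proof
        assume t0: "w t = 0"
        have "zero_on (shift r w) 0 (t - r)"
          unfolding zero_on_def
        proof
          fix v assume v: "v \<in> {0..t - r}"
          show "shift r w v = 0" using z[of "r + v"] v r t0 by (cases "v = t - r") auto
        qed
        then have "age u t w = age u r w + (t - r)"
          using age_flow[OF w r0, of "t - r" u] age_zero_on[of "t - r" "shift r w" "age u r w"] r by simp
        then show False using age1[of t] ar t by simp
      qed
      have h: "hits away (shift r w)" unfolding hits_def using wt r by (intro exI[of _ "t - r"]) simp
      have "entry away (shift r w) = t - r"
      proof (rule antisym)
        show "entry away (shift r w) \<le> t - r" by (rule entry_le[OF sw h]) (use wt r in auto)
        show "t - r \<le> entry away (shift r w)"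
        proof (rule ccontr)
          assume "\<not> ?thesis"
          then have "w (r + entry away (shift r w)) = 0"
            using z[of "r + entry away (shift r w)"] entry_nonneg[OF sw h] r by auto
          then show False using entry_in[OF sw h] entry_nonneg[OF sw h] by simp
        qed
      qed
      then have "late_exit r u w" using ar h by (simp add: late_exit_def)
      then show False using nl[OF r(1) r0] r t by simp
    qed
    ultimately have "(0, age u s w + (t - s)) \<in> hat_S S" using a0 s by (simp add: hat_S_def)
    then show ?thesis using lim by blast
  qed
qed

text \<open>Entry \<open>n\<close> of the sequence supplies the path on \<open>[n, n + 1)\<close>.
  No matching at the integers is built in: a left limit at an integer is taken from the segment that
  ends there.\<close>

definition path_of :: "(nat \<Rightarrow> real \<times> (real \<Rightarrow> nat)) \<Rightarrow> real \<Rightarrow> nat \<times> real" where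
  "path_of f t = hat_X (fst (f (nat \<lfloor>t\<rfloor>))) (t - real (nat \<lfloor>t\<rfloor>)) (snd (f (nat \<lfloor>t\<rfloor>)))"

lemma path_of_segment:
  "real n \<le> t \<Longrightarrow> t < real n + 1 \<Longrightarrow> path_of f t = hat_X (fst (f n)) (t - real n) (snd (f n))"
proof -
  assume "real n \<le> t" "t < real n + 1"
  then have "\<lfloor>t\<rfloor> = int n" by (simp add: floor_eq_iff)
  then show ?thesis by (simp add: path_of_def)
qed

lemma path_of_cadlag:
  assumes f: "\<And>n. good (f n)" "\<And>n. snd (f n) \<in> paths S"
  shows "(\<lambda>t\<in>{0..}. path_of f t) \<in> cadlag_paths {0..} (hat_S S)"
  unfolding cadlag_paths_def
proof (intro CollectI conjI ballI)
  fix t :: real assume "t \<in> {0..}"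
  then have t: "0 \<le> t" by simp
  define n where "n = nat \<lfloor>t\<rfloor>"
  have n: "real n \<le> t" "t < real n + 1" using t unfolding n_def by linarith+
  obtain u w where fn: "f n = (u, w)" by (cases "f n")
  have w: "w \<in> paths S" and g: "good (u, w)" using f[of n] fn by auto
  then have u: "0 \<le> u" and al: "ereal 1 < tau u w" by (auto simp: good_def)
  have pt: "path_of f t = hat_X u (t - real n) w" using path_of_segment[OF n, of f] fn by simp
  have "hat_X u (t - real n) w \<in> hat_S S"
    using n by (intro hat_X_in_hat_S[OF w u] less_tau_mono[OF al]) auto
  then show "(\<lambda>t\<in>{0..}. path_of f t) t \<in> hat_S S" using t pt by simp
  show "((\<lambda>t\<in>{0..}. path_of f t) \<longlongrightarrow> (\<lambda>t\<in>{0..}. path_of f t) t) (at t within {0..} \<inter> {t<..})"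
  proof -
    have "filterlim (\<lambda>r. r - real n) (at_right (t - real n)) (at_right t)"
      unfolding filterlim_at
      by (auto intro!: tendsto_eq_intros simp: eventually_at_right_field intro: exI[of _ "t + 1"])
    from filterlim_compose[OF hat_X_right_cont[OF w, of "t - real n" u] this]
    have "((\<lambda>r. hat_X u (r - real n) w) \<longlongrightarrow> hat_X u (t - real n) w) (at_right t)" using n by simp
    moreover have "\<forall>\<^sub>F r in at_right t. hat_X u (r - real n) w = (\<lambda>t\<in>{0..}. path_of f t) r"
      unfolding eventually_at_right_field
    proof (intro exI[of _ "real n + 1"] conjI allI impI n(2))
      fix r assume "t < r" "r < real n + 1"
      then show "hat_X u (r - real n) w = (\<lambda>t\<in>{0..}. path_of f t) r"
        using path_of_segment[of n r f] fn n t by simp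
    qed
    ultimately have "((\<lambda>t\<in>{0..}. path_of f t) \<longlongrightarrow> hat_X u (t - real n) w) (at_right t)"
      by (rule Lim_transform_eventually)
    moreover have "{0..} \<inter> {t<..} = {t<..}" using t by auto
    ultimately show ?thesis using t pt by simp
  qed
  show "\<exists>l\<in>hat_S S. ((\<lambda>t\<in>{0..}. path_of f t) \<longlongrightarrow> l) (at t within {0..} \<inter> {..<t})"
  proof (cases "t = 0")
    case True
    then have e: "{0..} \<inter> {..<t} = {}" by auto
    have "(0, 0) \<in> hat_S S" by (simp add: hat_S_def)
    then show ?thesis unfolding e by (intro bexI[of _ "(0, 0)"]) auto
  next
    case False
    with t have t: "0 < t" by simp
    \<comment> \<open>The segment to the left of \<open>t\<close>: unlike
      \<open>nat \<lfloor>t\<rfloor>\<close>, it is the earlier of the two segments when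
      \<open>t\<close> is an integer.\<close>
    define m where "m = nat (\<lceil>t\<rceil> - 1)"
    have m: "real m < t" "t \<le> real m + 1" using t unfolding m_def by linarith+
    obtain u w where fm: "f m = (u, w)" by (cases "f m")
    have w: "w \<in> paths S" and g: "good (u, w)" using f[of m] fm by auto
    obtain l where l: "l \<in> hat_S S" "((\<lambda>r. hat_X u r w) \<longlongrightarrow> l) (at_left (t - real m))"
      using good_left_limit[OF g w, of "t - real m"] m by auto
    have "filterlim (\<lambda>r. r - real m) (at_left (t - real m)) (at_left t)"
      unfolding filterlim_at
      by (auto intro!: tendsto_eq_intros simp: eventually_at_left_field intro: exI[of _ "t - 1"])
    from filterlim_compose[OF l(2) this]
    have "((\<lambda>r. hat_X u (r - real m) w) \<longlongrightarrow> l) (at_left t)" .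
    moreover have "\<forall>\<^sub>F r in at_left t. hat_X u (r - real m) w = (\<lambda>t\<in>{0..}. path_of f t) r"
      unfolding eventually_at_left_field
    proof (intro exI[of _ "real m"] conjI allI impI m(1))
      fix r assume "real m < r" "r < t"
      then show "hat_X u (r - real m) w = (\<lambda>t\<in>{0..}. path_of f t) r"
        using path_of_segment[of m r f] fm m by simp
    qed
    ultimately have "((\<lambda>t\<in>{0..}. path_of f t) \<longlongrightarrow> l) (at_left t)"
      by (rule Lim_transform_eventually)
    then have "((\<lambda>t\<in>{0..}. path_of f t) \<longlongrightarrow> l) (at t within {0..} \<inter> {..<t})"
      by (rule tendsto_within_subset) auto
    then show ?thesis using l(1) by blast
  qed
qed simp

end

section \<open>The transition kernel between unit segments\<close>

context harmonic_chain
begin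

text \<open>A kernel must be a probability measure at every point of
  \<open>nat \<times> real\<close>; points outside the extended state space are sent to
  \<open>(0, 0)\<close>.\<close>

definition pr :: "nat \<times> real \<Rightarrow> nat \<times> real" where "pr x = (if x \<in> hat_S S then x else (0, 0))"

lemma pr_in: "pr x \<in> hat_S S" by (simp add: pr_def hat_S_def)

lemma pr_fst: "fst (pr x) \<in> S" using hat_S_D[OF pr_in S_0] by blast

lemma pr_measurable: "pr \<in> borel_measurable borel"
  unfolding pr_def
proof (rule measurable_If)
  show "{x \<in> space borel. x \<in> hat_S S} \<in> sets borel" using hat_S_borel[of S] by simp
qed auto

definition wt :: "real \<Rightarrow> (real \<Rightarrow> nat) \<Rightarrow> ennreal" where
  "wt u v = alive u 1 v * ennreal (h (hat_X u 1 v))"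

lemma wt_measurable: "(\<lambda>z. wt (fst z) (snd z)) \<in> borel_measurable Seg"
proof -
  have "(\<lambda>y. ennreal (h y)) \<in> borel_measurable borel" by measurable
  from alive_pair_measurable[OF zero_le_one this] show ?thesis by (simp add: wt_def case_prod_beta)
qed

lemma wt_measurable': "wt u \<in> borel_measurable \<Omega>"
  using measurable_compose[OF measurable_Pair1' wt_measurable, of u] by simp

text \<open>The unit segment of the chain started from \<open>x\<close>, weighted on survival by
  \<open>h\<close> at its end over \<open>h x\<close>; harmonicity makes the total mass 1. The
  initial age is stored with the path because the process is a functional of both.\<close>

definition kern :: "nat \<times> real \<Rightarrow> (real \<times> (real \<Rightarrow> nat)) measure" where
  "kern x = distr (density (P (fst (pr x))) (\<lambda>v. wt (snd (pr x)) v * ennreal (1 / h (pr x)))) Seg (\<lambda>v. (snd (pr x), v))"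

lemma sets_kern [simp]: "sets (kern x) = sets Seg" by (simp add: kern_def)
lemma space_kern [simp]: "space (kern x) = space Seg" by (simp add: kern_def)

lemma nn_integral_kern:
  assumes F: "F \<in> borel_measurable Seg"
  shows "(\<integral>\<^sup>+z. F z \<partial>kern x) = (\<integral>\<^sup>+v. wt (snd (pr x)) v * ennreal (1 / h (pr x)) * F (snd (pr x), v) \<partial>P (fst (pr x)))"
proof -
  have m: "(\<lambda>v. (snd (pr x), v)) \<in> \<Omega> \<rightarrow>\<^sub>M Seg" by (rule measurable_Pair1') simp
  have D: "density (P (fst (pr x))) f \<rightarrow>\<^sub>M N = \<Omega> \<rightarrow>\<^sub>M N" for f :: "(real \<Rightarrow> nat) \<Rightarrow> ennreal" and N :: "'x measure"
    by (rule measurable_cong_sets) (simp_all add: pr_fst)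
  have "(\<integral>\<^sup>+z. F z \<partial>kern x) = (\<integral>\<^sup>+v. F (snd (pr x), v) \<partial>density (P (fst (pr x))) (\<lambda>v. wt (snd (pr x)) v * ennreal (1 / h (pr x))))"
    unfolding kern_def by (rule nn_integral_distr) (simp_all add: D m F)
  also have "\<dots> = (\<integral>\<^sup>+v. wt (snd (pr x)) v * ennreal (1 / h (pr x)) * F (snd (pr x), v) \<partial>P (fst (pr x)))"
    by (rule nn_integral_density)
      (simp_all only: measurable_P[OF pr_fst] measurable_compose[OF m F] borel_measurable_times_ennreal[OF wt_measurable' borel_measurable_const])
  finally show ?thesis .
qed

lemma h_cancel: "x \<in> hat_S S \<Longrightarrow> ennreal (h x) * ennreal (1 / h x) = 1"
  using h_pos[of x] by (simp add: ennreal_mult[symmetric])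

lemma wt_integral: "x \<in> hat_S S \<Longrightarrow> (\<integral>\<^sup>+v. wt (snd x) v \<partial>P (fst x)) = ennreal (h x)"
  using w_eq_h[of x 1] by (simp add: wh_def W_alive wt_def)

lemma kern_prob: "prob_space (kern x)"
proof
  have "emeasure (kern x) (space (kern x)) = (\<integral>\<^sup>+z. 1 \<partial>kern x)" by simp
  also have "\<dots> = (\<integral>\<^sup>+v. wt (snd (pr x)) v * ennreal (1 / h (pr x)) * 1 \<partial>P (fst (pr x)))"
    by (rule nn_integral_kern) simp
  also have "\<dots> = (\<integral>\<^sup>+v. wt (snd (pr x)) v \<partial>P (fst (pr x))) * ennreal (1 / h (pr x))"
    unfolding mult_1_right by (rule nn_integral_multc) (simp add: measurable_P[OF pr_fst] wt_measurable')
  finally show "emeasure (kern x) (space (kern x)) = 1"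
    by (simp add: wt_integral[OF pr_in] h_cancel[OF pr_in])
qed

lemma kern_measurable: "kern \<in> borel \<rightarrow>\<^sub>M subprob_algebra Seg"
proof (rule measurable_subprob_algebra)
  show "subprob_space (kern x)" for x by (rule prob_space_imp_subprob_space[OF kern_prob])
  fix A assume A: "A \<in> sets Seg"
  let ?G = "\<lambda>z. wt (fst z) (snd z) * indicator A z"
  have G: "?G \<in> borel_measurable Seg" by (intro borel_measurable_times_ennreal wt_measurable borel_measurable_indicator A)
  have "(\<lambda>x. (if fst (pr x) \<in> S then \<integral>\<^sup>+v. ?G (snd (pr x), v) \<partial>P (fst (pr x)) else 0) * ennreal (1 / h (pr x))) \<in> borel_measurable borel"
  proof (rule borel_measurable_times_ennreal)
    show "(\<lambda>x. if fst (pr x) \<in> S then \<integral>\<^sup>+v. ?G (snd (pr x), v) \<partial>P (fst (pr x)) else 0) \<in> borel_measurable borel"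
      by (rule measurable_compose[OF pr_measurable state_integral_measurable[OF G]])
    have "(\<lambda>y. ennreal (1 / h y)) \<in> borel_measurable borel" by measurable
    from measurable_compose[OF pr_measurable this] show "(\<lambda>x. ennreal (1 / h (pr x))) \<in> borel_measurable borel" .
  qed
  also have "(\<lambda>x. (if fst (pr x) \<in> S then \<integral>\<^sup>+v. ?G (snd (pr x), v) \<partial>P (fst (pr x)) else 0) * ennreal (1 / h (pr x))) = (\<lambda>x. emeasure (kern x) A)"
  proof
    fix x
    have m: "(\<lambda>v. (snd (pr x), v)) \<in> \<Omega> \<rightarrow>\<^sub>M Seg" by (rule measurable_Pair1') simp
    have "emeasure (kern x) A = (\<integral>\<^sup>+z. indicator A z \<partial>kern x)" using A by simp
    also have "\<dots> = (\<integral>\<^sup>+v. wt (snd (pr x)) v * ennreal (1 / h (pr x)) * indicator A (snd (pr x), v) \<partial>P (fst (pr x)))"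
      by (rule nn_integral_kern) (use A in simp)
    also have "\<dots> = (\<integral>\<^sup>+v. ?G (snd (pr x), v) * ennreal (1 / h (pr x)) \<partial>P (fst (pr x)))"
      by (intro nn_integral_cong) (simp add: mult_ac)
    also have "\<dots> = (\<integral>\<^sup>+v. ?G (snd (pr x), v) \<partial>P (fst (pr x))) * ennreal (1 / h (pr x))"
      by (rule nn_integral_multc) (simp only: measurable_P[OF pr_fst] measurable_compose[OF m G])
    finally show "(if fst (pr x) \<in> S then \<integral>\<^sup>+v. ?G (snd (pr x), v) \<partial>P (fst (pr x)) else 0) * ennreal (1 / h (pr x)) = emeasure (kern x) A"
      using pr_fst by simp
  qed
  finally show "(\<lambda>x. emeasure (kern x) A) \<in> borel_measurable borel" .
qed simp

lemma kern_good: "(\<integral>\<^sup>+z. (if good z then 0 else 1) \<partial>kern x) = 0"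
proof -
  let ?u = "snd (pr x)" and ?i = "fst (pr x)"
  have u: "0 \<le> ?u" using hat_S_D[OF pr_in S_0] by blast
  have m: "(\<lambda>z. if good z then 0 else 1 :: ennreal) \<in> borel_measurable Seg"
    using good_measurable by measurable
  have "AE v in P ?i. \<forall>r\<in>\<rat> \<inter> {0..<1}. \<not> late_exit r ?u v"
  proof (rule AE_ball_countable[THEN iffD2])
    show "countable (\<rat> \<inter> {0..<1::real})" using countable_rat by auto
    show "\<forall>r\<in>\<rat> \<inter> {0..<1}. AE v in P ?i. \<not> late_exit r ?u v"
    proof
      fix r :: real assume "r \<in> \<rat> \<inter> {0..<1}"
      then have r: "0 \<le> r" by simp
      have l: "Measurable.pred \<Omega> (\<lambda>v. (\<lambda>(u, w). late_exit r u w) (?u, v))"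
        by (rule measurable_compose[OF measurable_Pair1' late_exit_measurable[OF r]]) simp
      then have "(\<lambda>v. if late_exit r ?u v then 1 else 0 :: ennreal) \<in> borel_measurable (P ?i)"
        unfolding measurable_P[OF pr_fst] by (intro measurable_If) (auto simp: pred_def)
      from nn_integral_0_iff_AE[OF this] late_exit_null[OF pr_fst r, of x ?u]
      show "AE v in P ?i. \<not> late_exit r ?u v" by (auto elim!: eventually_mono split: if_splits)
    qed
  qed
  then have "AE v in P ?i. wt ?u v * ennreal (1 / h (pr x)) * (if good (?u, v) then 0 else 1) = 0"
    by eventually_elim (use u in \<open>auto simp: good_def wt_def alive_def\<close>)
  then have "(\<integral>\<^sup>+v. wt ?u v * ennreal (1 / h (pr x)) * (if good (?u, v) then 0 else 1) \<partial>P ?i) = (\<integral>\<^sup>+v. 0 \<partial>P ?i)"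
    by (rule nn_integral_cong_AE)
  then show ?thesis unfolding nn_integral_kern[OF m] by simp
qed

definition fin :: "real \<times> (real \<Rightarrow> nat) \<Rightarrow> nat \<times> real" where "fin z = hat_X (fst z) 1 (snd z)"

lemma fin_measurable: "fin \<in> Seg \<rightarrow>\<^sub>M borel"
  using measurable_hat_X_pair[of 1 S] by (simp add: fin_def[abs_def] case_prod_beta)

end

section \<open>The law of the h-transformed process from the theorem of Ionescu-Tulcea\<close>

locale h_process = harmonic_chain +
  fixes x :: "nat \<times> real"
  assumes x: "x \<in> hat_S S"
begin

abbreviation "i \<equiv> fst x"
abbreviation "u \<equiv> snd x"

lemma i: "i \<in> S" and u: "0 \<le> u" "u < 1" using hat_S_D[OF x S_0] by auto

definition endst :: "nat \<Rightarrow> (nat \<Rightarrow> real \<times> (real \<Rightarrow> nat)) \<Rightarrow> nat \<times> real" where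
  "endst n f = (if n = 0 then x else fin (f (n - 1)))"

lemma endst_measurable: "endst n \<in> PiM {0..<n} (\<lambda>_. Seg) \<rightarrow>\<^sub>M borel"
proof (cases n)
  case (Suc k)
  have "(\<lambda>f. f k) \<in> PiM {0..<n} (\<lambda>_. Seg) \<rightarrow>\<^sub>M Seg" by (rule measurable_component_singleton) (simp add: Suc)
  from measurable_compose[OF this fin_measurable] show ?thesis by (simp add: endst_def[abs_def] Suc)
qed (simp add: endst_def[abs_def])

sublocale IT: Ionescu_Tulcea "\<lambda>n f. kern (endst n f)" "\<lambda>_. Seg"
proof (rule Ionescu_Tulcea.intro)
  show "(\<lambda>f. kern (endst n f)) \<in> PiM {0..<n} (\<lambda>_. Seg) \<rightarrow>\<^sub>M subprob_algebra Seg" for n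
    by (rule measurable_compose[OF endst_measurable kern_measurable])
qed (rule kern_prob)

text \<open>Half-open, so that the first \<open>n\<close> segments determine it. The state at time
  \<open>n\<close>, which the next segment starts from, is recorded separately by
  \<open>endst\<close>.\<close>

definition zpath :: "nat \<Rightarrow> (nat \<Rightarrow> real \<times> (real \<Rightarrow> nat)) \<Rightarrow> real \<Rightarrow> nat \<times> real" where
  "zpath n f = (\<lambda>t\<in>{0..<real n}. path_of f t)"

definition hpath :: "nat \<Rightarrow> (real \<Rightarrow> nat) \<Rightarrow> real \<Rightarrow> nat \<times> real" where
  "hpath n w = (\<lambda>t\<in>{0..<real n}. hat_X u t w)"

abbreviation "PathM n \<equiv> \<Pi>\<^sub>M t\<in>{0..<real n}. (borel :: (nat \<times> real) measure)"

lemma path_of_measurable: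
  assumes t: "0 \<le> t" and I: "nat \<lfloor>t\<rfloor> \<in> I"
  shows "(\<lambda>f. path_of f t) \<in> PiM I (\<lambda>_. Seg) \<rightarrow>\<^sub>M borel"
proof -
  have "0 \<le> t - real (nat \<lfloor>t\<rfloor>)" using t by linarith
  from measurable_compose[OF measurable_component_singleton[OF I, of "\<lambda>_. Seg"] measurable_hat_X_pair[OF this, of S]]
  show ?thesis by (simp add: path_of_def case_prod_beta)
qed

lemma floor_less: "0 \<le> t \<Longrightarrow> t < real n \<Longrightarrow> nat \<lfloor>t\<rfloor> \<in> {0..<n}"
  by (simp add: nat_less_iff floor_less_iff)

lemma zpath_measurable: "zpath n \<in> PiM {0..<n} (\<lambda>_. Seg) \<rightarrow>\<^sub>M PathM n"
  unfolding zpath_def by (rule measurable_restrict) (auto intro!: path_of_measurable floor_less)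

definition glue :: "nat \<Rightarrow> (real \<Rightarrow> nat \<times> real) \<Rightarrow> real \<times> (real \<Rightarrow> nat) \<Rightarrow> real \<Rightarrow> nat \<times> real" where
  "glue n z y = (\<lambda>t\<in>{0..<real (Suc n)}. if t < real n then z t else hat_X (fst y) (t - real n) (snd y))"

lemma glue_measurable:
  assumes z: "Z \<in> M \<rightarrow>\<^sub>M PathM n" and y: "Y \<in> M \<rightarrow>\<^sub>M Seg"
  shows "(\<lambda>a. glue n (Z a) (Y a)) \<in> M \<rightarrow>\<^sub>M PathM (Suc n)"
  unfolding glue_def
proof (rule measurable_restrict)
  fix t assume t: "t \<in> {0..<real (Suc n)}"
  show "(\<lambda>a. if t < real n then Z a t else hat_X (fst (Y a)) (t - real n) (snd (Y a))) \<in> M \<rightarrow>\<^sub>M borel"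
  proof (cases "t < real n")
    case True
    have "(\<lambda>z. z t) \<in> PathM n \<rightarrow>\<^sub>M borel" by (rule measurable_component_singleton) (use t True in simp)
    from measurable_compose[OF z this] True show ?thesis by simp
  next
    case False
    then have "0 \<le> t - real n" by simp
    from measurable_compose[OF y measurable_hat_X_pair[OF this, of S]] False show ?thesis by (simp add: case_prod_beta)
  qed
qed

lemma zpath_Suc: "zpath (Suc n) (f(n := y)) = glue n (zpath n f) y"
proof
  fix t
  show "zpath (Suc n) (f(n := y)) t = glue n (zpath n f) y t"
  proof (cases "t \<in> {0..<real (Suc n)}")
    case True
    show ?thesis
    proof (cases "t < real n")
      case lt: True
      then have "nat \<lfloor>t\<rfloor> \<noteq> n" using True floor_less[of t n] by auto
      then show ?thesis using True lt by (simp add: zpath_def glue_def path_of_def)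
    next
      case ge: False
      then have "path_of (f(n := y)) t = hat_X (fst ((f(n := y)) n)) (t - real n) (snd ((f(n := y)) n))"
        using True by (intro path_of_segment) auto
      then show ?thesis using True ge by (simp add: zpath_def glue_def)
    qed
  qed (auto simp: zpath_def glue_def)
qed

lemma hpath_Suc:
  assumes w: "w \<in> paths S"
  shows "hpath (Suc n) w = glue n (hpath n w) (age u (real n) w, shift (real n) w)"
proof
  fix t
  show "hpath (Suc n) w t = glue n (hpath n w) (age u (real n) w, shift (real n) w) t"
    using hat_X_flow[OF w, of "real n" "t - real n" u] by (simp add: hpath_def glue_def)
qed

lemma hpath_measurable: "hpath n \<in> path_filtration S (real n) \<rightarrow>\<^sub>M PathM n"
  unfolding hpath_def by (rule measurable_restrict) (auto intro!: measurable_hat_X_filtration)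

abbreviation hden :: "real \<Rightarrow> (real \<Rightarrow> nat) \<Rightarrow> ennreal" where
  "hden t w \<equiv> alive u t w * ennreal (h (hat_X u t w)) * ennreal (1 / h x)"

lemma sets_C: "sets (IT.C 0 n (\<lambda>_. undefined)) = sets (PiM {0..<n} (\<lambda>_. Seg))"
  using IT.sets_C[of "\<lambda>_. undefined" 0 n] by (simp add: space_PiM)

lemma C_Suc_integral:
  assumes F: "F \<in> borel_measurable (PiM {0..<Suc n} (\<lambda>_. Seg))"
  shows "(\<integral>\<^sup>+f. F f \<partial>IT.C 0 (Suc n) (\<lambda>_. undefined)) = (\<integral>\<^sup>+f. \<integral>\<^sup>+g. F g \<partial>IT.eP n f \<partial>IT.C 0 n (\<lambda>_. undefined))"
  unfolding IT.C.simps add_0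
proof (rule nn_integral_bind[OF F])
  show "IT.eP n \<in> IT.C 0 n (\<lambda>_. undefined) \<rightarrow>\<^sub>M subprob_algebra (PiM {0..<Suc n} (\<lambda>_. Seg))"
    unfolding measurable_cong_sets[OF sets_C refl] by (rule IT.measurable_eP)
qed

text \<open>Under the first \<open>n\<close> segments, path and end state are distributed as for the
  original chain with density \<open>hden\<close>. In the step, \<open>h\<close> at time
  \<open>n\<close> cancels between the density so far and the kernel. \<open>Phi\<close> includes
  the end state because the next kernel depends on it.\<close>

lemma C_law:
  assumes "Phi \<in> borel_measurable (PathM n \<Otimes>\<^sub>M borel)"
  shows "(\<integral>\<^sup>+f. Phi (zpath n f, endst n f) \<partial>IT.C 0 n (\<lambda>_. undefined)) =
    (\<integral>\<^sup>+w. hden (real n) w * Phi (hpath n w, hat_X u (real n) w) \<partial>P i)"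
  using assms
proof (induction n arbitrary: Phi)
  case 0
  have e: "(\<lambda>t. undefined) \<in> space (PathM 0)" by (simp add: space_PiM)
  have "(\<integral>\<^sup>+f. Phi (zpath 0 f, endst 0 f) \<partial>IT.C 0 0 (\<lambda>_. undefined)) = Phi (zpath 0 (\<lambda>_. undefined), endst 0 (\<lambda>_. undefined))"
    unfolding IT.C.simps
  proof (rule nn_integral_return)
    show "(\<lambda>_. undefined) \<in> space (PiM {0..<0::nat} (\<lambda>_. Seg))" by (simp add: space_PiM)
    show "(\<lambda>f. Phi (zpath 0 f, endst 0 f)) \<in> borel_measurable (PiM {0..<0::nat} (\<lambda>_. Seg))"
      by (rule measurable_compose[OF measurable_Pair[OF zpath_measurable endst_measurable] 0])
  qed
  also have "\<dots> = (\<integral>\<^sup>+w. Phi (\<lambda>_. undefined, x) \<partial>P i)"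
    using prob_space.emeasure_space_1[OF prob_space_P[OF i]] by (simp add: zpath_def endst_def restrict_def)
  also have "\<dots> = (\<integral>\<^sup>+w. hden (real 0) w * Phi (hpath 0 w, hat_X u (real 0) w) \<partial>P i)"
  proof (rule nn_integral_cong_AE)
    show "AE w in P i. Phi (\<lambda>_. undefined, x) = hden (real 0) w * Phi (hpath 0 w, hat_X u (real 0) w)"
      using AE_start[OF i] AE_space
    proof eventually_elim
      case (elim w)
      then have wp: "w \<in> paths S" using i by simp
      have hx: "hat_X u 0 w = x" by (rule hat_X_0[where w = w, OF x elim(1)])
      have "age u 0 w = u" using hx by (metis age_def)
      then have "ereal 0 < tau u w" using less_tau_iff[OF wp, of 0 u] u by simp
      then have "hden (real 0) w = 1" using hx h_cancel[OF x] by (simp add: alive_def)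
      then show ?case using hx by (simp add: hpath_def restrict_def)
    qed
  qed
  finally show ?case .
next
  case (Suc n)
  let ?N = "real n"
  define Phi' where "Phi' = (\<lambda>(z, s). \<integral>\<^sup>+y. Phi (glue n z y, fin y) \<partial>kern s)"
  have gl: "(\<lambda>q. Phi (glue n (fst (fst q)) (snd q), fin (snd q))) \<in> borel_measurable ((PathM n \<Otimes>\<^sub>M borel) \<Otimes>\<^sub>M Seg)"
    by (intro measurable_compose[OF _ Suc.prems] measurable_Pair glue_measurable
        measurable_compose[OF measurable_fst measurable_fst] measurable_snd measurable_compose[OF measurable_snd fin_measurable])
  have Phi': "Phi' \<in> borel_measurable (PathM n \<Otimes>\<^sub>M borel)"
  proof -
    have "(\<lambda>q. \<integral>\<^sup>+y. Phi (glue n (fst q) y, fin y) \<partial>kern (snd q)) \<in> borel_measurable (PathM n \<Otimes>\<^sub>M borel)"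
    proof (rule nn_integral_measurable_subprob_algebra2)
      show "(\<lambda>(q, y). Phi (glue n (fst q) y, fin y)) \<in> borel_measurable ((PathM n \<Otimes>\<^sub>M borel) \<Otimes>\<^sub>M Seg)"
        using gl by (simp add: case_prod_unfold)
      show "(\<lambda>q. kern (snd q)) \<in> PathM n \<Otimes>\<^sub>M borel \<rightarrow>\<^sub>M subprob_algebra Seg"
        by (rule measurable_compose[OF measurable_snd kern_measurable])
    qed
    then show ?thesis by (simp add: Phi'_def case_prod_beta')
  qed
  have F: "(\<lambda>f. Phi (zpath (Suc n) f, endst (Suc n) f)) \<in> borel_measurable (PiM {0..<Suc n} (\<lambda>_. Seg))"
    by (rule measurable_compose[OF measurable_Pair[OF zpath_measurable endst_measurable] Suc.prems])
  have "(\<integral>\<^sup>+f. Phi (zpath (Suc n) f, endst (Suc n) f) \<partial>IT.C 0 (Suc n) (\<lambda>_. undefined)) =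
    (\<integral>\<^sup>+f. \<integral>\<^sup>+g. Phi (zpath (Suc n) g, endst (Suc n) g) \<partial>IT.eP n f \<partial>IT.C 0 n (\<lambda>_. undefined))"
    by (rule C_Suc_integral[OF F])
  also have "\<dots> = (\<integral>\<^sup>+f. Phi' (zpath n f, endst n f) \<partial>IT.C 0 n (\<lambda>_. undefined))"
  proof (rule nn_integral_cong)
    fix f assume "f \<in> space (IT.C 0 n (\<lambda>_. undefined))"
    then have f: "f \<in> space (PiM {0..<n} (\<lambda>_. Seg))"
      using IT.space_C[of "\<lambda>_. undefined" 0 n] by (simp add: space_PiM)
    have "(\<integral>\<^sup>+g. Phi (zpath (Suc n) g, endst (Suc n) g) \<partial>IT.eP n f) =
        (\<integral>\<^sup>+y. Phi (zpath (Suc n) (f(n := y)), endst (Suc n) (f(n := y))) \<partial>kern (endst n f))"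
      by (rule IT.nn_integral_eP[OF f F])
    then show "(\<integral>\<^sup>+g. Phi (zpath (Suc n) g, endst (Suc n) g) \<partial>IT.eP n f) = Phi' (zpath n f, endst n f)"
      by (simp add: Phi'_def zpath_Suc endst_def)
  qed
  also have "\<dots> = (\<integral>\<^sup>+w. hden ?N w * Phi' (hpath n w, hat_X u ?N w) \<partial>P i)"
    by (rule Suc.IH[OF Phi'])
  also have "\<dots> = (\<integral>\<^sup>+w. \<integral>\<^sup>+v. alive u ?N w * ennreal (1 / h x) * (wt (age u ?N w) v *
      Phi (glue n (hpath n w) (age u ?N w, v), fin (age u ?N w, v))) \<partial>P (w ?N) \<partial>P i)"
  proof (rule nn_integral_cong)
    fix w assume "w \<in> space (P i)"
    then have wp: "w \<in> paths S" using i by simp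
    let ?s = "hat_X u ?N w" and ?a = "age u ?N w"
    have j: "w ?N \<in> S" by (rule cadlag_in[OF wp]) simp
    have hp: "hpath n w \<in> space (PathM n)" by (simp add: hpath_def space_PiM)
    have gm: "(\<lambda>y. Phi (glue n (hpath n w) y, fin y)) \<in> borel_measurable Seg"
      by (intro measurable_compose[OF _ Suc.prems] measurable_Pair glue_measurable measurable_const hp fin_measurable measurable_ident_sets refl)
    have pm: "(\<lambda>v. (?a, v)) \<in> \<Omega> \<rightarrow>\<^sub>M Seg" by (rule measurable_Pair1') simp
    have Fm: "(\<lambda>v. wt ?a v * Phi (glue n (hpath n w) (?a, v), fin (?a, v))) \<in> borel_measurable (P (w ?N))"
      unfolding measurable_P[OF j] by (intro borel_measurable_times_ennreal wt_measurable' measurable_compose[OF pm gm])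
    show "hden ?N w * Phi' (hpath n w, ?s) = (\<integral>\<^sup>+v. alive u ?N w * ennreal (1 / h x) * (wt ?a v *
      Phi (glue n (hpath n w) (?a, v), fin (?a, v))) \<partial>P (w ?N))"
    proof (cases "ereal ?N < tau u w")
      case False
      then show ?thesis by (simp add: alive_def)
    next
      case True
      have s: "?s \<in> hat_S S" by (rule hat_X_in_hat_S[OF wp u(1) _ True]) simp
      have p: "pr ?s = ?s" using s by (simp add: pr_def)
      have fs: "fst ?s = w ?N" "snd ?s = ?a" by (simp_all add: hat_X_eq)
      have "Phi' (hpath n w, ?s) = (\<integral>\<^sup>+v. wt ?a v * ennreal (1 / h ?s) * Phi (glue n (hpath n w) (?a, v), fin (?a, v)) \<partial>P (w ?N))"
        unfolding Phi'_def prod.case nn_integral_kern[OF gm] p fs ..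
      also have "\<dots> = (\<integral>\<^sup>+v. ennreal (1 / h ?s) * (wt ?a v * Phi (glue n (hpath n w) (?a, v), fin (?a, v))) \<partial>P (w ?N))"
        by (intro nn_integral_cong) (simp only: mult_ac)
      also have "\<dots> = ennreal (1 / h ?s) * (\<integral>\<^sup>+v. wt ?a v * Phi (glue n (hpath n w) (?a, v), fin (?a, v)) \<partial>P (w ?N))"
        by (rule nn_integral_cmult[OF Fm])
      \<comment> \<open>The value of \<open>h\<close> at time \<open>n\<close> now stands next to
        its reciprocal from the kernel; this is the telescoping.\<close>
      finally have "hden ?N w * Phi' (hpath n w, ?s) = alive u ?N w * ennreal (1 / h x) * ((ennreal (h ?s) * ennreal (1 / h ?s)) *
         (\<integral>\<^sup>+v. wt ?a v * Phi (glue n (hpath n w) (?a, v), fin (?a, v)) \<partial>P (w ?N)))" by (simp only: mult_ac)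
      also have "\<dots> = (\<integral>\<^sup>+v. alive u ?N w * ennreal (1 / h x) * (wt ?a v * Phi (glue n (hpath n w) (?a, v), fin (?a, v))) \<partial>P (w ?N))"
        unfolding h_cancel[OF s] mult_1_left by (rule nn_integral_cmult[OF Fm, symmetric])
      finally show ?thesis .
    qed
  qed
  also have "\<dots> = (\<integral>\<^sup>+w. alive u ?N w * ennreal (1 / h x) * (wt (age u ?N w) (shift ?N w) *
      Phi (glue n (hpath n w) (age u ?N w, shift ?N w), fin (age u ?N w, shift ?N w))) \<partial>P i)"
  proof -
    let ?\<Xi> = "\<lambda>q. alive u ?N (fst q) * ennreal (1 / h x) * (wt (age u ?N (fst q)) (snd q) *
        Phi (glue n (hpath n (fst q)) (age u ?N (fst q), snd q), fin (age u ?N (fst q), snd q)))"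
    have y: "(\<lambda>q. (age u ?N (fst q), snd q)) \<in> path_filtration S ?N \<Otimes>\<^sub>M \<Omega> \<rightarrow>\<^sub>M Seg"
      by (intro measurable_Pair measurable_snd measurable_compose[OF measurable_fst measurable_age_filtration]) auto
    have wm: "(\<lambda>q. wt (age u ?N (fst q)) (snd q)) \<in> borel_measurable (path_filtration S ?N \<Otimes>\<^sub>M \<Omega>)"
      using measurable_compose[OF y wt_measurable] by simp
    have "?\<Xi> \<in> borel_measurable (path_filtration S ?N \<Otimes>\<^sub>M \<Omega>)"
      by (intro borel_measurable_times_ennreal wm borel_measurable_const measurable_compose[OF measurable_fst alive_filtration]
          measurable_compose[OF _ Suc.prems] measurable_Pair[OF glue_measurable[OF measurable_compose[OF measurable_fst hpath_measurable] y]]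
          measurable_compose[OF y fin_measurable]) auto
    from markov_nn_integral[OF i _ this] show ?thesis by simp
  qed
  also have "\<dots> = (\<integral>\<^sup>+w. hden (real (Suc n)) w * Phi (hpath (Suc n) w, hat_X u (real (Suc n)) w) \<partial>P i)"
  proof (rule nn_integral_cong)
    fix w assume "w \<in> space (P i)"
    then have wp: "w \<in> paths S" using i by simp
    have n1: "real (Suc n) = ?N + 1" by simp
    have X: "hat_X u (real (Suc n)) w = hat_X (age u ?N w) 1 (shift ?N w)"
      unfolding n1 by (rule hat_X_flow[OF wp]) auto
    have A: "alive u (real (Suc n)) w = alive u ?N w * alive (age u ?N w) 1 (shift ?N w)"
      unfolding n1 by (rule alive_flow[OF wp]) auto
    show "alive u ?N w * ennreal (1 / h x) * (wt (age u ?N w) (shift ?N w) *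
      Phi (glue n (hpath n w) (age u ?N w, shift ?N w), fin (age u ?N w, shift ?N w))) =
      hden (real (Suc n)) w * Phi (hpath (Suc n) w, hat_X u (real (Suc n)) w)"
      unfolding X A hpath_Suc[OF wp] wt_def fin_def fst_conv snd_conv by (simp only: mult_ac)
  qed
  finally show ?case .
qed

abbreviation "seg_law \<equiv> IT.PF.lim"

lemma space_seg_law: "space seg_law = UNIV \<rightarrow>\<^sub>E (UNIV \<times> paths S)"
  by (simp add: space_PiM space_Seg)

lemma measurable_seg_law: "seg_law \<rightarrow>\<^sub>M N = PiM UNIV (\<lambda>_. Seg) \<rightarrow>\<^sub>M N"
  by (rule measurable_cong_sets) simp_all

lemma restrict_seg_law: "(\<lambda>f. restrict f {0..<n}) \<in> seg_law \<rightarrow>\<^sub>M PiM {0..<n} (\<lambda>_. Seg)"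
  unfolding measurable_seg_law by (rule measurable_restrict_subset) simp

lemma up_to_n: "IT.up_to {0..<n} = n"
proof (rule antisym)
  show "IT.up_to {0..<n} \<le> n" using IT.up_to_iff[of "{0..<n}" n] by simp
  show "n \<le> IT.up_to {0..<n}" using IT.up_to_iff[of "{0..<n}" "IT.up_to {0..<n}"] by (cases n) auto
qed

lemma seg_law_restrict: "distr seg_law (PiM {0..<n} (\<lambda>_. Seg)) (\<lambda>f. restrict f {0..<n}) = distr (IT.C 0 n (\<lambda>_. undefined)) (PiM {0..<n} (\<lambda>_. Seg)) (\<lambda>f. restrict f {0..<n})"
  using IT.distr_lim[of "{0..<n}"] by (simp add: IT.CI_def up_to_n)

lemma seg_law_integral:
  assumes F: "F \<in> borel_measurable (PiM {0..<n} (\<lambda>_. Seg))"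
  shows "(\<integral>\<^sup>+f. F (restrict f {0..<n}) \<partial>seg_law) = (\<integral>\<^sup>+f. F f \<partial>IT.C 0 n (\<lambda>_. undefined))"
proof -
  have mC: "(\<lambda>f. restrict f {0..<n}) \<in> IT.C 0 n (\<lambda>_. undefined) \<rightarrow>\<^sub>M PiM {0..<n} (\<lambda>_. Seg)"
    unfolding measurable_cong_sets[OF sets_C refl] by (rule measurable_restrict_subset) simp
  have "(\<integral>\<^sup>+f. F (restrict f {0..<n}) \<partial>seg_law) = (\<integral>\<^sup>+f. F f \<partial>distr seg_law (PiM {0..<n} (\<lambda>_. Seg)) (\<lambda>f. restrict f {0..<n}))"
    by (rule nn_integral_distr[OF restrict_seg_law, symmetric]) (use F in simp)
  also have "\<dots> = (\<integral>\<^sup>+f. F (restrict f {0..<n}) \<partial>IT.C 0 n (\<lambda>_. undefined))"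
    unfolding seg_law_restrict by (rule nn_integral_distr[OF mC]) (use F in simp)
  also have "\<dots> = (\<integral>\<^sup>+f. F f \<partial>IT.C 0 n (\<lambda>_. undefined))"
  proof (rule nn_integral_cong)
    fix f assume "f \<in> space (IT.C 0 n (\<lambda>_. undefined))"
    then have "f \<in> extensional {0..<n}" using IT.space_C[of "\<lambda>_. undefined" 0 n] by (simp add: space_PiM PiE_iff)
    then show "F (restrict f {0..<n}) = F f" by (simp add: extensional_restrict)
  qed
  finally show ?thesis .
qed

lemma prob_space_seg_law: "prob_space seg_law"
proof
  have "emeasure seg_law (space seg_law) = (\<integral>\<^sup>+f. (\<lambda>_. 1) (restrict f {0..<0::nat}) \<partial>seg_law)" by simp
  also have "\<dots> = (\<integral>\<^sup>+f. 1 \<partial>IT.C 0 0 (\<lambda>_. undefined))" by (rule seg_law_integral) simp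
  also have "\<dots> = 1"
    using prob_space.emeasure_space_1[OF IT.prob_space_C[of "\<lambda>_. undefined" 0 0]] by (simp add: space_PiM)
  finally show "emeasure seg_law (space seg_law) = 1" .
qed

lemma seg_law_good: "AE f in seg_law. \<forall>n. good (f n)"
proof (rule AE_all_countable[THEN iffD2], rule allI)
  fix n :: nat
  let ?F = "\<lambda>f. if good (f n) then 0 else 1 :: ennreal"
  have gm: "(\<lambda>z. if good z then 0 else 1 :: ennreal) \<in> borel_measurable Seg" using good_measurable by measurable
  have F: "?F \<in> borel_measurable (PiM {0..<Suc n} (\<lambda>_. Seg))"
    by (rule measurable_compose[where f = "\<lambda>f. f n", OF _ gm], rule measurable_component_singleton) simp
  have FL: "?F \<in> borel_measurable seg_law"
    unfolding measurable_seg_law by (rule measurable_compose[where f = "\<lambda>f. f n", OF _ gm], rule measurable_component_singleton) simp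
  have "(\<integral>\<^sup>+f. ?F f \<partial>seg_law) = (\<integral>\<^sup>+f. ?F (restrict f {0..<Suc n}) \<partial>seg_law)" by simp
  also have "\<dots> = (\<integral>\<^sup>+f. ?F f \<partial>IT.C 0 (Suc n) (\<lambda>_. undefined))" by (rule seg_law_integral[OF F])
  also have "\<dots> = (\<integral>\<^sup>+f. \<integral>\<^sup>+g. ?F g \<partial>IT.eP n f \<partial>IT.C 0 n (\<lambda>_. undefined))"
    by (rule C_Suc_integral[OF F])
  also have "\<dots> = (\<integral>\<^sup>+f. 0 \<partial>IT.C 0 n (\<lambda>_. undefined))"
  proof (rule nn_integral_cong)
    fix f assume "f \<in> space (IT.C 0 n (\<lambda>_. undefined))"
    then have f: "f \<in> space (PiM {0..<n} (\<lambda>_. Seg))"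
      using IT.space_C[of "\<lambda>_. undefined" 0 n] by (simp add: space_PiM)
    show "(\<integral>\<^sup>+g. ?F g \<partial>IT.eP n f) = 0"
      unfolding IT.nn_integral_eP[OF f F] using kern_good by simp
  qed
  finally have "(\<integral>\<^sup>+f. ?F f \<partial>seg_law) = 0" by simp
  then show "AE f in seg_law. good (f n)"
    unfolding nn_integral_0_iff_AE[OF FL] by eventually_elim (simp split: if_splits)
qed

text \<open>On the null event of a segment that is not good, the constant path at \<open>x\<close>
  is substituted, so that every value is an admissible path.\<close>

definition \<Theta> :: "(nat \<Rightarrow> real \<times> (real \<Rightarrow> nat)) \<Rightarrow> real \<Rightarrow> nat \<times> real" where
  "\<Theta> f = (\<lambda>t\<in>{0..}. if \<forall>n. good (f n) then path_of f t else x)"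

lemma const_cadlag: "(\<lambda>t\<in>{0..}. x) \<in> cadlag_paths {0..} (hat_S S)"
proof -
  have l: "((\<lambda>t\<in>{0..}. x) \<longlongrightarrow> x) (at t within {0..} \<inter> A)" for t and A :: "real set"
  proof (rule tendsto_eventually)
    show "\<forall>\<^sub>F s in at t within {0..} \<inter> A. (\<lambda>t\<in>{0..}. x) s = x"
      unfolding eventually_at by (rule exI[of _ 1]) simp
  qed
  show ?thesis unfolding cadlag_paths_def using x l by (auto intro!: bexI[of _ x])
qed

lemma \<Theta>_measurable: "\<Theta> \<in> seg_law \<rightarrow>\<^sub>M skorokhod_space (hat_S S)"
proof (rule measurable_skorokhodI)
  fix f assume f: "f \<in> space seg_law"
  show "\<Theta> f \<in> cadlag_paths {0..} (hat_S S)"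
  proof (cases "\<forall>n. good (f n)")
    case True
    have "snd (f n) \<in> paths S" for n using f unfolding space_seg_law by (auto simp: PiE_iff mem_Times_iff)
    then show ?thesis using path_of_cadlag[of f] True by (simp add: \<Theta>_def)
  next
    case False
    show ?thesis unfolding \<Theta>_def if_not_P[OF False] by (rule const_cadlag)
  qed
next
  fix t :: real assume t: "0 \<le> t"
  have "Measurable.pred (PiM UNIV (\<lambda>_. Seg)) (\<lambda>f. \<forall>n :: nat. good (f n))"
  proof (intro pred_intros_countable)
    show "Measurable.pred (PiM UNIV (\<lambda>_. Seg)) (\<lambda>f. good (f n))" for n :: nat
      by (rule measurable_compose[where f = "\<lambda>f. f n", OF _ good_measurable], rule measurable_component_singleton) simp
  qed
  then have "(\<lambda>f. if \<forall>n. good (f n) then path_of f t else x) \<in> PiM UNIV (\<lambda>_. Seg) \<rightarrow>\<^sub>M borel"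
    by (intro measurable_If path_of_measurable t) (auto simp: pred_def)
  then show "(\<lambda>f. \<Theta> f t) \<in> seg_law \<rightarrow>\<^sub>M borel" using t by (simp add: \<Theta>_def measurable_seg_law)
qed

definition H_law :: "(real \<Rightarrow> nat \<times> real) measure" where
  "H_law = distr seg_law (skorokhod_space (hat_S S)) \<Theta>"

abbreviation "hat_path s w \<equiv> \<lambda>t\<in>{0..s}. hat_X u t w"

text \<open>Take enough whole segments to cover \<open>[0, s]\<close>. By harmonicity the weight
  \<open>h\<close> at time \<open>n\<close> averages to \<open>h\<close> at time \<open>s\<close>
  given the path up to \<open>s\<close>, so the density does not depend on the number of
  segments.\<close>

lemma H_law_integral:
  assumes s: "0 \<le> s" and Phi: "Phi \<in> borel_measurable (\<Pi>\<^sub>M t\<in>{0..s}. borel)"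
  shows "(\<integral>\<^sup>+y. Phi (restrict y {0..s}) \<partial>H_law) = (\<integral>\<^sup>+w. hden s w * Phi (hat_path s w) \<partial>P i)"
proof -
  obtain n where n: "s < real n" using reals_Archimedean2 by blast
  have sub: "{0..s} \<subseteq> {0..<real n}" using n by auto
  have r1: "(\<lambda>y. restrict y {0..s}) \<in> skorokhod_space (hat_S S) \<rightarrow>\<^sub>M (\<Pi>\<^sub>M t\<in>{0..s}. borel)"
    by (rule measurable_restrict) (auto intro: measurable_eval)
  have r2: "(\<lambda>z. restrict z {0..s}) \<in> PathM n \<rightarrow>\<^sub>M (\<Pi>\<^sub>M t\<in>{0..s}. borel)"
    by (rule measurable_restrict_subset[OF sub])
  have Phi1: "(\<lambda>q. Phi (restrict (fst q) {0..s})) \<in> borel_measurable (PathM n \<Otimes>\<^sub>M borel)"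
    by (rule measurable_compose[OF measurable_compose[OF measurable_fst r2] Phi])
  have Phi2: "(\<lambda>f. Phi (restrict (zpath n f) {0..s})) \<in> borel_measurable (PiM {0..<n} (\<lambda>_. Seg))"
    by (rule measurable_compose[OF measurable_compose[OF zpath_measurable r2] Phi])
  have "(\<integral>\<^sup>+y. Phi (restrict y {0..s}) \<partial>H_law) = (\<integral>\<^sup>+f. Phi (restrict (\<Theta> f) {0..s}) \<partial>seg_law)"
    unfolding H_law_def
    by (rule nn_integral_distr[OF \<Theta>_measurable]) (use measurable_compose[OF r1 Phi] in simp)
  also have "\<dots> = (\<integral>\<^sup>+f. Phi (restrict (zpath n (restrict f {0..<n})) {0..s}) \<partial>seg_law)"
  proof (rule nn_integral_cong_AE)
    show "AE f in seg_law. Phi (restrict (\<Theta> f) {0..s}) = Phi (restrict (zpath n (restrict f {0..<n})) {0..s})"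
      using seg_law_good
    proof eventually_elim
      case (elim f)
      have "restrict (\<Theta> f) {0..s} = restrict (zpath n (restrict f {0..<n})) {0..s}"
      proof (rule restrict_ext)
        fix t assume t: "t \<in> {0..s}"
        then have "nat \<lfloor>t\<rfloor> \<in> {0..<n}" using n by (intro floor_less) auto
        then show "\<Theta> f t = zpath n (restrict f {0..<n}) t"
          using elim t n by (simp add: \<Theta>_def zpath_def path_of_def)
      qed
      then show ?case by simp
    qed
  qed
  also have "\<dots> = (\<integral>\<^sup>+f. Phi (restrict (zpath n f) {0..s}) \<partial>IT.C 0 n (\<lambda>_. undefined))"
    by (rule seg_law_integral[OF Phi2])
  also have "\<dots> = (\<integral>\<^sup>+w. hden (real n) w * Phi (restrict (hpath n w) {0..s}) \<partial>P i)"
    using C_law[OF Phi1] by simp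
  also have "\<dots> = (\<integral>\<^sup>+w. (Phi (hat_path s w) * ennreal (1 / h x)) * (alive u (s + (real n - s)) w * ennreal (h (hat_X u (s + (real n - s)) w))) \<partial>P i)"
  proof (intro nn_integral_cong)
    fix w
    have "restrict (hpath n w) {0..s} = hat_path s w"
      unfolding hpath_def using n by (intro restrict_ext) auto
    then show "hden (real n) w * Phi (restrict (hpath n w) {0..s}) =
        (Phi (hat_path s w) * ennreal (1 / h x)) * (alive u (s + (real n - s)) w * ennreal (h (hat_X u (s + (real n - s)) w)))"
      by (simp add: mult_ac)
  qed
  also have "\<dots> = (\<integral>\<^sup>+w. (Phi (hat_path s w) * ennreal (1 / h x)) * (alive u s w * W (\<lambda>y. ennreal (h y)) (hat_X u s w) (real n - s)) \<partial>P i)"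
  proof (rule W_semigroup[OF i s])
    show "0 \<le> real n - s" using n by simp
    show "(\<lambda>y. ennreal (h y)) \<in> borel_measurable borel" by measurable
    have "(\<lambda>w. \<lambda>t\<in>{0..s}. hat_X u t w) \<in> path_filtration S s \<rightarrow>\<^sub>M (\<Pi>\<^sub>M t\<in>{0..s}. borel)"
      by (rule measurable_restrict) (auto intro!: measurable_hat_X_filtration)
    from measurable_compose[OF this Phi]
    show "(\<lambda>w. Phi (hat_path s w) * ennreal (1 / h x)) \<in> borel_measurable (path_filtration S s)"
      by (intro borel_measurable_times_ennreal borel_measurable_const)
  qed
  also have "\<dots> = (\<integral>\<^sup>+w. hden s w * Phi (hat_path s w) \<partial>P i)"
  proof (rule nn_integral_cong)
    fix w assume "w \<in> space (P i)"
    then have wp: "w \<in> paths S" using i by simp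
    have "alive u s w * W (\<lambda>y. ennreal (h y)) (hat_X u s w) (real n - s) = alive u s w * ennreal (h (hat_X u s w))"
    proof (cases "ereal s < tau u w")
      case True
      have "wh (hat_X u s w) (real n - s) = ennreal (h (hat_X u s w))"
        by (rule w_eq_h[OF hat_X_in_hat_S[OF wp u(1) s True]]) (use n in simp)
      then show ?thesis by (simp add: wh_def)
    qed (simp add: alive_def)
    then show "(Phi (hat_path s w) * ennreal (1 / h x)) * (alive u s w * W (\<lambda>y. ennreal (h y)) (hat_X u s w) (real n - s)) =
       hden s w * Phi (hat_path s w)" by (simp only: mult_ac)
  qed
  finally show ?thesis .
qed

end

section \<open>Convergence of the conditioned laws\<close>

lemma densities_tendsto:
  fixes F :: "nat \<Rightarrow> 'w \<Rightarrow> real"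
  assumes F: "\<And>k. F k \<in> borel_measurable M" "\<And>k w. 0 \<le> F k w" "\<And>k. (\<integral>\<^sup>+w. F k w \<partial>M) = 1"
    and G: "G \<in> borel_measurable M" "\<And>w. 0 \<le> G w" "(\<integral>\<^sup>+w. G w \<partial>M) = 1"
    and lim: "\<And>w. w \<in> space M \<Longrightarrow> (\<lambda>k. F k w) \<longlonglongrightarrow> G w"
    and phi: "phi \<in> borel_measurable M" "\<And>w. w \<in> space M \<Longrightarrow> \<bar>phi w\<bar> \<le> C"
  shows "(\<lambda>k. \<integral>w. F k w * phi w \<partial>M) \<longlonglongrightarrow> (\<integral>w. G w * phi w \<partial>M)"
proof (rule tendsto_L1_int)
  have int: "integrable M (\<lambda>w. g w * phi w)" "integrable M g"
    if g: "g \<in> borel_measurable M" "\<And>w. 0 \<le> g w" "(\<integral>\<^sup>+w. ennreal (g w) \<partial>M) = 1" for g :: "'w \<Rightarrow> real"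
  proof -
    show i: "integrable M g" using g by (intro integrableI_nonneg) auto
    show "integrable M (\<lambda>w. g w * phi w)"
    proof (rule Bochner_Integration.integrable_bound)
      show "integrable M (\<lambda>w. g w * \<bar>C\<bar>)" using i by simp
      show "AE w in M. norm (g w * phi w) \<le> norm (g w * \<bar>C\<bar>)"
      proof (rule AE_I2)
        fix w assume "w \<in> space M"
        then have "\<bar>phi w\<bar> \<le> \<bar>C\<bar>" using phi(2)[of w] by linarith
        then show "norm (g w * phi w) \<le> norm (g w * \<bar>C\<bar>)" using g(2)[of w] by (simp add: abs_mult mult_left_mono)
      qed
    qed (use g phi in measurable)
  qed
  show "integrable M (\<lambda>w. F k w * phi w)" for k by (rule int[OF F])
  show "integrable M (\<lambda>w. G w * phi w)" by (rule int[OF G])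
  have S: "(\<lambda>k. \<integral>\<^sup>+w. norm (F k w - G w) \<partial>M) \<longlonglongrightarrow> 0"
  proof (rule Scheffe_lemma2)
    show "integrable M G" by (rule int[OF G])
    show "(\<integral>\<^sup>+w. norm (F k w) \<partial>M) \<le> (\<integral>\<^sup>+w. norm (G w) \<partial>M)" for k using F G by simp
  qed (use F lim in auto)
  show "(\<lambda>k. \<integral>\<^sup>+w. norm (F k w * phi w - G w * phi w) \<partial>M) \<longlonglongrightarrow> 0"
  proof (rule tendsto_sandwich[OF _ _ tendsto_const])
    show "(\<lambda>k. ennreal \<bar>C\<bar> * (\<integral>\<^sup>+w. norm (F k w - G w) \<partial>M)) \<longlonglongrightarrow> 0"
      using ennreal_tendsto_cmult[OF _ S, of "ennreal \<bar>C\<bar>"] by simp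
    show "\<forall>\<^sub>F k in sequentially. (\<integral>\<^sup>+w. norm (F k w * phi w - G w * phi w) \<partial>M) \<le> ennreal \<bar>C\<bar> * (\<integral>\<^sup>+w. norm (F k w - G w) \<partial>M)"
    proof (rule always_eventually, rule allI)
      fix k
      have "(\<integral>\<^sup>+w. norm (F k w * phi w - G w * phi w) \<partial>M) \<le> (\<integral>\<^sup>+w. ennreal \<bar>C\<bar> * norm (F k w - G w) \<partial>M)"
      proof (rule nn_integral_mono)
        fix w assume "w \<in> space M"
        then have "\<bar>phi w\<bar> \<le> \<bar>C\<bar>" using phi(2)[of w] by linarith
        then have "\<bar>phi w\<bar> * \<bar>F k w - G w\<bar> \<le> \<bar>C\<bar> * \<bar>F k w - G w\<bar>" by (rule mult_right_mono) simp
        moreover have "F k w * phi w - G w * phi w = phi w * (F k w - G w)" by (simp add: algebra_simps)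
        ultimately show "ennreal (norm (F k w * phi w - G w * phi w)) \<le> ennreal \<bar>C\<bar> * ennreal (norm (F k w - G w))"
          by (simp add: abs_mult flip: ennreal_mult)
      qed
      also have "\<dots> = ennreal \<bar>C\<bar> * (\<integral>\<^sup>+w. norm (F k w - G w) \<partial>M)"
        by (rule nn_integral_cmult) (use F G in measurable)
      finally show "(\<integral>\<^sup>+w. norm (F k w * phi w - G w * phi w) \<partial>M) \<le> ennreal \<bar>C\<bar> * (\<integral>\<^sup>+w. norm (F k w - G w) \<partial>M)" .
    qed
  qed simp
qed

context h_process
begin

lemma sets_H_law: "sets H_law = sets (skorokhod_space (hat_S S))" by (simp add: H_law_def)

lemma space_H_law: "space H_law = cadlag_paths {0..} (hat_S S)"
  using sets_eq_imp_space_eq[OF sets_H_law] by simp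

lemma measurable_H_law: "H_law \<rightarrow>\<^sub>M N = skorokhod_space (hat_S S) \<rightarrow>\<^sub>M N"
  by (rule measurable_cong_sets[OF sets_H_law refl])

lemma measurable_hat_path_filtration: "(\<lambda>w. \<lambda>t\<in>{0..s}. hat_X u t w) \<in> path_filtration S s \<rightarrow>\<^sub>M (\<Pi>\<^sub>M t\<in>{0..s}. borel)"
  by (rule measurable_restrict) (auto intro!: measurable_hat_X_filtration)

lemma H_law_start: "AE y in H_law. y 0 = x"
proof -
  let ?f = "indicator (- {x}) :: nat \<times> real \<Rightarrow> ennreal"
  have f: "?f \<in> borel_measurable borel" by simp
  have "(\<lambda>z. ?f (z 0)) \<in> borel_measurable (\<Pi>\<^sub>M t\<in>{0..0::real}. borel)"
    by (rule measurable_compose[where f = "\<lambda>z. z 0", OF _ f], rule measurable_component_singleton) simp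
  from H_law_integral[OF order_refl this]
  have "(\<integral>\<^sup>+y. ?f (y 0) \<partial>H_law) = (\<integral>\<^sup>+w. hden 0 w * ?f (hat_X u 0 w) \<partial>P i)" by simp
  also have "\<dots> = (\<integral>\<^sup>+w. 0 \<partial>P i)"
  proof (rule nn_integral_cong_AE)
    show "AE w in P i. hden 0 w * ?f (hat_X u 0 w) = 0"
      using AE_start[OF i]
    proof eventually_elim
      case (elim w)
      show ?case unfolding hat_X_0[where w = w, OF x elim] by simp
    qed
  qed
  finally have "(\<integral>\<^sup>+y. ?f (y 0) \<partial>H_law) = 0" by simp
  moreover have "(\<lambda>y. ?f (y 0)) \<in> borel_measurable H_law"
    unfolding measurable_H_law by (rule measurable_compose[OF measurable_eval f]) simp
  ultimately have "AE y in H_law. ?f (y 0) = 0" by (simp add: nn_integral_0_iff_AE)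
  then show ?thesis by eventually_elim (simp add: indicator_def split: if_splits)
qed

text \<open>Both sides become integrals over paths of the original chain by
  \<open>H_law_integral\<close>. There the weight \<open>h\<close> at time \<open>s + t\<close>
  splits at \<open>s\<close> into the density up to \<open>s\<close> and the kernel of the
  h-transform, again by cancelling \<open>h\<close> at time \<open>s\<close>.\<close>

lemma H_law_markov:
  assumes s: "0 \<le> s" and t: "0 \<le> t" and A: "A \<in> sets (path_filtration (hat_S S) s)" and B: "B \<in> sets borel"
  shows "emeasure H_law {y\<in>A. y (s + t) \<in> B} = (\<integral>\<^sup>+y\<in>A. emeasure (K t (y s)) B \<partial>H_law)"
proof -
  let ?f = "\<lambda>y. ennreal (h y) * indicator B y :: ennreal"
  have f: "?f \<in> borel_measurable borel" using B by measurable
  have "sets (path_filtration (hat_S S) s) =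
      {(\<lambda>y. restrict y {0..s}) -` A' \<inter> cadlag_paths {0..} (hat_S S) |A'. A' \<in> sets (\<Pi>\<^sub>M t\<in>{0..s}. borel)}"
    unfolding path_filtration_def by (rule sets_vimage_algebra2) (auto simp: space_PiM)
  then obtain A' where A': "A' \<in> sets (\<Pi>\<^sub>M t\<in>{0..s}. (borel :: (nat \<times> real) measure))"
    and A_eq: "A = (\<lambda>y. restrict y {0..s}) -` A' \<inter> cadlag_paths {0..} (hat_S S)" using A by blast
  \<comment> \<open>Cut off outside \<open>hat_S S\<close>, because \<open>emeasure_K\<close> gives
    a measurable expression for the kernel only there.\<close>
  define g where "g y = (if y \<in> hat_S S then emeasure (K t y) B else 0)" for y
  have g: "g \<in> borel_measurable borel"
  proof -
    let ?I = "\<lambda>y. if fst y \<in> S then \<integral>\<^sup>+v. (\<lambda>(u, v). alive u t v * ?f (hat_X u t v)) (snd y, v) \<partial>P (fst y) else 0"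
    have "(\<lambda>y. if y \<in> hat_S S then ?I y * ennreal (1 / h y) else 0) \<in> borel_measurable borel"
    proof (rule measurable_If)
      show "(\<lambda>y. ?I y * ennreal (1 / h y)) \<in> borel_measurable borel"
        by (intro borel_measurable_times_ennreal state_integral_measurable alive_pair_measurable t f) measurable
    qed (use hat_S_borel[of S] in auto)
    also have "(\<lambda>y. if y \<in> hat_S S then ?I y * ennreal (1 / h y) else 0) = g"
      using hat_S_D[OF _ S_0] by (intro ext) (simp add: g_def emeasure_K[OF _ t B] W_alive)
    finally show ?thesis .
  qed
  define Phi where "Phi z = (indicator A' (restrict z {0..s}) * indicator B (z (s + t)) :: ennreal)" for z :: "real \<Rightarrow> nat \<times> real"
  define Psi where "Psi z = indicator A' z * g (z s)" for z
  have Phi: "Phi \<in> borel_measurable (\<Pi>\<^sub>M t\<in>{0..s + t}. borel)"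
    unfolding Phi_def
  proof (rule borel_measurable_times_ennreal)
    show "(\<lambda>z. indicator A' (restrict z {0..s}) :: ennreal) \<in> borel_measurable (\<Pi>\<^sub>M t\<in>{0..s + t}. (borel :: (nat \<times> real) measure))"
      by (rule measurable_compose[OF measurable_restrict_subset borel_measurable_indicator[OF A']]) (use t in auto)
    have "(\<lambda>z. z (s + t)) \<in> (\<Pi>\<^sub>M t\<in>{0..s + t}. (borel :: (nat \<times> real) measure)) \<rightarrow>\<^sub>M borel"
      by (rule measurable_component_singleton) (use s t in simp)
    from measurable_compose[OF this borel_measurable_indicator[OF B]]
    show "(\<lambda>z. indicator B (z (s + t)) :: ennreal) \<in> borel_measurable (\<Pi>\<^sub>M t\<in>{0..s + t}. (borel :: (nat \<times> real) measure))" .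
  qed
  have Psi: "Psi \<in> borel_measurable (\<Pi>\<^sub>M t\<in>{0..s}. borel)"
  proof -
    have "(\<lambda>z. z s) \<in> (\<Pi>\<^sub>M t\<in>{0..s}. (borel :: (nat \<times> real) measure)) \<rightarrow>\<^sub>M borel"
      by (rule measurable_component_singleton) (use s in simp)
    from borel_measurable_times_ennreal[OF borel_measurable_indicator[OF A'] measurable_compose[OF this g]]
    show ?thesis unfolding Psi_def .
  qed
  have "{y\<in>A. y (s + t) \<in> B} = A \<inter> ((\<lambda>y. y (s + t)) -` B \<inter> space (skorokhod_space (hat_S S)))"
    using A_eq unfolding space_skorokhod by blast
  moreover have "(\<lambda>y. y (s + t)) -` B \<inter> space (skorokhod_space (hat_S S)) \<in> sets (skorokhod_space (hat_S S))"
    by (rule measurable_sets[OF measurable_eval B]) (use s t in simp)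
  ultimately have "{y\<in>A. y (s + t) \<in> B} \<in> sets H_law"
    unfolding sets_H_law using sets.Int[OF sets_filtration_skorokhod[OF A]] by metis
  then have "emeasure H_law {y\<in>A. y (s + t) \<in> B} = (\<integral>\<^sup>+y. indicator {y\<in>A. y (s + t) \<in> B} y \<partial>H_law)"
    by (rule nn_integral_indicator[symmetric])
  also have "\<dots> = (\<integral>\<^sup>+y. Phi (restrict y {0..s + t}) \<partial>H_law)"
  proof (rule nn_integral_cong)
    fix y assume "y \<in> space H_law"
    moreover have "{0..s + t} \<inter> {0..s} = {0..s}" using t by auto
    ultimately show "indicator {y\<in>A. y (s + t) \<in> B} y = Phi (restrict y {0..s + t})"
      using s t by (simp add: Phi_def A_eq space_H_law indicator_def)
  qed
  also have "\<dots> = (\<integral>\<^sup>+w. hden (s + t) w * Phi (\<lambda>t\<in>{0..s + t}. hat_X u t w) \<partial>P i)"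
    by (rule H_law_integral[OF _ Phi]) (use s t in simp)
  also have "\<dots> = (\<integral>\<^sup>+w. (indicator A' (hat_path s w) * ennreal (1 / h x)) * (alive u (s + t) w * ?f (hat_X u (s + t) w)) \<partial>P i)"
  proof (rule nn_integral_cong)
    fix w
    have "restrict (\<lambda>t\<in>{0..s + t}. hat_X u t w) {0..s} = hat_path s w"
      by (rule restrict_ext) (use t in simp)
    then show "hden (s + t) w * Phi (\<lambda>t\<in>{0..s + t}. hat_X u t w) =
        (indicator A' (hat_path s w) * ennreal (1 / h x)) * (alive u (s + t) w * ?f (hat_X u (s + t) w))"
      using s t by (simp add: Phi_def mult_ac)
  qed
  also have "\<dots> = (\<integral>\<^sup>+w. (indicator A' (hat_path s w) * ennreal (1 / h x)) * (alive u s w * W ?f (hat_X u s w) t) \<partial>P i)"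
    by (intro W_semigroup[OF i s t f] borel_measurable_times_ennreal borel_measurable_const
        measurable_compose[OF measurable_hat_path_filtration] borel_measurable_indicator A')
  also have "\<dots> = (\<integral>\<^sup>+w. hden s w * Psi (hat_path s w) \<partial>P i)"
  proof (rule nn_integral_cong)
    fix w assume "w \<in> space (P i)"
    then have wp: "w \<in> paths S" using i by simp
    have "alive u s w * W ?f (hat_X u s w) t = alive u s w * ennreal (h (hat_X u s w)) * g (hat_X u s w)"
    proof (cases "ereal s < tau u w")
      case True
      have y: "hat_X u s w \<in> hat_S S" by (rule hat_X_in_hat_S[OF wp u(1) s True])
      have "ennreal (h (hat_X u s w)) * g (hat_X u s w) =
          ennreal (h (hat_X u s w)) * ennreal (1 / h (hat_X u s w)) * W ?f (hat_X u s w) t"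
        unfolding g_def using y by (simp add: emeasure_K[OF y t B] mult_ac)
      then show ?thesis unfolding h_cancel[OF y] by (simp add: mult.assoc)
    qed (simp add: alive_def)
    then show "(indicator A' (hat_path s w) * ennreal (1 / h x)) * (alive u s w * W ?f (hat_X u s w) t) =
        hden s w * Psi (hat_path s w)"
      using s by (simp add: Psi_def mult_ac)
  qed
  also have "\<dots> = (\<integral>\<^sup>+y. Psi (restrict y {0..s}) \<partial>H_law)" by (rule H_law_integral[OF s Psi, symmetric])
  also have "\<dots> = (\<integral>\<^sup>+y\<in>A. emeasure (K t (y s)) B \<partial>H_law)"
  proof (rule nn_integral_cong)
    fix y assume "y \<in> space H_law"
    then have y: "y \<in> cadlag_paths {0..} (hat_S S)" by (simp add: space_H_law)
    then have "y s \<in> hat_S S" using s by (simp add: cadlag_paths_def)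
    then show "Psi (restrict y {0..s}) = emeasure (K t (y s)) B * indicator A y"
      using s y by (simp add: Psi_def A_eq g_def indicator_def)
  qed
  finally show ?thesis .
qed

lemma markov_law_H_law: "markov_law (hat_S S) K x H_law"
  unfolding markov_law_def
  using prob_space.prob_space_distr[OF prob_space_seg_law \<Theta>_measurable] sets_H_law H_law_start H_law_markov
  by (auto simp: H_law_def)

lemma sv_pos: "0 < sv x t"
proof -
  have "\<forall>\<^sub>F t in at_top. 0 < sv x t / s0 t" using sv_h_ratio[OF x] h_pos[OF x] by (rule order_tendstoD)
  then obtain T where T: "\<And>t. t \<ge> T \<Longrightarrow> 0 < sv x t / s0 t" unfolding eventually_at_top_linorder by blast
  have "0 < sv x (max t T)" using T[of "max t T"] s0_pos[of "max t T"] by (simp add: zero_less_divide_iff)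
  also have "\<dots> \<le> sv x t" by (rule sv_antimono[OF i]) simp
  finally show ?thesis .
qed

abbreviation "D s \<equiv> \<Pi>\<^sub>M t\<in>{0..s}. (borel :: (nat \<times> real) measure)"

definition h_density :: "real \<Rightarrow> (real \<Rightarrow> nat) \<Rightarrow> real" where
  "h_density s w = (if ereal s < tau u w then h (hat_X u s w) / h x else 0)"

definition sv_density :: "real \<Rightarrow> real \<Rightarrow> (real \<Rightarrow> nat) \<Rightarrow> real" where
  "sv_density s T w = (if ereal s < tau u w then sv (hat_X u s w) (T - s) / sv x T else 0)"

lemma hat_path_measurable: "hat_path s \<in> \<Omega> \<rightarrow>\<^sub>M D s"
  by (rule measurable_filtration_skorokhod[OF measurable_hat_path_filtration])

lemma h_density_measurable: "0 \<le> s \<Longrightarrow> h_density s \<in> borel_measurable \<Omega>"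
proof -
  assume "0 \<le> s"
  from measurable_compose[OF measurable_hat_X[OF this] h_measurable]
  have "(\<lambda>w. h (hat_X u s w)) \<in> borel_measurable \<Omega>" .
  then show ?thesis unfolding h_density_def[abs_def] using measurable_tau[of u S] by measurable
qed

lemma sv_density_measurable: "0 \<le> s \<Longrightarrow> s \<le> T \<Longrightarrow> sv_density s T \<in> borel_measurable \<Omega>"
  unfolding sv_density_def[abs_def] using measurable_tau[of u S] sv_hat_measurable[of s "T - s" u] by measurable

lemma hden_eq:
  assumes s: "0 \<le> s" and w: "w \<in> paths S"
  shows "hden s w = ennreal (h_density s w)"
proof (cases "ereal s < tau u w")
  case True
  then show ?thesis using h_pos[OF hat_X_in_hat_S[OF w u(1) s True]] h_pos[OF x]
    by (simp add: alive_def h_density_def flip: ennreal_mult)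
qed (simp add: alive_def h_density_def)

lemma h_density_nonneg: "0 \<le> s \<Longrightarrow> w \<in> paths S \<Longrightarrow> 0 \<le> h_density s w"
  using h_pos[OF hat_X_in_hat_S[OF _ u(1)]] h_pos[OF x] by (simp add: h_density_def less_imp_le)

lemma distr_density_eqI:
  assumes g: "g \<in> borel_measurable \<Omega>" and sets: "sets \<mu> = sets (D s)"
    and eq: "\<And>A. A \<in> sets (D s) \<Longrightarrow> emeasure \<mu> A = (\<integral>\<^sup>+w. ennreal (g w) * indicator A (hat_path s w) \<partial>P i)"
  shows "\<mu> = distr (density (P i) (\<lambda>w. ennreal (g w))) (D s) (hat_path s)"
proof (rule measure_eqI)
  fix A assume "A \<in> sets \<mu>"
  then have A: "A \<in> sets (D s)" using sets by simp
  have X: "hat_path s \<in> density (P i) (\<lambda>w. ennreal (g w)) \<rightarrow>\<^sub>M D s"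
    unfolding measurable_cong_sets[OF sets_density refl] measurable_P[OF i] by (rule hat_path_measurable)
  have B: "hat_path s -` A \<inter> space (P i) \<in> sets (P i)"
    by (rule measurable_sets[OF _ A]) (simp only: measurable_P[OF i] hat_path_measurable)
  have "emeasure (distr (density (P i) (\<lambda>w. ennreal (g w))) (D s) (hat_path s)) A =
      emeasure (density (P i) (\<lambda>w. ennreal (g w))) (hat_path s -` A \<inter> space (P i))"
    unfolding emeasure_distr[OF X A] space_density ..
  also have "\<dots> = (\<integral>\<^sup>+w. ennreal (g w) * indicator (hat_path s -` A \<inter> space (P i)) w \<partial>P i)"
    by (rule emeasure_density[OF _ B]) (simp only: measurable_P[OF i] measurable_compose[OF g measurable_ennreal])
  also have "\<dots> = emeasure \<mu> A"
    unfolding eq[OF A] by (intro nn_integral_cong) (simp add: indicator_def)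
  finally show "emeasure \<mu> A = emeasure (distr (density (P i) (\<lambda>w. ennreal (g w))) (D s) (hat_path s)) A" ..
qed (simp add: sets)

lemma integral_distr_density:
  assumes g: "g \<in> borel_measurable \<Omega>" "\<And>w. w \<in> paths S \<Longrightarrow> 0 \<le> g w" and f: "f \<in> borel_measurable (D s)"
  shows "integral\<^sup>L (distr (density (P i) (\<lambda>w. ennreal (g w))) (D s) (hat_path s)) f = (\<integral>w. g w * f (hat_path s w) \<partial>P i)"
proof -
  have X: "hat_path s \<in> density (P i) (\<lambda>w. ennreal (g w)) \<rightarrow>\<^sub>M D s"
    unfolding measurable_cong_sets[OF sets_density refl] measurable_P[OF i] by (rule hat_path_measurable)
  have "integral\<^sup>L (distr (density (P i) (\<lambda>w. ennreal (g w))) (D s) (hat_path s)) f =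
      (\<integral>w. f (hat_path s w) \<partial>density (P i) (\<lambda>w. ennreal (g w)))"
    by (rule integral_distr[OF X f])
  also have "\<dots> = (\<integral>w. g w *\<^sub>R f (hat_path s w) \<partial>P i)"
  proof (rule integral_density)
    show "(\<lambda>w. f (hat_path s w)) \<in> borel_measurable (P i)"
      unfolding measurable_P[OF i] by (rule measurable_compose[OF hat_path_measurable f])
    show "AE w in P i. 0 \<le> g w" by (rule AE_I2) (use g i in simp)
  qed (simp add: measurable_P[OF i] g)
  finally show ?thesis by simp
qed

lemma law_upto_H_law:
  assumes s: "0 \<le> s"
  shows "law_upto s H_law (\<lambda>t y. y t) = distr (density (P i) (\<lambda>w. ennreal (h_density s w))) (D s) (hat_path s)"
proof (rule distr_density_eqI[OF h_density_measurable[OF s]])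
  fix A assume A: "A \<in> sets (D s)"
  have R: "(\<lambda>y. restrict y {0..s}) \<in> H_law \<rightarrow>\<^sub>M D s"
    unfolding measurable_H_law by (rule measurable_restrict) (auto intro: measurable_eval)
  have "emeasure (law_upto s H_law (\<lambda>t y. y t)) A = (\<integral>\<^sup>+z. indicator A z \<partial>distr H_law (D s) (\<lambda>y. restrict y {0..s}))"
    using A by (simp add: law_upto_def)
  also have "\<dots> = (\<integral>\<^sup>+y. indicator A (restrict y {0..s}) \<partial>H_law)" by (rule nn_integral_distr[OF R]) (use A in simp)
  also have "\<dots> = (\<integral>\<^sup>+w. hden s w * indicator A (hat_path s w) \<partial>P i)" by (rule H_law_integral[OF s]) (use A in simp)
  also have "\<dots> = (\<integral>\<^sup>+w. ennreal (h_density s w) * indicator A (hat_path s w) \<partial>P i)"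
  proof (rule nn_integral_cong)
    fix w assume "w \<in> space (P i)"
    then have wp: "w \<in> paths S" using i by simp
    show "hden s w * indicator A (hat_path s w) = ennreal (h_density s w) * indicator A (hat_path s w)"
      unfolding hden_eq[OF s wp] ..
  qed
  finally show "emeasure (law_upto s H_law (\<lambda>t y. y t)) A = (\<integral>\<^sup>+w. ennreal (h_density s w) * indicator A (hat_path s w) \<partial>P i)" .
qed (simp add: law_upto_def)

text \<open>Given the path up to \<open>s\<close>, the probability of surviving past
  \<open>T\<close> is the survival function of the current state at \<open>T - s\<close>. Division
  by the probability of the conditioning event gives the density.\<close>

lemma conditioned_law_eq:
  assumes s: "0 \<le> s" and T: "s \<le> T"
  shows "conditioned_law P x s T = distr (density (P i) (\<lambda>w. ennreal (sv_density s T w))) (D s) (hat_path s)"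
proof (rule distr_density_eqI[OF sv_density_measurable[OF s T]])
  interpret prob_space "P i" by (rule prob_space_P[OF i])
  let ?E = "{w \<in> space (P i). ereal T < tau u w}"
  have E: "?E \<in> sets (P i)" using tau_sets[of T u] i by simp
  have e: "emeasure (P i) ?E = ennreal (sv x T)" unfolding sv_def surv_def by (rule emeasure_eq_measure)
  fix A assume A: "A \<in> sets (D s)"
  have X: "hat_path s \<in> uniform_measure (P i) ?E \<rightarrow>\<^sub>M D s"
    unfolding measurable_cong_sets[OF sets_uniform_measure refl] measurable_P[OF i] by (rule hat_path_measurable)
  have B: "(\<lambda>w. indicator A (hat_path s w) :: ennreal) \<in> borel_measurable (P i)"
    unfolding measurable_P[OF i] by (rule measurable_compose[OF hat_path_measurable borel_measurable_indicator[OF A]])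
  have "emeasure (conditioned_law P x s T) A = (\<integral>\<^sup>+z. indicator A z \<partial>distr (uniform_measure (P i) ?E) (D s) (hat_path s))"
    using A by (simp add: conditioned_law_def law_upto_def)
  also have "\<dots> = (\<integral>\<^sup>+w. indicator A (hat_path s w) \<partial>uniform_measure (P i) ?E)"
    by (rule nn_integral_distr[OF X]) (use A in simp)
  also have "\<dots> = (\<integral>\<^sup>+w. indicator ?E w / emeasure (P i) ?E * indicator A (hat_path s w) \<partial>P i)"
    unfolding uniform_measure_def
    by (rule nn_integral_density[OF _ B]) (use E in simp)
  also have "\<dots> = (\<integral>\<^sup>+w. (indicator A (hat_path s w) * ennreal (1 / sv x T)) * alive u (s + (T - s)) w \<partial>P i)"
  proof (rule nn_integral_cong)
    fix w assume "w \<in> space (P i)"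
    then have "indicator ?E w / emeasure (P i) ?E = ennreal (1 / sv x T) * alive u (s + (T - s)) w"
      unfolding e using sv_pos[of T] by (simp add: alive_def divide_ennreal[of 1, simplified])
    then show "indicator ?E w / emeasure (P i) ?E * indicator A (hat_path s w) =
       (indicator A (hat_path s w) * ennreal (1 / sv x T)) * alive u (s + (T - s)) w" by (simp only: mult_ac)
  qed
  also have "\<dots> = (\<integral>\<^sup>+w. (indicator A (hat_path s w) * ennreal (1 / sv x T)) * (alive u s w * ennreal (sv (hat_X u s w) (T - s))) \<partial>P i)"
    by (intro sv_markov[OF i s] borel_measurable_times_ennreal borel_measurable_const
        measurable_compose[OF measurable_hat_path_filtration] borel_measurable_indicator A) (use T in simp)
  also have "\<dots> = (\<integral>\<^sup>+w. ennreal (sv_density s T w) * indicator A (hat_path s w) \<partial>P i)"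
  proof (rule nn_integral_cong)
    fix w
    have eq: "ennreal (1 / sv x T) * (alive u s w * ennreal (sv (hat_X u s w) (T - s))) = ennreal (sv_density s T w)"
      using sv_pos[of T] sv_nonneg by (simp add: alive_def sv_density_def flip: ennreal_mult)
    show "(indicator A (hat_path s w) * ennreal (1 / sv x T)) * (alive u s w * ennreal (sv (hat_X u s w) (T - s))) =
        ennreal (sv_density s T w) * indicator A (hat_path s w)" unfolding eq[symmetric] by (simp only: mult_ac)
  qed
  finally show "emeasure (conditioned_law P x s T) A = (\<integral>\<^sup>+w. ennreal (sv_density s T w) * indicator A (hat_path s w) \<partial>P i)" .
qed (simp add: conditioned_law_def law_upto_def)

lemma sv_density_nonneg: "0 \<le> sv_density s T w"
  by (simp add: sv_density_def sv_nonneg)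

lemma h_density_integral: "0 \<le> s \<Longrightarrow> (\<integral>\<^sup>+w. ennreal (h_density s w) \<partial>P i) = 1"
proof -
  assume s: "0 \<le> s"
  have "prob_space H_law"
    unfolding H_law_def by (rule prob_space.prob_space_distr[OF prob_space_seg_law \<Theta>_measurable])
  then have "emeasure H_law (space H_law) = 1" by (rule prob_space.emeasure_space_1)
  then have "1 = (\<integral>\<^sup>+y. (\<lambda>_. 1) (restrict y {0..s}) \<partial>H_law)" by simp
  also have "\<dots> = (\<integral>\<^sup>+w. hden s w * 1 \<partial>P i)" by (rule H_law_integral[OF s]) simp
  also have "\<dots> = (\<integral>\<^sup>+w. ennreal (h_density s w) \<partial>P i)"
  proof (rule nn_integral_cong)
    fix w assume "w \<in> space (P i)"
    then have wp: "w \<in> paths S" using i by simp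
    show "hden s w * 1 = ennreal (h_density s w)" unfolding hden_eq[OF s wp] by simp
  qed
  finally show ?thesis ..
qed

lemma sv_density_integral:
  assumes s: "0 \<le> s" and T: "s \<le> T"
  shows "(\<integral>\<^sup>+w. ennreal (sv_density s T w) \<partial>P i) = 1"
proof -
  have "(\<integral>\<^sup>+w. ennreal (sv_density s T w) \<partial>P i) =
      (\<integral>\<^sup>+w. ennreal (1 / sv x T) * (alive u s w * ennreal (sv (hat_X u s w) (T - s))) \<partial>P i)"
    by (intro nn_integral_cong) (use sv_pos[of T] sv_nonneg in \<open>simp add: alive_def sv_density_def flip: ennreal_mult\<close>)
  also have "\<dots> = (\<integral>\<^sup>+w. ennreal (1 / sv x T) * alive u (s + (T - s)) w \<partial>P i)"
    by (rule sv_markov[OF i s, symmetric]) (use T in simp_all)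
  also have "\<dots> = ennreal (1 / sv x T) * (\<integral>\<^sup>+w. alive u (s + (T - s)) w \<partial>P i)"
    by (rule nn_integral_cmult) (simp only: measurable_P[OF i] alive_measurable)
  also have "(\<integral>\<^sup>+w. alive u (s + (T - s)) w \<partial>P i) = ennreal (sv x T)"
    using W_1[OF i, of T] by (simp add: W_alive)
  finally show ?thesis using sv_pos[of T] by (simp flip: ennreal_mult)
qed

lemma sv_density_tendsto:
  assumes s: "0 \<le> s" and w: "w \<in> paths S"
  shows "((\<lambda>T. sv_density s T w) \<longlongrightarrow> h_density s w) at_top"
proof (cases "ereal s < tau u w")
  case True
  have "((\<lambda>T. surv P (hat_X u s w) (T - s) / surv P x T) \<longlongrightarrow> h (hat_X u s w) / h x) at_top"
    using part2 s x hat_X_in_hat_S[OF w u(1) s True] unfolding survival_ratio_limit_def by blast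
  then show ?thesis using True by (simp add: sv_density_def h_density_def sv_def)
qed (simp add: sv_density_def h_density_def)

lemma conditioned_law_weak_conv:
  assumes s: "0 < s"
  shows "skorokhod_weak_conv (hat_S S) s (conditioned_law P x s) (law_upto s H_law (\<lambda>t y. y t))"
  unfolding skorokhod_weak_conv_def
proof (intro ballI impI)
  fix f :: "(real \<Rightarrow> nat \<times> real) \<Rightarrow> real"
  assume f: "f \<in> borel_measurable (D s)" and "bounded (f ` space (D s)) \<and> skorokhod_continuous (hat_S S) s f"
  then obtain C where C: "\<And>z. z \<in> space (D s) \<Longrightarrow> \<bar>f z\<bar> \<le> C" unfolding bounded_iff by auto
  have s0: "0 \<le> s" using s by simp
  \<comment> \<open>\<open>h_density\<close> is known to be nonnegative on \<open>paths S\<close>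
    only, whereas \<open>densities_tendsto\<close> asks for densities that are nonnegative
    everywhere.\<close>
  have nn: "0 \<le> max 0 (h_density s w)" for w by simp
  have I: "integral\<^sup>L (conditioned_law P x s T) f = (\<integral>w. sv_density s T w * f (hat_path s w) \<partial>P i)" if "s \<le> T" for T
    unfolding conditioned_law_eq[OF s0 that]
    by (rule integral_distr_density[OF sv_density_measurable[OF s0 that] sv_density_nonneg f])
  have fX: "(\<lambda>w. f (hat_path s w)) \<in> borel_measurable (P i)"
    unfolding measurable_P[OF i] by (rule measurable_compose[OF hat_path_measurable f])
  show "((\<lambda>T. integral\<^sup>L (conditioned_law P x s T) f) \<longlongrightarrow> integral\<^sup>L (law_upto s H_law (\<lambda>t y. y t)) f) at_top"
  proof (rule tendsto_at_topI_sequentially)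
    fix T :: "nat \<Rightarrow> real" assume T: "filterlim T at_top sequentially"
    \<comment> \<open>The density formula and the total mass 1 are available from
      \<open>T = s\<close> on; raising the times to \<open>s\<close> changes only finitely many
      terms.\<close>
    let ?T = "\<lambda>k. max s (T k)"
    have T': "filterlim ?T at_top sequentially" by (rule filterlim_at_top_mono[OF T]) simp
    have h_int: "integral\<^sup>L (law_upto s H_law (\<lambda>t y. y t)) f = (\<integral>w. max 0 (h_density s w) * f (hat_path s w) \<partial>P i)"
    proof -
      have "integral\<^sup>L (law_upto s H_law (\<lambda>t y. y t)) f = (\<integral>w. h_density s w * f (hat_path s w) \<partial>P i)"
        unfolding law_upto_H_law[OF s0] by (rule integral_distr_density[OF h_density_measurable[OF s0] h_density_nonneg[OF s0] f])
      also have "\<dots> = (\<integral>w. max 0 (h_density s w) * f (hat_path s w) \<partial>P i)"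
        by (rule Bochner_Integration.integral_cong) (use i h_density_nonneg[OF s0] in \<open>auto simp: max_def\<close>)
      finally show ?thesis .
    qed
    have "(\<lambda>k. \<integral>w. sv_density s (?T k) w * f (hat_path s w) \<partial>P i) \<longlonglongrightarrow> (\<integral>w. max 0 (h_density s w) * f (hat_path s w) \<partial>P i)"
    proof (rule densities_tendsto[OF _ sv_density_nonneg _ _ nn _ _ fX])
      show "sv_density s (?T k) \<in> borel_measurable (P i)" for k
        unfolding measurable_P[OF i] by (rule sv_density_measurable[OF s0]) simp
      show "(\<integral>\<^sup>+w. ennreal (sv_density s (?T k) w) \<partial>P i) = 1" for k
        by (rule sv_density_integral[OF s0]) simp
      show "(\<lambda>w. max 0 (h_density s w)) \<in> borel_measurable (P i)"
        unfolding measurable_P[OF i] using h_density_measurable[OF s0] by measurable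
      show "(\<integral>\<^sup>+w. ennreal (max 0 (h_density s w)) \<partial>P i) = 1"
        using h_density_integral[OF s0] by simp
      fix w assume "w \<in> space (P i)"
      then have w: "w \<in> paths S" using i by simp
      show "(\<lambda>k. sv_density s (?T k) w) \<longlonglongrightarrow> max 0 (h_density s w)"
        using filterlim_compose[OF sv_density_tendsto[OF s0 w] T'] h_density_nonneg[OF s0 w] by (simp add: max_absorb2)
      show "\<bar>f (hat_path s w)\<bar> \<le> C" by (rule C) (simp add: space_PiM)
    qed
    then show "(\<lambda>k. integral\<^sup>L (conditioned_law P x s (T k)) f) \<longlonglongrightarrow> integral\<^sup>L (law_upto s H_law (\<lambda>t y. y t)) f"
      unfolding h_int
    proof (rule Lim_transform_eventually)
      have "\<forall>\<^sub>F k in sequentially. s \<le> T k" using T by (rule filterlim_at_top[THEN iffD1, rule_format])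
      then show "\<forall>\<^sub>F k in sequentially. (\<integral>w. sv_density s (?T k) w * f (hat_path s w) \<partial>P i) = integral\<^sup>L (conditioned_law P x s (T k)) f"
        by eventually_elim (simp add: I max_absorb2)
    qed
  qed
qed

end

theorem theorem3p9:
  fixes S :: "nat set" and q :: "nat \<Rightarrow> nat \<Rightarrow> real" and P :: "nat \<Rightarrow> (real \<Rightarrow> nat) measure"
  assumes "S = UNIV \<or> (\<exists>K\<ge>1. S = {0..K})"
    and "nonexplosive_chain S q P"
    and "irreducible_on S (transition P)"
    and "recurrent S P"
    and "irreducible_on (S - {0}) (tilde_P P)"
    and "\<exists>i\<in>S - {0}. mu_C P i = 0"
  shows
    "(\<forall>c. comparable_heavy_tails S P c \<longrightarrow> survival_ratio_limit S P (h_fun q c)) \<and>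
     (\<forall>a n. comparable_subexponential_tails S P a \<and> (\<forall>i\<in>S. i > n \<longrightarrow> q 0 i = 0) \<and> a 0 = 0 \<longrightarrow>
        survival_ratio_limit S P (h_subexp S q a) \<and>
        superharmonic (S - {0}) (tilde_P P) a \<and>
        (harmonic (S - {0}) (tilde_P P) a \<longrightarrow>
           harmonic (hat_S S) (hat_P P) (h_subexp S q a) \<and>
           stochastic (hat_S S) (h_transform (hat_P P) (h_subexp S q a)) \<and>
           (\<forall>x\<in>hat_S S. \<exists>L.
              markov_law (hat_S S) (h_transform (hat_P P) (h_subexp S q a)) x L \<and>
              (\<forall>s>0. skorokhod_weak_conv (hat_S S) s
                 (conditioned_law P x s) (law_upto s L (\<lambda>t \<omega>. \<omega> t))))))"
proof (intro conjI allI impI)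
  interpret chain S q P by (rule chain.intro) (fact assms)+
  fix c assume "comparable_heavy_tails S P c"
  then show "survival_ratio_limit S P (h_fun q c)" by (rule heavy_tails_survival_ratio)
next
  fix a n
  assume A: "comparable_subexponential_tails S P a \<and> (\<forall>i\<in>S. i > n \<longrightarrow> q 0 i = 0) \<and> a 0 = 0"
  interpret subexp_chain S q P n a
    by (intro subexp_chain.intro finite_exit_chain.intro chain.intro finite_exit_chain_axioms.intro subexp_chain_axioms.intro)
      (fact assms | use A in blast)+
  show "survival_ratio_limit S P (h_subexp S q a)" unfolding h_subexp_eq by (rule part2)
  show "superharmonic (S - {0}) (tilde_P P) a" by (rule a_superharmonic)
  assume "harmonic (S - {0}) (tilde_P P) a"
  then interpret harmonic_chain S q P n a by unfold_locales
  show "harmonic (hat_S S) (hat_P P) (h_subexp S q a)" unfolding h_subexp_eq by (rule h_harmonic)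
  show "stochastic (hat_S S) (h_transform (hat_P P) (h_subexp S q a))" unfolding h_subexp_eq by (rule K_stochastic)
  show "\<forall>x\<in>hat_S S. \<exists>L. markov_law (hat_S S) (h_transform (hat_P P) (h_subexp S q a)) x L \<and>
      (\<forall>s>0. skorokhod_weak_conv (hat_S S) s (conditioned_law P x s) (law_upto s L (\<lambda>t \<omega>. \<omega> t)))"
    unfolding h_subexp_eq
  proof
    fix x assume "x \<in> hat_S S"
    then interpret h_process S q P n a x by unfold_locales
    show "\<exists>L. markov_law (hat_S S) K x L \<and>
        (\<forall>s>0. skorokhod_weak_conv (hat_S S) s (conditioned_law P x s) (law_upto s L (\<lambda>t \<omega>. \<omega> t)))"
      using markov_law_H_law conditioned_law_weak_conv by blast
  qed
qed

end
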